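(* Let $\mathcal A$ be a $k$-linear Abelian category, let $\mathcal C=\underline{\mathsf C}(\mathcal A)$ be the differential graded category of complexes in $\mathcal A$, and let $\mathcal B\subset\mathcal C$ be its full subcategory of acyclic complexes. Let $\mathcal D=\mathsf Q(\mathcal C|\mathcal B)$, and let $e:\mathcal C\hookrightarrow\mathcal D$ be the canonical embedding. Then the functor $H^0e:H^0\mathcal C\to H^0\mathcal D$ factors as $$H^0\mathcal C\xrightarrow{Q_{\mathrm{Verdier}}}H^0\mathcal C/H^0\mathcal B\xrightarrow{\;g\;}H^0(\mathsf Q(\mathcal C|\mathcal B)),$$ where the Verdier quotient $H^0\mathcal C/H^0\mathcal B=D(\mathcal A)$ is the derived category of $\mathcal A$, and the functor $g:D(\mathcal A)\to H^0\mathcal D$ is identity on objects.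
   Context: Conventions. $k$ is a commutative associative unital ring; $\mathcal A$ is small with respect to a fixed universe. Gradings are by $\mathbb Z$, differentials have degree $+1$. Maps are written on the right: $fg$ means first $f$, then $g$; Koszul rule $(x\otimes y)(f\otimes g)=(-1)^{\deg y\,\deg f}xf\otimes yg$. A graded quiver $C$ is a set $\mathrm{Ob}\,C$ with graded $k$-modules $C(X,Y)$. $sC=C[1]$, $(sC)^d=C^{d+1}$; $s:C\to sC$ is the identity viewed as a map of degree $-1$. $(sC)^{\otimes n}(X,Y)=\bigoplus_{X=X_0,\dots,X_n=Y}sC(X_0,X_1)\otimes\dots\otimes sC(X_{n-1},X_n)$. An $A_\infty$-category is a graded quiver $C$ with maps $b_n:(sC)^{\otimes n}\to sC$ of degree $1$, $n\ge1$, with $\sum_{r+n+t=m}(1^{\otimes r}\otimes b_n\otimes1^{\otimes t})b_{r+1+t}=0$ for all $m\ge1$; $m_n=s^{\otimes n}b_ns^{-1}$. A differential graded category with differential $m_1$ and composition $m_2:C(X,Y)\otimes C(Y,Z)\to C(X,Z)$ is an $A_\infty$-category with these $m_1$, $m_2$ and $m_n=0$ for $n>2$. For a unital $A_\infty$-category $C$ (each object $X$ has a $b_1$-cycle ${}_X\mathbf i_0\in sC(X,X)$ of degree $-1$ such that $(1\otimes{}_Y\mathbf i_0)b_2$ and $-({}_X\mathbf i_0\otimes1)b_2$ are homotopic to the identity of $sC(X,Y)$), $H^0C$ is the category with the same objects, morphisms $H^0(C(X,Y),m_1)$ and composition induced by $m_2$. For the differential graded category $\underline{\mathsf C}(\mathcal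 A)$, $H^0$ is the homotopy category of complexes. $\mathsf Q(\mathcal C|\mathcal B)$ below is unital for a differential graded category $\mathcal C$. Construction of $\mathsf Q(\mathcal C|\mathcal B)$ for a unital $A_\infty$-category $\mathcal C$ and a full subcategory $\mathcal B$. Define a graded quiver $\mathcal E$, $\mathrm{Ob}\,\mathcal E=\mathrm{Ob}\,\mathcal C$, as freely generated by $s\mathcal C$ under operations $b_n$ of degree $1$, $n\ge2$, and $H$ of degree $-1$, where $H$ may be applied to a morphism $X\to Y$ only if $X\in\mathrm{Ob}\,\mathcal B$ or $Y\in\mathrm{Ob}\,\mathcal B$, and $H$ is never applied to a result of $H$. That is, $s\mathcal E(X,Y)=P(X,Y)\oplus P(X,Y)H$ if $X$ or $Y$ is in $\mathrm{Ob}\,\mathcal B$, and $s\mathcal E(X,Y)=P(X,Y)$ otherwise, where $P=s\mathcal C\oplus\bigoplus_{n\ge2}b_n((s\mathcal E)^{\otimes n})$, and $b_n:(s\mathcal E)^{\otimes n}\to P$, $H:P(X,Y)\to P(X,Y)H$ are isomorphisms onto their images. The differential $b_1$ on $s\mathcal E$ extends that of $s\mathcal C$ by $b_nb_1=-\sum_{a+p+c=n,\,a+c>0}(1^{\otimes a}\otimes b_p\otimes1^{\otimes c})b_{a+1+c}$ for $n\ge2$ and $Hb_1=1-b_1H$ (on $P$). This makes $\mathcal E$ an $A_\infty$-category. Let $R_{\mathcal C}=\sum_{n\ge2}\mathrm{Im}(b_n^{\mathcal E}-b_n^{\mathcal C}:(s\mathcal C)^{\otimes n}\to s\mathcal E)$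 and let $(R_{\mathcal C})_+$ be the smallest graded subquiver of $s\mathcal E$ containing $R_{\mathcal C}$, closed under $b_n$, $n\ge2$, with one argument in it and the others in $s\mathcal E$, and closed under $H$ where $H$ is defined. It is stable under $b_1$, and $\mathsf Q(\mathcal C|\mathcal B)=\mathcal E/s^{-1}(R_{\mathcal C})_+$ is the quotient $A_\infty$-category. The map $s\mathcal C\subset s\mathcal E\to s\mathsf Q(\mathcal C|\mathcal B)$ is injective and is the first component of the strict $A_\infty$-functor $e:\mathcal C\to\mathsf Q(\mathcal C|\mathcal B)$, identity on objects (all other components vanish). *)

theory Defs
  imports "HOL-Algebra.AbelCoset" "HOL-Algebra.Module"
begin

section \<open>Categories and functors\<close>

text \<open>
  Composition is written in diagrammatic order (first \<open>f\<close>, then \<open>g\<close>) and carries its objects,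
  because the hom-sets that occur below (families of morphisms, cosets) need not be disjoint.
\<close>

record ('o, 'm) cat =
  ob :: "'o set"
  hom_of :: "'o \<Rightarrow> 'o \<Rightarrow> 'm set"
  cmp :: "'o \<Rightarrow> 'o \<Rightarrow> 'o \<Rightarrow> 'm \<Rightarrow> 'm \<Rightarrow> 'm"
  idn :: "'o \<Rightarrow> 'm"

definition category :: "('o, 'm) cat \<Rightarrow> bool" where
  "category T \<longleftrightarrow>
    (\<forall>X\<in>ob T. idn T X \<in> hom_of T X X) \<and>
    (\<forall>X\<in>ob T. \<forall>Y\<in>ob T. \<forall>Z\<in>ob T. \<forall>f\<in>hom_of T X Y. \<forall>g\<in>hom_of T Y Z.
       cmp T X Y Z f g \<in> hom_of T X Z) \<and>
    (\<forall>X\<in>ob T. \<forall>Y\<in>ob T. \<forall>f\<in>hom_of T X Y.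
       cmp T X X Y (idn T X) f = f \<and> cmp T X Y Y f (idn T Y) = f) \<and>
    (\<forall>W\<in>ob T. \<forall>X\<in>ob T. \<forall>Y\<in>ob T. \<forall>Z\<in>ob T.
       \<forall>f\<in>hom_of T W X. \<forall>g\<in>hom_of T X Y. \<forall>h\<in>hom_of T Y Z.
       cmp T W Y Z (cmp T W X Y f g) h = cmp T W X Z f (cmp T X Y Z g h))"

definition is_iso :: "('o, 'm) cat \<Rightarrow> 'o \<Rightarrow> 'o \<Rightarrow> 'm \<Rightarrow> bool" where
  "is_iso T X Y f \<longleftrightarrow> f \<in> hom_of T X Y \<and>
    (\<exists>g\<in>hom_of T Y X. cmp T X Y X f g = idn T X \<and> cmp T Y X Y g f = idn T Y)"

record ('o, 'm, 'p, 'n) funct =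
  fob :: "'o \<Rightarrow> 'p"
  fmor :: "'o \<Rightarrow> 'o \<Rightarrow> 'm \<Rightarrow> 'n"

definition is_functor :: "('o, 'm) cat \<Rightarrow> ('p, 'n) cat \<Rightarrow> ('o, 'm, 'p, 'n) funct \<Rightarrow> bool" where
  "is_functor S T F \<longleftrightarrow> category S \<and> category T \<and>
    (\<forall>X\<in>ob S. fob F X \<in> ob T) \<and>
    (\<forall>X\<in>ob S. \<forall>Y\<in>ob S. \<forall>f\<in>hom_of S X Y. fmor F X Y f \<in> hom_of T (fob F X) (fob F Y)) \<and>
    (\<forall>X\<in>ob S. fmor F X X (idn S X) = idn T (fob F X)) \<and>
    (\<forall>X\<in>ob S. \<forall>Y\<in>ob S. \<forall>Z\<in>ob S. \<forall>f\<in>hom_of S X Y. \<forall>g\<in>hom_of S Y Z.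
       fmor F X Z (cmp S X Y Z f g)
         = cmp T (fob F X) (fob F Y) (fob F Z) (fmor F X Y f) (fmor F Y Z g))"

definition functor_comp ::
  "('o, 'm, 'p, 'n) funct \<Rightarrow> ('p, 'n, 'q, 'l) funct \<Rightarrow> ('o, 'm, 'q, 'l) funct" where
  "functor_comp F G =
    \<lparr> fob = (\<lambda>X. fob G (fob F X)),
      fmor = (\<lambda>X Y f. fmor G (fob F X) (fob F Y) (fmor F X Y f)) \<rparr>"

definition functor_eq ::
  "('o, 'm) cat \<Rightarrow> ('o, 'm, 'p, 'n) funct \<Rightarrow> ('o, 'm, 'p, 'n) funct \<Rightarrow> bool" where
  "functor_eq S F G \<longleftrightarrow>
    (\<forall>X\<in>ob S. fob F X = fob G X) \<and>
    (\<forall>X\<in>ob S. \<forall>Y\<in>ob S. \<forall>f\<in>hom_of S X Y. fmor F X Y f = fmor G X Y f)"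


section \<open>Localization and Verdier quotients\<close>

text \<open>
  Gabriel--Zisman localization of \<open>T\<close> at a class \<open>S\<close> of morphisms: morphisms are classes of zigzags.
  \<open>Bwd X Y s\<close> is the formal inverse \<open>Y \<rightarrow> X\<close> of \<open>s : X \<rightarrow> Y\<close>.
\<close>

datatype ('o, 'm) step = Fwd 'o 'o 'm | Bwd 'o 'o 'm

inductive zigzag ::
  "('o, 'm) cat \<Rightarrow> ('o \<Rightarrow> 'o \<Rightarrow> 'm set) \<Rightarrow> 'o \<Rightarrow> ('o, 'm) step list \<Rightarrow> 'o \<Rightarrow> bool"
  for T S where
  "X \<in> ob T \<Longrightarrow> zigzag T S X [] X"
| "X \<in> ob T \<Longrightarrow> Y \<in> ob T \<Longrightarrow> f \<in> hom_of T X Y \<Longrightarrow> zigzag T S Y w Z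
    \<Longrightarrow> zigzag T S X (Fwd X Y f # w) Z"
| "X \<in> ob T \<Longrightarrow> Y \<in> ob T \<Longrightarrow> s \<in> S X Y \<Longrightarrow> zigzag T S X w Z
    \<Longrightarrow> zigzag T S Y (Bwd X Y s # w) Z"

inductive zz_rel ::
  "('o, 'm) cat \<Rightarrow> ('o, 'm) step list \<Rightarrow> ('o, 'm) step list \<Rightarrow> bool" for T where
  "zz_rel T [Fwd X X (idn T X)] []"
| "zz_rel T [Fwd X Y f, Fwd Y Z g] [Fwd X Z (cmp T X Y Z f g)]"
| "zz_rel T [Fwd X Y s, Bwd X Y s] []"
| "zz_rel T [Bwd X Y s, Fwd X Y s] []"

inductive zz_equiv ::
  "('o, 'm) cat \<Rightarrow> ('o \<Rightarrow> 'o \<Rightarrow> 'm set) \<Rightarrow> 'o \<Rightarrow> 'o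
    \<Rightarrow> ('o, 'm) step list \<Rightarrow> ('o, 'm) step list \<Rightarrow> bool"
  for T S X Y where
  "zz_rel T a b \<Longrightarrow> zigzag T S X (u @ a @ v) Y \<Longrightarrow> zigzag T S X (u @ b @ v) Y
    \<Longrightarrow> zz_equiv T S X Y (u @ a @ v) (u @ b @ v)"
| "zigzag T S X w Y \<Longrightarrow> zz_equiv T S X Y w w"
| "zz_equiv T S X Y w w' \<Longrightarrow> zz_equiv T S X Y w' w"
| "zz_equiv T S X Y w w' \<Longrightarrow> zz_equiv T S X Y w' w'' \<Longrightarrow> zz_equiv T S X Y w w''"

definition zz_class where
  "zz_class T S X Y w = {w'. zz_equiv T S X Y w w'}"

definition rep :: "'a set \<Rightarrow> 'a" where
  "rep K = (SOME x. x \<in> K)"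

definition localization ::
  "('o, 'm) cat \<Rightarrow> ('o \<Rightarrow> 'o \<Rightarrow> 'm set) \<Rightarrow> ('o, ('o, 'm) step list set) cat" where
  "localization T S =
    \<lparr> ob = ob T,
      hom_of = (\<lambda>X Y. {zz_class T S X Y w | w. zigzag T S X w Y}),
      cmp = (\<lambda>X Y Z K L. zz_class T S X Z (rep K @ rep L)),
      idn = (\<lambda>X. zz_class T S X X []) \<rparr>"

definition localization_functor ::
  "('o, 'm) cat \<Rightarrow> ('o \<Rightarrow> 'o \<Rightarrow> 'm set) \<Rightarrow> ('o, 'm, 'o, ('o, 'm) step list set) funct" where
  "localization_functor T S =
    \<lparr> fob = (\<lambda>X. X), fmor = (\<lambda>X Y f. zz_class T S X Y [Fwd X Y f]) \<rparr>"

text \<open>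
  A triangle \<open>X \<rightarrow> Y \<rightarrow> Z \<rightarrow> X[1]\<close> is the tuple \<open>(X, Y, Z, u, v, w)\<close>. The Verdier quotient of a
  triangulated category \<open>T\<close> with distinguished triangles \<open>\<Delta>\<close> by a full triangulated subcategory \<open>N\<close>
  is the localization of \<open>T\<close> at the morphisms that have a cone in \<open>N\<close>.
\<close>

type_synonym ('o, 'm) triangle = "'o \<times> 'o \<times> 'o \<times> 'm \<times> 'm \<times> 'm"

definition cone_in ::
  "('o, 'm) cat \<Rightarrow> ('o, 'm) triangle set \<Rightarrow> ('o, 'm) cat \<Rightarrow> 'o \<Rightarrow> 'o \<Rightarrow> 'm set" where
  "cone_in T \<Delta> N X Y =
    {s \<in> hom_of T X Y. \<exists>Z\<in>ob N. \<exists>v w. (X, Y, Z, s, v, w) \<in> \<Delta>}"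

definition verdier_quotient where
  "verdier_quotient T \<Delta> N = localization T (cone_in T \<Delta> N)"

definition Q_Verdier where
  "Q_Verdier T \<Delta> N = localization_functor T (cone_in T \<Delta> N)"


section \<open>Linear and Abelian categories\<close>

record ('k, 'o, 'm) lin_cat =
  lob :: "'o set"
  lhom :: "'o \<Rightarrow> 'o \<Rightarrow> ('k, 'm) module"
  lcmp :: "'o \<Rightarrow> 'o \<Rightarrow> 'o \<Rightarrow> 'm \<Rightarrow> 'm \<Rightarrow> 'm"
  lidn :: "'o \<Rightarrow> 'm"

definition underlying_cat :: "('k, 'o, 'm) lin_cat \<Rightarrow> ('o, 'm) cat" where
  "underlying_cat A =
    \<lparr> ob = lob A, hom_of = (\<lambda>X Y. carrier (lhom A X Y)), cmp = lcmp A, idn = lidn A \<rparr>"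

definition linear_category :: "'k ring \<Rightarrow> ('k, 'o, 'm) lin_cat \<Rightarrow> bool" where
  "linear_category R A \<longleftrightarrow> cring R \<and> category (underlying_cat A) \<and>
    (\<forall>X\<in>lob A. \<forall>Y\<in>lob A. module R (lhom A X Y)) \<and>
    (\<forall>X\<in>lob A. \<forall>Y\<in>lob A. \<forall>Z\<in>lob A.
       \<forall>f\<in>carrier (lhom A X Y). \<forall>f'\<in>carrier (lhom A X Y).
       \<forall>g\<in>carrier (lhom A Y Z). \<forall>g'\<in>carrier (lhom A Y Z). \<forall>a\<in>carrier R.
         lcmp A X Y Z (f \<oplus>\<^bsub>lhom A X Y\<^esub> f') g
           = lcmp A X Y Z f g \<oplus>\<^bsub>lhom A X Z\<^esub> lcmp A X Y Z f' g \<and>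
         lcmp A X Y Z f (g \<oplus>\<^bsub>lhom A Y Z\<^esub> g')
           = lcmp A X Y Z f g \<oplus>\<^bsub>lhom A X Z\<^esub> lcmp A X Y Z f g' \<and>
         lcmp A X Y Z (a \<odot>\<^bsub>lhom A X Y\<^esub> f) g = a \<odot>\<^bsub>lhom A X Z\<^esub> lcmp A X Y Z f g \<and>
         lcmp A X Y Z f (a \<odot>\<^bsub>lhom A Y Z\<^esub> g) = a \<odot>\<^bsub>lhom A X Z\<^esub> lcmp A X Y Z f g)"

definition zero_object :: "('k, 'o, 'm) lin_cat \<Rightarrow> 'o \<Rightarrow> bool" where
  "zero_object A Z \<longleftrightarrow> Z \<in> lob A \<and>
    (\<forall>X\<in>lob A. carrier (lhom A X Z) = {\<zero>\<^bsub>lhom A X Z\<^esub>} \<and>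
               carrier (lhom A Z X) = {\<zero>\<^bsub>lhom A Z X\<^esub>})"

definition is_mono :: "('k, 'o, 'm) lin_cat \<Rightarrow> 'o \<Rightarrow> 'o \<Rightarrow> 'm \<Rightarrow> bool" where
  "is_mono A X Y f \<longleftrightarrow> X \<in> lob A \<and> Y \<in> lob A \<and> f \<in> carrier (lhom A X Y) \<and>
    (\<forall>W\<in>lob A. \<forall>g\<in>carrier (lhom A W X). \<forall>h\<in>carrier (lhom A W X).
       lcmp A W X Y g f = lcmp A W X Y h f \<longrightarrow> g = h)"

definition is_epi :: "('k, 'o, 'm) lin_cat \<Rightarrow> 'o \<Rightarrow> 'o \<Rightarrow> 'm \<Rightarrow> bool" where
  "is_epi A X Y f \<longleftrightarrow> X \<in> lob A \<and> Y \<in> lob A \<and> f \<in> carrier (lhom A X Y) \<and>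
    (\<forall>W\<in>lob A. \<forall>g\<in>carrier (lhom A Y W). \<forall>h\<in>carrier (lhom A Y W).
       lcmp A X Y W f g = lcmp A X Y W f h \<longrightarrow> g = h)"

definition is_kernel :: "('k, 'o, 'm) lin_cat \<Rightarrow> 'o \<Rightarrow> 'o \<Rightarrow> 'm \<Rightarrow> 'o \<Rightarrow> 'm \<Rightarrow> bool" where
  "is_kernel A X Y f K k \<longleftrightarrow> K \<in> lob A \<and> k \<in> carrier (lhom A K X) \<and>
    lcmp A K X Y k f = \<zero>\<^bsub>lhom A K Y\<^esub> \<and>
    (\<forall>W\<in>lob A. \<forall>g\<in>carrier (lhom A W X). lcmp A W X Y g f = \<zero>\<^bsub>lhom A W Y\<^esub> \<longrightarrow>
       (\<exists>!u. u \<in> carrier (lhom A W K) \<and> lcmp A W K X u k = g))"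

definition is_cokernel :: "('k, 'o, 'm) lin_cat \<Rightarrow> 'o \<Rightarrow> 'o \<Rightarrow> 'm \<Rightarrow> 'o \<Rightarrow> 'm \<Rightarrow> bool" where
  "is_cokernel A X Y f K k \<longleftrightarrow> K \<in> lob A \<and> k \<in> carrier (lhom A Y K) \<and>
    lcmp A X Y K f k = \<zero>\<^bsub>lhom A X K\<^esub> \<and>
    (\<forall>W\<in>lob A. \<forall>g\<in>carrier (lhom A Y W). lcmp A X Y W f g = \<zero>\<^bsub>lhom A X W\<^esub> \<longrightarrow>
       (\<exists>!u. u \<in> carrier (lhom A K W) \<and> lcmp A Y K W k u = g))"

definition is_biproduct ::
  "('k, 'o, 'm) lin_cat \<Rightarrow> 'o \<Rightarrow> 'o \<Rightarrow> 'o \<Rightarrow> 'm \<Rightarrow> 'm \<Rightarrow> 'm \<Rightarrow> 'm \<Rightarrow> bool" where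
  "is_biproduct A X Y Z i j p q \<longleftrightarrow> Z \<in> lob A \<and>
    i \<in> carrier (lhom A X Z) \<and> j \<in> carrier (lhom A Y Z) \<and>
    p \<in> carrier (lhom A Z X) \<and> q \<in> carrier (lhom A Z Y) \<and>
    lcmp A X Z X i p = lidn A X \<and> lcmp A Y Z Y j q = lidn A Y \<and>
    lcmp A X Z Y i q = \<zero>\<^bsub>lhom A X Y\<^esub> \<and> lcmp A Y Z X j p = \<zero>\<^bsub>lhom A Y X\<^esub> \<and>
    lcmp A Z X Z p i \<oplus>\<^bsub>lhom A Z Z\<^esub> lcmp A Z Y Z q j = lidn A Z"

definition abelian_category :: "'k ring \<Rightarrow> ('k, 'o, 'm) lin_cat \<Rightarrow> bool" where
  "abelian_category R A \<longleftrightarrow> linear_category R A \<and>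
    (\<exists>Z. zero_object A Z) \<and>
    (\<forall>X\<in>lob A. \<forall>Y\<in>lob A. \<exists>Z i j p q. is_biproduct A X Y Z i j p q) \<and>
    (\<forall>X\<in>lob A. \<forall>Y\<in>lob A. \<forall>f\<in>carrier (lhom A X Y).
       (\<exists>K k. is_kernel A X Y f K k) \<and> (\<exists>K k. is_cokernel A X Y f K k)) \<and>
    (\<forall>X Y f. is_mono A X Y f \<longrightarrow>
       (\<exists>Z\<in>lob A. \<exists>g\<in>carrier (lhom A Y Z). is_kernel A Y Z g X f)) \<and>
    (\<forall>X Y f. is_epi A X Y f \<longrightarrow>
       (\<exists>Z\<in>lob A. \<exists>g\<in>carrier (lhom A Z X). is_cokernel A Z X g Y f))"


section \<open>A-infinity categories\<close>

text \<open>
  \<open>Arr X Y d x\<close> is a homogeneous element \<open>x\<close> of degree \<open>d\<close> of a graded quiver, with source \<open>X\<close> and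
  target \<open>Y\<close>. An A-infinity category \<open>C\<close> is given by the modules \<open>shom C X Y d = (sC)\<^sup>d(X, Y)\<close> and
  its operations: \<open>bop C [x\<^sub>1, \<dots>, x\<^sub>n]\<close> is the value of \<open>b\<^sub>n\<close> on \<open>x\<^sub>1 \<otimes> \<dots> \<otimes> x\<^sub>n\<close>. All degrees are
  those of \<open>sC\<close>.
\<close>

datatype ('o, 'm) arr = Arr (asrc: 'o) (atgt: 'o) (adeg: int) (aval: 'm)

record ('k, 'o, 'm) ainf =
  aob :: "'o set"
  shom :: "'o \<Rightarrow> 'o \<Rightarrow> int \<Rightarrow> ('k, 'm) module"
  bop :: "('o, 'm) arr list \<Rightarrow> 'm"

definition composable :: "('k, 'o, 'm) ainf \<Rightarrow> ('o, 'm) arr list \<Rightarrow> bool" where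
  "composable C xs \<longleftrightarrow> xs \<noteq> [] \<and>
    (\<forall>x\<in>set xs. asrc x \<in> aob C \<and> atgt x \<in> aob C \<and>
       aval x \<in> carrier (shom C (asrc x) (atgt x) (adeg x))) \<and>
    successively (\<lambda>x y. atgt x = asrc y) xs"

definition bsrc :: "('o, 'm) arr list \<Rightarrow> 'o" where "bsrc xs = asrc (hd xs)"
definition btgt :: "('o, 'm) arr list \<Rightarrow> 'o" where "btgt xs = atgt (last xs)"
definition bdeg :: "('o, 'm) arr list \<Rightarrow> int" where "bdeg xs = sum_list (map adeg xs) + 1"

definition sgn_in :: "'k ring \<Rightarrow> int \<Rightarrow> 'k" where
  "sgn_in R d = (if even d then \<one>\<^bsub>R\<^esub> else \<ominus>\<^bsub>R\<^esub> \<one>\<^bsub>R\<^esub>)"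

definition full_subcat :: "('k, 'o, 'm) ainf \<Rightarrow> 'o set \<Rightarrow> ('k, 'o, 'm) ainf" where
  "full_subcat C S = C\<lparr>aob := S\<rparr>"

definition homotopic_to_id ::
  "'k ring \<Rightarrow> ('k, 'o, 'm) ainf \<Rightarrow> 'o \<Rightarrow> 'o \<Rightarrow> (int \<Rightarrow> 'm \<Rightarrow> 'm) \<Rightarrow> bool" where
  "homotopic_to_id R C X Y \<phi> \<longleftrightarrow>
    (\<exists>h. (\<forall>d. h d \<in> carrier (shom C X Y d) \<rightarrow> carrier (shom C X Y (d - 1))) \<and>
      (\<forall>d. \<forall>x\<in>carrier (shom C X Y d). \<forall>y\<in>carrier (shom C X Y d).
         h d (x \<oplus>\<^bsub>shom C X Y d\<^esub> y) = h d x \<oplus>\<^bsub>shom C X Y (d - 1)\<^esub> h d y) \<and>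
      (\<forall>d. \<forall>a\<in>carrier R. \<forall>x\<in>carrier (shom C X Y d).
         h d (a \<odot>\<^bsub>shom C X Y d\<^esub> x) = a \<odot>\<^bsub>shom C X Y (d - 1)\<^esub> h d x) \<and>
      (\<forall>d. \<forall>x\<in>carrier (shom C X Y d).
         \<phi> d x = x \<oplus>\<^bsub>shom C X Y d\<^esub>
           (bop C [Arr X Y (d - 1) (h d x)] \<oplus>\<^bsub>shom C X Y d\<^esub>
            h (d + 1) (bop C [Arr X Y d x]))))"

text \<open>
  The two maps required to be homotopic to the identity are \<open>(1 \<otimes> i)b\<^sub>2\<close>, which sends \<open>x\<close> to
  \<open>(x \<otimes> i)b\<^sub>2\<close>, and \<open>-(i \<otimes> 1)b\<^sub>2\<close>, which sends \<open>x\<close> to \<open>-(-1)\<^bsup>deg x\<^esup> (i \<otimes> x)b\<^sub>2\<close> by the Koszul rule.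
\<close>

definition unit_elt :: "'k ring \<Rightarrow> ('k, 'o, 'm) ainf \<Rightarrow> 'o \<Rightarrow> 'm \<Rightarrow> bool" where
  "unit_elt R C X i \<longleftrightarrow> i \<in> carrier (shom C X X (-1)) \<and>
    bop C [Arr X X (-1) i] = \<zero>\<^bsub>shom C X X 0\<^esub> \<and>
    (\<forall>W\<in>aob C. homotopic_to_id R C W X (\<lambda>d x. bop C [Arr W X d x, Arr X X (-1) i])) \<and>
    (\<forall>Y\<in>aob C. homotopic_to_id R C X Y
       (\<lambda>d x. sgn_in R (d + 1) \<odot>\<^bsub>shom C X Y d\<^esub> bop C [Arr X X (-1) i, Arr X Y d x]))"

text \<open>
  \<open>H\<^sup>0\<close>: degree 0 in \<open>C\<close> is degree \<open>-1\<close> in \<open>sC\<close>, and \<open>m\<^sub>1 = s b\<^sub>1 s\<^sup>-\<^sup>1\<close>. On elements \<open>f, g\<close> of degree 0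
  the sign in \<open>(f \<otimes> g)(s \<otimes> s) = (-1)\<^bsup>deg g\<^esup> fs \<otimes> gs\<close> is trivial, so \<open>m\<^sub>2\<close> is given by \<open>b\<^sub>2\<close>.
\<close>

definition cocycles :: "('k, 'o, 'm) ainf \<Rightarrow> 'o \<Rightarrow> 'o \<Rightarrow> 'm set" where
  "cocycles C X Y =
    {x \<in> carrier (shom C X Y (-1)). bop C [Arr X Y (-1) x] = \<zero>\<^bsub>shom C X Y 0\<^esub>}"

definition coboundaries :: "('k, 'o, 'm) ainf \<Rightarrow> 'o \<Rightarrow> 'o \<Rightarrow> 'm set" where
  "coboundaries C X Y = (\<lambda>x. bop C [Arr X Y (-2) x]) ` carrier (shom C X Y (-2))"

definition H0_class :: "('k, 'o, 'm) ainf \<Rightarrow> 'o \<Rightarrow> 'o \<Rightarrow> 'm \<Rightarrow> 'm set" where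
  "H0_class C X Y x = coboundaries C X Y +>\<^bsub>shom C X Y (-1)\<^esub> x"

definition H0 :: "'k ring \<Rightarrow> ('k, 'o, 'm) ainf \<Rightarrow> ('o, 'm set) cat" where
  "H0 R C =
    \<lparr> ob = aob C,
      hom_of = (\<lambda>X Y. H0_class C X Y ` cocycles C X Y),
      cmp = (\<lambda>X Y Z K L.
        H0_class C X Z (bop C [Arr X Y (-1) (rep K), Arr Y Z (-1) (rep L)])),
      idn = (\<lambda>X. H0_class C X X (SOME i. unit_elt R C X i)) \<rparr>"

text \<open>A strict A-infinity functor is given by its object map and its first component.\<close>

record ('o, 'm, 'p, 'n) strict_ainf_functor =
  sob :: "'o \<Rightarrow> 'p"
  scomp :: "'o \<Rightarrow> 'o \<Rightarrow> int \<Rightarrow> 'm \<Rightarrow> 'n"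

definition H0_functor ::
  "('k, 'p, 'n) ainf \<Rightarrow> ('o, 'm, 'p, 'n) strict_ainf_functor \<Rightarrow> ('o, 'm set, 'p, 'n set) funct" where
  "H0_functor D F =
    \<lparr> fob = sob F,
      fmor = (\<lambda>X Y K. H0_class D (sob F X) (sob F Y) (scomp F X Y (-1) (rep K))) \<rparr>"

text \<open>
  Differential graded categories. From \<open>m\<^sub>2 = (s \<otimes> s) b\<^sub>2 s\<^sup>-\<^sup>1\<close> one gets
  \<open>(fs \<otimes> gs) b\<^sub>2 = (-1)\<^bsup>deg g\<^esup> (f \<otimes> g) m\<^sub>2 s\<close>, with \<open>deg g = adeg g + 1\<close> the degree before the shift.
\<close>

record ('k, 'o, 'm) dg_cat =
  dob :: "'o set"
  dhom :: "'o \<Rightarrow> 'o \<Rightarrow> int \<Rightarrow> ('k, 'm) module"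
  dm1 :: "'o \<Rightarrow> 'o \<Rightarrow> int \<Rightarrow> 'm \<Rightarrow> 'm"
  dm2 :: "'o \<Rightarrow> 'o \<Rightarrow> 'o \<Rightarrow> int \<Rightarrow> int \<Rightarrow> 'm \<Rightarrow> 'm \<Rightarrow> 'm"

definition ainf_of_dg :: "'k ring \<Rightarrow> ('k, 'o, 'm) dg_cat \<Rightarrow> ('k, 'o, 'm) ainf" where
  "ainf_of_dg R C =
    \<lparr> aob = dob C,
      shom = (\<lambda>X Y d. dhom C X Y (d + 1)),
      bop = (\<lambda>xs. case xs of
          [Arr X Y d f] \<Rightarrow> dm1 C X Y (d + 1) f
        | [Arr X Y d f, Arr Y' Z e g] \<Rightarrow>
            sgn_in R (e + 1) \<odot>\<^bsub>dhom C X Z (d + e + 2)\<^esub> dm2 C X Y Z (d + 1) (e + 1) f g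
        | _ \<Rightarrow> \<zero>\<^bsub>dhom C (bsrc xs) (btgt xs) (bdeg xs + 1)\<^esub>) \<rparr>"


section \<open>Complexes\<close>

record ('o, 'm) complex =
  cob :: "int \<Rightarrow> 'o"
  cdiff :: "int \<Rightarrow> 'm"

definition is_complex :: "('k, 'o, 'm) lin_cat \<Rightarrow> ('o, 'm) complex \<Rightarrow> bool" where
  "is_complex A X \<longleftrightarrow>
    (\<forall>n. cob X n \<in> lob A \<and> cdiff X n \<in> carrier (lhom A (cob X n) (cob X (n + 1))) \<and>
      lcmp A (cob X n) (cob X (n + 1)) (cob X (n + 2)) (cdiff X n) (cdiff X (n + 1))
        = \<zero>\<^bsub>lhom A (cob X n) (cob X (n + 2))\<^esub>)"

definition cohomology_object ::
  "('k, 'o, 'm) lin_cat \<Rightarrow> ('o, 'm) complex \<Rightarrow> int \<Rightarrow> 'o \<Rightarrow> bool" where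
  "cohomology_object A X n H \<longleftrightarrow>
    (\<exists>K k u c. is_kernel A (cob X n) (cob X (n + 1)) (cdiff X n) K k \<and>
      u \<in> carrier (lhom A (cob X (n - 1)) K) \<and>
      lcmp A (cob X (n - 1)) K (cob X n) u k = cdiff X (n - 1) \<and>
      is_cokernel A (cob X (n - 1)) K u H c)"

definition acyclic_complex :: "('k, 'o, 'm) lin_cat \<Rightarrow> ('o, 'm) complex \<Rightarrow> bool" where
  "acyclic_complex A X \<longleftrightarrow> is_complex A X \<and>
    (\<forall>n H. cohomology_object A X n H \<longrightarrow> zero_object A H)"

text \<open>
  A morphism of degree \<open>d\<close> is a family \<open>f n : X\<^sup>n \<rightarrow> Y\<^sup>n\<^sup>+\<^sup>d\<close>. With maps written on the right,
  \<open>f m\<^sub>1 = f d\<^sub>Y - (-1)\<^bsup>deg f\<^esup> d\<^sub>X f\<close> and \<open>(f \<otimes> g) m\<^sub>2 = f g\<close>.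
\<close>

definition complexes_dg ::
  "'k ring \<Rightarrow> ('k, 'o, 'm) lin_cat \<Rightarrow> ('k, ('o, 'm) complex, int \<Rightarrow> 'm) dg_cat" where
  "complexes_dg R A =
    \<lparr> dob = {X. is_complex A X},
      dhom = (\<lambda>X Y d.
        \<lparr> carrier = {f. \<forall>n. f n \<in> carrier (lhom A (cob X n) (cob Y (n + d)))},
          mult = undefined, one = undefined,
          zero = (\<lambda>n. \<zero>\<^bsub>lhom A (cob X n) (cob Y (n + d))\<^esub>),
          add = (\<lambda>f g n. f n \<oplus>\<^bsub>lhom A (cob X n) (cob Y (n + d))\<^esub> g n),
          smult = (\<lambda>a f n. a \<odot>\<^bsub>lhom A (cob X n) (cob Y (n + d))\<^esub> f n) \<rparr>),
      dm1 = (\<lambda>X Y d f n.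
        lcmp A (cob X n) (cob Y (n + d)) (cob Y (n + d + 1)) (f n) (cdiff Y (n + d))
        \<ominus>\<^bsub>lhom A (cob X n) (cob Y (n + d + 1))\<^esub>
        (sgn_in R d \<odot>\<^bsub>lhom A (cob X n) (cob Y (n + d + 1))\<^esub>
         lcmp A (cob X n) (cob X (n + 1)) (cob Y (n + d + 1)) (cdiff X n) (f (n + 1)))),
      dm2 = (\<lambda>X Y Z d e f g n.
        lcmp A (cob X n) (cob Y (n + d)) (cob Z (n + d + e)) (f n) (g (n + d))) \<rparr>"

definition complexes :: "'k ring \<Rightarrow> ('k, 'o, 'm) lin_cat \<Rightarrow> ('k, ('o, 'm) complex, int \<Rightarrow> 'm) ainf"
  where "complexes R A = ainf_of_dg R (complexes_dg R A)"

definition acyclic_complexes ::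
  "'k ring \<Rightarrow> ('k, 'o, 'm) lin_cat \<Rightarrow> ('k, ('o, 'm) complex, int \<Rightarrow> 'm) ainf" where
  "acyclic_complexes R A = full_subcat (complexes R A) {X. acyclic_complex A X}"

definition shift_complex :: "('k, 'o, 'm) lin_cat \<Rightarrow> ('o, 'm) complex \<Rightarrow> ('o, 'm) complex" where
  "shift_complex A X =
    \<lparr> cob = (\<lambda>n. cob X (n + 1)),
      cdiff = (\<lambda>n. \<ominus>\<^bsub>lhom A (cob X (n + 1)) (cob X (n + 2))\<^esub> cdiff X (n + 1)) \<rparr>"

text \<open>
  \<open>Z\<close> is a mapping cone of the chain map \<open>f : X \<rightarrow> Y\<close>, with canonical maps \<open>i : Y \<rightarrow> Z\<close> and
  \<open>p : Z \<rightarrow> X[1]\<close>: \<open>Z\<^sup>n\<close> is a biproduct of \<open>X\<^sup>n\<^sup>+\<^sup>1\<close> and \<open>Y\<^sup>n\<close>, and \<open>(x, y)d = (-xd, xf + yd)\<close>.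
\<close>

definition mapping_cone ::
  "('k, 'o, 'm) lin_cat \<Rightarrow> ('o, 'm) complex \<Rightarrow> ('o, 'm) complex \<Rightarrow> (int \<Rightarrow> 'm)
    \<Rightarrow> ('o, 'm) complex \<Rightarrow> (int \<Rightarrow> 'm) \<Rightarrow> (int \<Rightarrow> 'm) \<Rightarrow> bool" where
  "mapping_cone A X Y f Z i p \<longleftrightarrow> is_complex A Z \<and>
    (\<exists>j q. \<forall>n.
      is_biproduct A (cob X (n + 1)) (cob Y n) (cob Z n) (j n) (i n) (p n) (q n) \<and>
      cdiff Z n =
        lcmp A (cob Z n) (cob X (n + 1)) (cob Z (n + 1)) (p n)
          (lcmp A (cob X (n + 1)) (cob X (n + 2)) (cob Z (n + 1))
            (\<ominus>\<^bsub>lhom A (cob X (n + 1)) (cob X (n + 2))\<^esub> cdiff X (n + 1)) (j (n + 1)))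
        \<oplus>\<^bsub>lhom A (cob Z n) (cob Z (n + 1))\<^esub>
        (lcmp A (cob Z n) (cob X (n + 1)) (cob Z (n + 1)) (p n)
          (lcmp A (cob X (n + 1)) (cob Y (n + 1)) (cob Z (n + 1)) (f (n + 1)) (i (n + 1)))
        \<oplus>\<^bsub>lhom A (cob Z n) (cob Z (n + 1))\<^esub>
         lcmp A (cob Z n) (cob Y n) (cob Z (n + 1)) (q n)
          (lcmp A (cob Y n) (cob Y (n + 1)) (cob Z (n + 1)) (cdiff Y n) (i (n + 1)))))"

text \<open>
  Distinguished triangles of the homotopy category: those isomorphic to the triangle of a mapping
  cone. The shift of a homotopy class is computed on representatives.
\<close>

definition distinguished_triangles ::
  "'k ring \<Rightarrow> ('k, 'o, 'm) lin_cat \<Rightarrow> (('o, 'm) complex, (int \<Rightarrow> 'm) set) triangle set" where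
  "distinguished_triangles R A =
    (let C = complexes R A; T = H0 R C; sh = shift_complex A in
     {(X', Y', Z', u, v, w).
        X' \<in> ob T \<and> Y' \<in> ob T \<and> Z' \<in> ob T \<and>
        u \<in> hom_of T X' Y' \<and> v \<in> hom_of T Y' Z' \<and> w \<in> hom_of T Z' (sh X') \<and>
        (\<exists>X\<in>ob T. \<exists>Y\<in>ob T. \<exists>f\<in>cocycles C X Y. \<exists>Z i p a b c.
           mapping_cone A X Y f Z i p \<and>
           is_iso T X X' a \<and> is_iso T Y Y' b \<and> is_iso T Z Z' c \<and>
           cmp T X Y Y' (H0_class C X Y f) b = cmp T X X' Y' a u \<and>
           cmp T Y Z Z' (H0_class C Y Z i) c = cmp T Y Y' Z' b v \<and>
           cmp T Z (sh X) (sh X') (H0_class C Z (sh X) p) ((\<lambda>g n. g (n + 1)) ` a)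
             = cmp T Z Z' (sh X') c w)})"

text \<open>The derived category, as the Verdier quotient \<open>D(A) = H\<^sup>0C / H\<^sup>0B\<close>.\<close>

definition derived_category ::
  "'k ring \<Rightarrow> ('k, 'o, 'm) lin_cat
    \<Rightarrow> (('o, 'm) complex, (('o, 'm) complex, (int \<Rightarrow> 'm) set) step list set) cat" where
  "derived_category R A =
    verdier_quotient (H0 R (complexes R A)) (distinguished_triangles R A)
      (H0 R (acyclic_complexes R A))"


section \<open>The quotient A-infinity category\<close>

text \<open>
  The graded quiver \<open>sE\<close> freely generated by \<open>sC\<close> under \<open>b\<^sub>n\<close> (\<open>n \<ge> 2\<close>) and \<open>H\<close> is realised as
  formal expressions modulo the identities saying that each \<open>sE(X, Y)\<^sup>d\<close> is a module, that
  \<open>sC \<rightarrow> sE\<close> and \<open>H\<close> are linear, and that each \<open>b\<^sub>n\<close> is multilinear. The free structure is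
  \<open>sE = P \<oplus> PH\<close> with \<open>P = sC \<oplus> (direct sum of the b\<^sub>n((sE)\<^sup>\<otimes>\<^sup>n))\<close>; \<open>in_P\<close> recognises the expressions
  that denote elements of \<open>P\<close> because \<open>H\<close> is not outermost in any of their summands.
\<close>

datatype ('k, 'o, 'm) expr =
    Gen 'o 'o int 'm
  | Nul 'o 'o int
  | Plus "('k, 'o, 'm) expr" "('k, 'o, 'm) expr"
  | Scale 'k "('k, 'o, 'm) expr"
  | Bop "('k, 'o, 'm) expr list"
  | Hop "('k, 'o, 'm) expr"

fun esrc :: "('k, 'o, 'm) expr \<Rightarrow> 'o" where
  "esrc (Gen X Y d f) = X"
| "esrc (Nul X Y d) = X"
| "esrc (Plus s t) = esrc s"
| "esrc (Scale a t) = esrc t"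
| "esrc (Bop ts) = hd (map esrc ts)"
| "esrc (Hop t) = esrc t"

fun etgt :: "('k, 'o, 'm) expr \<Rightarrow> 'o" where
  "etgt (Gen X Y d f) = Y"
| "etgt (Nul X Y d) = Y"
| "etgt (Plus s t) = etgt s"
| "etgt (Scale a t) = etgt t"
| "etgt (Bop ts) = last (map etgt ts)"
| "etgt (Hop t) = etgt t"

fun edeg :: "('k, 'o, 'm) expr \<Rightarrow> int" where
  "edeg (Gen X Y d f) = d"
| "edeg (Nul X Y d) = d"
| "edeg (Plus s t) = edeg s"
| "edeg (Scale a t) = edeg t"
| "edeg (Bop ts) = sum_list (map edeg ts) + 1"
| "edeg (Hop t) = edeg t - 1"

fun in_P :: "('k, 'o, 'm) expr \<Rightarrow> bool" where
  "in_P (Gen X Y d f) = True"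
| "in_P (Nul X Y d) = True"
| "in_P (Plus s t) = (in_P s \<and> in_P t)"
| "in_P (Scale a t) = in_P t"
| "in_P (Bop ts) = True"
| "in_P (Hop t) = False"

fun wf_expr :: "'k ring \<Rightarrow> ('k, 'o, 'm) ainf \<Rightarrow> 'o set \<Rightarrow> ('k, 'o, 'm) expr \<Rightarrow> bool" where
  "wf_expr R C B (Gen X Y d f) = (X \<in> aob C \<and> Y \<in> aob C \<and> f \<in> carrier (shom C X Y d))"
| "wf_expr R C B (Nul X Y d) = (X \<in> aob C \<and> Y \<in> aob C)"
| "wf_expr R C B (Plus s t) =
    (wf_expr R C B s \<and> wf_expr R C B t \<and>
     esrc s = esrc t \<and> etgt s = etgt t \<and> edeg s = edeg t)"
| "wf_expr R C B (Scale a t) = (a \<in> carrier R \<and> wf_expr R C B t)"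
| "wf_expr R C B (Bop ts) =
    (2 \<le> length ts \<and> (\<forall>t\<in>set ts. wf_expr R C B t) \<and>
     successively (\<lambda>s t. etgt s = esrc t) ts)"
| "wf_expr R C B (Hop t) = (wf_expr R C B t \<and> in_P t \<and> (esrc t \<in> B \<or> etgt t \<in> B))"

inductive lin_identity ::
  "'k ring \<Rightarrow> ('k, 'o, 'm) ainf \<Rightarrow> ('k, 'o, 'm) expr \<Rightarrow> ('k, 'o, 'm) expr \<Rightarrow> bool"
  for R C where
  "lin_identity R C (Plus (Plus r s) t) (Plus r (Plus s t))"
| "lin_identity R C (Plus s t) (Plus t s)"
| "lin_identity R C (Plus t (Nul X Y d)) t"
| "lin_identity R C (Plus t (Scale (\<ominus>\<^bsub>R\<^esub> \<one>\<^bsub>R\<^esub>) t)) (Nul (esrc t) (etgt t) (edeg t))"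
| "lin_identity R C (Scale a (Plus s t)) (Plus (Scale a s) (Scale a t))"
| "lin_identity R C (Scale (a \<oplus>\<^bsub>R\<^esub> b) t) (Plus (Scale a t) (Scale b t))"
| "lin_identity R C (Scale (a \<otimes>\<^bsub>R\<^esub> b) t) (Scale a (Scale b t))"
| "lin_identity R C (Scale \<one>\<^bsub>R\<^esub> t) t"
| "lin_identity R C (Gen X Y d (f \<oplus>\<^bsub>shom C X Y d\<^esub> g)) (Plus (Gen X Y d f) (Gen X Y d g))"
| "lin_identity R C (Gen X Y d (a \<odot>\<^bsub>shom C X Y d\<^esub> f)) (Scale a (Gen X Y d f))"
| "lin_identity R C (Bop (us @ Plus s t # vs)) (Plus (Bop (us @ s # vs)) (Bop (us @ t # vs)))"
| "lin_identity R C (Bop (us @ Scale a t # vs)) (Scale a (Bop (us @ t # vs)))"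
| "lin_identity R C (Hop (Plus s t)) (Plus (Hop s) (Hop t))"
| "lin_identity R C (Hop (Scale a t)) (Scale a (Hop t))"

inductive expr_eq ::
  "'k ring \<Rightarrow> ('k, 'o, 'm) ainf \<Rightarrow> 'o set \<Rightarrow> ('k, 'o, 'm) expr \<Rightarrow> ('k, 'o, 'm) expr \<Rightarrow> bool"
  for R C B where
  "wf_expr R C B s \<Longrightarrow> wf_expr R C B t \<Longrightarrow> lin_identity R C s t \<Longrightarrow> expr_eq R C B s t"
| "wf_expr R C B t \<Longrightarrow> expr_eq R C B t t"
| "expr_eq R C B s t \<Longrightarrow> expr_eq R C B t s"
| "expr_eq R C B r s \<Longrightarrow> expr_eq R C B s t \<Longrightarrow> expr_eq R C B r t"
| "expr_eq R C B s s' \<Longrightarrow> expr_eq R C B t t' \<Longrightarrow> wf_expr R C B (Plus s t)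
    \<Longrightarrow> expr_eq R C B (Plus s t) (Plus s' t')"
| "a \<in> carrier R \<Longrightarrow> expr_eq R C B t t' \<Longrightarrow> expr_eq R C B (Scale a t) (Scale a t')"
| "expr_eq R C B t t' \<Longrightarrow> wf_expr R C B (Bop (us @ t # vs))
    \<Longrightarrow> expr_eq R C B (Bop (us @ t # vs)) (Bop (us @ t' # vs))"
| "expr_eq R C B t t' \<Longrightarrow> wf_expr R C B (Hop t) \<Longrightarrow> wf_expr R C B (Hop t')
    \<Longrightarrow> expr_eq R C B (Hop t) (Hop t')"

definition ecls ::
  "'k ring \<Rightarrow> ('k, 'o, 'm) ainf \<Rightarrow> 'o set \<Rightarrow> ('k, 'o, 'm) expr \<Rightarrow> ('k, 'o, 'm) expr set" where
  "ecls R C B t = {u. expr_eq R C B t u}"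

text \<open>
  The differential. In \<open>insertions R ts ds\<close> the summands of \<open>\<Sum>(1\<^sup>\<otimes>\<^sup>a \<otimes> b\<^sub>p \<otimes> 1\<^sup>\<otimes>\<^sup>c) b\<^sub>a\<^sub>+\<^sub>1\<^sub>+\<^sub>c\<close> with
  \<open>a + c > 0\<close> (that is, \<open>p < length ts\<close>) are listed, applied to \<open>ts\<close>; \<open>ds\<close> are the values of \<open>b\<^sub>1\<close> on
  \<open>ts\<close>. By the Koszul rule \<open>b\<^sub>p\<close>, of degree 1, produces the sign of the last \<open>c\<close> arguments.
\<close>

definition insertions ::
  "'k ring \<Rightarrow> ('k, 'o, 'm) expr list \<Rightarrow> ('k, 'o, 'm) expr list \<Rightarrow> ('k, 'o, 'm) expr list" where
  "insertions R ts ds =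
    [Scale (sgn_in R (sum_list (map edeg (drop (a + p) ts))))
       (Bop (take a ts @ (if p = 1 then ds ! a else Bop (take p (drop a ts))) # drop (a + p) ts)).
     a \<leftarrow> [0..<length ts], p \<leftarrow> [1..<Suc (length ts - a)], p < length ts]"

fun ediff :: "'k ring \<Rightarrow> ('k, 'o, 'm) ainf \<Rightarrow> ('k, 'o, 'm) expr \<Rightarrow> ('k, 'o, 'm) expr" where
  "ediff R C (Gen X Y d f) = Gen X Y (d + 1) (bop C [Arr X Y d f])"
| "ediff R C (Nul X Y d) = Nul X Y (d + 1)"
| "ediff R C (Plus s t) = Plus (ediff R C s) (ediff R C t)"
| "ediff R C (Scale a t) = Scale a (ediff R C t)"
| "ediff R C (Bop ts) =
    Scale (\<ominus>\<^bsub>R\<^esub> \<one>\<^bsub>R\<^esub>)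
      (foldr Plus (insertions R ts (map (ediff R C) ts))
        (Nul (esrc (Bop ts)) (etgt (Bop ts)) (edeg (Bop ts) + 1)))"
| "ediff R C (Hop t) = Plus t (Scale (\<ominus>\<^bsub>R\<^esub> \<one>\<^bsub>R\<^esub>) (Hop (ediff R C t)))"

definition free_ainf ::
  "'k ring \<Rightarrow> ('k, 'o, 'm) ainf \<Rightarrow> 'o set \<Rightarrow> ('k, 'o, ('k, 'o, 'm) expr set) ainf" where
  "free_ainf R C B =
    \<lparr> aob = aob C,
      shom = (\<lambda>X Y d.
        \<lparr> carrier =
            {ecls R C B t | t. wf_expr R C B t \<and> esrc t = X \<and> etgt t = Y \<and> edeg t = d},
          mult = undefined, one = undefined,
          zero = ecls R C B (Nul X Y d),
          add = (\<lambda>K L. ecls R C B (Plus (rep K) (rep L))),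
          smult = (\<lambda>a K. ecls R C B (Scale a (rep K))) \<rparr>),
      bop = (\<lambda>xs. case xs of
          [x] \<Rightarrow> ecls R C B (ediff R C (rep (aval x)))
        | _ \<Rightarrow> ecls R C B (Bop (map (\<lambda>x. rep (aval x)) xs))) \<rparr>"

definition P_part ::
  "'k ring \<Rightarrow> ('k, 'o, 'm) ainf \<Rightarrow> 'o set \<Rightarrow> 'o \<Rightarrow> 'o \<Rightarrow> int \<Rightarrow> ('k, 'o, 'm) expr set set" where
  "P_part R C B X Y d =
    {ecls R C B t | t. wf_expr R C B t \<and> in_P t \<and> esrc t = X \<and> etgt t = Y \<and> edeg t = d}"

definition H_op ::
  "'k ring \<Rightarrow> ('k, 'o, 'm) ainf \<Rightarrow> 'o set \<Rightarrow> ('k, 'o, 'm) expr set \<Rightarrow> ('k, 'o, 'm) expr set" where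
  "H_op R C B K = ecls R C B (Hop (rep {t \<in> K. in_P t}))"

definition gen_arr ::
  "'k ring \<Rightarrow> ('k, 'o, 'm) ainf \<Rightarrow> 'o set \<Rightarrow> ('o, 'm) arr \<Rightarrow> ('o, ('k, 'o, 'm) expr set) arr" where
  "gen_arr R C B x =
    Arr (asrc x) (atgt x) (adeg x) (ecls R C B (Gen (asrc x) (atgt x) (adeg x) (aval x)))"

inductive in_R_plus ::
  "'k ring \<Rightarrow> ('k, 'o, 'm) ainf \<Rightarrow> 'o set \<Rightarrow> 'o \<Rightarrow> 'o \<Rightarrow> int \<Rightarrow> ('k, 'o, 'm) expr set \<Rightarrow> bool"
  for R C B where
  "X \<in> aob C \<Longrightarrow> Y \<in> aob C \<Longrightarrow> in_R_plus R C B X Y d (\<zero>\<^bsub>shom (free_ainf R C B) X Y d\<^esub>)"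
| "in_R_plus R C B X Y d K \<Longrightarrow> in_R_plus R C B X Y d L
    \<Longrightarrow> in_R_plus R C B X Y d (K \<oplus>\<^bsub>shom (free_ainf R C B) X Y d\<^esub> L)"
| "a \<in> carrier R \<Longrightarrow> in_R_plus R C B X Y d K
    \<Longrightarrow> in_R_plus R C B X Y d (a \<odot>\<^bsub>shom (free_ainf R C B) X Y d\<^esub> K)"
| "composable C xs \<Longrightarrow> 2 \<le> length xs
    \<Longrightarrow> in_R_plus R C B (bsrc xs) (btgt xs) (bdeg xs)
          (bop (free_ainf R C B) (map (gen_arr R C B) xs)
           \<ominus>\<^bsub>shom (free_ainf R C B) (bsrc xs) (btgt xs) (bdeg xs)\<^esub>
           aval (gen_arr R C B (Arr (bsrc xs) (btgt xs) (bdeg xs) (bop C xs))))"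
| "composable (free_ainf R C B) ys \<Longrightarrow> 2 \<le> length ys \<Longrightarrow> y \<in> set ys
    \<Longrightarrow> in_R_plus R C B (asrc y) (atgt y) (adeg y) (aval y)
    \<Longrightarrow> in_R_plus R C B (bsrc ys) (btgt ys) (bdeg ys) (bop (free_ainf R C B) ys)"
| "in_R_plus R C B X Y d K \<Longrightarrow> K \<in> P_part R C B X Y d \<Longrightarrow> X \<in> B \<or> Y \<in> B
    \<Longrightarrow> in_R_plus R C B X Y (d - 1) (H_op R C B K)"

definition R_plus ::
  "'k ring \<Rightarrow> ('k, 'o, 'm) ainf \<Rightarrow> 'o set \<Rightarrow> 'o \<Rightarrow> 'o \<Rightarrow> int \<Rightarrow> ('k, 'o, 'm) expr set set" where
  "R_plus R C B X Y d = {K. in_R_plus R C B X Y d K}"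

text \<open>The quotient of an A-infinity category by a graded subquiver \<open>N\<close> of \<open>sE\<close>.\<close>

definition quotient_ainf ::
  "('k, 'o, 'm) ainf \<Rightarrow> ('o \<Rightarrow> 'o \<Rightarrow> int \<Rightarrow> 'm set) \<Rightarrow> ('k, 'o, 'm set) ainf" where
  "quotient_ainf E N =
    \<lparr> aob = aob E,
      shom = (\<lambda>X Y d.
        \<lparr> carrier = a_rcosets\<^bsub>shom E X Y d\<^esub> (N X Y d),
          mult = undefined, one = undefined,
          zero = N X Y d,
          add = (\<lambda>K L. K <+>\<^bsub>shom E X Y d\<^esub> L),
          smult = (\<lambda>a K. N X Y d +>\<^bsub>shom E X Y d\<^esub> (a \<odot>\<^bsub>shom E X Y d\<^esub> rep K)) \<rparr>),
      bop = (\<lambda>xs. N (bsrc xs) (btgt xs) (bdeg xs)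
        +>\<^bsub>shom E (bsrc xs) (btgt xs) (bdeg xs)\<^esub>
        bop E (map (\<lambda>x. Arr (asrc x) (atgt x) (adeg x) (rep (aval x))) xs)) \<rparr>"

text \<open>\<open>quot_Q R C B\<close> is \<open>Q(C|B)\<close>, and \<open>emb_Q R C B\<close> is the strict embedding \<open>e : C \<rightarrow> Q(C|B)\<close>.\<close>

definition quot_Q ::
  "'k ring \<Rightarrow> ('k, 'o, 'm) ainf \<Rightarrow> ('k, 'o, 'm) ainf
    \<Rightarrow> ('k, 'o, ('k, 'o, 'm) expr set set) ainf" where
  "quot_Q R C B = quotient_ainf (free_ainf R C (aob B)) (R_plus R C (aob B))"

definition emb_Q ::
  "'k ring \<Rightarrow> ('k, 'o, 'm) ainf \<Rightarrow> ('k, 'o, 'm) ainf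
    \<Rightarrow> ('o, 'm, 'o, ('k, 'o, 'm) expr set set) strict_ainf_functor" where
  "emb_Q R C B =
    \<lparr> sob = (\<lambda>X. X),
      scomp = (\<lambda>X Y d f.
        R_plus R C (aob B) X Y d
        +>\<^bsub>shom (free_ainf R C (aob B)) X Y d\<^esub> ecls R C (aob B) (Gen X Y d f)) \<rparr>"

end

theory Submission
  imports Defs "HOL-Algebra.Free_Abelian_Groups"
begin

text \<open>
  For an object \<open>V\<close> of \<open>B\<close> the identity of \<open>V\<close> is a boundary in \<open>Q(C|B)\<close>, because \<open>H\<close> contracts
  every complex of morphisms from or to \<open>V\<close>. Suppose that the mapping cone \<open>Z\<close> of a cocycle
  \<open>f : X \<rightarrow> Y\<close>, with \<open>i : Y \<rightarrow> Z\<close> and \<open>p : Z \<rightarrow> X[1]\<close>, is homotopy equivalent to such an object, and let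
  \<open>\<eta>\<close> be an element with boundary the identity of \<open>Z\<close>. Then \<open>((i \<otimes> \<eta>)b\<^sub>2 \<otimes> p)b\<^sub>2\<close> represents an
  inverse of \<open>f\<close> in \<open>H\<^sup>0Q(C|B)\<close>: the A-infinity relations for \<open>b\<^sub>3\<close> reduce this to the identities between
  \<open>f, i, p\<close> and the splittings of the cone, which hold in \<open>C\<close>. So \<open>H\<^sup>0e\<close> inverts the morphisms with acyclic cone, and
  the universal property of the localization gives \<open>g\<close>.

  That \<open>H\<^sup>0Q(C|B)\<close> is a category rests on the unitality of the quotient. Multiplication by the image of an
  identity morphism of \<open>C\<close> is homotopic to the identity by a homotopy built by recursion on formal expressions,
  which is zero on \<open>sC\<close>.
\<close>

text \<open>The obstacle is that elements of the quotient are cosets of classes of formal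
  expressions, without a normal form: a map given by recursion on expressions makes sense only after
  it has been shown to respect every identity. This is done once, in \<open>eqv_recursion\<close>,
  and then applied to the differential, the contraction and the unit homotopies. The linear
  identities and the passage modulo (R_C)_+ are merged into one congruence, \<open>qeq\<close> with
  \<open>q = True\<close>, and sums with signs are computed in the free abelian group on expressions
  modulo \<open>null\<close>. A second obstacle is that H is defined on P, while \<open>in_P\<close>
  is a property of expressions that the congruence does not preserve: the sum of
  \<open>Hop t\<close> and its negative is congruent to \<open>Nul\<close>. Hence H is replaced by
  \<open>hx\<close>, its extension by zero to PH, which is still a contraction. The unit homotopy on
  b_n(t_1, ..., t_n) is read off from the A-infinity relation for t_1, ..., t_n, 1. It can start
  with zero on sC because identities are strict units in a differential graded category and its
  higher operations vanish.\<close>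

lemma category_idn: "category T \<Longrightarrow> X \<in> ob T \<Longrightarrow> idn T X \<in> hom_of T X X"
  by (simp add: category_def)

lemma category_cmp: "category T \<Longrightarrow> X \<in> ob T \<Longrightarrow> Y \<in> ob T \<Longrightarrow> Z \<in> ob T
  \<Longrightarrow> f \<in> hom_of T X Y \<Longrightarrow> g \<in> hom_of T Y Z \<Longrightarrow> cmp T X Y Z f g \<in> hom_of T X Z"
  by (simp add: category_def)

lemma category_idl: "category T \<Longrightarrow> X \<in> ob T \<Longrightarrow> Y \<in> ob T \<Longrightarrow> f \<in> hom_of T X Y
  \<Longrightarrow> cmp T X X Y (idn T X) f = f"
  by (simp add: category_def)

lemma category_idr: "category T \<Longrightarrow> X \<in> ob T \<Longrightarrow> Y \<in> ob T \<Longrightarrow> f \<in> hom_of T X Y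
  \<Longrightarrow> cmp T X Y Y f (idn T Y) = f"
  by (simp add: category_def)

lemma category_assoc: "category T \<Longrightarrow> W \<in> ob T \<Longrightarrow> X \<in> ob T \<Longrightarrow> Y \<in> ob T \<Longrightarrow> Z \<in> ob T
  \<Longrightarrow> f \<in> hom_of T W X \<Longrightarrow> g \<in> hom_of T X Y \<Longrightarrow> h \<in> hom_of T Y Z
  \<Longrightarrow> cmp T W Y Z (cmp T W X Y f g) h = cmp T W X Z f (cmp T X Y Z g h)"
  by (simp add: category_def)

lemmas category_rules = category_idn category_cmp category_idl category_idr

lemma is_iso_cmp:
  assumes T: "category T" and X: "X \<in> ob T" and Y: "Y \<in> ob T" and Z: "Z \<in> ob T"
    and f: "is_iso T X Y f" and g: "is_iso T Y Z g"
  shows "is_iso T X Z (cmp T X Y Z f g)"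
proof -
  obtain f' where f': "f \<in> hom_of T X Y" "f' \<in> hom_of T Y X" "cmp T X Y X f f' = idn T X" "cmp T Y X Y f' f = idn T Y"
    using f by (auto simp: is_iso_def)
  obtain g' where g': "g \<in> hom_of T Y Z" "g' \<in> hom_of T Z Y" "cmp T Y Z Y g g' = idn T Y" "cmp T Z Y Z g' g = idn T Z"
    using g by (auto simp: is_iso_def)
  let ?h = "cmp T Z Y X g' f'"
  have fg: "cmp T X Y Z f g \<in> hom_of T X Z" and h: "?h \<in> hom_of T Z X"
    using T X Y Z f' g' by (simp_all add: category_cmp)
  have "cmp T X Z X (cmp T X Y Z f g) ?h = cmp T X Y X f (cmp T Y Z X g ?h)"
    using T X Y Z f' g' h by (simp add: category_assoc)
  also have "cmp T Y Z X g ?h = f'"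
    using T X Y Z f' g' by (simp add: category_assoc[symmetric] category_rules)
  finally have 1: "cmp T X Z X (cmp T X Y Z f g) ?h = idn T X" by (simp add: f')
  have "cmp T Z X Z ?h (cmp T X Y Z f g) = cmp T Z Y Z g' (cmp T Y X Z f' (cmp T X Y Z f g))"
    using T X Y Z f' g' fg by (simp add: category_assoc)
  also have "cmp T Y X Z f' (cmp T X Y Z f g) = g"
    using T X Y Z f' g' by (simp add: category_assoc[symmetric] category_rules)
  finally show ?thesis using 1 fg h g' by (auto simp: is_iso_def)
qed

lemma is_iso_inverse:
  assumes "is_iso T X Y f"
  obtains g where "is_iso T Y X g" "cmp T X Y X f g = idn T X" "cmp T Y X Y g f = idn T Y"
  using assms by (auto simp: is_iso_def)

lemma is_iso_functor:
  assumes F: "is_functor T U F" and X: "X \<in> ob T" and Y: "Y \<in> ob T" and f: "is_iso T X Y f"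
  shows "is_iso U (fob F X) (fob F Y) (fmor F X Y f)"
proof -
  obtain g where g: "g \<in> hom_of T Y X" "cmp T X Y X f g = idn T X" "cmp T Y X Y g f = idn T Y"
    and f': "f \<in> hom_of T X Y"
    using f by (auto simp: is_iso_def)
  have cmp: "fmor F X Z (cmp T X Y Z f g) = cmp U (fob F X) (fob F Y) (fob F Z) (fmor F X Y f) (fmor F Y Z g)"
    if "X \<in> ob T" "Y \<in> ob T" "Z \<in> ob T" "f \<in> hom_of T X Y" "g \<in> hom_of T Y Z" for X Y Z f g
    using F that by (simp add: is_functor_def)
  have "fmor F X Y f \<in> hom_of U (fob F X) (fob F Y)" "fmor F Y X g \<in> hom_of U (fob F Y) (fob F X)"
    "fmor F X X (idn T X) = idn U (fob F X)" "fmor F Y Y (idn T Y) = idn U (fob F Y)"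
    using F X Y f' g by (simp_all add: is_functor_def)
  then show ?thesis
    using cmp[OF X Y X f' g(1)] cmp[OF Y X Y g(1) f'] g unfolding is_iso_def by metis
qed

section \<open>The universal property of the localization\<close>

lemma zigzag_ob: "zigzag T S X w Z \<Longrightarrow> X \<in> ob T \<and> Z \<in> ob T"
  by (induction rule: zigzag.induct) auto

lemma zigzag_Nil_iff [simp]: "zigzag T S X [] Z \<longleftrightarrow> X \<in> ob T \<and> Z = X"
  by (auto elim: zigzag.cases intro: zigzag.intros)

lemma zigzag_Fwd_iff [simp]: "zigzag T S X (Fwd A B f # w) Z \<longleftrightarrow>
    A = X \<and> X \<in> ob T \<and> B \<in> ob T \<and> f \<in> hom_of T X B \<and> zigzag T S B w Z"
  by (auto elim: zigzag.cases[of _ _ _ "_ # _"] intro: zigzag.intros)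

lemma zigzag_Bwd_iff [simp]: "zigzag T S X (Bwd A B s # w) Z \<longleftrightarrow>
    B = X \<and> A \<in> ob T \<and> X \<in> ob T \<and> s \<in> S A X \<and> zigzag T S A w Z"
  by (auto elim: zigzag.cases[of _ _ _ "_ # _"] intro: zigzag.intros)

lemma zigzag_append_iff: "zigzag T S X (u @ v) Z \<longleftrightarrow> (\<exists>Y. zigzag T S X u Y \<and> zigzag T S Y v Z)"
proof (induction u arbitrary: X)
  case Nil
  then show ?case by (auto dest: zigzag_ob)
next
  case (Cons a u)
  then show ?case by (cases a) auto
qed

lemma zigzag_append: "zigzag T S X u Y \<Longrightarrow> zigzag T S Y v Z \<Longrightarrow> zigzag T S X (u @ v) Z"
  by (auto simp: zigzag_append_iff)

lemma zz_equiv_zigzag: "zz_equiv T S X Y w w' \<Longrightarrow> zigzag T S X w Y \<and> zigzag T S X w' Y"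
  by (induction rule: zz_equiv.induct) auto

lemma zz_equiv_append_left:
  "zz_equiv T S Y Z w w' \<Longrightarrow> zigzag T S X u Y \<Longrightarrow> zz_equiv T S X Z (u @ w) (u @ w')"
proof (induction rule: zz_equiv.induct)
  case (1 a b u' v)
  then show ?case
    using zz_equiv.intros(1)[of T a b S X "u @ u'" v Z] by (auto intro: zigzag_append)
qed (auto intro: zz_equiv.intros zigzag_append)

lemma zz_equiv_append_right:
  "zz_equiv T S X Y w w' \<Longrightarrow> zigzag T S Y v Z \<Longrightarrow> zz_equiv T S X Z (w @ v) (w' @ v)"
proof (induction rule: zz_equiv.induct)
  case (1 a b u v')
  then show ?case
    using zz_equiv.intros(1)[of T a b S X u "v' @ v" Z] zigzag_append[OF _ 1(4)] by fastforce
qed (auto intro: zz_equiv.intros zigzag_append)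

lemma zz_equiv_append:
  assumes "zz_equiv T S X Y u u'" "zz_equiv T S Y Z v v'"
  shows "zz_equiv T S X Z (u @ v) (u' @ v')"
  using assms zz_equiv_append_left[of T S Y Z v v' X u] zz_equiv_append_right[of T S X Y u u' v' Z]
    zz_equiv_zigzag zz_equiv.intros(4) by metis

lemma zz_class_eqI: "zz_equiv T S X Y w w' \<Longrightarrow> zz_class T S X Y w = zz_class T S X Y w'"
  unfolding zz_class_def by (auto intro: zz_equiv.intros)

text \<open>Composition in \<open>localization\<close> goes through representatives chosen by
  \<open>rep\<close>. The choice is harmless because the chosen zigzag is linked to the given one by
  \<open>zz_equiv\<close>, which is compatible with concatenation.\<close>

lemma zz_equiv_rep:
  assumes "zigzag T S X w Y"
  shows "zz_equiv T S X Y w (rep (zz_class T S X Y w))"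
proof -
  have "w \<in> zz_class T S X Y w" using assms by (auto simp: zz_class_def intro: zz_equiv.intros)
  then have "rep (zz_class T S X Y w) \<in> zz_class T S X Y w" unfolding rep_def by (rule someI)
  then show ?thesis by (simp add: zz_class_def)
qed

lemma localization_cmp:
  assumes "zigzag T S X u Y" "zigzag T S Y v Z"
  shows "cmp (localization T S) X Y Z (zz_class T S X Y u) (zz_class T S Y Z v) = zz_class T S X Z (u @ v)"
  unfolding localization_def cat.simps
  by (rule zz_class_eqI, rule zz_equiv.intros(3), rule zz_equiv_append; rule zz_equiv_rep; rule assms)

lemma category_localization: "category (localization T S)"
proof -
  let ?L = "localization T S"
  have hom: "\<exists>w. f = zz_class T S X Y w \<and> zigzag T S X w Y" if "f \<in> hom_of ?L X Y" for f X Y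
    using that by (auto simp: localization_def)
  have homI: "zz_class T S X Y w \<in> hom_of ?L X Y" if "zigzag T S X w Y" for w X Y
    using that by (auto simp: localization_def)
  have idn: "idn ?L X = zz_class T S X X []" for X by (simp add: localization_def)
  have ob: "ob ?L = ob T" by (simp add: localization_def)
  show ?thesis
    unfolding category_def
    by (intro conjI ballI)
      (auto dest!: hom simp: localization_cmp idn ob zigzag_append localization_cmp[where u = "[]"]
        localization_cmp[where v = "[]"] intro!: homI)
qed

lemma is_functor_localization:
  assumes T: "category T"
  shows "is_functor T (localization T S) (localization_functor T S)"
proof -
  have fwd: "zigzag T S X [Fwd X Y f] Y" if "X \<in> ob T" "Y \<in> ob T" "f \<in> hom_of T X Y" for X Y f
    using that by (auto intro: zigzag.intros)
  show ?thesis
    unfolding is_functor_def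
  proof (intro conjI ballI T category_localization)
    fix X assume X: "X \<in> ob T"
    then show "fob (localization_functor T S) X \<in> ob (localization T S)"
      by (simp add: localization_def localization_functor_def)
    have "zz_equiv T S X X ([] @ [Fwd X X (idn T X)] @ []) ([] @ [] @ [])"
      by (rule zz_equiv.intros) (use X in \<open>auto intro: zz_rel.intros zigzag.intros category_idn[OF T]\<close>)
    then show "fmor (localization_functor T S) X X (idn T X)
        = idn (localization T S) (fob (localization_functor T S) X)"
      by (simp add: localization_def localization_functor_def zz_class_eqI)
  next
    fix X Y f assume "X \<in> ob T" "Y \<in> ob T" "f \<in> hom_of T X Y"
    then show "fmor (localization_functor T S) X Y f
      \<in> hom_of (localization T S) (fob (localization_functor T S) X) (fob (localization_functor T S) Y)"
      by (auto simp: localization_def localization_functor_def intro: fwd)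
  next
    fix X Y Z f g assume XY: "X \<in> ob T" "Y \<in> ob T" "Z \<in> ob T" "f \<in> hom_of T X Y" "g \<in> hom_of T Y Z"
    have "zz_equiv T S X Z ([] @ [Fwd X Y f, Fwd Y Z g] @ []) ([] @ [Fwd X Z (cmp T X Y Z f g)] @ [])"
      by (rule zz_equiv.intros) (use XY in \<open>auto intro: zz_rel.intros zigzag.intros category_cmp[OF T]\<close>)
    then show "fmor (localization_functor T S) X Z (cmp T X Y Z f g)
      = cmp (localization T S) (fob (localization_functor T S) X) (fob (localization_functor T S) Y)
          (fob (localization_functor T S) Z)
          (fmor (localization_functor T S) X Y f) (fmor (localization_functor T S) Y Z g)"
      using XY by (simp add: localization_functor_def localization_cmp fwd zz_class_eqI)
  qed
qed

definition iso_inv :: "('o, 'm) cat \<Rightarrow> 'o \<Rightarrow> 'o \<Rightarrow> 'm \<Rightarrow> 'm" where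
  "iso_inv U X Y f = (SOME g. g \<in> hom_of U Y X \<and> cmp U X Y X f g = idn U X \<and> cmp U Y X Y g f = idn U Y)"

lemma iso_inv:
  assumes "is_iso U X Y f"
  shows "iso_inv U X Y f \<in> hom_of U Y X" "cmp U X Y X f (iso_inv U X Y f) = idn U X"
    "cmp U Y X Y (iso_inv U X Y f) f = idn U Y"
  using someI_ex[of "\<lambda>g. g \<in> hom_of U Y X \<and> cmp U X Y X f g = idn U X \<and> cmp U Y X Y g f = idn U Y"] assms
  by (auto simp: is_iso_def iso_inv_def)

fun step_tgt :: "('o, 'm) step \<Rightarrow> 'o" where
  "step_tgt (Fwd X Y f) = Y"
| "step_tgt (Bwd X Y f) = X"

fun step_src :: "('o, 'm) step \<Rightarrow> 'o" where
  "step_src (Fwd X Y f) = X"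
| "step_src (Bwd X Y f) = Y"

fun step_mor :: "('p, 'n) cat \<Rightarrow> ('o, 'm, 'p, 'n) funct \<Rightarrow> ('o, 'm) step \<Rightarrow> 'n" where
  "step_mor U F (Fwd X Y f) = fmor F X Y f"
| "step_mor U F (Bwd X Y f) = iso_inv U (fob F X) (fob F Y) (fmor F X Y f)"

text \<open>The end object is an argument because the empty zigzag does not record the object at
  which it sits.\<close>

fun zz_mor :: "('p, 'n) cat \<Rightarrow> ('o, 'm, 'p, 'n) funct \<Rightarrow> ('o, 'm) step list \<Rightarrow> 'o \<Rightarrow> 'n" where
  "zz_mor U F [] Z = idn U (fob F Z)"
| "zz_mor U F (s # w) Z = cmp U (fob F (step_src s)) (fob F (step_tgt s)) (fob F Z) (step_mor U F s) (zz_mor U F w Z)"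

locale inverting_functor =
  fixes T :: "('o, 'm) cat" and S :: "'o \<Rightarrow> 'o \<Rightarrow> 'm set" and U :: "('p, 'n) cat" and F :: "('o, 'm, 'p, 'n) funct"
  assumes F: "is_functor T U F"
    and S_hom: "X \<in> ob T \<Longrightarrow> Y \<in> ob T \<Longrightarrow> s \<in> S X Y \<Longrightarrow> s \<in> hom_of T X Y"
    and S_iso: "X \<in> ob T \<Longrightarrow> Y \<in> ob T \<Longrightarrow> s \<in> S X Y \<Longrightarrow> is_iso U (fob F X) (fob F Y) (fmor F X Y s)"
begin

lemma U: "category U" and Fob: "X \<in> ob T \<Longrightarrow> fob F X \<in> ob U"
  and Fmor: "X \<in> ob T \<Longrightarrow> Y \<in> ob T \<Longrightarrow> f \<in> hom_of T X Y \<Longrightarrow> fmor F X Y f \<in> hom_of U (fob F X) (fob F Y)"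
  and Fidn: "X \<in> ob T \<Longrightarrow> fmor F X X (idn T X) = idn U (fob F X)"
  and Fcmp: "X \<in> ob T \<Longrightarrow> Y \<in> ob T \<Longrightarrow> Z \<in> ob T \<Longrightarrow> f \<in> hom_of T X Y \<Longrightarrow> g \<in> hom_of T Y Z
    \<Longrightarrow> fmor F X Z (cmp T X Y Z f g) = cmp U (fob F X) (fob F Y) (fob F Z) (fmor F X Y f) (fmor F Y Z g)"
  using F by (auto simp: is_functor_def)

lemma step_hom:
  "X \<in> ob T \<Longrightarrow> Y \<in> ob T \<Longrightarrow> s \<in> S X Y
    \<Longrightarrow> iso_inv U (fob F X) (fob F Y) (fmor F X Y s) \<in> hom_of U (fob F Y) (fob F X)"
  by (simp add: iso_inv S_iso)

lemma zz_mor_hom: "zigzag T S X w Z \<Longrightarrow> zz_mor U F w Z \<in> hom_of U (fob F X) (fob F Z)"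
proof (induction rule: zigzag.induct)
  case (1 X)
  then show ?case by (simp add: category_idn[OF U] Fob)
next
  case (2 X Y f w Z)
  then show ?case
    using category_cmp[OF U Fob[OF 2(1)] Fob[OF 2(2)] Fob] zigzag_ob[OF 2(4)] Fmor by simp
next
  case (3 X Y s w Z)
  then show ?case
    using category_cmp[OF U Fob[OF 3(2)] Fob[OF 3(1)] Fob] zigzag_ob[OF 3(4)] step_hom by simp
qed

lemma zz_mor_append:
  "zigzag T S X u Y \<Longrightarrow> zigzag T S Y v Z
    \<Longrightarrow> zz_mor U F (u @ v) Z = cmp U (fob F X) (fob F Y) (fob F Z) (zz_mor U F u Y) (zz_mor U F v Z)"
proof (induction rule: zigzag.induct)
  case (1 X)
  then show ?case
    using category_idl[OF U Fob Fob zz_mor_hom] zigzag_ob[OF 1(2)] by simp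
next
  case (2 X Y f w Z')
  then show ?case
    using zigzag_ob[OF 2(4)] zigzag_ob[OF 2(6)]
    by (simp add: category_assoc[OF U Fob[OF 2(1)] Fob[OF 2(2)] Fob Fob Fmor zz_mor_hom[OF 2(4)] zz_mor_hom])
next
  case (3 X Y s w Z')
  then show ?case
    using zigzag_ob[OF 3(4)] zigzag_ob[OF 3(6)]
    by (simp add: category_assoc[OF U Fob[OF 3(2)] Fob[OF 3(1)] Fob Fob step_hom zz_mor_hom[OF 3(4)] zz_mor_hom])
qed

lemma zz_mor_rel:
  assumes "zz_rel T a b" "zigzag T S X a Y" "zigzag T S X b Y"
  shows "zz_mor U F a Y = zz_mor U F b Y"
  using assms
proof cases
  case (1 X')
  then show ?thesis using assms(2)
    by (auto simp: Fidn category_idl[OF U] category_idn[OF U] Fob)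
next
  case (2 X' Y' f Z' g)
  then show ?thesis using assms(2)
    by (auto simp: Fcmp category_idr[OF U] Fob Fmor category_cmp[OF U])
next
  case (3 X' Y' s)
  then show ?thesis using assms(2)
    by (auto simp: category_idr[OF U] Fob S_iso iso_inv)
next
  case (4 X' Y' s)
  then show ?thesis using assms(2)
    by (auto simp: category_idr[OF U] Fob S_iso iso_inv Fmor)
qed

lemma zigzag_tgt_unique: "zigzag T S X w Y \<Longrightarrow> zigzag T S X w Z \<Longrightarrow> Z = Y"
  by (induction rule: zigzag.induct) auto

lemma zz_mor_equiv: "zz_equiv T S X Y w w' \<Longrightarrow> zz_mor U F w Y = zz_mor U F w' Y"
proof (induction rule: zz_equiv.induct)
  case (1 a b u v)
  obtain P Q where P: "zigzag T S X u P" "zigzag T S P a Q" "zigzag T S Q v Y"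
    using 1(2) by (auto simp: zigzag_append_iff)
  obtain Q' where P': "zigzag T S P b Q'" "zigzag T S Q' v Y"
    using 1(3) zigzag_tgt_unique[OF P(1)] by (auto simp: zigzag_append_iff)
  \<comment> \<open>\<open>a\<close> and \<open>b\<close> both start at \<open>P\<close>, but
    nothing yet says that they end at the same object. The tail \<open>v\<close> decides: if it is
    empty, both ends are \<open>Y\<close>; otherwise its first step names its own source.\<close>
  have eq: "Q' = Q"
  proof (cases v)
    case Nil
    with P(3) P'(2) show ?thesis by simp
  next
    case (Cons s v')
    with P(3) P'(2) show ?thesis by (cases s) auto
  qed
  show ?case
    unfolding zz_mor_append[OF P(1) zigzag_append[OF P(2,3)]] zz_mor_append[OF P(2,3)]
      zz_mor_append[OF P(1) zigzag_append[OF P']] zz_mor_append[OF P']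
    using zz_mor_rel[OF 1(1) P(2)] P'(1) eq by simp
qed auto

definition extension :: "('o, ('o, 'm) step list set, 'p, 'n) funct" where
  "extension = \<lparr> fob = fob F, fmor = (\<lambda>X Y K. zz_mor U F (rep K) Y) \<rparr>"

lemma extension_class:
  assumes "zigzag T S X w Y"
  shows "fmor extension X Y (zz_class T S X Y w) = zz_mor U F w Y"
  using zz_mor_equiv[OF zz_equiv_rep[OF assms]] by (simp add: extension_def)

lemma is_functor_extension: "is_functor (localization T S) U extension"
proof -
  let ?L = "localization T S"
  have hom: "\<exists>w. f = zz_class T S X Y w \<and> zigzag T S X w Y" if "f \<in> hom_of ?L X Y" for f X Y
    using that by (auto simp: localization_def)
  have [simp]: "ob ?L = ob T" "idn ?L X = zz_class T S X X []" "fob extension = fob F" for X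
    by (simp_all add: localization_def extension_def)
  show ?thesis
    unfolding is_functor_def
    by (intro conjI ballI category_localization U)
      (auto dest!: hom simp: extension_class localization_cmp zigzag_append zz_mor_append zigzag.intros
        intro!: Fob zz_mor_hom)
qed

lemma extension_factors: "functor_eq T F (functor_comp (localization_functor T S) extension)"
proof -
  have "fmor F X Y f = fmor extension X Y (zz_class T S X Y [Fwd X Y f])"
    if "X \<in> ob T" "Y \<in> ob T" "f \<in> hom_of T X Y" for X Y f
  proof -
    have "zigzag T S X [Fwd X Y f] Y" using that by (auto intro: zigzag.intros)
    then show ?thesis
      using that by (simp add: extension_class category_idr[OF U] Fob Fmor)
  qed
  then show ?thesis
    by (auto simp: functor_eq_def functor_comp_def localization_functor_def extension_def)
qed

end

section \<open>The homotopy category of an A-infinity category\<close>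

text \<open>Beyond linearity and b_1 b_1 = 0, the A-infinity relations enter through their
  consequences for cohomology: products respect cocycles and boundaries, and are associative on
  cocycles up to a boundary. In this form the locale is shared by the dg category of complexes and
  by the quotient, where the ternary operation supplies the boundary.\<close>

locale h0_ainf =
  fixes R :: "'k ring" and C :: "('k, 'o, 'm) ainf"
  assumes shom_module: "X \<in> aob C \<Longrightarrow> Y \<in> aob C \<Longrightarrow> module R (shom C X Y d)"
    and b1_closed: "X \<in> aob C \<Longrightarrow> Y \<in> aob C \<Longrightarrow> x \<in> carrier (shom C X Y d)
      \<Longrightarrow> bop C [Arr X Y d x] \<in> carrier (shom C X Y (d + 1))"
    and b1_add: "X \<in> aob C \<Longrightarrow> Y \<in> aob C \<Longrightarrow> x \<in> carrier (shom C X Y d) \<Longrightarrow> y \<in> carrier (shom C X Y d)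
      \<Longrightarrow> bop C [Arr X Y d (x \<oplus>\<^bsub>shom C X Y d\<^esub> y)]
        = bop C [Arr X Y d x] \<oplus>\<^bsub>shom C X Y (d + 1)\<^esub> bop C [Arr X Y d y]"
    and b1_b1: "X \<in> aob C \<Longrightarrow> Y \<in> aob C \<Longrightarrow> x \<in> carrier (shom C X Y d)
      \<Longrightarrow> bop C [Arr X Y (d + 1) (bop C [Arr X Y d x])] = \<zero>\<^bsub>shom C X Y (d + 2)\<^esub>"
    and b2_closed: "X \<in> aob C \<Longrightarrow> Y \<in> aob C \<Longrightarrow> Z \<in> aob C \<Longrightarrow> x \<in> carrier (shom C X Y d)
      \<Longrightarrow> y \<in> carrier (shom C Y Z e) \<Longrightarrow> bop C [Arr X Y d x, Arr Y Z e y] \<in> carrier (shom C X Z (d + e + 1))"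
    and b2_add_left: "X \<in> aob C \<Longrightarrow> Y \<in> aob C \<Longrightarrow> Z \<in> aob C \<Longrightarrow> x \<in> carrier (shom C X Y d)
      \<Longrightarrow> x' \<in> carrier (shom C X Y d) \<Longrightarrow> y \<in> carrier (shom C Y Z e)
      \<Longrightarrow> bop C [Arr X Y d (x \<oplus>\<^bsub>shom C X Y d\<^esub> x'), Arr Y Z e y]
        = bop C [Arr X Y d x, Arr Y Z e y] \<oplus>\<^bsub>shom C X Z (d + e + 1)\<^esub> bop C [Arr X Y d x', Arr Y Z e y]"
    and b2_add_right: "X \<in> aob C \<Longrightarrow> Y \<in> aob C \<Longrightarrow> Z \<in> aob C \<Longrightarrow> x \<in> carrier (shom C X Y d)
      \<Longrightarrow> y \<in> carrier (shom C Y Z e) \<Longrightarrow> y' \<in> carrier (shom C Y Z e)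
      \<Longrightarrow> bop C [Arr X Y d x, Arr Y Z e (y \<oplus>\<^bsub>shom C Y Z e\<^esub> y')]
        = bop C [Arr X Y d x, Arr Y Z e y] \<oplus>\<^bsub>shom C X Z (d + e + 1)\<^esub> bop C [Arr X Y d x, Arr Y Z e y']"
    and cocycles_b2: "X \<in> aob C \<Longrightarrow> Y \<in> aob C \<Longrightarrow> Z \<in> aob C \<Longrightarrow> x \<in> cocycles C X Y \<Longrightarrow> y \<in> cocycles C Y Z
      \<Longrightarrow> bop C [Arr X Y (-1) x, Arr Y Z (-1) y] \<in> cocycles C X Z"
    and b2_cob_left: "X \<in> aob C \<Longrightarrow> Y \<in> aob C \<Longrightarrow> Z \<in> aob C \<Longrightarrow> x \<in> coboundaries C X Y \<Longrightarrow> y \<in> cocycles C Y Z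
      \<Longrightarrow> bop C [Arr X Y (-1) x, Arr Y Z (-1) y] \<in> coboundaries C X Z"
    and b2_cob_right: "X \<in> aob C \<Longrightarrow> Y \<in> aob C \<Longrightarrow> Z \<in> aob C \<Longrightarrow> x \<in> cocycles C X Y \<Longrightarrow> y \<in> coboundaries C Y Z
      \<Longrightarrow> bop C [Arr X Y (-1) x, Arr Y Z (-1) y] \<in> coboundaries C X Z"
    and b2_assoc: "W \<in> aob C \<Longrightarrow> X \<in> aob C \<Longrightarrow> Y \<in> aob C \<Longrightarrow> Z \<in> aob C \<Longrightarrow> x \<in> cocycles C W X
      \<Longrightarrow> y \<in> cocycles C X Y \<Longrightarrow> z \<in> cocycles C Y Z
      \<Longrightarrow> \<exists>b\<in>coboundaries C W Z. bop C [Arr W Y (-1) (bop C [Arr W X (-1) x, Arr X Y (-1) y]), Arr Y Z (-1) z]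
        = b \<oplus>\<^bsub>shom C W Z (-1)\<^esub> bop C [Arr W X (-1) x, Arr X Z (-1) (bop C [Arr X Y (-1) y, Arr Y Z (-1) z])]"
    and has_unit: "X \<in> aob C \<Longrightarrow> \<exists>i. unit_elt R C X i"
begin

abbreviation b2 where "b2 X Y Z x y \<equiv> bop C [Arr X Y (-1) x, Arr Y Z (-1) y]"

lemma shom_abelian: "X \<in> aob C \<Longrightarrow> Y \<in> aob C \<Longrightarrow> abelian_group (shom C X Y d)"
  using shom_module by (auto simp: module_def)

lemma cocycles_carrier: "x \<in> cocycles C X Y \<Longrightarrow> x \<in> carrier (shom C X Y (-1))"
  by (simp add: cocycles_def)

lemma coboundaries_cocycles:
  assumes "X \<in> aob C" "Y \<in> aob C" "x \<in> coboundaries C X Y"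
  shows "x \<in> cocycles C X Y"
proof -
  obtain u where "u \<in> carrier (shom C X Y (-2))" "x = bop C [Arr X Y (-2) u]"
    using assms by (auto simp: coboundaries_def)
  then show ?thesis
    using b1_closed[OF assms(1,2), of u "-2"] b1_b1[OF assms(1,2), of u "-2"] by (simp add: cocycles_def)
qed

lemma coboundaries_subgroup:
  assumes "X \<in> aob C" "Y \<in> aob C"
  shows "subgroup (coboundaries C X Y) (add_monoid (shom C X Y (-1)))"
proof -
  interpret M: abelian_group "shom C X Y (-2)" using assms by (rule shom_abelian)
  interpret N: abelian_group "shom C X Y (-1)" using assms by (rule shom_abelian)
  have "group_hom (add_monoid (shom C X Y (-2))) (add_monoid (shom C X Y (-1))) (\<lambda>x. bop C [Arr X Y (-2) x])"
    using b1_closed[OF assms, of _ "-2"] b1_add[OF assms, of _ "-2"]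
    by (unfold_locales) (auto simp: hom_def)
  from group_hom.subgroup_img_is_subgroup[OF this group.subgroup_self[OF M.a_group]]
  show ?thesis by (simp add: coboundaries_def)
qed

lemma cocycles_add:
  assumes "X \<in> aob C" "Y \<in> aob C" "x \<in> cocycles C X Y" "y \<in> cocycles C X Y"
  shows "x \<oplus>\<^bsub>shom C X Y (-1)\<^esub> y \<in> cocycles C X Y"
proof -
  interpret M: abelian_group "shom C X Y (-1)" using assms(1,2) by (rule shom_abelian)
  interpret N: abelian_group "shom C X Y 0" using assms(1,2) by (rule shom_abelian)
  show ?thesis using assms b1_add[OF assms(1,2), of x "-1" y] by (auto simp: cocycles_def)
qed

lemma H0_class_mem:
  assumes "X \<in> aob C" "Y \<in> aob C" "x \<in> carrier (shom C X Y (-1))"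
  shows "x \<in> H0_class C X Y x"
proof -
  interpret N: abelian_group "shom C X Y (-1)" using assms(1,2) by (rule shom_abelian)
  show ?thesis unfolding H0_class_def
    using group.rcos_self[OF N.a_group _ coboundaries_subgroup[OF assms(1,2)], of x] assms(3)
    by (simp add: a_r_coset_def)
qed

lemma H0_class_eqI:
  assumes "X \<in> aob C" "Y \<in> aob C" "x \<in> carrier (shom C X Y (-1))" "y \<in> H0_class C X Y x"
  shows "H0_class C X Y y = H0_class C X Y x"
proof -
  interpret N: abelian_group "shom C X Y (-1)" using assms(1,2) by (rule shom_abelian)
  show ?thesis unfolding H0_class_def a_r_coset_def
    using group.repr_independence[OF N.a_group _ _ coboundaries_subgroup[OF assms(1,2)], of y x] assms(3,4)
    by (simp add: a_r_coset_def H0_class_def)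
qed

lemma H0_class_iff: "y \<in> H0_class C X Y x \<longleftrightarrow> (\<exists>b\<in>coboundaries C X Y. y = b \<oplus>\<^bsub>shom C X Y (-1)\<^esub> x)"
  by (auto simp: H0_class_def a_r_coset_def')

lemma rep_H0_class:
  assumes "X \<in> aob C" "Y \<in> aob C" "x \<in> cocycles C X Y"
  shows "\<exists>b\<in>coboundaries C X Y. rep (H0_class C X Y x) = b \<oplus>\<^bsub>shom C X Y (-1)\<^esub> x"
    and "rep (H0_class C X Y x) \<in> cocycles C X Y"
    and "rep (H0_class C X Y x) \<in> H0_class C X Y x"
proof -
  show *: "rep (H0_class C X Y x) \<in> H0_class C X Y x"
    unfolding rep_def by (rule someI) (rule H0_class_mem[OF assms(1,2) cocycles_carrier[OF assms(3)]])
  then show 1: "\<exists>b\<in>coboundaries C X Y. rep (H0_class C X Y x) = b \<oplus>\<^bsub>shom C X Y (-1)\<^esub> x"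
    by (simp add: H0_class_iff)
  then show "rep (H0_class C X Y x) \<in> cocycles C X Y"
    using assms coboundaries_cocycles cocycles_add by metis
qed

lemma b2_H0_class:
  assumes "X \<in> aob C" "Y \<in> aob C" "Z \<in> aob C" "x \<in> cocycles C X Y" "y \<in> cocycles C Y Z"
    and "x' \<in> H0_class C X Y x" "y' \<in> H0_class C Y Z y"
  shows "b2 X Y Z x' y' \<in> H0_class C X Z (b2 X Y Z x y)"
proof -
  interpret N: abelian_group "shom C X Z (-1)" using assms(1,3) by (rule shom_abelian)
  interpret S: subgroup "coboundaries C X Z" "add_monoid (shom C X Z (-1))"
    by (rule coboundaries_subgroup[OF assms(1,3)])
  obtain b where b: "b \<in> coboundaries C X Y" "x' = b \<oplus>\<^bsub>shom C X Y (-1)\<^esub> x"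
    using assms(6) by (auto simp: H0_class_iff)
  obtain c where c: "c \<in> coboundaries C Y Z" "y' = c \<oplus>\<^bsub>shom C Y Z (-1)\<^esub> y"
    using assms(7) by (auto simp: H0_class_iff)
  have bc: "b \<in> cocycles C X Y" "c \<in> cocycles C Y Z" and y': "y' \<in> cocycles C Y Z"
    using coboundaries_cocycles b c assms cocycles_add by auto
  \<comment> \<open>The product is expanded so that each boundary meets a cocycle: \<open>b\<close>
    is paired with all of \<open>y'\<close>, and \<open>c\<close> with \<open>x\<close>.\<close>
  have "b2 X Y Z x' y' = b2 X Y Z b y' \<oplus>\<^bsub>shom C X Z (-1)\<^esub> (b2 X Y Z x c \<oplus>\<^bsub>shom C X Z (-1)\<^esub> b2 X Y Z x y)"
    using b2_add_left[OF assms(1-3), of b "-1" x y' "-1"] b2_add_right[OF assms(1-3), of x "-1" c "-1" y]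
      b c bc y' assms(4,5) by (simp add: cocycles_carrier)
  moreover have "b2 X Y Z b y' \<in> coboundaries C X Z" "b2 X Y Z x c \<in> coboundaries C X Z"
    using b2_cob_left[OF assms(1-3) b(1) y'] b2_cob_right[OF assms(1-4) c(1)] by auto
  moreover have "b2 X Y Z x y \<in> carrier (shom C X Z (-1))"
    using cocycles_b2[OF assms(1-5)] by (rule cocycles_carrier)
  ultimately have "b2 X Y Z x' y' = (b2 X Y Z b y' \<oplus>\<^bsub>shom C X Z (-1)\<^esub> b2 X Y Z x c) \<oplus>\<^bsub>shom C X Z (-1)\<^esub> b2 X Y Z x y"
    "b2 X Y Z b y' \<oplus>\<^bsub>shom C X Z (-1)\<^esub> b2 X Y Z x c \<in> coboundaries C X Z"
    using S.m_closed S.subset by (simp_all add: N.a_assoc subset_iff)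
  then show ?thesis by (auto simp: H0_class_iff)
qed

lemma H0_cmp:
  assumes "X \<in> aob C" "Y \<in> aob C" "Z \<in> aob C" "x \<in> cocycles C X Y" "y \<in> cocycles C Y Z"
  shows "cmp (H0 R C) X Y Z (H0_class C X Y x) (H0_class C Y Z y) = H0_class C X Z (b2 X Y Z x y)"
  unfolding H0_def cat.simps
  by (rule H0_class_eqI[OF assms(1,3) cocycles_carrier[OF cocycles_b2[OF assms]]])
    (intro b2_H0_class assms rep_H0_class)

lemma unit_cocycle:
  assumes "X \<in> aob C" "unit_elt R C X i"
  shows "i \<in> cocycles C X X"
  using assms by (simp add: unit_elt_def cocycles_def)

text \<open>On a cocycle the summand h(b_1 x) of the homotopy formula is h(0) = 0, so the map
  changes \<open>x\<close> by the boundary of h(x).\<close>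

lemma homotopic_to_id_class:
  assumes "X \<in> aob C" "Y \<in> aob C" "homotopic_to_id R C X Y \<phi>" "x \<in> cocycles C X Y"
  shows "\<phi> (-1) x \<in> H0_class C X Y x"
proof -
  interpret N: abelian_group "shom C X Y (-1)" using assms(1,2) by (rule shom_abelian)
  interpret M: abelian_group "shom C X Y 0" using assms(1,2) by (rule shom_abelian)
  obtain h where h: "\<And>d. h d \<in> carrier (shom C X Y d) \<rightarrow> carrier (shom C X Y (d - 1))"
    "\<And>d x y. x\<in>carrier (shom C X Y d) \<Longrightarrow> y\<in>carrier (shom C X Y d) \<Longrightarrow>
         h d (x \<oplus>\<^bsub>shom C X Y d\<^esub> y) = h d x \<oplus>\<^bsub>shom C X Y (d - 1)\<^esub> h d y"
    "\<And>d x. x\<in>carrier (shom C X Y d) \<Longrightarrow>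
         \<phi> d x = x \<oplus>\<^bsub>shom C X Y d\<^esub>
           (bop C [Arr X Y (d - 1) (h d x)] \<oplus>\<^bsub>shom C X Y d\<^esub> h (d + 1) (bop C [Arr X Y d x]))"
    using assms(3) unfolding homotopic_to_id_def by metis
  have h0: "h 0 \<zero>\<^bsub>shom C X Y 0\<^esub> = \<zero>\<^bsub>shom C X Y (-1)\<^esub>"
    using h(2)[of "\<zero>\<^bsub>shom C X Y 0\<^esub>" 0 "\<zero>\<^bsub>shom C X Y 0\<^esub>"] funcset_mem[OF h(1)[of 0] M.zero_closed]
    by simp
  have hx: "h (-1) x \<in> carrier (shom C X Y (-2))"
    using h(1)[of "-1"] cocycles_carrier[OF assms(4)] by (auto dest: Pi_mem)
  let ?b = "bop C [Arr X Y (-2) (h (-1) x)]"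
  have b: "?b \<in> carrier (shom C X Y (-1))" using b1_closed[OF assms(1,2) hx] by simp
  have "\<phi> (-1) x = ?b \<oplus>\<^bsub>shom C X Y (-1)\<^esub> x"
    using h(3)[OF cocycles_carrier[OF assms(4)]] assms(4) b by (simp add: cocycles_def h0 N.a_comm)
  then show ?thesis using hx by (auto simp: H0_class_iff coboundaries_def)
qed

lemma b2_unit_right:
  assumes "X \<in> aob C" "Y \<in> aob C" "unit_elt R C Y i" "x \<in> cocycles C X Y"
  shows "b2 X Y Y x i \<in> H0_class C X Y x"
  using homotopic_to_id_class[OF assms(1,2) _ assms(4)] assms(1,3) by (auto simp: unit_elt_def)

lemma b2_unit_left:
  assumes "X \<in> aob C" "Y \<in> aob C" "unit_elt R C X i" "x \<in> cocycles C X Y"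
  shows "b2 X X Y i x \<in> H0_class C X Y x"
proof -
  interpret M: module R "shom C X Y (-1)" using assms(1,2) by (rule shom_module)
  have "homotopic_to_id R C X Y
       (\<lambda>d x. sgn_in R (d + 1) \<odot>\<^bsub>shom C X Y d\<^esub> bop C [Arr X X (-1) i, Arr X Y d x])"
    using assms(2,3) by (simp add: unit_elt_def)
  from homotopic_to_id_class[OF assms(1,2) this assms(4)]
  show ?thesis
    using cocycles_carrier[OF cocycles_b2[OF assms(1,1,2) unit_cocycle[OF assms(1,3)] assms(4)]]
    by (simp add: sgn_in_def)
qed

text \<open>The product of two units is cohomologous to either factor, by the right unit law for one
  and the left unit law for the other. This frees the identities of \<open>H0\<close> from the
  choice made in their definition.\<close>

lemma units_H0_class:
  assumes "X \<in> aob C" "unit_elt R C X i" "unit_elt R C X j"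
  shows "H0_class C X X i = H0_class C X X j"
proof -
  note c = unit_cocycle[OF assms(1,2)] unit_cocycle[OF assms(1,3)]
  note e = H0_class_eqI[OF assms(1,1)]
  show ?thesis
    using e[OF _ b2_unit_right[OF assms(1,1,3) c(1)]] e[OF _ b2_unit_left[OF assms(1,1,2) c(2)]] c
    by (simp add: cocycles_carrier)
qed

lemma H0_idn:
  assumes "X \<in> aob C" "unit_elt R C X i"
  shows "idn (H0 R C) X = H0_class C X X i"
  using units_H0_class[OF assms(1) someI_ex[OF has_unit[OF assms(1)]] assms(2)] by (simp add: H0_def)

lemma H0_homE:
  assumes "f \<in> hom_of (H0 R C) X Y"
  obtains x where "x \<in> cocycles C X Y" "f = H0_class C X Y x"
  using assms by (auto simp: H0_def)

lemma H0_homI: "x \<in> cocycles C X Y \<Longrightarrow> H0_class C X Y x \<in> hom_of (H0 R C) X Y"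
  by (simp add: H0_def)

lemma H0_ob [simp]: "ob (H0 R C) = aob C"
  by (simp add: H0_def)

lemma category_H0: "category (H0 R C)"
proof -
  have id: "\<exists>i. unit_elt R C X i \<and> idn (H0 R C) X = H0_class C X X i" if "X \<in> aob C" for X
    using H0_idn[OF that] has_unit[OF that] by auto
  have 1: "idn (H0 R C) X \<in> hom_of (H0 R C) X X" if "X \<in> aob C" for X
    using id[OF that] unit_cocycle[OF that] H0_homI by metis
  have 2: "cmp (H0 R C) X Y Z f g \<in> hom_of (H0 R C) X Z"
    if "X \<in> aob C" "Y \<in> aob C" "Z \<in> aob C" "f \<in> hom_of (H0 R C) X Y" "g \<in> hom_of (H0 R C) Y Z" for X Y Z f g
    using that by (auto elim!: H0_homE simp: H0_cmp intro!: H0_homI cocycles_b2)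
  have 3: "cmp (H0 R C) X X Y (idn (H0 R C) X) f = f \<and> cmp (H0 R C) X Y Y f (idn (H0 R C) Y) = f"
    if XY: "X \<in> aob C" "Y \<in> aob C" "f \<in> hom_of (H0 R C) X Y" for X Y f
  proof -
    obtain x where x: "x \<in> cocycles C X Y" "f = H0_class C X Y x" using XY(3) by (rule H0_homE)
    obtain i where i: "unit_elt R C X i" "idn (H0 R C) X = H0_class C X X i" using id[OF XY(1)] by auto
    obtain j where j: "unit_elt R C Y j" "idn (H0 R C) Y = H0_class C Y Y j" using id[OF XY(2)] by auto
    show ?thesis
      unfolding i(2) j(2) x(2) using XY i j x
      by (simp add: H0_cmp unit_cocycle H0_class_eqI[OF _ _ _ b2_unit_left] H0_class_eqI[OF _ _ _ b2_unit_right]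
          cocycles_carrier)
  qed
  have 4: "cmp (H0 R C) W Y Z (cmp (H0 R C) W X Y f g) h = cmp (H0 R C) W X Z f (cmp (H0 R C) X Y Z g h)"
    if WXYZ: "W \<in> aob C" "X \<in> aob C" "Y \<in> aob C" "Z \<in> aob C"
      "f \<in> hom_of (H0 R C) W X" "g \<in> hom_of (H0 R C) X Y" "h \<in> hom_of (H0 R C) Y Z" for W X Y Z f g h
  proof -
    obtain x where x: "x \<in> cocycles C W X" "f = H0_class C W X x" using WXYZ(5) by (rule H0_homE)
    obtain y where y: "y \<in> cocycles C X Y" "g = H0_class C X Y y" using WXYZ(6) by (rule H0_homE)
    obtain z where z: "z \<in> cocycles C Y Z" "h = H0_class C Y Z z" using WXYZ(7) by (rule H0_homE)
    have "b2 W Y Z (b2 W X Y x y) z \<in> H0_class C W Z (b2 W X Z x (b2 X Y Z y z))"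
      using b2_assoc[OF WXYZ(1-4) x(1) y(1) z(1)] by (simp add: H0_class_iff)
    from H0_class_eqI[OF WXYZ(1,4) _ this]
    show ?thesis
      using WXYZ(1-4) x y z by (simp add: H0_cmp cocycles_b2 cocycles_carrier)
  qed
  show ?thesis
    unfolding category_def using 1 2 3 4 by auto
qed

end

text \<open>Identities are preserved as soon as one unit of each object goes to a unit, because all
  units of an object have the same class. The second conclusion evaluates the functor on the class
  of a given cocycle instead of a chosen representative.\<close>

lemma is_functor_H0:
  assumes C: "h0_ainf R C" and D: "h0_ainf R D" and ob: "aob D = aob C"
    and sob: "\<And>X. sob F X = X"
    and closed: "\<And>X Y d x. X \<in> aob C \<Longrightarrow> Y \<in> aob C \<Longrightarrow> x \<in> carrier (shom C X Y d)
      \<Longrightarrow> scomp F X Y d x \<in> carrier (shom D X Y d)"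
    and zero: "\<And>X Y d. X \<in> aob C \<Longrightarrow> Y \<in> aob C \<Longrightarrow> scomp F X Y d \<zero>\<^bsub>shom C X Y d\<^esub> = \<zero>\<^bsub>shom D X Y d\<^esub>"
    and add: "\<And>X Y d x y. X \<in> aob C \<Longrightarrow> Y \<in> aob C \<Longrightarrow> x \<in> carrier (shom C X Y d)
      \<Longrightarrow> y \<in> carrier (shom C X Y d)
      \<Longrightarrow> scomp F X Y d (x \<oplus>\<^bsub>shom C X Y d\<^esub> y) = scomp F X Y d x \<oplus>\<^bsub>shom D X Y d\<^esub> scomp F X Y d y"
    and b1: "\<And>X Y d x. X \<in> aob C \<Longrightarrow> Y \<in> aob C \<Longrightarrow> x \<in> carrier (shom C X Y d)
      \<Longrightarrow> scomp F X Y (d + 1) (bop C [Arr X Y d x]) = bop D [Arr X Y d (scomp F X Y d x)]"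
    and b2: "\<And>X Y Z d e x y. X \<in> aob C \<Longrightarrow> Y \<in> aob C \<Longrightarrow> Z \<in> aob C \<Longrightarrow> x \<in> carrier (shom C X Y d)
      \<Longrightarrow> y \<in> carrier (shom C Y Z e)
      \<Longrightarrow> scomp F X Z (d + e + 1) (bop C [Arr X Y d x, Arr Y Z e y])
        = bop D [Arr X Y d (scomp F X Y d x), Arr Y Z e (scomp F Y Z e y)]"
    and unit: "\<And>X. X \<in> aob C \<Longrightarrow> \<exists>i. unit_elt R C X i \<and> unit_elt R D X (scomp F X X (-1) i)"
  shows "is_functor (H0 R C) (H0 R D) (H0_functor D F)"
    and "\<And>X Y x. X \<in> aob C \<Longrightarrow> Y \<in> aob C \<Longrightarrow> x \<in> cocycles C X Y
      \<Longrightarrow> fmor (H0_functor D F) X Y (H0_class C X Y x) = H0_class D X Y (scomp F X Y (-1) x)"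
proof -
  interpret C: h0_ainf R C by fact
  interpret D: h0_ainf R D by fact
  have cocycle: "scomp F X Y (-1) x \<in> cocycles D X Y" if "X \<in> aob C" "Y \<in> aob C" "x \<in> cocycles C X Y" for X Y x
    using closed[OF that(1,2), of x "-1"] b1[OF that(1,2), of x "-1"] zero[OF that(1,2), of 0] that(3)
    by (auto simp: cocycles_def)
  have cob: "scomp F X Y (-1) x \<in> coboundaries D X Y" if XY: "X \<in> aob C" "Y \<in> aob C" "x \<in> coboundaries C X Y" for X Y x
  proof -
    obtain u where u: "u \<in> carrier (shom C X Y (-2))" "x = bop C [Arr X Y (-2) u]"
      using XY(3) by (auto simp: coboundaries_def)
    then have "scomp F X Y (-1) x = bop D [Arr X Y (-2) (scomp F X Y (-2) u)]"
      using b1[OF XY(1,2) u(1)] by simp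
    then show ?thesis using closed[OF XY(1,2) u(1)] by (auto simp: coboundaries_def)
  qed
  have cls: "fmor (H0_functor D F) X Y (H0_class C X Y x) = H0_class D X Y (scomp F X Y (-1) x)"
    if XY: "X \<in> aob C" "Y \<in> aob C" "x \<in> cocycles C X Y" for X Y x
  proof -
    obtain b where b: "b \<in> coboundaries C X Y" "rep (H0_class C X Y x) = b \<oplus>\<^bsub>shom C X Y (-1)\<^esub> x"
      using C.rep_H0_class(1)[OF XY] by auto
    have "scomp F X Y (-1) (rep (H0_class C X Y x)) \<in> H0_class D X Y (scomp F X Y (-1) x)"
      unfolding b(2) D.H0_class_iff
      using add[OF XY(1,2), of b "-1" x] cob[OF XY(1,2) b(1)] C.cocycles_carrier[OF XY(3)]
        C.cocycles_carrier[OF C.coboundaries_cocycles[OF XY(1,2) b(1)]] by auto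
    then show ?thesis
      using D.H0_class_eqI XY ob closed[OF XY(1,2) C.cocycles_carrier[OF XY(3)]]
      by (simp add: H0_functor_def sob)
  qed
  then show "\<And>X Y x. X \<in> aob C \<Longrightarrow> Y \<in> aob C \<Longrightarrow> x \<in> cocycles C X Y
      \<Longrightarrow> fmor (H0_functor D F) X Y (H0_class C X Y x) = H0_class D X Y (scomp F X Y (-1) x)" .
  have [simp]: "fob (H0_functor D F) X = X" for X by (simp add: H0_functor_def sob)
  show "is_functor (H0 R C) (H0 R D) (H0_functor D F)"
    unfolding is_functor_def
  proof (intro conjI ballI C.category_H0 D.category_H0)
    fix X assume "X \<in> ob (H0 R C)"
    then have X: "X \<in> aob C" by simp
    then show "fob (H0_functor D F) X \<in> ob (H0 R D)" using ob by simp
    obtain i where i: "unit_elt R C X i" "unit_elt R D X (scomp F X X (-1) i)" using unit[OF X] by auto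
    then show "fmor (H0_functor D F) X X (idn (H0 R C) X) = idn (H0 R D) (fob (H0_functor D F) X)"
      using X ob by (simp add: C.H0_idn D.H0_idn cls C.unit_cocycle)
  next
    fix X Y f assume XY: "X \<in> ob (H0 R C)" "Y \<in> ob (H0 R C)" "f \<in> hom_of (H0 R C) X Y"
    then show "fmor (H0_functor D F) X Y f \<in> hom_of (H0 R D) (fob (H0_functor D F) X) (fob (H0_functor D F) Y)"
      by (auto elim!: C.H0_homE simp: cls intro!: D.H0_homI cocycle)
  next
    fix X Y Z f g assume XY: "X \<in> ob (H0 R C)" "Y \<in> ob (H0 R C)" "Z \<in> ob (H0 R C)"
      "f \<in> hom_of (H0 R C) X Y" "g \<in> hom_of (H0 R C) Y Z"
    obtain x where x: "x \<in> cocycles C X Y" "f = H0_class C X Y x" using XY(4) by (rule C.H0_homE)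
    obtain y where y: "y \<in> cocycles C Y Z" "g = H0_class C Y Z y" using XY(5) by (rule C.H0_homE)
    show "fmor (H0_functor D F) X Z (cmp (H0 R C) X Y Z f g)
      = cmp (H0 R D) (fob (H0_functor D F) X) (fob (H0_functor D F) Y) (fob (H0_functor D F) Z)
          (fmor (H0_functor D F) X Y f) (fmor (H0_functor D F) Y Z g)"
      using XY(1-3) x y ob b2[of X Y Z x "-1" y "-1"]
      by (simp add: C.H0_cmp D.H0_cmp cls cocycle C.cocycles_b2 C.cocycles_carrier)
  qed
qed

section \<open>Signs, and sums over decompositions of a list into blocks\<close>

definition sgm :: "int \<Rightarrow> 'a::ab_group_add \<Rightarrow> 'a" where
  "sgm d x = (if even d then x else - x)"

lemma sgm_simps [simp]:
  "sgm 0 x = x" "sgm d 0 = 0" "sgm d (x + y) = sgm d x + sgm d y" "sgm d (x - y) = sgm d x - sgm d y"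
  "sgm d (- x) = - sgm d x" "sgm d (sgm e x) = sgm (d + e) x" "sgm 1 x = - x" "sgm (-1) x = - x"
  by (auto simp: sgm_def)

lemma sgm_parity: "even (d - e) \<Longrightarrow> sgm d x = sgm e x"
  by (auto simp: sgm_def)

lemma sgm_sum: "sgm d (sum f A) = (\<Sum>x\<in>A. sgm d (f x))"
  by (auto simp: sgm_def sum_negf)

definition splits2 :: "'a list \<Rightarrow> ('a list \<times> 'a list) set" where
  "splits2 ts = {(u, v). u @ v = ts}"

text \<open>The index set of an A-infinity relation: \<open>m\<close> is the block that the inner
  operation contracts, \<open>u\<close> and \<open>v\<close> are the arguments left alone.
  \<open>splits5\<close> plays the same role for two disjoint blocks.\<close>

definition splits3 :: "'a list \<Rightarrow> ('a list \<times> 'a list \<times> 'a list) set" where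
  "splits3 ts = {(u, m, v). u @ m @ v = ts \<and> m \<noteq> []}"

definition splits5 ::
  "'a list \<Rightarrow> ('a list \<times> 'a list \<times> 'a list \<times> 'a list \<times> 'a list) set" where
  "splits5 ts = {(u, m, r, n, v). u @ m @ r @ n @ v = ts \<and> m \<noteq> [] \<and> n \<noteq> []}"

lemma finite_splits2 [simp]: "finite (splits2 ts)"
  by (rule finite_subset[of _ "{u. set u \<subseteq> set ts \<and> length u \<le> length ts} \<times> {u. set u \<subseteq> set ts \<and> length u \<le> length ts}"])
    (auto simp: splits2_def finite_lists_length_le)

lemma finite_splits3 [simp]: "finite (splits3 ts)"
proof -
  let ?L = "{u. set u \<subseteq> set ts \<and> length u \<le> length ts}"
  have "finite (?L \<times> ?L \<times> ?L)" by (simp add: finite_lists_length_le)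
  moreover have "splits3 ts \<subseteq> ?L \<times> ?L \<times> ?L" by (auto simp: splits3_def)
  ultimately show ?thesis by (rule rev_finite_subset)
qed

lemma splits2_Nil [simp]: "splits2 [] = {([], [])}"
  and splits3_Nil [simp]: "splits3 [] = {}"
  by (auto simp: splits2_def splits3_def)

text \<open>A block lies to the left of the marked entry \<open>x\<close>, to its right, or contains
  it. A block containing \<open>x\<close> is determined by where it starts in \<open>us\<close> and
  where it ends in \<open>vs\<close>, whence the product of two \<open>splits2\<close>.\<close>

lemma splits3_middle:
  "splits3 (us @ x # vs) =
    (\<lambda>(u, m, r). (u, m, r @ x # vs)) ` splits3 us
    \<union> (\<lambda>(r, m, v). (us @ x # r, m, v)) ` splits3 vs
    \<union> (\<lambda>((u, l), (r, v)). (u, l @ x # r, v)) ` (splits2 us \<times> splits2 vs)" (is "_ = ?R")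
proof
  show "splits3 (us @ x # vs) \<subseteq> ?R"
  proof
    fix s assume s: "s \<in> splits3 (us @ x # vs)"
    obtain u m v where [simp]: "s = (u, m, v)" by (cases s) auto
    from s have eq: "u @ m @ v = us @ x # vs" and m: "m \<noteq> []" by (auto simp: splits3_def)
    from eq consider (a) w where "u = us @ w" "w @ m @ v = x # vs" | (b) w where "us = u @ w" "m @ v = w @ x # vs"
      by (auto simp: append_eq_append_conv2)
    then have "(u, m, v) \<in> ?R"
    proof cases
      case a
      show ?thesis
      proof (cases w)
        case Nil
        with a m obtain r where "m = x # r" "r @ v = vs" "u = us" by (cases m) auto
        then have "(u, m, v) = (\<lambda>((u, l), (r, v)). (u, l @ x # r, v)) ((us, []), (r, v))"
          and "((us, []), (r, v)) \<in> splits2 us \<times> splits2 vs"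
          by (auto simp: splits2_def)
        then show ?thesis by blast
      next
        case (Cons y r)
        with a m have "(u, m, v) = (\<lambda>(r, m, v). (us @ x # r, m, v)) (r, m, v)" and "(r, m, v) \<in> splits3 vs"
          by (auto simp: splits3_def)
        then show ?thesis by blast
      qed
    next
      case b
      from b(2) consider (c) r where "m = w @ r" "r @ v = x # vs" | (d) r where "w = m @ r" "v = r @ x # vs"
        by (auto simp: append_eq_append_conv2)
      then show ?thesis
      proof cases
        case c
        show ?thesis
        proof (cases r)
          case Nil
          with b c m have "(u, m, v) = (\<lambda>(u, m, r). (u, m, r @ x # vs)) (u, m, [])" and "(u, m, []) \<in> splits3 us"
            by (auto simp: splits3_def)
          then show ?thesis by blast
        next
          case (Cons y r')
          with b c m have "(u, m, v) = (\<lambda>((u, l), (r, v)). (u, l @ x # r, v)) ((u, w), (r', v))"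
            and "((u, w), (r', v)) \<in> splits2 us \<times> splits2 vs"
            by (auto simp: splits2_def)
          then show ?thesis by blast
        qed
      next
        case d
        with b m have "(u, m, v) = (\<lambda>(u, m, r). (u, m, r @ x # vs)) (u, m, r)" and "(u, m, r) \<in> splits3 us"
          by (auto simp: splits3_def)
        then show ?thesis by blast
      qed
    qed
    then show "s \<in> ?R" by simp
  qed
  show "?R \<subseteq> splits3 (us @ x # vs)"
    by (auto simp: splits3_def splits2_def)
qed

lemma sum_splits3_middle:
  fixes F :: "'a list \<Rightarrow> 'a list \<Rightarrow> 'a list \<Rightarrow> 'v::ab_group_add"
  shows "(\<Sum>(u, m, v)\<in>splits3 (us @ x # vs). F u m v) =
    (\<Sum>(u, m, r)\<in>splits3 us. F u m (r @ x # vs))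
    + (\<Sum>(r, m, v)\<in>splits3 vs. F (us @ x # r) m v)
    + (\<Sum>(u, l)\<in>splits2 us. \<Sum>(r, v)\<in>splits2 vs. F u (l @ x # r) v)"
proof -
  let ?f = "\<lambda>(u, m, r). (u, m, r @ x # vs)"
  let ?g = "\<lambda>(r, m, v). (us @ x # r, m, v)"
  let ?h = "\<lambda>((u, l), (r, v)). (u, l @ x # r, v)"
  let ?F = "\<lambda>(u, m, v). F u m v"
  have disj: "?f ` splits3 us \<inter> ?g ` splits3 vs = {}"
    "(?f ` splits3 us \<union> ?g ` splits3 vs) \<inter> ?h ` (splits2 us \<times> splits2 vs) = {}"
    by (auto simp: splits3_def splits2_def append_eq_append_conv2 append_eq_Cons_conv Cons_eq_append_conv)
  have inj: "inj_on ?f (splits3 us)" "inj_on ?g (splits3 vs)" "inj_on ?h (splits2 us \<times> splits2 vs)"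
    by (auto simp: inj_on_def splits3_def splits2_def)
  have "sum ?F (splits3 (us @ x # vs)) =
      sum ?F (?f ` splits3 us) + sum ?F (?g ` splits3 vs) + sum ?F (?h ` (splits2 us \<times> splits2 vs))"
    unfolding splits3_middle using disj by (subst sum.union_disjoint; simp)+
  also have "sum ?F (?f ` splits3 us) = (\<Sum>(u, m, r)\<in>splits3 us. F u m (r @ x # vs))"
    by (subst sum.reindex[OF inj(1)]) (auto intro!: sum.cong)
  also have "sum ?F (?g ` splits3 vs) = (\<Sum>(r, m, v)\<in>splits3 vs. F (us @ x # r) m v)"
    by (subst sum.reindex[OF inj(2)]) (auto intro!: sum.cong)
  also have "sum ?F (?h ` (splits2 us \<times> splits2 vs))
      = (\<Sum>(u, l)\<in>splits2 us. \<Sum>(r, v)\<in>splits2 vs. F u (l @ x # r) v)"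
    by (subst sum.reindex[OF inj(3)]) (simp add: sum.cartesian_product split_def)
  finally show ?thesis .
qed

lemma sum_splits3_snoc:
  fixes F :: "'a list \<Rightarrow> 'a list \<Rightarrow> 'a list \<Rightarrow> 'v::ab_group_add"
  shows "(\<Sum>(u, m, v)\<in>splits3 (us @ [x]). F u m v) =
    (\<Sum>(u, m, r)\<in>splits3 us. F u m (r @ [x])) + (\<Sum>(u, l)\<in>splits2 us. F u (l @ [x]) [])"
  by (simp add: sum_splits3_middle[of F us x "[]"])

lemma sum_splits3_Cons:
  fixes F :: "'a list \<Rightarrow> 'a list \<Rightarrow> 'a list \<Rightarrow> 'v::ab_group_add"
  shows "(\<Sum>(u, m, v)\<in>splits3 (x # vs). F u m v) =
    (\<Sum>(r, m, v)\<in>splits3 vs. F (x # r) m v) + (\<Sum>(r, v)\<in>splits2 vs. F [] (x # r) v)"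
  using sum_splits3_middle[of F "[]" x vs] by simp

lemma sum_splits2_Cons:
  fixes F :: "'a list \<Rightarrow> 'a list \<Rightarrow> 'v::ab_group_add"
  shows "(\<Sum>(u, v)\<in>splits2 (x # vs). F u v) = F [] (x # vs) + (\<Sum>(u, v)\<in>splits2 vs. F (x # u) v)"
proof -
  have "splits2 (x # vs) = insert ([], x # vs) ((\<lambda>(u, v). (x # u, v)) ` splits2 vs)"
    by (auto simp: splits2_def Cons_eq_append_conv append_eq_Cons_conv)
  moreover have "inj_on (\<lambda>(u, v). (x # u, v)) (splits2 vs)" by (auto simp: inj_on_def)
  moreover have "([], x # vs) \<notin> (\<lambda>(u, v). (x # u, v)) ` splits2 vs" by auto
  ultimately show ?thesis
    by (simp add: sum.reindex) (auto intro!: sum.cong)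
qed

lemma sum_splits2_snoc:
  fixes F :: "'a list \<Rightarrow> 'a list \<Rightarrow> 'v::ab_group_add"
  shows "(\<Sum>(u, v)\<in>splits2 (us @ [x]). F u v) = F (us @ [x]) [] + (\<Sum>(u, v)\<in>splits2 us. F u (v @ [x]))"
proof (induction us arbitrary: F)
  case Nil
  then show ?case by (simp add: sum_splits2_Cons)
next
  case (Cons a us)
  then show ?case by (simp add: sum_splits2_Cons algebra_simps)
qed

text \<open>
  Two successive contractions of blocks of \<open>ts\<close> either concern disjoint blocks, in one of the two
  orders, or the second block contains the first one.
\<close>

lemma sum_splits3_splits3:
  fixes F :: "'a list \<Rightarrow> 'a list \<Rightarrow> 'a list \<Rightarrow> 'a list \<Rightarrow> 'a list \<Rightarrow> 'a list \<Rightarrow> 'v::ab_group_add"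
  shows "(\<Sum>(u, m, v)\<in>splits3 ts. \<Sum>(u', m', v')\<in>splits3 (u @ X m # v). F u m v u' m' v') =
    (\<Sum>(u, m, r, n, v)\<in>splits5 ts. F (u @ m @ r) n v u m (r @ X n # v) + F u m (r @ n @ v) (u @ X m # r) n v)
    + (\<Sum>(u, M, v)\<in>splits3 ts. \<Sum>(l, m, r)\<in>splits3 M. F (u @ l) m (r @ v) u (l @ X m # r) v)"
proof -
  have "(\<Sum>(u, m, v)\<in>splits3 ts. \<Sum>(u', m', v')\<in>splits3 (u @ X m # v). F u m v u' m' v') =
    (\<Sum>(u, m, v)\<in>splits3 ts. \<Sum>(u', m', r)\<in>splits3 u. F u m v u' m' (r @ X m # v))
    + (\<Sum>(u, m, v)\<in>splits3 ts. \<Sum>(r, m', v')\<in>splits3 v. F u m v (u @ X m # r) m' v')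
    + (\<Sum>(u, m, v)\<in>splits3 ts. \<Sum>(u', l)\<in>splits2 u. \<Sum>(r, v')\<in>splits2 v. F u m v u' (l @ X m # r) v')"
    unfolding sum.distrib[symmetric]
    by (rule sum.cong) (auto simp: sum_splits3_middle[where F = "F _ _ _"])
  also have "(\<Sum>(u, m, v)\<in>splits3 ts. \<Sum>(u', m', r)\<in>splits3 u. F u m v u' m' (r @ X m # v))
    = (\<Sum>(u, m, r, n, v)\<in>splits5 ts. F (u @ m @ r) n v u m (r @ X n # v))"
    unfolding split_def sum.cartesian_product 
    by ((subst sum.Sigma, simp, simp)+,
      rule sum.reindex_bij_witness[of _ "\<lambda>(u, m, r, n, v). ((u @ m @ r, n, v), (u, m, r))"
          "\<lambda>((u, m, v), (u', m', r)). (u', m', r, m, v)"])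
      (auto simp: splits3_def splits5_def)
  also have "(\<Sum>(u, m, v)\<in>splits3 ts. \<Sum>(r, m', v')\<in>splits3 v. F u m v (u @ X m # r) m' v')
    = (\<Sum>(u, m, r, n, v)\<in>splits5 ts. F u m (r @ n @ v) (u @ X m # r) n v)"
    unfolding split_def sum.cartesian_product 
    by ((subst sum.Sigma, simp, simp)+,
      rule sum.reindex_bij_witness[of _ "\<lambda>(u, m, r, n, v). ((u, m, r @ n @ v), (r, n, v))"
          "\<lambda>((u, m, v), (r, m', v')). (u, m, r, m', v')"])
      (auto simp: splits3_def splits5_def)
  also have "(\<Sum>(u, m, v)\<in>splits3 ts. \<Sum>(u', l)\<in>splits2 u. \<Sum>(r, v')\<in>splits2 v. F u m v u' (l @ X m # r) v')
    = (\<Sum>(u, M, v)\<in>splits3 ts. \<Sum>(l, m, r)\<in>splits3 M. F (u @ l) m (r @ v) u (l @ X m # r) v)"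
    unfolding split_def sum.cartesian_product 
    by ((subst sum.Sigma, simp, simp)+,
      rule sum.reindex_bij_witness[of _ "\<lambda>((u, M, v), (l, m, r)). ((u @ l, m, r @ v), ((u, l), (r, v)))"
          "\<lambda>((u, m, v), ((u', l), (r, v'))). ((u', l @ m @ r, v'), (l, m, r))"])
      (auto simp: splits3_def splits2_def)
  finally show ?thesis by (simp add: sum.distrib split_def)
qed

section \<open>Formal expressions\<close>

definition genx :: "('o, 'm) arr \<Rightarrow> ('k, 'o, 'm) expr" where
  "genx x = Gen (asrc x) (atgt x) (adeg x) (aval x)"

definition barr :: "('k, 'o, 'm) ainf \<Rightarrow> ('o, 'm) arr list \<Rightarrow> ('o, 'm) arr" where
  "barr C xs = Arr (bsrc xs) (btgt xs) (bdeg xs) (bop C xs)"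

lemma genx_simps [simp]: "esrc (genx x) = asrc x" "etgt (genx x) = atgt x" "edeg (genx x) = adeg x"
  by (simp_all add: genx_def)

lemma barr_simps [simp]: "asrc (barr C xs) = bsrc xs" "atgt (barr C xs) = btgt xs" "adeg (barr C xs) = bdeg xs"
    "aval (barr C xs) = bop C xs"
  by (simp_all add: barr_def)

abbreviation sdeg :: "('k, 'o, 'm) expr list \<Rightarrow> int" where
  "sdeg ts \<equiv> sum_list (map edeg ts)"

text \<open>
  For \<open>q = False\<close> this is \<^const>\<open>expr_eq\<close>; for \<open>q = True\<close> the operations \<open>b\<^sub>n\<close> on elements of \<open>sC\<close>
  are moreover identified with those of \<open>C\<close>, which is congruence modulo \<open>(R\<^sub>C)\<^sub>+\<close>.
\<close>

inductive qeq ::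
  "'k ring \<Rightarrow> ('k, 'o, 'm) ainf \<Rightarrow> 'o set \<Rightarrow> bool \<Rightarrow> ('k, 'o, 'm) expr \<Rightarrow> ('k, 'o, 'm) expr \<Rightarrow> bool"
  for R C B q where
  qeq_lin: "wf_expr R C B s \<Longrightarrow> wf_expr R C B t \<Longrightarrow> lin_identity R C s t \<Longrightarrow> qeq R C B q s t"
| qeq_gen: "q \<Longrightarrow> composable C xs \<Longrightarrow> 2 \<le> length xs \<Longrightarrow> wf_expr R C B (genx (barr C xs))
    \<Longrightarrow> qeq R C B q (Bop (map genx xs)) (genx (barr C xs))"
| qeq_refl: "wf_expr R C B t \<Longrightarrow> qeq R C B q t t"
| qeq_sym: "qeq R C B q s t \<Longrightarrow> qeq R C B q t s"
| qeq_trans: "qeq R C B q r s \<Longrightarrow> qeq R C B q s t \<Longrightarrow> qeq R C B q r t"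
| qeq_Plus: "qeq R C B q s s' \<Longrightarrow> qeq R C B q t t' \<Longrightarrow> wf_expr R C B (Plus s t)
    \<Longrightarrow> qeq R C B q (Plus s t) (Plus s' t')"
| qeq_Scale: "a \<in> carrier R \<Longrightarrow> qeq R C B q t t' \<Longrightarrow> qeq R C B q (Scale a t) (Scale a t')"
| qeq_Bop: "qeq R C B q t t' \<Longrightarrow> wf_expr R C B (Bop (us @ t # vs))
    \<Longrightarrow> qeq R C B q (Bop (us @ t # vs)) (Bop (us @ t' # vs))"
| qeq_Hop: "qeq R C B q t t' \<Longrightarrow> wf_expr R C B (Hop t) \<Longrightarrow> wf_expr R C B (Hop t')
    \<Longrightarrow> qeq R C B q (Hop t) (Hop t')"

lemma expr_eq_qeq: "expr_eq R C B s t = qeq R C B False s t"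
proof
  show "expr_eq R C B s t \<Longrightarrow> qeq R C B False s t"
    by (induction rule: expr_eq.induct) (rule qeq.intros; assumption)+
  show "qeq R C B False s t \<Longrightarrow> expr_eq R C B s t"
  proof (induction rule: qeq.induct)
    case (qeq_gen xs) then show ?case by simp
  qed (rule expr_eq.intros; assumption)+
qed

lemma qeq_mono: "qeq R C B False s t \<Longrightarrow> qeq R C B q s t"
proof (induction rule: qeq.induct)
  case (qeq_gen xs) then show ?case by simp
qed (rule qeq.intros; assumption)+

locale exprs =
  fixes R :: "'k ring" and C :: "('k, 'o, 'm) ainf" and B :: "'o set"
  assumes cring: "cring R"
begin

abbreviation wf where "wf \<equiv> wf_expr R C B"
abbreviation eqv where "eqv \<equiv> qeq R C B"

text \<open>Unlike well-formedness of \<open>Bop ts\<close>, this notion makes sense for lists of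
  length 0 and 1 and splits along concatenation, exposing the intermediate object. Typing arguments
  about blocks of arguments go through it.\<close>

fun path :: "'o \<Rightarrow> ('k, 'o, 'm) expr list \<Rightarrow> 'o \<Rightarrow> bool" where
  "path X [] Y \<longleftrightarrow> X = Y"
| "path X (t # ts) Y \<longleftrightarrow> wf t \<and> esrc t = X \<and> path (etgt t) ts Y"

lemma path_append [simp]: "path X (us @ vs) Y \<longleftrightarrow> (\<exists>Z. path X us Z \<and> path Z vs Y)"
  by (induction us arbitrary: X) auto

lemma path_ends: "path X ts Y \<Longrightarrow> ts \<noteq> [] \<Longrightarrow> hd (map esrc ts) = X \<and> last (map etgt ts) = Y"
proof (induction ts arbitrary: X)
  case (Cons t ts)
  then show ?case by (cases ts) auto
qed simp

lemma path_iff: "ts \<noteq> [] \<Longrightarrow> path X ts Y \<longleftrightarrow>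
  (\<forall>t\<in>set ts. wf t) \<and> successively (\<lambda>s t. etgt s = esrc t) ts \<and> hd (map esrc ts) = X \<and> last (map etgt ts) = Y"
proof (induction ts arbitrary: X)
  case (Cons t ts)
  show ?case
  proof (cases ts)
    case (Cons t' ts')
    then show ?thesis using Cons.IH[of "etgt t"] by auto
  qed auto
qed simp

lemma wf_Bop_iff: "wf (Bop ts) \<longleftrightarrow> 2 \<le> length ts \<and> (\<exists>X Y. path X ts Y)"
proof (cases "ts = []")
  case False
  then show ?thesis by (auto simp: path_iff)
qed simp

lemma wf_BopI: "path X ts Y \<Longrightarrow> 2 \<le> length ts \<Longrightarrow> wf (Bop ts)"
  unfolding wf_Bop_iff by blast

lemma Bop_ends: "path X ts Y \<Longrightarrow> ts \<noteq> [] \<Longrightarrow> esrc (Bop ts) = X \<and> etgt (Bop ts) = Y"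
  using path_ends by simp

lemma wf_Bop_subst:
  assumes "wf (Bop (us @ t # vs))" "wf t'" "esrc t' = esrc t" "etgt t' = etgt t"
  shows "wf (Bop (us @ t' # vs))" "esrc (Bop (us @ t' # vs)) = esrc (Bop (us @ t # vs))"
    "etgt (Bop (us @ t' # vs)) = etgt (Bop (us @ t # vs))"
proof -
  obtain X Y where p: "path X (us @ t # vs) Y" using assms(1) wf_Bop_iff by blast
  then have p': "path X (us @ t' # vs) Y" using assms by auto
  show "wf (Bop (us @ t' # vs))" using assms(1) by (intro wf_BopI[OF p']) simp
  show "esrc (Bop (us @ t' # vs)) = esrc (Bop (us @ t # vs))"
    "etgt (Bop (us @ t' # vs)) = etgt (Bop (us @ t # vs))"
    using Bop_ends[OF p] Bop_ends[OF p'] by simp_all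
qed

lemma edeg_Bop_subst: "edeg t' = edeg t \<Longrightarrow> edeg (Bop (us @ t' # vs)) = edeg (Bop (us @ t # vs))"
  by simp

definition typed :: "'o \<Rightarrow> 'o \<Rightarrow> int \<Rightarrow> ('k, 'o, 'm) expr \<Rightarrow> bool" where
  "typed X Y d t \<longleftrightarrow> wf t \<and> esrc t = X \<and> etgt t = Y \<and> edeg t = d"

lemma wf_ob: "wf t \<Longrightarrow> esrc t \<in> aob C \<and> etgt t \<in> aob C"
proof (induction t)
  case (Bop ts)
  then obtain X Y where p: "path X ts Y" and l: "2 \<le> length ts" using wf_Bop_iff by blast
  then have ne: "ts \<noteq> []" by auto
  have "esrc (hd ts) \<in> aob C" "etgt (last ts) \<in> aob C"
    using Bop.IH[of "hd ts"] Bop.IH[of "last ts"] Bop.prems ne by auto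
  then show ?case using ne by (simp add: hd_map last_map)
qed auto

lemma lin_identity_typed:
  "lin_identity R C s t \<Longrightarrow> wf s \<Longrightarrow> wf t \<Longrightarrow> esrc s = esrc t \<and> etgt s = etgt t \<and> edeg s = edeg t"
proof (induction rule: lin_identity.induct)
  case (11 us s t vs)
  then have "wf (Bop (us @ s # vs))" by simp
  from wf_Bop_subst(2,3)[OF this, of "Plus s t"] edeg_Bop_subst[of "Plus s t" s us vs] 11 show ?case
    by (simp del: esrc.simps(5) etgt.simps(5))
next
  case (12 us a t vs)
  then have "wf (Bop (us @ t # vs))" by simp
  from wf_Bop_subst(2,3)[OF this, of "Scale a t"] edeg_Bop_subst[of "Scale a t" t us vs] 12 show ?case
    by (simp del: esrc.simps(5) etgt.simps(5))
qed auto

lemma wf_Bop_genx: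
  assumes "composable C xs" "2 \<le> length xs"
  shows "wf (Bop (map genx xs))" "esrc (Bop (map genx xs) :: ('k, 'o, 'm) expr) = bsrc xs"
    "etgt (Bop (map genx xs) :: ('k, 'o, 'm) expr) = btgt xs" "edeg (Bop (map genx xs) :: ('k, 'o, 'm) expr) = bdeg xs"
proof -
  have ne: "xs \<noteq> []" using assms by auto
  show "wf (Bop (map genx xs))"
    using assms by (auto simp: composable_def successively_map genx_def)
  show "esrc (Bop (map genx xs) :: ('k, 'o, 'm) expr) = bsrc xs" "etgt (Bop (map genx xs) :: ('k, 'o, 'm) expr) = btgt xs"
    using ne by (simp_all add: bsrc_def btgt_def hd_map last_map)
  show "edeg (Bop (map genx xs) :: ('k, 'o, 'm) expr) = bdeg xs"
    by (simp add: bdeg_def o_def)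
qed

lemma eqv_typed: "eqv q s t \<Longrightarrow> wf s \<and> wf t \<and> esrc s = esrc t \<and> etgt s = etgt t \<and> edeg s = edeg t"
proof (induction rule: qeq.induct)
  case (qeq_lin s t)
  then show ?case using lin_identity_typed by blast
next
  case (qeq_gen xs)
  then show ?case using wf_Bop_genx by (simp del: esrc.simps etgt.simps edeg.simps wf_expr.simps)
next
  case (qeq_Bop t t' us vs)
  then show ?case
    using wf_Bop_subst[of us t vs t'] edeg_Bop_subst[of t' t us vs]
    by (simp del: esrc.simps etgt.simps edeg.simps wf_expr.simps)
qed auto

lemma eqv_typedD: "eqv q s t \<Longrightarrow> typed X Y d s \<longleftrightarrow> typed X Y d t"
  using eqv_typed by (auto simp: typed_def)

text \<open>The class map \<open>c\<close> is left abstract because the argument is used twice: for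
  classes of expressions in \<open>emod\<close>, and for the cosets \<open>dcl\<close> in the
  quotient. The module axioms come from the rules of \<open>lin_identity\<close>, transported by
  \<open>eq\<close>.\<close>

lemma module_of_exprs:
  fixes M :: "('k, 'x) module" and c :: "('k, 'o, 'm) expr \<Rightarrow> 'x"
  assumes X: "X \<in> aob C" and Y: "Y \<in> aob C"
    and car: "carrier M = {c t | t. typed X Y d t}"
    and zero: "\<zero>\<^bsub>M\<^esub> = c (Nul X Y d)"
    and add: "\<And>s t. typed X Y d s \<Longrightarrow> typed X Y d t \<Longrightarrow> c s \<oplus>\<^bsub>M\<^esub> c t = c (Plus s t)"
    and smult: "\<And>a t. a \<in> carrier R \<Longrightarrow> typed X Y d t \<Longrightarrow> a \<odot>\<^bsub>M\<^esub> c t = c (Scale a t)"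
    and eq: "\<And>s t. typed X Y d s \<Longrightarrow> typed X Y d t \<Longrightarrow> eqv q s t \<Longrightarrow> c s = c t"
  shows "module R M"
    and "\<And>t. typed X Y d t \<Longrightarrow> \<ominus>\<^bsub>M\<^esub> c t = c (Scale (\<ominus>\<^bsub>R\<^esub> \<one>\<^bsub>R\<^esub>) t)"
proof -
  interpret R: cring R by (rule cring)
  have lin: "c s = c t" if "lin_identity R C s t" "typed X Y d s" "typed X Y d t" for s t
    using that eq[OF that(2,3)] by (auto simp: typed_def intro: qeq_lin)
  have nul: "typed X Y d (Nul X Y d)" using X Y by (simp add: typed_def)
  have tP: "typed X Y d (Plus s t)" if "typed X Y d s" "typed X Y d t" for s t
    using that by (simp add: typed_def)
  have tS: "typed X Y d (Scale a t)" if "a \<in> carrier R" "typed X Y d t" for a t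
    using that by (simp add: typed_def)
  have E: "\<exists>t. x = c t \<and> typed X Y d t" if "x \<in> carrier M" for x using that car by auto
  have I: "c t \<in> carrier M" if "typed X Y d t" for t using that car by auto
  have comm: "c (Plus s t) = c (Plus t s)" if "typed X Y d s" "typed X Y d t" for s t
    using that by (intro lin lin_identity.intros tP)
  have unitr: "c (Plus t (Nul X Y d)) = c t" if "typed X Y d t" for t
    using that nul by (intro lin lin_identity.intros tP)
  have inv: "c (Plus t (Scale (\<ominus>\<^bsub>R\<^esub> \<one>\<^bsub>R\<^esub>) t)) = c (Nul X Y d)" if "typed X Y d t" for t
  proof -
    have "lin_identity R C (Plus t (Scale (\<ominus>\<^bsub>R\<^esub> \<one>\<^bsub>R\<^esub>) t)) (Nul (esrc t) (etgt t) (edeg t))"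
      by (rule lin_identity.intros)
    then show ?thesis using that nul by (intro lin tP tS) (auto simp: typed_def)
  qed
  have assoc: "c (Plus (Plus r s) t) = c (Plus r (Plus s t))" if "typed X Y d r" "typed X Y d s" "typed X Y d t" for r s t
    using that by (intro lin lin_identity.intros tP)
  have one: "\<ominus>\<^bsub>R\<^esub> \<one>\<^bsub>R\<^esub> \<in> carrier R" by simp
  have ab: "abelian_group M"
  proof (rule abelian_groupI)
    fix x assume "x \<in> carrier M"
    then obtain t where t: "x = c t" "typed X Y d t" using E by auto
    show "\<zero>\<^bsub>M\<^esub> \<oplus>\<^bsub>M\<^esub> x = x" unfolding zero t(1)
      using t(2) nul comm[OF nul t(2)] unitr[OF t(2)] by (simp add: add)
    show "\<exists>y\<in>carrier M. y \<oplus>\<^bsub>M\<^esub> x = \<zero>\<^bsub>M\<^esub>"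
      using I[OF tS[OF one t(2)]] add[OF tS[OF one t(2)] t(2)] comm[OF t(2) tS[OF one t(2)]] inv[OF t(2)]
      unfolding zero t(1) by auto
  next
    fix x y z assume "x \<in> carrier M" "y \<in> carrier M" "z \<in> carrier M"
    then obtain r s t where "x = c r" "y = c s" "z = c t" "typed X Y d r" "typed X Y d s" "typed X Y d t"
      using E by metis
    then show "x \<oplus>\<^bsub>M\<^esub> y \<oplus>\<^bsub>M\<^esub> z = x \<oplus>\<^bsub>M\<^esub> (y \<oplus>\<^bsub>M\<^esub> z)" by (simp add: add tP assoc)
  next
    fix x y assume "x \<in> carrier M" "y \<in> carrier M"
    then obtain s t where "x = c s" "y = c t" "typed X Y d s" "typed X Y d t"
      using E by metis
    then show "x \<oplus>\<^bsub>M\<^esub> y \<in> carrier M" "x \<oplus>\<^bsub>M\<^esub> y = y \<oplus>\<^bsub>M\<^esub> x" by (simp_all add: add tP comm I)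
  qed (simp add: zero I nul)
  show "module R M"
  proof (rule moduleI[OF cring ab])
    fix a x assume a: "a \<in> carrier R" and "x \<in> carrier M"
    then obtain t where t: "x = c t" "typed X Y d t" using E by metis
    then show "a \<odot>\<^bsub>M\<^esub> x \<in> carrier M" using a by (simp add: smult tS I)
    fix b assume b: "b \<in> carrier R"
    have "c (Scale (a \<oplus>\<^bsub>R\<^esub> b) t) = c (Plus (Scale a t) (Scale b t))"
      using a b t(2) by (intro lin lin_identity.intros tP tS) auto
    then show "(a \<oplus>\<^bsub>R\<^esub> b) \<odot>\<^bsub>M\<^esub> x = a \<odot>\<^bsub>M\<^esub> x \<oplus>\<^bsub>M\<^esub> b \<odot>\<^bsub>M\<^esub> x"
      using a b t by (simp add: smult add tS)
    have "c (Scale (a \<otimes>\<^bsub>R\<^esub> b) t) = c (Scale a (Scale b t))"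
      using a b t(2) by (intro lin lin_identity.intros tP tS) auto
    then show "(a \<otimes>\<^bsub>R\<^esub> b) \<odot>\<^bsub>M\<^esub> x = a \<odot>\<^bsub>M\<^esub> (b \<odot>\<^bsub>M\<^esub> x)"
      using a b t by (simp add: smult add tS)
  next
    fix a x y assume a: "a \<in> carrier R" and "x \<in> carrier M" "y \<in> carrier M"
    then obtain s t where t: "x = c s" "y = c t" "typed X Y d s" "typed X Y d t"
      using E by metis
    have "c (Scale a (Plus s t)) = c (Plus (Scale a s) (Scale a t))"
      using a t by (intro lin lin_identity.intros tP tS) auto
    then show "a \<odot>\<^bsub>M\<^esub> (x \<oplus>\<^bsub>M\<^esub> y) = a \<odot>\<^bsub>M\<^esub> x \<oplus>\<^bsub>M\<^esub> a \<odot>\<^bsub>M\<^esub> y"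
      using a t by (simp add: smult add tS tP)
  next
    fix x assume "x \<in> carrier M"
    then obtain t where t: "x = c t" "typed X Y d t" using E by metis
    have "c (Scale \<one>\<^bsub>R\<^esub> t) = c t"
      using t(2) by (intro lin lin_identity.intros tS) auto
    then show "\<one>\<^bsub>R\<^esub> \<odot>\<^bsub>M\<^esub> x = x" using t by (simp add: smult)
  qed
  interpret M: abelian_group M by (rule ab)
  show "\<ominus>\<^bsub>M\<^esub> c t = c (Scale (\<ominus>\<^bsub>R\<^esub> \<one>\<^bsub>R\<^esub>) t)" if t: "typed X Y d t" for t
    using inv[OF t] t tS[OF one t] comm[OF tS[OF one t] t]
    by (intro M.minus_equality) (simp_all add: add zero I)
qed

definition ecl :: "bool \<Rightarrow> ('k, 'o, 'm) expr \<Rightarrow> ('k, 'o, 'm) expr set" where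
  "ecl q t = {u. eqv q t u}"

lemma ecls_ecl: "ecls R C B = ecl False"
  by (auto simp: ecls_def ecl_def expr_eq_qeq fun_eq_iff)

lemma eqv_rep: "wf t \<Longrightarrow> eqv q t (rep (ecl q t))"
  unfolding rep_def ecl_def by (rule someI2[where a = t]) (auto intro: qeq_refl)

lemma ecl_eq_iff: "wf s \<Longrightarrow> ecl q s = ecl q t \<longleftrightarrow> eqv q s t"
  unfolding ecl_def by (blast intro: qeq_refl qeq_sym qeq_trans)

text \<open>For \<open>q = False\<close> these are the modules of the free A-infinity category. For
  \<open>q = True\<close> they model the quotient in one step, without cosets, and serve as the
  target of the homomorphism in \<open>eqv_of_null\<close>.\<close>

definition emod :: "bool \<Rightarrow> 'o \<Rightarrow> 'o \<Rightarrow> int \<Rightarrow> ('k, ('k, 'o, 'm) expr set) module" where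
  "emod q X Y d =
    \<lparr> carrier = {ecl q t | t. wf t \<and> esrc t = X \<and> etgt t = Y \<and> edeg t = d},
      mult = undefined, one = undefined, ring.zero = ecl q (Nul X Y d),
      add = (\<lambda>K L. ecl q (Plus (rep K) (rep L))),
      smult = (\<lambda>a K. ecl q (Scale a (rep K))) \<rparr>"

lemma shom_free_ainf: "shom (free_ainf R C B) = emod False"
  by (simp add: free_ainf_def emod_def ecls_ecl fun_eq_iff)

lemma emod_simps:
  "carrier (emod q X Y d) = {ecl q t | t. typed X Y d t}"
  "\<zero>\<^bsub>emod q X Y d\<^esub> = ecl q (Nul X Y d)"
  "typed X Y d s \<Longrightarrow> typed X Y d t \<Longrightarrow> ecl q s \<oplus>\<^bsub>emod q X Y d\<^esub> ecl q t = ecl q (Plus s t)"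
  "a \<in> carrier R \<Longrightarrow> typed X Y d t \<Longrightarrow> a \<odot>\<^bsub>emod q X Y d\<^esub> ecl q t = ecl q (Scale a t)"
proof -
  show "carrier (emod q X Y d) = {ecl q t | t. typed X Y d t}"
    by (simp add: emod_def typed_def)
  show "\<zero>\<^bsub>emod q X Y d\<^esub> = ecl q (Nul X Y d)" by (simp add: emod_def)
  { assume st: "typed X Y d s" "typed X Y d t"
    then have "eqv q (Plus s t) (Plus (rep (ecl q s)) (rep (ecl q t)))"
      by (intro qeq_Plus eqv_rep) (auto simp: typed_def)
    then have "ecl q (Plus s t) = ecl q (Plus (rep (ecl q s)) (rep (ecl q t)))"
      using ecl_eq_iff eqv_typed by metis
    then show "ecl q s \<oplus>\<^bsub>emod q X Y d\<^esub> ecl q t = ecl q (Plus s t)"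
      by (simp add: emod_def) }
  { assume st: "a \<in> carrier R" "typed X Y d t"
    then have "eqv q (Scale a t) (Scale a (rep (ecl q t)))"
      by (intro qeq_Scale eqv_rep) (auto simp: typed_def)
    then have "ecl q (Scale a t) = ecl q (Scale a (rep (ecl q t)))"
      using ecl_eq_iff eqv_typed by metis
    then show "a \<odot>\<^bsub>emod q X Y d\<^esub> ecl q t = ecl q (Scale a t)"
      by (simp add: emod_def) }
qed

lemma module_emod:
  assumes "X \<in> aob C" "Y \<in> aob C"
  shows "module R (emod q X Y d)"
    and "typed X Y d t \<Longrightarrow> \<ominus>\<^bsub>emod q X Y d\<^esub> ecl q t = ecl q (Scale (\<ominus>\<^bsub>R\<^esub> \<one>\<^bsub>R\<^esub>) t)"
proof -
  have eq: "ecl q s = ecl q t" if "typed X Y d s" "typed X Y d t" "eqv q s t" for s t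
    using that ecl_eq_iff by (auto simp: typed_def)
  note * = module_of_exprs[where M = "emod q X Y d" and c = "ecl q" and q = q, OF assms emod_simps(1-4) eq]
  show "module R (emod q X Y d)" by (rule *(1))
  show "typed X Y d t \<Longrightarrow> \<ominus>\<^bsub>emod q X Y d\<^esub> ecl q t = ecl q (Scale (\<ominus>\<^bsub>R\<^esub> \<one>\<^bsub>R\<^esub>) t)" by (rule *(2))
qed

section \<open>Integral combinations of expressions\<close>

text \<open>The subgroup by which integral combinations are divided: formal addition becomes
  \<open>Plus\<close>, and congruent expressions become equal. Scalars of \<open>R\<close> stay
  inside the expressions.\<close>

inductive null :: "bool \<Rightarrow> (('k, 'o, 'm) expr \<Rightarrow>\<^sub>0 int) \<Rightarrow> bool" for q where
  null_zero: "null q 0"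
| null_diff: "null q x \<Longrightarrow> null q y \<Longrightarrow> null q (x - y)"
| null_eqv: "eqv q s t \<Longrightarrow> null q (frag_of s - frag_of t)"
| null_Plus: "wf (Plus s t) \<Longrightarrow> null q (frag_of (Plus s t) - frag_of s - frag_of t)"

lemma null_minus: "null q x \<Longrightarrow> null q (- x)"
  using null_diff[OF null_zero] by fastforce

lemma null_add: "null q x \<Longrightarrow> null q y \<Longrightarrow> null q (x + y)"
  using null_diff[OF _ null_minus, of q x y] by simp

lemma null_sgm: "null q x \<Longrightarrow> null q (sgm d x)"
  by (auto simp: sgm_def null_minus)

lemma null_sum: "(\<And>i. i \<in> I \<Longrightarrow> null q (f i)) \<Longrightarrow> null q (sum f I)"
  by (induction I rule: infinite_finite_induct) (auto intro: null_zero null_add)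

text \<open>Nothing is lost by calculating with integral combinations of expressions modulo null ones.\<close>

lemma eqv_of_null:
  assumes "null q (frag_of s - frag_of t)" "typed X Y d s" "typed X Y d t"
  shows "eqv q s t"
proof -
  have XY: "X \<in> aob C" "Y \<in> aob C" using wf_ob assms(2) by (auto simp: typed_def)
  let ?M = "emod q X Y d"
  interpret M: module R ?M using XY by (rule module_emod)
  \<comment> \<open>The basis consists of expressions of all types, so the homomorphism is the class
    map on the type \<open>X\<close>, \<open>Y\<close>, \<open>d\<close> and zero on every other
    type. Each generator of \<open>null\<close> involves expressions of a single type and is
    therefore killed.\<close>
  let ?f = "\<lambda>u. if typed X Y d u then ecl q u else \<zero>\<^bsub>?M\<^esub>"
  have f: "?f ` UNIV \<subseteq> carrier (add_monoid ?M)"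
    using M.zero_closed by (auto simp: emod_simps)
  obtain h where h: "h \<in> hom (free_Abelian_group UNIV) (add_monoid ?M)" "\<And>u. h (frag_of u) = ?f u"
    using comm_group.free_Abelian_group_universal[OF M.a_comm_group f] by auto
  have hc: "h x \<in> carrier ?M" for x using h(1) by (auto simp: hom_def)
  have hd: "h (x - y) \<oplus>\<^bsub>?M\<^esub> h y = h x" for x y
    using hom_mult[OF h(1), of "x - y" y] by simp
  have cancel: "x = \<zero>\<^bsub>?M\<^esub>" if "x \<oplus>\<^bsub>?M\<^esub> y = y" "x \<in> carrier ?M" "y \<in> carrier ?M" for x y
    using that by simp
  have "h x = \<zero>\<^bsub>?M\<^esub>" if "null q x" for x
    using that
  proof induction
    case null_zero
    then show ?case using hd[of 0 0] cancel hc by simp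
  next
    case (null_diff x y)
    then show ?case using hd[of x y] hc[of "x - y"] by simp
  next
    case (null_eqv s t)
    then have "h (frag_of s) = h (frag_of t)"
      using eqv_typedD[OF null_eqv] ecl_eq_iff[of s q t] by (auto simp: h(2) typed_def)
    then show ?case using hd[of "frag_of s" "frag_of t"] cancel hc by metis
  next
    case (null_Plus s t)
    let ?x = "h (frag_of (Plus s t) - frag_of s - frag_of t)"
    have "typed X Y d (Plus s t) \<longleftrightarrow> typed X Y d s" "typed X Y d s \<longleftrightarrow> typed X Y d t"
      using null_Plus by (auto simp: typed_def)
    then have "h (frag_of (Plus s t)) = h (frag_of s) \<oplus>\<^bsub>?M\<^esub> h (frag_of t)"
      by (auto simp: h(2) emod_simps(3))
    moreover have "(?x \<oplus>\<^bsub>?M\<^esub> h (frag_of t)) \<oplus>\<^bsub>?M\<^esub> h (frag_of s) = h (frag_of (Plus s t))"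
      by (simp only: hd)
    ultimately have "?x \<oplus>\<^bsub>?M\<^esub> (h (frag_of s) \<oplus>\<^bsub>?M\<^esub> h (frag_of t)) = h (frag_of s) \<oplus>\<^bsub>?M\<^esub> h (frag_of t)"
      using hc by (simp add: M.a_assoc M.a_comm)
    then show ?case using cancel hc M.a_closed by metis
  qed
  from this[OF assms(1)] have "h (frag_of s) = h (frag_of t)"
    using hd[of "frag_of s" "frag_of t"] hc[of "frag_of t"] by simp
  then show ?thesis using assms h(2) ecl_eq_iff by (simp add: typed_def)
qed

end

section \<open>Calculation modulo the congruence, and maps defined by recursion on
  expressions\<close>

context exprs
begin

abbreviation fr :: "('k, 'o, 'm) expr \<Rightarrow> ('k, 'o, 'm) expr \<Rightarrow>\<^sub>0 int" where
  "fr t \<equiv> frag_of t"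

declare null_zero [simp]

definition veq :: "(('k, 'o, 'm) expr \<Rightarrow>\<^sub>0 int) \<Rightarrow> (('k, 'o, 'm) expr \<Rightarrow>\<^sub>0 int) \<Rightarrow> bool"
    (infix \<open>\<doteq>\<close> 50) where
  "x \<doteq> y \<longleftrightarrow> null True (x - y)"

lemma veq_refl [simp]: "x \<doteq> x"
  by (simp add: veq_def)

lemma veq_sym: "x \<doteq> y \<Longrightarrow> y \<doteq> x"
  unfolding veq_def using null_minus by fastforce

lemma veq_trans [trans]: "x \<doteq> y \<Longrightarrow> y \<doteq> z \<Longrightarrow> x \<doteq> z"
  unfolding veq_def using null_add[of True "x - y" "y - z"] by simp

lemma veq_add: "x \<doteq> x' \<Longrightarrow> y \<doteq> y' \<Longrightarrow> x + y \<doteq> x' + y'"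
  unfolding veq_def using null_add[of True "x - x'" "y - y'"] by (simp add: algebra_simps)

lemma veq_diff: "x \<doteq> x' \<Longrightarrow> y \<doteq> y' \<Longrightarrow> x - y \<doteq> x' - y'"
  unfolding veq_def using null_diff[of True "x - x'" "y - y'"] by (simp add: algebra_simps)

lemma veq_minus: "x \<doteq> x' \<Longrightarrow> - x \<doteq> - x'"
  unfolding veq_def using null_minus[of True "x - x'"] by (simp add: algebra_simps)

lemma veq_sgm: "x \<doteq> x' \<Longrightarrow> sgm d x \<doteq> sgm d x'"
  unfolding veq_def using null_sgm[of True "x - x'" d] by simp

lemma veq_sum: "(\<And>i. i \<in> I \<Longrightarrow> f i \<doteq> g i) \<Longrightarrow> sum f I \<doteq> sum g I"
  unfolding veq_def sum_subtractf[symmetric] by (rule null_sum)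

lemma eqv_veq: "eqv True s t \<Longrightarrow> fr s \<doteq> fr t"
  unfolding veq_def by (rule null_eqv)

lemma veq_Plus: "wf (Plus s t) \<Longrightarrow> fr (Plus s t) \<doteq> fr s + fr t"
  unfolding veq_def using null_Plus[of s t True] by (simp add: algebra_simps)

lemma lin_eqv: "lin_identity R C s t \<Longrightarrow> wf s \<Longrightarrow> wf t \<Longrightarrow> eqv True s t"
  by (rule qeq_lin)

lemma lin_veq: "lin_identity R C s t \<Longrightarrow> wf s \<Longrightarrow> wf t \<Longrightarrow> fr s \<doteq> fr t"
  by (rule eqv_veq[OF lin_eqv])

lemma minus_one_closed: "\<ominus>\<^bsub>R\<^esub> \<one>\<^bsub>R\<^esub> \<in> carrier R" and sgn_closed: "sgn_in R d \<in> carrier R"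
proof -
  interpret R: cring R by (rule cring)
  show "\<ominus>\<^bsub>R\<^esub> \<one>\<^bsub>R\<^esub> \<in> carrier R" "sgn_in R d \<in> carrier R" by (simp_all add: sgn_in_def)
qed

lemma null_of_double: "fr s \<doteq> fr s + fr s \<Longrightarrow> fr s \<doteq> 0"
  unfolding veq_def using null_minus[of True "fr s - (fr s + fr s)"] by simp

lemma veq_Nul:
  assumes "X \<in> aob C" "Y \<in> aob C"
  shows "fr (Nul X Y d) \<doteq> 0"
proof -
  let ?n = "Nul X Y d"
  have "fr (Plus ?n ?n) \<doteq> fr ?n" using assms by (intro lin_veq lin_identity.intros) auto
  from veq_trans[OF veq_sym[OF this] veq_Plus] show ?thesis using assms by (intro null_of_double) auto
qed

lemma veq_Scale_minus: "wf t \<Longrightarrow> fr (Scale (\<ominus>\<^bsub>R\<^esub> \<one>\<^bsub>R\<^esub>) t) \<doteq> - fr t"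
proof -
  assume t: "wf t"
  let ?m = "Scale (\<ominus>\<^bsub>R\<^esub> \<one>\<^bsub>R\<^esub>) t"
  have "fr (Plus t ?m) \<doteq> fr (Nul (esrc t) (etgt t) (edeg t))"
    using t wf_ob[OF t] minus_one_closed by (intro lin_veq lin_identity.intros) auto
  also have "fr (Nul (esrc t) (etgt t) (edeg t)) \<doteq> 0" using wf_ob[OF t] by (intro veq_Nul) auto
  finally have "fr t + fr ?m \<doteq> 0"
    using veq_trans[OF veq_sym[OF veq_Plus[of t ?m]]] t minus_one_closed by simp
  then show ?thesis by (simp add: veq_def algebra_simps)
qed

lemma veq_Scale_sgn: "wf t \<Longrightarrow> fr (Scale (sgn_in R d) t) \<doteq> sgm d (fr t)"
proof (cases "even d")
  interpret R: cring R by (rule cring)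
  case True
  assume "wf t"
  then have "fr (Scale \<one>\<^bsub>R\<^esub> t) \<doteq> fr t" by (intro lin_veq lin_identity.intros) auto
  then show ?thesis using True by (simp add: sgn_in_def sgm_def)
next
  case False
  assume "wf t"
  then show ?thesis using veq_Scale_minus False by (simp add: sgn_in_def sgm_def)
qed

text \<open>Operations such as \<open>Bop\<close> with one open argument are partial: an argument
  that does not fit gives an ill-formed result, which obeys no congruence. Sending such arguments to
  0 makes the additive extension total, and \<open>admissible\<close> says when it descends modulo
  \<open>null\<close>.\<close>

definition lift :: "(('k, 'o, 'm) expr \<Rightarrow> bool) \<Rightarrow> (('k, 'o, 'm) expr \<Rightarrow> ('k, 'o, 'm) expr)
    \<Rightarrow> (('k, 'o, 'm) expr \<Rightarrow>\<^sub>0 int) \<Rightarrow> (('k, 'o, 'm) expr \<Rightarrow>\<^sub>0 int)" where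
  "lift P F = frag_extend (\<lambda>t. if P t then fr (F t) else 0)"

lemma lift_simps [simp]:
  "lift P F 0 = 0" "lift P F (x + y) = lift P F x + lift P F y"
  "lift P F (x - y) = lift P F x - lift P F y" "lift P F (- x) = - lift P F x"
  "lift P F (sgm d x) = sgm d (lift P F x)"
  by (auto simp: lift_def frag_extend_add frag_extend_diff frag_extend_minus sgm_def)

lemma lift_fr: "P t \<Longrightarrow> lift P F (fr t) = fr (F t)"
  by (simp add: lift_def)

lemma lift_sum: "lift P F (sum f I) = (\<Sum>i\<in>I. lift P F (f i))"
  by (induction I rule: infinite_finite_induct) auto

definition admissible where
  "admissible P F \<longleftrightarrow>
    (\<forall>s t. eqv True s t \<longrightarrow> P s = P t \<and> (P s \<longrightarrow> fr (F s) \<doteq> fr (F t))) \<and>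
    (\<forall>s t. wf (Plus s t) \<longrightarrow> P (Plus s t) = P s \<and> P t = P s \<and>
      (P s \<longrightarrow> fr (F (Plus s t)) \<doteq> fr (F s) + fr (F t)))"

lemma lift_null:
  assumes "admissible P F" "null True x"
  shows "null True (lift P F x)"
  using assms(2)
proof induction
  case (null_eqv s t)
  then have "P s = P t" "P s \<Longrightarrow> fr (F s) \<doteq> fr (F t)"
    using assms(1) by (simp_all add: admissible_def)
  then show ?case by (cases "P s") (simp_all add: lift_def frag_extend_diff veq_def)
next
  case (null_Plus s t)
  then have "P (Plus s t) = P s" "P t = P s" "P s \<Longrightarrow> fr (F (Plus s t)) \<doteq> fr (F s) + fr (F t)"
    using assms(1) by (simp_all add: admissible_def)
  then show ?case by (cases "P s") (simp_all add: lift_def frag_extend_diff veq_def diff_diff_eq[symmetric])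
qed (auto intro: null_zero null_diff)

lemma lift_veq: "admissible P F \<Longrightarrow> x \<doteq> y \<Longrightarrow> lift P F x \<doteq> lift P F y"
  unfolding veq_def using lift_null[of P F "x - y"] by simp

abbreviation slot where
  "slot us vs \<equiv> lift (\<lambda>t. wf (Bop (us @ t # vs))) (\<lambda>t. Bop (us @ t # vs))"

lemma wf_Bop_Plus: "wf (Plus s t) \<Longrightarrow> wf (Bop (us @ Plus s t # vs)) = wf (Bop (us @ s # vs)) \<and>
    wf (Bop (us @ t # vs)) = wf (Bop (us @ s # vs))"
  by (auto simp: wf_Bop_iff simp del: wf_expr.simps(5))

lemma admissible_slot: "admissible (\<lambda>t. wf (Bop (us @ t # vs))) (\<lambda>t. Bop (us @ t # vs))"
  unfolding admissible_def
proof (intro conjI allI impI)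
  fix s t assume st: "eqv True s t"
  show "wf (Bop (us @ s # vs)) = wf (Bop (us @ t # vs))"
    using wf_Bop_subst(1)[of us s vs t] wf_Bop_subst(1)[of us t vs s] eqv_typed[OF st] by metis
  show "wf (Bop (us @ s # vs)) \<Longrightarrow> fr (Bop (us @ s # vs)) \<doteq> fr (Bop (us @ t # vs))"
    by (intro eqv_veq qeq_Bop st)
next
  fix s t assume st: "wf (Plus s t)"
  show w: "wf (Bop (us @ Plus s t # vs)) = wf (Bop (us @ s # vs))" "wf (Bop (us @ t # vs)) = wf (Bop (us @ s # vs))"
    using wf_Bop_Plus[OF st] by auto
  assume s: "wf (Bop (us @ s # vs))"
  have wP: "wf (Plus (Bop (us @ s # vs)) (Bop (us @ t # vs)))"
    using s w wf_Bop_subst(2,3)[OF s, of t] edeg_Bop_subst[of t s us vs] st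
    by (simp del: esrc.simps(5) etgt.simps(5) edeg.simps(5) wf_expr.simps(5))
  have "fr (Bop (us @ Plus s t # vs)) \<doteq> fr (Plus (Bop (us @ s # vs)) (Bop (us @ t # vs)))"
    using s w by (intro lin_veq lin_identity.intros wP) simp
  also have "\<dots> \<doteq> fr (Bop (us @ s # vs)) + fr (Bop (us @ t # vs))" by (rule veq_Plus[OF wP])
  finally show "fr (Bop (us @ Plus s t # vs)) \<doteq> fr (Bop (us @ s # vs)) + fr (Bop (us @ t # vs))" .
qed

lemma slot_veq: "x \<doteq> y \<Longrightarrow> slot us vs x \<doteq> slot us vs y"
  by (rule lift_veq[OF admissible_slot])

abbreviation scl where
  "scl a \<equiv> lift wf (Scale a)"

lemma admissible_scl: "a \<in> carrier R \<Longrightarrow> admissible wf (Scale a)"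
  unfolding admissible_def
proof (intro conjI allI impI)
  fix s t assume a: "a \<in> carrier R" and st: "wf (Plus s t)"
  have "fr (Scale a (Plus s t)) \<doteq> fr (Plus (Scale a s) (Scale a t))"
    using a st by (intro lin_veq lin_identity.intros) auto
  also have "\<dots> \<doteq> fr (Scale a s) + fr (Scale a t)" using a st by (intro veq_Plus) auto
  finally show "fr (Scale a (Plus s t)) \<doteq> fr (Scale a s) + fr (Scale a t)" .
qed (auto dest: eqv_typed intro: eqv_veq qeq_Scale)

lemma scl_veq: "a \<in> carrier R \<Longrightarrow> x \<doteq> y \<Longrightarrow> scl a x \<doteq> scl a y"
  by (rule lift_veq[OF admissible_scl])

text \<open>
  A map defined by structural recursion respects \<^const>\<open>qeq\<close> as soon as it is linear in each slot of
  every operation; \<open>\<kappa>\<close> collects what the induction hypothesis says about the slot.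
\<close>

definition multilin where
  "multilin \<kappa> \<tau> G \<longleftrightarrow>
    (\<forall>s t. \<tau> s \<longrightarrow> \<tau> t \<longrightarrow> G (Plus s t) \<doteq> G s + G t) \<and>
    (\<forall>a t. a \<in> carrier R \<longrightarrow> \<tau> t \<longrightarrow> G (Scale a t) \<doteq> scl a (G t)) \<and>
    (\<forall>t t'. \<tau> t \<longrightarrow> \<tau> t' \<longrightarrow> \<kappa> t t' \<longrightarrow> G t \<doteq> G t')"

lemma multilinD:
  assumes "multilin \<kappa> \<tau> G"
  shows "\<tau> s \<Longrightarrow> \<tau> t \<Longrightarrow> G (Plus s t) \<doteq> G s + G t"
    "a \<in> carrier R \<Longrightarrow> \<tau> t \<Longrightarrow> G (Scale a t) \<doteq> scl a (G t)"
    "\<tau> t \<Longrightarrow> \<tau> t' \<Longrightarrow> \<kappa> t t' \<Longrightarrow> G t \<doteq> G t'"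
  using assms by (auto simp: multilin_def)

lemma multilin_veq:
  assumes "multilin \<kappa> \<tau> G" and HG: "\<And>t. \<tau> t \<Longrightarrow> H t \<doteq> G t" and "\<And>s t. \<tau> s \<Longrightarrow> \<tau> t \<Longrightarrow> \<tau> (Plus s t)"
    "\<And>a t. a \<in> carrier R \<Longrightarrow> \<tau> t \<Longrightarrow> \<tau> (Scale a t)"
  shows "multilin \<kappa> \<tau> H"
  unfolding multilin_def
proof (intro conjI allI impI)
  fix s t assume st: "\<tau> s" "\<tau> t"
  then have "H (Plus s t) \<doteq> G (Plus s t)" by (intro HG assms(3-))
  also have "\<dots> \<doteq> G s + G t" by (intro multilinD[OF assms(1)] st)
  also have "\<dots> \<doteq> H s + H t" by (intro veq_sym[OF veq_add] HG st)
  finally show "H (Plus s t) \<doteq> H s + H t" .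
next
  fix a t assume st: "a \<in> carrier R" "\<tau> t"
  then have "H (Scale a t) \<doteq> G (Scale a t)" by (intro HG assms(3-))
  also have "\<dots> \<doteq> scl a (G t)" by (intro multilinD[OF assms(1)] st)
  also have "\<dots> \<doteq> scl a (H t)" by (intro veq_sym[OF scl_veq] HG st)
  finally show "H (Scale a t) \<doteq> scl a (H t)" .
next
  fix t t' assume st: "\<tau> t" "\<tau> t'" "\<kappa> t t'"
  then have "H t \<doteq> G t" by (intro HG assms(3-))
  also have "\<dots> \<doteq> G t'" by (intro multilinD[OF assms(1)] st)
  also have "\<dots> \<doteq> H t'" by (intro veq_sym[OF HG] st)
  finally show "H t \<doteq> H t'" .
qed

lemma multilin_zero: "multilin \<kappa> \<tau> (\<lambda>t. 0)"
  by (simp add: multilin_def)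

lemma multilin_add:
  assumes "multilin \<kappa> \<tau> G" "multilin \<kappa> \<tau> H"
  shows "multilin \<kappa> \<tau> (\<lambda>t. G t + H t)"
  unfolding multilin_def
proof (intro conjI allI impI)
  fix s t assume "\<tau> s" "\<tau> t"
  then have "G (Plus s t) + H (Plus s t) \<doteq> (G s + G t) + (H s + H t)"
    by (intro veq_add multilinD[OF assms(1)] multilinD[OF assms(2)])
  then show "G (Plus s t) + H (Plus s t) \<doteq> (G s + H s) + (G t + H t)" by (simp add: algebra_simps)
next
  fix a t assume "a \<in> carrier R" "\<tau> t"
  then have "G (Scale a t) + H (Scale a t) \<doteq> scl a (G t) + scl a (H t)"
    by (intro veq_add multilinD[OF assms(1)] multilinD[OF assms(2)])
  then show "G (Scale a t) + H (Scale a t) \<doteq> scl a (G t + H t)" by simp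
next
  fix t t' assume "\<tau> t" "\<tau> t'" "\<kappa> t t'"
  then show "G t + H t \<doteq> G t' + H t'"
    by (intro veq_add multilinD[OF assms(1)] multilinD[OF assms(2)])
qed

lemma multilin_minus:
  assumes "multilin \<kappa> \<tau> G"
  shows "multilin \<kappa> \<tau> (\<lambda>t. - G t)"
  unfolding multilin_def
proof (intro conjI allI impI)
  fix s t assume "\<tau> s" "\<tau> t"
  then have "- G (Plus s t) \<doteq> - (G s + G t)" by (intro veq_minus multilinD[OF assms(1)])
  then show "- G (Plus s t) \<doteq> - G s + - G t" by simp
next
  fix a t assume "a \<in> carrier R" "\<tau> t"
  then have "- G (Scale a t) \<doteq> - scl a (G t)" by (intro veq_minus multilinD[OF assms(1)])
  then show "- G (Scale a t) \<doteq> scl a (- G t)" by simp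
next
  fix t t' assume "\<tau> t" "\<tau> t'" "\<kappa> t t'"
  then show "- G t \<doteq> - G t'" by (intro veq_minus multilinD[OF assms(1)])
qed

lemma multilin_sgm: "multilin \<kappa> \<tau> G \<Longrightarrow> multilin \<kappa> \<tau> (\<lambda>t. sgm d (G t))"
  by (cases "even d") (auto simp: sgm_def multilin_minus)

lemma multilin_diff: "multilin \<kappa> \<tau> G \<Longrightarrow> multilin \<kappa> \<tau> H \<Longrightarrow> multilin \<kappa> \<tau> (\<lambda>t. G t - H t)"
  using multilin_add[OF _ multilin_minus, of \<kappa> \<tau> G H] by simp

lemma multilin_sum: "(\<And>i. i \<in> I \<Longrightarrow> multilin \<kappa> \<tau> (G i)) \<Longrightarrow> multilin \<kappa> \<tau> (\<lambda>t. \<Sum>i\<in>I. G i t)"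
  by (induction I rule: infinite_finite_induct) (auto intro: multilin_zero multilin_add)

lemma typed_Plus: "typed X Y d s \<Longrightarrow> typed X Y d t \<Longrightarrow> typed X Y d (Plus s t)"
  by (simp add: typed_def)

lemma typed_Scale: "a \<in> carrier R \<Longrightarrow> typed X Y d t \<Longrightarrow> typed X Y d (Scale a t)"
  by (simp add: typed_def)

lemma multilin_fr:
  assumes "\<And>t t'. \<kappa> t t' \<Longrightarrow> eqv True t t'"
  shows "multilin \<kappa> (typed X Y d) fr"
  unfolding multilin_def
  using assms by (auto simp: typed_def lift_fr intro!: veq_Plus eqv_veq)

text \<open>The inner map \<open>F\<close> is there because the varying argument may sit inside an
  inner operation or under a homotopy; with \<open>F\<close> the identity this is plain linearity of
  \<open>Bop\<close>.\<close>

lemma multilin_Bop: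
  assumes F: "multilin \<kappa> \<tau> (\<lambda>t. fr (F t))"
    and \<tau>: "\<And>s t. \<tau> s \<Longrightarrow> \<tau> t \<Longrightarrow> \<tau> (Plus s t)" "\<And>a t. a \<in> carrier R \<Longrightarrow> \<tau> t \<Longrightarrow> \<tau> (Scale a t)"
    and wfF: "\<And>t. \<tau> t \<Longrightarrow> wf (Bop (us @ F t # vs))"
  shows "multilin \<kappa> \<tau> (\<lambda>t. fr (Bop (us @ F t # vs)))"
  unfolding multilin_def
proof (intro conjI allI impI)
  fix s t assume st: "\<tau> s" "\<tau> t"
  then have "slot us vs (fr (F (Plus s t))) \<doteq> slot us vs (fr (F s) + fr (F t))"
    by (intro slot_veq multilinD[OF F])
  then show "fr (Bop (us @ F (Plus s t) # vs)) \<doteq> fr (Bop (us @ F s # vs)) + fr (Bop (us @ F t # vs))"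
    using st \<tau> wfF by (simp add: lift_fr)
next
  fix a t assume at: "a \<in> carrier R" "\<tau> t"
  have wft: "wf (F t)" using wfF[OF at(2)] by (auto simp: wf_Bop_iff)
  have wS: "wf (Bop (us @ Scale a (F t) # vs))" "wf (Scale a (Bop (us @ F t # vs)))"
    using wfF[OF at(2)] wf_Bop_subst(1)[of us "F t" vs "Scale a (F t)"] wft at by auto
  have "slot us vs (fr (F (Scale a t))) \<doteq> slot us vs (scl a (fr (F t)))"
    using at by (intro slot_veq multilinD[OF F])
  also have "scl a (fr (F t)) = fr (Scale a (F t))" using wft by (simp add: lift_fr)
  also have "slot us vs (fr (Scale a (F t))) = fr (Bop (us @ Scale a (F t) # vs))"
    using wS by (simp add: lift_fr)
  also have "\<dots> \<doteq> fr (Scale a (Bop (us @ F t # vs)))"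
    by (intro lin_veq lin_identity.intros wS)
  also have "\<dots> = scl a (fr (Bop (us @ F t # vs)))" using wfF[OF at(2)] by (subst lift_fr) simp_all
  finally show "fr (Bop (us @ F (Scale a t) # vs)) \<doteq> scl a (fr (Bop (us @ F t # vs)))"
    using at \<tau> wfF by (simp add: lift_fr)
next
  fix t t' assume st: "\<tau> t" "\<tau> t'" "\<kappa> t t'"
  then have "slot us vs (fr (F t)) \<doteq> slot us vs (fr (F t'))"
    by (intro slot_veq multilinD[OF F])
  then show "fr (Bop (us @ F t # vs)) \<doteq> fr (Bop (us @ F t' # vs))"
    using st wfF by (simp add: lift_fr)
qed

lemma veq_typedD: "fr s \<doteq> fr t \<Longrightarrow> typed X Y d s \<Longrightarrow> typed X Y d t \<Longrightarrow> eqv True s t"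
  unfolding veq_def by (rule eqv_of_null)

text \<open>Induction over the congruence. Since \<open>F\<close> commutes with \<open>Plus\<close>,
  \<open>Scale\<close> and \<open>Nul\<close>, it carries the module identities to instances of
  themselves; what remains are the identities involving generators, \<open>Bop\<close> and
  \<open>Hop\<close>, and these are the premises. The constant \<open>k\<close> is the degree of
  \<open>F\<close>. The premise for \<open>Hop\<close> is restricted to \<open>in_P\<close> because
  \<open>Hop\<close> of any other argument is ill-formed.\<close>

lemma eqv_recursion:
  assumes typed: "\<And>X Y d t. typed X Y d t \<Longrightarrow> typed X Y (d + k) (F t)"
    and Plus: "\<And>s t. F (Plus s t) = Plus (F s) (F t)"
    and Scale: "\<And>a t. F (Scale a t) = Scale a (F t)"
    and Nul: "\<And>X Y d. F (Nul X Y d) = Nul X Y (d + k)"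
    and Gen_add: "\<And>X Y d f g. wf (Gen X Y d f) \<Longrightarrow> wf (Gen X Y d g) \<Longrightarrow> wf (Gen X Y d (f \<oplus>\<^bsub>shom C X Y d\<^esub> g))
      \<Longrightarrow> fr (F (Gen X Y d (f \<oplus>\<^bsub>shom C X Y d\<^esub> g))) \<doteq> fr (F (Gen X Y d f)) + fr (F (Gen X Y d g))"
    and Gen_smult: "\<And>X Y d a f. a \<in> carrier R \<Longrightarrow> wf (Gen X Y d f) \<Longrightarrow> wf (Gen X Y d (a \<odot>\<^bsub>shom C X Y d\<^esub> f))
      \<Longrightarrow> fr (F (Gen X Y d (a \<odot>\<^bsub>shom C X Y d\<^esub> f))) \<doteq> scl a (fr (F (Gen X Y d f)))"
    and Gen_bop: "\<And>xs. composable C xs \<Longrightarrow> 2 \<le> length xs \<Longrightarrow> wf (genx (barr C xs))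
      \<Longrightarrow> fr (F (Bop (map genx xs))) \<doteq> fr (F (genx (barr C xs)))"
    and Bop: "\<And>us t vs. wf (Bop (us @ t # vs)) \<Longrightarrow>
      multilin (\<lambda>t t'. eqv True t t' \<and> fr (F t) \<doteq> fr (F t')) (typed (esrc t) (etgt t) (edeg t))
        (\<lambda>t. fr (F (Bop (us @ t # vs))))"
    and Hop: "\<And>t. wf (Hop t) \<Longrightarrow>
      multilin (\<lambda>t t'. eqv True t t' \<and> fr (F t) \<doteq> fr (F t'))
        (\<lambda>u. typed (esrc t) (etgt t) (edeg t) u \<and> in_P u) (\<lambda>t. fr (F (Hop t)))"
    and st: "eqv True s t"
  shows "eqv True (F s) (F t)"
proof -
  have ty: "typed (esrc t) (etgt t) (edeg t + k) (F t)" if "wf t" for t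
    using that by (intro typed) (simp add: typed_def)
  then have wfF: "wf (F t)" if "wf t" for t using that by (auto simp: typed_def)
  have tyW: "typed (esrc t) (etgt t) (edeg t) t" if "wf t" for t using that by (simp add: typed_def)
  have PlusF: "fr (F (Plus s t)) \<doteq> fr (F s) + fr (F t)" if "wf (Plus s t)" for s t
    unfolding Plus
  proof (rule veq_Plus)
    show "wf (Plus (F s) (F t))" using that ty[of s] ty[of t] by (auto simp: typed_def)
  qed
  have SclF: "fr (F (Scale a t)) \<doteq> scl a (fr (F t))" if "wf (Scale a t)" for a t
    unfolding Scale using that wfF[of t] by (simp add: lift_fr)
  have id: "fr (F s) \<doteq> fr (F t)" if L: "lin_identity R C s t" and w: "wf s" "wf t" for s t
    using L
  proof cases
    case (9 X Y d f g)
    have "fr (F s) \<doteq> fr (F (Gen X Y d f)) + fr (F (Gen X Y d g))"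
      using 9 w by (auto intro!: Gen_add)
    also have "\<dots> \<doteq> fr (F t)" unfolding 9(2) by (rule veq_sym, rule PlusF) (use 9 w in auto)
    finally show ?thesis .
  next
    case (10 X Y d a f)
    have "fr (F s) \<doteq> scl a (fr (F (Gen X Y d f)))"
      using 10 w by (auto intro!: Gen_smult)
    also have "\<dots> \<doteq> fr (F t)" unfolding 10(2) by (rule veq_sym, rule SclF) (use 10 w in auto)
    finally show ?thesis .
  next
    case (11 us s' t' vs)
    have wb: "wf (Bop (us @ s' # vs))" and ws: "wf (Plus s' t')" using w 11 by auto
    have "fr (F s) \<doteq> fr (F (Bop (us @ s' # vs))) + fr (F (Bop (us @ t' # vs)))"
      unfolding 11(1) by (rule multilinD(1)[OF Bop[OF wb]]) (use ws in \<open>auto simp: typed_def\<close>)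
    also have "\<dots> \<doteq> fr (F t)" unfolding 11(2) by (rule veq_sym, rule PlusF) (use 11 w in auto)
    finally show ?thesis .
  next
    case (12 us a t' vs)
    have wb: "wf (Bop (us @ t' # vs))" and ws: "wf t'" "a \<in> carrier R" using w 12 by auto
    have "fr (F s) \<doteq> scl a (fr (F (Bop (us @ t' # vs))))"
      unfolding 12(1) by (rule multilinD(2)[OF Bop[OF wb]]) (use ws in \<open>auto simp: typed_def\<close>)
    also have "\<dots> \<doteq> fr (F t)" unfolding 12(2) by (rule veq_sym, rule SclF) (use 12 w in auto)
    finally show ?thesis .
  next
    case (13 s' t')
    have wb: "wf (Hop s')" and ws: "wf (Plus s' t')" "in_P s'" "in_P t'" using w 13 by auto
    have "fr (F s) \<doteq> fr (F (Hop s')) + fr (F (Hop t'))"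
      unfolding 13(1) by (rule multilinD(1)[OF Hop[OF wb]]) (use ws in \<open>auto simp: typed_def\<close>)
    also have "\<dots> \<doteq> fr (F t)" unfolding 13(2) by (rule veq_sym, rule PlusF) (use 13 w in auto)
    finally show ?thesis .
  next
    case (14 a t')
    have wb: "wf (Hop t')" and ws: "wf t'" "in_P t'" "a \<in> carrier R" using w 14 by auto
    have "fr (F s) \<doteq> scl a (fr (F (Hop t')))"
      unfolding 14(1) by (rule multilinD(2)[OF Hop[OF wb]]) (use ws in \<open>auto simp: typed_def\<close>)
    also have "\<dots> \<doteq> fr (F t)" unfolding 14(2) by (rule veq_sym, rule SclF) (use 14 w in auto)
    finally show ?thesis .
  next
    \<comment> \<open>The right-hand side of this identity mentions the type of \<open>u\<close>;
      its image has to be the zero of the type of \<open>F u\<close>, which is where the shift by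
      \<open>k\<close> enters.\<close>
    case (4 u)
    have "lin_identity R C (F s) (F t)"
    proof -
      have "F t = Nul (esrc (F u)) (etgt (F u)) (edeg (F u))"
        unfolding 4(2) Nul using ty[of u] w 4 by (auto simp: typed_def)
      then show ?thesis using lin_identity.intros(4)[of R C "F u"] by (simp add: 4(1) Plus Scale)
    qed
    then show ?thesis using wfF w by (intro lin_veq) auto
  qed (rule lin_veq[OF _ wfF[OF w(1)] wfF[OF w(2)]], simp add: Plus Scale Nul lin_identity.intros)+
  have "fr (F s) \<doteq> fr (F t)"
    using st
  proof induction
    case (qeq_lin s t)
    then show ?case by (intro id)
  next
    case (qeq_gen xs)
    then show ?case by (intro Gen_bop)
  next
    case (qeq_sym s t)
    then show ?case using veq_sym by blast
  next
    case (qeq_trans r s t)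
    then show ?case using veq_trans by blast
  next
    case (qeq_Plus s s' t t')
    have "fr (F (Plus s t)) \<doteq> fr (F s) + fr (F t)" by (rule PlusF[OF qeq_Plus(3)])
    also have "\<dots> \<doteq> fr (F s') + fr (F t')" by (intro veq_add qeq_Plus)
    also have "\<dots> \<doteq> fr (F (Plus s' t'))"
      by (rule veq_sym, rule PlusF) (use qeq_Plus eqv_typed[OF qeq_Plus(1)] eqv_typed[OF qeq_Plus(2)] in auto)
    finally show ?case .
  next
    case (qeq_Scale a t t')
    have "fr (F (Scale a t)) \<doteq> scl a (fr (F t))" using qeq_Scale eqv_typed by (intro SclF) auto
    also have "\<dots> \<doteq> scl a (fr (F t'))" by (intro scl_veq qeq_Scale)
    also have "\<dots> \<doteq> fr (F (Scale a t'))"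
      by (rule veq_sym, rule SclF) (use qeq_Scale eqv_typed[OF qeq_Scale(2)] in auto)
    finally show ?case .
  next
    case (qeq_Bop t t' us vs)
    show ?case
      by (rule multilinD(3)[OF Bop[OF qeq_Bop(2)]])
        (use qeq_Bop eqv_typed[OF qeq_Bop(1)] in \<open>auto simp: typed_def\<close>)
  next
    case (qeq_Hop t t')
    show ?case
      by (rule multilinD(3)[OF Hop[OF qeq_Hop(2)]])
        (use qeq_Hop eqv_typed[OF qeq_Hop(1)] in \<open>auto simp: typed_def\<close>)
  qed simp
  moreover have "typed (esrc s) (etgt s) (edeg s + k) (F t)"
    using eqv_typed[OF st] ty[of t] by simp
  ultimately show ?thesis
    using ty[of s] eqv_typed[OF st] veq_typedD by blast
qed

end

section \<open>The differential and the A-infinity relations\<close>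

lemma sum_list_map_concat: "sum_list (map g (concat xss)) = sum_list (map (\<lambda>xs. sum_list (map g xs)) xss)"
  by (induction xss) auto

text \<open>The differential counts as the unary operation b_1, so that one sum over blocks
  expresses a whole A-infinity relation.\<close>

definition bb :: "'k ring \<Rightarrow> ('k, 'o, 'm) ainf \<Rightarrow> ('k, 'o, 'm) expr list \<Rightarrow> ('k, 'o, 'm) expr" where
  "bb R C ts = (if length ts = 1 then ediff R C (hd ts) else Bop ts)"

lemma bb_simps [simp]:
  "bb R C [t] = ediff R C t"
  "u \<noteq> [] \<Longrightarrow> bb R C (u @ x # v) = Bop (u @ x # v)"
  "v \<noteq> [] \<Longrightarrow> bb R C (u @ x # v) = Bop (u @ x # v)"
  "v \<noteq> [] \<Longrightarrow> bb R C (x # v) = Bop (x # v)"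
  "2 \<le> length ts \<Longrightarrow> bb R C ts = Bop ts"
  by (auto simp: bb_def)

lemma insertions_set:
  assumes "x \<in> set (insertions R ts (map (ediff R C) ts))"
  shows "\<exists>u m v. (u, m, v) \<in> splits3 ts \<and> (u \<noteq> [] \<or> v \<noteq> []) \<and>
    x = Scale (sgn_in R (sdeg v)) (Bop (u @ bb R C m # v))"
proof -
  obtain a p where a: "a < length ts" "1 \<le> p" "a + p \<le> length ts" "p < length ts" and
    x: "x = Scale (sgn_in R (sdeg (drop (a + p) ts)))
       (Bop (take a ts @ (if p = 1 then map (ediff R C) ts ! a else Bop (take p (drop a ts))) # drop (a + p) ts))"
  proof -
    obtain a where a: "a \<in> set [0..<length ts]"
      and xa: "x \<in> set (concat (map (\<lambda>p. if p < length ts then [Scale (sgn_in R (sdeg (drop (a + p) ts)))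
       (Bop (take a ts @ (if p = 1 then map (ediff R C) ts ! a else Bop (take p (drop a ts))) # drop (a + p) ts))]
       else []) [1..<Suc (length ts - a)]))"
      using assms unfolding insertions_def set_concat set_map UN_iff bex_simps by blast
    obtain p where p: "p \<in> set [1..<Suc (length ts - a)]"
      and xp: "x \<in> set (if p < length ts then [Scale (sgn_in R (sdeg (drop (a + p) ts)))
       (Bop (take a ts @ (if p = 1 then map (ediff R C) ts ! a else Bop (take p (drop a ts))) # drop (a + p) ts))] else [])"
      using xa unfolding set_concat set_map UN_iff bex_simps by blast
    from p a have "1 \<le> p \<and> a + p \<le> length ts \<and> a < length ts" unfolding set_upt by auto
    with xp show thesis by (intro that[of a p]) (simp_all split: if_split_asm)
  qed
  have "(if p = 1 then map (ediff R C) ts ! a else Bop (take p (drop a ts))) = bb R C (take p (drop a ts))"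
    using a by (auto simp: bb_def hd_drop_conv_nth)
  moreover have "(take a ts, take p (drop a ts), drop (a + p) ts) \<in> splits3 ts"
    using a by (auto simp: splits3_def) (metis add.commute append_take_drop_id drop_drop)
  ultimately show ?thesis using x a by (intro exI[of _ "take a ts"] exI[of _ "take p (drop a ts)"] exI[of _ "drop (a + p) ts"]) auto
qed

text \<open>\<open>insertions\<close> enumerates a block by its start and its length. The bijection
  with \<open>splits3\<close> turns the condition \<open>p < length ts\<close> into the exclusion of
  the block that is all of \<open>ts\<close>.\<close>

lemma sum_insertions:
  fixes g :: "('k, 'o, 'm) expr \<Rightarrow> 'v::ab_group_add"
  shows "sum_list (map g (insertions R ts (map (ediff R C) ts))) =
    (\<Sum>(u, m, v)\<in>splits3 ts. if u = [] \<and> v = [] then 0 else g (Scale (sgn_in R (sdeg v)) (Bop (u @ bb R C m # v))))"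
proof -
  let ?n = "length ts"
  let ?G = "\<lambda>u m v. if u = [] \<and> v = [] then 0 else g (Scale (sgn_in R (sdeg v)) (Bop (u @ bb R C m # v)))"
  let ?ins = "\<lambda>a p. Scale (sgn_in R (sdeg (drop (a + p) ts)))
       (Bop (take a ts @ (if p = 1 then map (ediff R C) ts ! a else Bop (take p (drop a ts))) # drop (a + p) ts))"
  have "sum_list (map g (insertions R ts (map (ediff R C) ts))) =
    sum_list (map (\<lambda>a. sum_list (map (\<lambda>p. if p < ?n then g (?ins a p) else 0) [1..<Suc (?n - a)])) [0..<?n])"
    unfolding insertions_def sum_list_map_concat map_map o_def
    by (intro arg_cong[where f = sum_list] map_cong refl) auto
  also have "\<dots> = (\<Sum>a\<in>{0..<?n}. \<Sum>p\<in>{1..<Suc (?n - a)}. if p < ?n then g (?ins a p) else 0)"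
    by (simp only: interv_sum_list_conv_sum_set_nat set_upt)
  also have "\<dots> = (\<Sum>(a, p)\<in>Sigma {0..<?n} (\<lambda>a. {1..<Suc (?n - a)}). if p < ?n then g (?ins a p) else 0)"
    by (rule sum.Sigma) auto
  also have "\<dots> = (\<Sum>(u, m, v)\<in>splits3 ts. ?G u m v)"
  proof (rule sum.reindex_bij_witness[of _ "\<lambda>(u, m, v). (length u, length m)"
        "\<lambda>(a, p). (take a ts, take p (drop a ts), drop (a + p) ts)"])
    fix x assume "x \<in> splits3 ts"
    then show "(case (case x of (u, m, v) \<Rightarrow> (length u, length m)) of
        (a, p) \<Rightarrow> (take a ts, take p (drop a ts), drop (a + p) ts)) = x"
      "(case x of (u, m, v) \<Rightarrow> (length u, length m)) \<in> Sigma {0..<?n} (\<lambda>a. {1..<Suc (?n - a)})"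
      by (auto simp: splits3_def Suc_le_eq)
  next
    fix x assume "x \<in> Sigma {0..<?n} (\<lambda>a. {1..<Suc (?n - a)})"
    then obtain a p where x: "x = (a, p)" and a: "a < ?n" "1 \<le> p" "a + p \<le> ?n" by auto
    show "(case (case x of (a, p) \<Rightarrow> (take a ts, take p (drop a ts), drop (a + p) ts)) of
        (u, m, v) \<Rightarrow> (length u, length m)) = x"
      using a by (simp add: x)
    show "(case x of (a, p) \<Rightarrow> (take a ts, take p (drop a ts), drop (a + p) ts)) \<in> splits3 ts"
      using a by (auto simp: x splits3_def) (metis add.commute append_take_drop_id drop_drop)
    have "(if p = 1 then map (ediff R C) ts ! a else Bop (take p (drop a ts))) = bb R C (take p (drop a ts))"
      using a by (auto simp: bb_def hd_drop_conv_nth)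
    moreover have "p < ?n \<longleftrightarrow> \<not> (take a ts = [] \<and> drop (a + p) ts = [])" using a by auto
    ultimately show "(case case x of (a, p) \<Rightarrow> (take a ts, take p (drop a ts), drop (a + p) ts) of
        (u, m, v) \<Rightarrow> ?G u m v) = (case x of (a, p) \<Rightarrow> if p < ?n then g (?ins a p) else 0)"
      by (simp add: x del: take_eq_Nil drop_eq_Nil)
  qed
  finally show ?thesis .
qed

text \<open>A differential graded category in the shifted form of an A-infinity category:
  \<open>leibniz\<close> and \<open>assoc\<close> are the relations of arity two and three, the
  scalar in them being the Koszul sign of b_1 or b_2 passing the last argument. The elements
  \<open>ident\<close> are strict units of degree -1; \<open>ident_left\<close> carries the sign of
  the map -(i \<otimes> 1)b_2.\<close>

locale dg_exprs = exprs R C B for R :: "'k ring" and C :: "('k, 'o, 'm) ainf" and B :: "'o set" +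
  fixes ident :: "'o \<Rightarrow> 'm"
  assumes module_C: "X \<in> aob C \<Longrightarrow> Y \<in> aob C \<Longrightarrow> module R (shom C X Y d)"
    and b1C_closed: "X \<in> aob C \<Longrightarrow> Y \<in> aob C \<Longrightarrow> x \<in> carrier (shom C X Y d)
      \<Longrightarrow> bop C [Arr X Y d x] \<in> carrier (shom C X Y (d + 1))"
    and b1C_add: "X \<in> aob C \<Longrightarrow> Y \<in> aob C \<Longrightarrow> x \<in> carrier (shom C X Y d) \<Longrightarrow> y \<in> carrier (shom C X Y d)
      \<Longrightarrow> bop C [Arr X Y d (x \<oplus>\<^bsub>shom C X Y d\<^esub> y)]
        = bop C [Arr X Y d x] \<oplus>\<^bsub>shom C X Y (d + 1)\<^esub> bop C [Arr X Y d y]"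
    and b1C_smult: "X \<in> aob C \<Longrightarrow> Y \<in> aob C \<Longrightarrow> x \<in> carrier (shom C X Y d) \<Longrightarrow> a \<in> carrier R
      \<Longrightarrow> bop C [Arr X Y d (a \<odot>\<^bsub>shom C X Y d\<^esub> x)] = a \<odot>\<^bsub>shom C X Y (d + 1)\<^esub> bop C [Arr X Y d x]"
    and b1C_b1C: "X \<in> aob C \<Longrightarrow> Y \<in> aob C \<Longrightarrow> x \<in> carrier (shom C X Y d)
      \<Longrightarrow> bop C [Arr X Y (d + 1) (bop C [Arr X Y d x])] = \<zero>\<^bsub>shom C X Y (d + 2)\<^esub>"
    and b2C_closed: "X \<in> aob C \<Longrightarrow> Y \<in> aob C \<Longrightarrow> Z \<in> aob C \<Longrightarrow> x \<in> carrier (shom C X Y d)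
      \<Longrightarrow> y \<in> carrier (shom C Y Z e) \<Longrightarrow> bop C [Arr X Y d x, Arr Y Z e y] \<in> carrier (shom C X Z (d + e + 1))"
    and b2C_add_left: "X \<in> aob C \<Longrightarrow> Y \<in> aob C \<Longrightarrow> Z \<in> aob C \<Longrightarrow> x \<in> carrier (shom C X Y d)
      \<Longrightarrow> x' \<in> carrier (shom C X Y d) \<Longrightarrow> y \<in> carrier (shom C Y Z e)
      \<Longrightarrow> bop C [Arr X Y d (x \<oplus>\<^bsub>shom C X Y d\<^esub> x'), Arr Y Z e y]
        = bop C [Arr X Y d x, Arr Y Z e y] \<oplus>\<^bsub>shom C X Z (d + e + 1)\<^esub> bop C [Arr X Y d x', Arr Y Z e y]"
    and b2C_add_right: "X \<in> aob C \<Longrightarrow> Y \<in> aob C \<Longrightarrow> Z \<in> aob C \<Longrightarrow> x \<in> carrier (shom C X Y d)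
      \<Longrightarrow> y \<in> carrier (shom C Y Z e) \<Longrightarrow> y' \<in> carrier (shom C Y Z e)
      \<Longrightarrow> bop C [Arr X Y d x, Arr Y Z e (y \<oplus>\<^bsub>shom C Y Z e\<^esub> y')]
        = bop C [Arr X Y d x, Arr Y Z e y] \<oplus>\<^bsub>shom C X Z (d + e + 1)\<^esub> bop C [Arr X Y d x, Arr Y Z e y']"
    and leibniz: "X \<in> aob C \<Longrightarrow> Y \<in> aob C \<Longrightarrow> Z \<in> aob C \<Longrightarrow> x \<in> carrier (shom C X Y d)
      \<Longrightarrow> y \<in> carrier (shom C Y Z e)
      \<Longrightarrow> bop C [Arr X Z (d + e + 1) (bop C [Arr X Y d x, Arr Y Z e y])]
        \<oplus>\<^bsub>shom C X Z (d + e + 2)\<^esub>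
          (sgn_in R e \<odot>\<^bsub>shom C X Z (d + e + 2)\<^esub> bop C [Arr X Y (d + 1) (bop C [Arr X Y d x]), Arr Y Z e y]
           \<oplus>\<^bsub>shom C X Z (d + e + 2)\<^esub> bop C [Arr X Y d x, Arr Y Z (e + 1) (bop C [Arr Y Z e y])])
        = \<zero>\<^bsub>shom C X Z (d + e + 2)\<^esub>"
    and assoc: "W \<in> aob C \<Longrightarrow> X \<in> aob C \<Longrightarrow> Y \<in> aob C \<Longrightarrow> Z \<in> aob C \<Longrightarrow> x \<in> carrier (shom C W X d)
      \<Longrightarrow> y \<in> carrier (shom C X Y e) \<Longrightarrow> z \<in> carrier (shom C Y Z g)
      \<Longrightarrow> sgn_in R g \<odot>\<^bsub>shom C W Z (d + e + g + 2)\<^esub>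
            bop C [Arr W Y (d + e + 1) (bop C [Arr W X d x, Arr X Y e y]), Arr Y Z g z]
          \<oplus>\<^bsub>shom C W Z (d + e + g + 2)\<^esub>
            bop C [Arr W X d x, Arr X Z (e + g + 1) (bop C [Arr X Y e y, Arr Y Z g z])]
        = \<zero>\<^bsub>shom C W Z (d + e + g + 2)\<^esub>"
    and higher: "composable C xs \<Longrightarrow> 3 \<le> length xs \<Longrightarrow> bop C xs = \<zero>\<^bsub>shom C (bsrc xs) (btgt xs) (bdeg xs)\<^esub>"
    and ident_closed: "X \<in> aob C \<Longrightarrow> ident X \<in> carrier (shom C X X (-1))"
    and b1C_ident: "X \<in> aob C \<Longrightarrow> bop C [Arr X X (-1) (ident X)] = \<zero>\<^bsub>shom C X X 0\<^esub>"
    and ident_right: "X \<in> aob C \<Longrightarrow> Y \<in> aob C \<Longrightarrow> x \<in> carrier (shom C X Y d)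
      \<Longrightarrow> bop C [Arr X Y d x, Arr Y Y (-1) (ident Y)] = x"
    and ident_left: "X \<in> aob C \<Longrightarrow> Y \<in> aob C \<Longrightarrow> x \<in> carrier (shom C X Y d)
      \<Longrightarrow> sgn_in R (d + 1) \<odot>\<^bsub>shom C X Y d\<^esub> bop C [Arr X X (-1) (ident X), Arr X Y d x] = x"
begin

abbreviation dd where "dd \<equiv> ediff R C"
abbreviation b where "b \<equiv> bb R C"

lemma typed_foldr_Plus:
  "(\<And>x. x \<in> set L \<Longrightarrow> typed X Y d x) \<Longrightarrow> X \<in> aob C \<Longrightarrow> Y \<in> aob C
    \<Longrightarrow> typed X Y d (foldr Plus L (Nul X Y d))"
  by (induction L) (auto simp: typed_def)

lemma veq_foldr_Plus:
  assumes "\<And>x. x \<in> set L \<Longrightarrow> typed X Y d x" "X \<in> aob C" "Y \<in> aob C"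
  shows "fr (foldr Plus L (Nul X Y d)) \<doteq> sum_list (map fr L)"
  using assms
proof (induction L)
  case Nil
  then show ?case by (simp add: veq_Nul)
next
  case (Cons a L)
  let ?f = "foldr Plus L (Nul X Y d)"
  have "fr (Plus a ?f) \<doteq> fr a + fr ?f"
    using Cons.prems typed_foldr_Plus[of L X Y d] by (intro veq_Plus) (auto simp: typed_def)
  also have "\<dots> \<doteq> fr a + sum_list (map fr L)" using Cons by (intro veq_add) auto
  finally show ?case by simp
qed

lemma typed_bb_aux:
  assumes "path X ts Y" "ts \<noteq> []" "\<And>t. t \<in> set ts \<Longrightarrow> typed (esrc t) (etgt t) (edeg t + 1) (dd t)"
  shows "typed X Y (sdeg ts + 1) (b ts)"
proof (cases "2 \<le> length ts")
  case True
  then show ?thesis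
    using Bop_ends[OF assms(1,2)] wf_BopI[OF assms(1)] by (simp add: typed_def del: esrc.simps etgt.simps wf_expr.simps)
next
  case False
  with assms(2) obtain t where "ts = [t]" by (cases ts rule: remdups_adj.cases) auto
  then show ?thesis using assms by simp
qed

lemma typed_Bop:
  assumes "path X ts Y" "2 \<le> length ts"
  shows "typed X Y (sdeg ts + 1) (Bop ts)"
proof -
  have "ts \<noteq> []" using assms(2) by auto
  then show ?thesis
    using Bop_ends[OF assms(1)] wf_BopI[OF assms] by (simp add: typed_def del: esrc.simps etgt.simps wf_expr.simps)
qed

lemma typed_insertion:
  assumes "path X ts Y" "(u, m, v) \<in> splits3 ts" "\<And>t. t \<in> set ts \<Longrightarrow> typed (esrc t) (etgt t) (edeg t + 1) (dd t)"
    "u \<noteq> [] \<or> v \<noteq> []"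
  shows "typed X Y (sdeg ts + 2) (Bop (u @ b m # v))"
proof -
  have ts: "ts = u @ m @ v" and m: "m \<noteq> []" using assms(2) by (auto simp: splits3_def)
  obtain P Q where p: "path X u P" "path P m Q" "path Q v Y" using assms(1) ts by auto
  have "typed P Q (sdeg m + 1) (b m)" using typed_bb_aux[OF p(2) m] assms(3) ts by auto
  then have "path X (u @ b m # v) Y" "edeg (b m) = sdeg m + 1" using p by (auto simp: typed_def)
  from typed_Bop[OF this(1)] this(2) show ?thesis
    using assms(4) by (simp add: ts algebra_simps Suc_le_eq)
qed

lemma in_P_foldr_Plus: "(\<And>x. x \<in> set L \<Longrightarrow> in_P x) \<Longrightarrow> in_P (foldr Plus L (Nul X Y d))"
  by (induction L) auto

text \<open>Preservation of \<open>in_P\<close> belongs to the induction because the differential of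
  \<open>Hop t\<close> contains \<open>Hop (dd t)\<close>, which has to be well-formed.\<close>

lemma typed_dd_P: "wf t \<Longrightarrow> typed (esrc t) (etgt t) (edeg t + 1) (dd t) \<and> (in_P t \<longrightarrow> in_P (dd t))"
proof (induction t)
  case (Gen X Y d f)
  then show ?case by (simp add: typed_def b1C_closed)
next
  case (Bop ts)
  obtain X Y where p: "path X ts Y" and l: "2 \<le> length ts" using Bop.prems unfolding wf_Bop_iff by blast
  have ne: "ts \<noteq> []" using l by auto
  have XY: "X \<in> aob C" "Y \<in> aob C" using wf_ob[OF Bop.prems] Bop_ends[OF p ne] by auto
  have wt: "wf t" if "t \<in> set ts" for t using Bop.prems that by auto
  have L: "typed X Y (sdeg ts + 2) x \<and> in_P x" if x: "x \<in> set (insertions R ts (map dd ts))" for x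
  proof -
    obtain u m v where umv: "(u, m, v) \<in> splits3 ts" "u \<noteq> [] \<or> v \<noteq> []"
      "x = Scale (sgn_in R (sdeg v)) (Bop (u @ b m # v))"
      using insertions_set[OF x] by blast
    show ?thesis
      unfolding umv(3) using typed_insertion[OF p umv(1) _ umv(2)] Bop.IH wt
      by (intro conjI typed_Scale sgn_closed) auto
  qed
  have "typed X Y (sdeg ts + 2) (foldr Plus (insertions R ts (map dd ts)) (Nul X Y (sdeg ts + 2)))"
    using L XY by (intro typed_foldr_Plus) auto
  moreover have "in_P (foldr Plus (insertions R ts (map dd ts)) (Nul X Y (sdeg ts + 2)))"
    using L by (intro in_P_foldr_Plus) auto
  ultimately show ?case
    using Bop_ends[OF p ne] minus_one_closed by (simp add: typed_def add.commute del: esrc.simps(5) etgt.simps(5))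
next
  case (Hop t)
  then show ?case using minus_one_closed by (auto simp: typed_def)
qed (auto simp: typed_def)

lemma typed_dd: "typed X Y d t \<Longrightarrow> typed X Y (d + 1) (dd t)"
  using typed_dd_P[of t] by (auto simp: typed_def)

lemma typed_bb: "path X ts Y \<Longrightarrow> ts \<noteq> [] \<Longrightarrow> typed X Y (sdeg ts + 1) (b ts)"
  by (rule typed_bb_aux) (auto intro!: typed_dd simp: path_iff, simp add: typed_def)

lemma path_insertion:
  assumes "path X ts Y" "(u, m, v) \<in> splits3 ts"
  shows "path X (u @ b m # v) Y"
proof -
  have ts: "ts = u @ m @ v" and m: "m \<noteq> []" using assms(2) by (auto simp: splits3_def)
  obtain P Q where p: "path X u P" "path P m Q" "path Q v Y" using assms(1) ts by auto
  show ?thesis using typed_bb[OF p(2) m] p by (auto simp: typed_def)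
qed

lemma dd_Bop:
  assumes p: "path X ts Y" and l: "2 \<le> length ts"
  shows "fr (dd (Bop ts)) \<doteq>
    - (\<Sum>(u, m, v)\<in>splits3 ts. if u = [] \<and> v = [] then 0 else sgm (sdeg v) (fr (Bop (u @ b m # v))))"
proof -
  have ne: "ts \<noteq> []" using l by auto
  have XY: "X \<in> aob C" "Y \<in> aob C" using wf_ob[OF wf_BopI[OF p l]] Bop_ends[OF p ne] by auto
  have wt: "wf t" if "t \<in> set ts" for t using p that ne by (simp add: path_iff)
  let ?L = "insertions R ts (map dd ts)"
  have ins: "typed X Y (sdeg ts + 2) (Bop (u @ b m # v))"
    if "(u, m, v) \<in> splits3 ts" "u \<noteq> [] \<or> v \<noteq> []" for u m v
    using typed_insertion[OF p that(1) _ that(2)] wt typed_dd_P by blast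
  have L: "typed X Y (sdeg ts + 2) x" if x: "x \<in> set ?L" for x
  proof -
    obtain u m v where umv: "(u, m, v) \<in> splits3 ts" "u \<noteq> [] \<or> v \<noteq> []"
      "x = Scale (sgn_in R (sdeg v)) (Bop (u @ b m # v))"
      using insertions_set[OF x] by blast
    show ?thesis
      unfolding umv(3) using ins[OF umv(1,2)] by (intro typed_Scale sgn_closed)
  qed
  have "fr (dd (Bop ts)) \<doteq> - fr (foldr Plus ?L (Nul X Y (sdeg ts + 2)))"
    using Bop_ends[OF p ne] veq_Scale_minus[of "foldr Plus ?L (Nul X Y (sdeg ts + 2))"]
      typed_foldr_Plus[of ?L X Y "sdeg ts + 2"] L XY by (simp add: typed_def add.commute del: esrc.simps(5) etgt.simps(5))
  also have "\<dots> \<doteq> - sum_list (map fr ?L)"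
    by (intro veq_minus veq_foldr_Plus L XY)
  also have "\<dots> \<doteq> - (\<Sum>(u, m, v)\<in>splits3 ts. if u = [] \<and> v = [] then 0 else sgm (sdeg v) (fr (Bop (u @ b m # v))))"
    unfolding sum_insertions
  proof (intro veq_minus veq_sum)
    fix x assume x: "x \<in> splits3 ts"
    then show "(case x of (u, m, v) \<Rightarrow> if u = [] \<and> v = [] then 0 else fr (Scale (sgn_in R (sdeg v)) (Bop (u @ b m # v))))
      \<doteq> (case x of (u, m, v) \<Rightarrow> if u = [] \<and> v = [] then 0 else sgm (sdeg v) (fr (Bop (u @ b m # v))))"
      using ins by (cases x) (auto simp: typed_def simp del: wf_expr.simps intro!: veq_Scale_sgn)
  qed
  finally show ?thesis .
qed

text \<open>The block that is all of \<open>ts\<close> contributes \<open>dd (Bop ts)\<close>, and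
  \<open>ediff\<close> defines this as minus the sum of all other summands.\<close>

lemma ainf_relation:
  assumes p: "path X ts Y" and l: "2 \<le> length ts"
  shows "(\<Sum>(u, m, v)\<in>splits3 ts. sgm (sdeg v) (fr (b (u @ b m # v)))) \<doteq> 0"
proof -
  let ?F = "\<lambda>u m v. sgm (sdeg v) (fr (b (u @ b m # v)))"
  let ?G = "\<lambda>u m v. if u = [] \<and> v = [] then 0 else sgm (sdeg v) (fr (Bop (u @ b m # v)))"
  have mem: "([], ts, []) \<in> splits3 ts" using l by (auto simp: splits3_def)
  have "(\<Sum>(u, m, v)\<in>splits3 ts. ?F u m v) = fr (dd (Bop ts)) + (\<Sum>(u, m, v)\<in>splits3 ts - {([], ts, [])}. ?F u m v)"
    using sum.remove[OF finite_splits3 mem, of "\<lambda>(u, m, v). ?F u m v"] l by simp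
  also have "(\<Sum>(u, m, v)\<in>splits3 ts - {([], ts, [])}. ?F u m v) = (\<Sum>(u, m, v)\<in>splits3 ts - {([], ts, [])}. ?G u m v)"
  proof (rule sum.cong[OF refl])
    fix x assume x: "x \<in> splits3 ts - {([], ts, [])}"
    obtain u m v where "x = (u, m, v)" by (cases x)
    with x show "(case x of (u, m, v) \<Rightarrow> ?F u m v) = (case x of (u, m, v) \<Rightarrow> ?G u m v)"
      by (cases "u = []"; cases "v = []") (auto simp: splits3_def)
  qed
  also have "\<dots> = (\<Sum>(u, m, v)\<in>splits3 ts. ?G u m v)"
    using sum.remove[OF finite_splits3 mem, of "\<lambda>(u, m, v). ?G u m v"] by simp
  finally have "(\<Sum>(u, m, v)\<in>splits3 ts. ?F u m v) = fr (dd (Bop ts)) - (- (\<Sum>(u, m, v)\<in>splits3 ts. ?G u m v))"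
    by simp
  then show ?thesis using dd_Bop[OF p l] by (simp add: veq_def)
qed

end

lemma sum_splits3_map:
  fixes F :: "'b list \<Rightarrow> 'b list \<Rightarrow> 'b list \<Rightarrow> 'v::ab_group_add"
  shows "(\<Sum>(u, m, v)\<in>splits3 (map f xs). F u m v) = (\<Sum>(u, m, v)\<in>splits3 xs. F (map f u) (map f m) (map f v))"
proof (induction xs arbitrary: F)
  case (Cons x xs)
  have 2: "(\<Sum>(u, v)\<in>splits2 (map f ys). G u v) = (\<Sum>(u, v)\<in>splits2 ys. G (map f u) (map f v))"
    for G :: "'b list \<Rightarrow> 'b list \<Rightarrow> 'v" and ys
    by (induction ys arbitrary: G) (simp_all add: sum_splits2_Cons)
  show ?case by (simp add: sum_splits3_Cons Cons.IH 2)
qed simp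

text \<open>Serves to compare two sums over blocks whose summands agree except for the block that is
  the whole list.\<close>

lemma sum_splits3_full:
  fixes c :: "'a list \<Rightarrow> 'v::ab_group_add"
  assumes "ts \<noteq> []"
  shows "(\<Sum>(u, m, v)\<in>splits3 ts. if u = [] \<and> v = [] then c m else 0) = c ts"
proof -
  have "(\<Sum>(u, m, v)\<in>splits3 ts. if u = [] \<and> v = [] then c m else 0)
      = (\<Sum>x\<in>splits3 ts. if x = ([], ts, []) then c ts else 0)"
  proof (rule sum.cong[OF refl])
    fix x assume x: "x \<in> splits3 ts"
    obtain u m v where "x = (u, m, v)" by (cases x)
    with x show "(case x of (u, m, v) \<Rightarrow> if u = [] \<and> v = [] then c m else 0)
        = (if x = ([], ts, []) then c ts else 0)"
      by (cases "u = []"; cases "v = []") (auto simp: splits3_def)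
  qed
  moreover have "([], ts, []) \<in> splits3 ts" using assms by (simp add: splits3_def)
  ultimately show ?thesis by simp
qed

context dg_exprs
begin

declare ediff.simps(5) [simp del]

lemma veq_Gen_add:
  assumes "X \<in> aob C" "Y \<in> aob C" "f \<in> carrier (shom C X Y d)" "g \<in> carrier (shom C X Y d)"
  shows "fr (Gen X Y d (f \<oplus>\<^bsub>shom C X Y d\<^esub> g)) \<doteq> fr (Gen X Y d f) + fr (Gen X Y d g)"
proof -
  interpret M: module R "shom C X Y d" using assms(1,2) by (rule module_C)
  have "fr (Gen X Y d (f \<oplus>\<^bsub>shom C X Y d\<^esub> g)) \<doteq> fr (Plus (Gen X Y d f) (Gen X Y d g))"
    using assms by (intro lin_veq lin_identity.intros) auto
  also have "\<dots> \<doteq> fr (Gen X Y d f) + fr (Gen X Y d g)" using assms by (intro veq_Plus) auto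
  finally show ?thesis .
qed

lemma veq_Gen_smult:
  assumes "X \<in> aob C" "Y \<in> aob C" "f \<in> carrier (shom C X Y d)" "a \<in> carrier R"
  shows "fr (Gen X Y d (a \<odot>\<^bsub>shom C X Y d\<^esub> f)) \<doteq> fr (Scale a (Gen X Y d f))"
proof -
  interpret M: module R "shom C X Y d" using assms(1,2) by (rule module_C)
  show ?thesis using assms by (intro lin_veq lin_identity.intros) auto
qed

lemma veq_Gen_sgn:
  assumes "X \<in> aob C" "Y \<in> aob C" "f \<in> carrier (shom C X Y d)"
  shows "fr (Gen X Y d (sgn_in R e \<odot>\<^bsub>shom C X Y d\<^esub> f)) \<doteq> sgm e (fr (Gen X Y d f))"
  using veq_trans[OF veq_Gen_smult[OF assms sgn_closed] veq_Scale_sgn] assms by simp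

lemma veq_Gen_zero:
  assumes "X \<in> aob C" "Y \<in> aob C"
  shows "fr (Gen X Y d \<zero>\<^bsub>shom C X Y d\<^esub>) \<doteq> 0"
proof -
  interpret M: module R "shom C X Y d" using assms(1,2) by (rule module_C)
  show ?thesis
    using veq_Gen_add[OF assms M.zero_closed M.zero_closed] by (intro null_of_double) simp
qed

lemma b1C_zero: "X \<in> aob C \<Longrightarrow> Y \<in> aob C \<Longrightarrow> bop C [Arr X Y d \<zero>\<^bsub>shom C X Y d\<^esub>] = \<zero>\<^bsub>shom C X Y (d + 1)\<^esub>"
proof -
  assume XY: "X \<in> aob C" "Y \<in> aob C"
  interpret M: module R "shom C X Y d" using XY by (rule module_C)
  interpret N: module R "shom C X Y (d + 1)" using XY by (rule module_C)
  show ?thesis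
    using b1C_add[OF XY M.zero_closed M.zero_closed] b1C_closed[OF XY M.zero_closed] by simp
qed

lemma b2C_zero_left: "X \<in> aob C \<Longrightarrow> Y \<in> aob C \<Longrightarrow> Z \<in> aob C \<Longrightarrow> y \<in> carrier (shom C Y Z e)
  \<Longrightarrow> bop C [Arr X Y d \<zero>\<^bsub>shom C X Y d\<^esub>, Arr Y Z e y] = \<zero>\<^bsub>shom C X Z (d + e + 1)\<^esub>"
proof -
  assume XY: "X \<in> aob C" "Y \<in> aob C" "Z \<in> aob C" "y \<in> carrier (shom C Y Z e)"
  interpret M: module R "shom C X Y d" using XY(1,2) by (rule module_C)
  interpret N: module R "shom C X Z (d + e + 1)" using XY(1,3) by (rule module_C)
  show ?thesis
    using b2C_add_left[OF XY(1-3) M.zero_closed M.zero_closed XY(4)] b2C_closed[OF XY(1-3) M.zero_closed XY(4)] by simp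
qed

lemma b2C_zero_right: "X \<in> aob C \<Longrightarrow> Y \<in> aob C \<Longrightarrow> Z \<in> aob C \<Longrightarrow> x \<in> carrier (shom C X Y d)
  \<Longrightarrow> bop C [Arr X Y d x, Arr Y Z e \<zero>\<^bsub>shom C Y Z e\<^esub>] = \<zero>\<^bsub>shom C X Z (d + e + 1)\<^esub>"
proof -
  assume XY: "X \<in> aob C" "Y \<in> aob C" "Z \<in> aob C" "x \<in> carrier (shom C X Y d)"
  interpret M: module R "shom C Y Z e" using XY(2,3) by (rule module_C)
  interpret N: module R "shom C X Z (d + e + 1)" using XY(1,3) by (rule module_C)
  show ?thesis
    using b2C_add_right[OF XY M.zero_closed M.zero_closed] b2C_closed[OF XY M.zero_closed] by simp
qed

lemma composable_path:
  "composable C xs \<longleftrightarrow> xs \<noteq> [] \<and> path (bsrc xs) (map genx xs) (btgt xs)"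
proof (cases "xs = []")
  case False
  then show ?thesis
    by (auto simp: composable_def path_iff successively_map genx_def bsrc_def btgt_def hd_map last_map)
qed (simp add: composable_def)

lemma path_bends: "path X (map genx xs) Y \<Longrightarrow> xs \<noteq> [] \<Longrightarrow> bsrc xs = X \<and> btgt xs = Y"
  by (auto simp: path_iff bsrc_def btgt_def hd_map last_map o_def)

lemma composable_iff: "composable C xs \<longleftrightarrow> xs \<noteq> [] \<and> (\<exists>X Y. path X (map genx xs) Y)"
  using composable_path path_bends by metis

lemma wf_barr:
  assumes "composable C xs"
  shows "wf (genx (barr C xs))"
proof -
  have ne: "xs \<noteq> []" using assms by (simp add: composable_def)
  then have XY: "bsrc xs \<in> aob C" "btgt xs \<in> aob C"
    using assms by (simp_all add: composable_def bsrc_def btgt_def)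
  consider (1) x where "xs = [x]" | (2) x y where "xs = [x, y]" | (3) "3 \<le> length xs"
    using ne by (cases xs rule: remdups_adj.cases) (auto simp: Suc_le_eq neq_Nil_conv, metis length_greater_0_conv neq_Nil_conv)
  then show ?thesis
  proof cases
    case 1
    then show ?thesis using assms b1C_closed[of "asrc x" "atgt x" "aval x" "adeg x"]
      by (simp add: genx_def composable_def bsrc_def btgt_def bdeg_def)
  next
    case 2
    then show ?thesis
      using assms b2C_closed[of "asrc x" "atgt x" "atgt y" "aval x" "adeg x" "aval y" "adeg y"]
      by (cases x; cases y) (auto simp: genx_def composable_def bsrc_def btgt_def bdeg_def)
  next
    case 3
    interpret M: module R "shom C (bsrc xs) (btgt xs) (bdeg xs)" using XY by (rule module_C)
    show ?thesis using higher[OF assms 3] XY by (simp add: genx_def)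
  qed
qed

lemma path_barr:
  assumes "path X (map genx xs) Y" "(u, m, v) \<in> splits3 xs"
  shows "path X (map genx (u @ barr C m # v)) Y"
proof -
  have xs: "xs = u @ m @ v" and m: "m \<noteq> []" using assms(2) by (auto simp: splits3_def)
  obtain P Q where p: "path X (map genx u) P" "path P (map genx m) Q" "path Q (map genx v) Y"
    using assms(1) xs by auto
  have "composable C m" using p(2) m composable_iff by blast
  then show ?thesis using p wf_barr[of m] path_bends[OF p(2) m] by auto
qed

text \<open>For one entry both sides are the same generator, by the definition of
  \<open>ediff\<close>; from two entries on this is the rule \<open>qeq_gen\<close>.\<close>

lemma bb_genx:
  assumes "composable C m"
  shows "fr (b (map genx m)) \<doteq> fr (genx (barr C m))"
proof (cases "2 \<le> length m")
  case True
  then show ?thesis using assms wf_barr by (auto intro!: eqv_veq qeq_gen)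
next
  case False
  with assms obtain x where m: "m = [x]" by (cases m rule: remdups_adj.cases) (auto simp: composable_def)
  show ?thesis by (cases x) (simp add: m genx_def barr_def bsrc_def btgt_def bdeg_def)
qed

text \<open>Either the outer operation has arity at least three and vanishes, as in any differential
  graded category, or the inner one does, and then a unary or binary operation is applied to
  zero.\<close>

lemma insertion_zero:
  assumes xs: "composable C xs" and umv: "(u, m, v) \<in> splits3 xs" and l: "3 \<le> length m \<or> 2 \<le> length u + length v"
  shows "fr (genx (barr C (u @ barr C m # v))) \<doteq> 0"
proof -
  let ?ys = "u @ barr C m # v"
  have p: "path (bsrc xs) (map genx ?ys) (btgt xs)"
    by (rule path_barr[OF _ umv]) (use xs composable_path in blast)
  have ys: "composable C ?ys" using p composable_iff by blast
  have XY: "bsrc ?ys \<in> aob C" "btgt ?ys \<in> aob C" using wf_ob[OF wf_barr[OF ys]] by simp_all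
  have m: "composable C m" "xs = u @ m @ v"
    using umv xs by (auto simp: splits3_def composable_iff)
  have "bop C ?ys = \<zero>\<^bsub>shom C (bsrc ?ys) (btgt ?ys) (bdeg ?ys)\<^esub>"
  proof (cases "2 \<le> length u + length v")
    case True
    then show ?thesis by (intro higher[OF ys]) simp
  next
    case False
    with l have m3: "3 \<le> length m" by simp
    have PQ: "bsrc m \<in> aob C" "btgt m \<in> aob C" using wf_ob[OF wf_barr[OF m(1)]] by simp_all
    have bm: "barr C m = Arr (bsrc m) (btgt m) (bdeg m) \<zero>\<^bsub>shom C (bsrc m) (btgt m) (bdeg m)\<^esub>"
      using higher[OF m(1) m3] by (simp add: barr_def)
    consider (a) "u = []" "v = []" | (b) y where "u = []" "v = [y]" | (c) x where "u = [x]" "v = []"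
      using False by (cases u; cases v) (auto simp: Suc_le_eq)
    then show ?thesis
    proof cases
      case a
      then show ?thesis using b1C_zero[OF PQ] by (simp add: bm bsrc_def btgt_def bdeg_def)
    next
      case b
      then show ?thesis using b2C_zero_left[OF PQ, of "atgt y" "aval y" "adeg y" "bdeg m"] p b PQ ys
        by (cases y) (simp add: bm bsrc_def btgt_def bdeg_def composable_def)
    next
      case c
      then show ?thesis using b2C_zero_right[OF _ PQ, of "asrc x" "aval x" "adeg x" "bdeg m"] p c PQ ys
        by (cases x) (simp add: bm bsrc_def btgt_def bdeg_def composable_def)
    qed
  qed
  then show ?thesis using veq_Gen_zero[OF XY] by (simp add: genx_def)
qed

text \<open>In arity two and three these are the Leibniz rule and associativity. From arity four on,
  every block leaves the inner or the outer operation with at least three arguments, so all summands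
  vanish.\<close>

lemma relation_C:
  assumes xs: "composable C xs" and l: "2 \<le> length xs"
  shows "(\<Sum>(u, m, v)\<in>splits3 xs. sgm (sdeg (map genx v :: ('k, 'o, 'm) expr list)) (fr (genx (barr C (u @ barr C m # v))))) \<doteq> 0"
proof -
  let ?F = "\<lambda>u m v. sgm (sdeg (map genx v :: ('k, 'o, 'm) expr list)) (fr (genx (barr C (u @ barr C m # v))))"
  consider (2) x y where "xs = [x, y]" | (3) x y z where "xs = [x, y, z]" | (4) "4 \<le> length xs"
  proof -
    have "length xs = 2 \<or> length xs = 3 \<or> 4 \<le> length xs" using l by auto
    then show thesis
      using 2 3 4 by (auto simp: numeral_eq_Suc length_Suc_conv)
  qed
  then show ?thesis
  proof cases
    case 2
    obtain X Y d f where x: "x = Arr X Y d f" by (cases x)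
    obtain Y' Z e g where y: "y = Arr Y' Z e g" by (cases y)
    have ty: "X \<in> aob C" "Y \<in> aob C" "Z \<in> aob C" "Y' = Y" "f \<in> carrier (shom C X Y d)" "g \<in> carrier (shom C Y Z e)"
      using xs by (auto simp: 2 x y composable_def)
    note cl = b1C_closed[OF ty(1,2,5)] b1C_closed[OF ty(2,3,6)] b2C_closed[OF ty(1,2,3,5,6)]
    let ?A = "bop C [Arr X Y (d + 1) (bop C [x]), y]"
    let ?B = "bop C [x, Arr Y Z (e + 1) (bop C [y])]"
    let ?D = "bop C [Arr X Z (d + e + 1) (bop C [x, y])]"
    let ?d = "d + e + 2"
    have AB: "?A \<in> carrier (shom C X Z ?d)" "?B \<in> carrier (shom C X Z ?d)" "?D \<in> carrier (shom C X Z ?d)"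
      using b2C_closed[OF ty(1,2,3) cl(1) ty(6)] b2C_closed[OF ty(1,2,3,5) cl(2)] b1C_closed[OF ty(1,3) cl(3)]
      by (simp_all add: x y ty(4) algebra_simps)
    interpret M: module R "shom C X Z ?d" using ty(1,3) by (rule module_C)
    have "(\<Sum>(u, m, v)\<in>splits3 xs. ?F u m v)
      = fr (Gen X Z ?d ?D) + (sgm e (fr (Gen X Z ?d ?A)) + fr (Gen X Z ?d ?B))"
      by (simp add: 2 sum_splits3_Cons sum_splits2_Cons x y ty(4) genx_def barr_def bsrc_def btgt_def bdeg_def algebra_simps)
    also have "\<dots> \<doteq> fr (Gen X Z ?d ?D) +
        (fr (Gen X Z ?d (sgn_in R e \<odot>\<^bsub>shom C X Z ?d\<^esub> ?A)) + fr (Gen X Z ?d ?B))"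
      by (intro veq_add veq_refl veq_sym[OF veq_Gen_sgn] ty AB)
    also have "\<dots> \<doteq> fr (Gen X Z ?d ?D) + fr (Gen X Z ?d (sgn_in R e \<odot>\<^bsub>shom C X Z ?d\<^esub> ?A \<oplus>\<^bsub>shom C X Z ?d\<^esub> ?B))"
      by (intro veq_add veq_refl veq_sym[OF veq_Gen_add] ty AB M.smult_closed sgn_closed)
    also have "\<dots> \<doteq> fr (Gen X Z ?d (?D \<oplus>\<^bsub>shom C X Z ?d\<^esub>
        (sgn_in R e \<odot>\<^bsub>shom C X Z ?d\<^esub> ?A \<oplus>\<^bsub>shom C X Z ?d\<^esub> ?B)))"
      by (intro veq_sym[OF veq_Gen_add] ty AB M.smult_closed sgn_closed M.a_closed)
    also have "\<dots> \<doteq> 0" using leibniz[OF ty(1,2,3,5,6)] veq_Gen_zero[OF ty(1,3)] by (simp add: x y ty(4))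
    finally show ?thesis .
  next
    case 3
    obtain W X d f where x: "x = Arr W X d f" by (cases x)
    obtain X' Y e g where y: "y = Arr X' Y e g" by (cases y)
    obtain Y' Z c h where z: "z = Arr Y' Z c h" by (cases z)
    have ty: "W \<in> aob C" "X \<in> aob C" "Y \<in> aob C" "Z \<in> aob C" "X' = X" "Y' = Y"
      "f \<in> carrier (shom C W X d)" "g \<in> carrier (shom C X Y e)" "h \<in> carrier (shom C Y Z c)"
      using xs by (auto simp: 3 x y z composable_def)
    let ?d = "d + e + c + 2"
    let ?A = "bop C [Arr W Y (d + e + 1) (bop C [x, y]), z]"
    let ?B = "bop C [x, Arr X Z (e + c + 1) (bop C [y, z])]"
    note cl = b2C_closed[OF ty(1,2,3,7,8)] b2C_closed[OF ty(2,3,4,8,9)]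
    have AB: "?A \<in> carrier (shom C W Z ?d)" "?B \<in> carrier (shom C W Z ?d)"
      using b2C_closed[OF ty(1,3,4) cl(1) ty(9)] b2C_closed[OF ty(1,2,4,7) cl(2)]
      by (simp_all add: x y z ty(5,6) algebra_simps)
    interpret M: module R "shom C W Z ?d" using ty(1,4) by (rule module_C)
    \<comment> \<open>A block of length one or three involves a ternary operation; the two blocks of
      length two remain.\<close>
    let ?N = "\<lambda>u m v. if 3 \<le> length m \<or> 2 \<le> length u + length v then 0 else ?F u m v"
    have "(\<Sum>(u, m, v)\<in>splits3 xs. ?F u m v) \<doteq> (\<Sum>(u, m, v)\<in>splits3 xs. ?N u m v)"
    proof (rule veq_sum)
      fix i assume i: "i \<in> splits3 xs"
      obtain u m v where umv: "i = (u, m, v)" by (cases i)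
      show "(case i of (u, m, v) \<Rightarrow> ?F u m v) \<doteq> (case i of (u, m, v) \<Rightarrow> ?N u m v)"
        using veq_sgm[OF insertion_zero[OF xs i[unfolded umv]], of "sdeg (map genx v :: ('k, 'o, 'm) expr list)"]
        by (simp add: umv)
    qed
    also have "(\<Sum>(u, m, v)\<in>splits3 xs. ?N u m v) = sgm c (fr (Gen W Z ?d ?A)) + fr (Gen W Z ?d ?B)"
      by (simp add: 3 sum_splits3_Cons sum_splits2_Cons x y z ty(5,6) genx_def barr_def bsrc_def btgt_def bdeg_def algebra_simps)
    also have "\<dots> \<doteq> fr (Gen W Z ?d (sgn_in R c \<odot>\<^bsub>shom C W Z ?d\<^esub> ?A)) + fr (Gen W Z ?d ?B)"
      by (intro veq_add veq_refl veq_sym[OF veq_Gen_sgn] ty AB)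
    also have "\<dots> \<doteq> fr (Gen W Z ?d (sgn_in R c \<odot>\<^bsub>shom C W Z ?d\<^esub> ?A \<oplus>\<^bsub>shom C W Z ?d\<^esub> ?B))"
      by (intro veq_sym[OF veq_Gen_add] ty AB M.smult_closed sgn_closed)
    also have "\<dots> \<doteq> 0" using assoc[OF ty(1-4,7-9)] veq_Gen_zero[OF ty(1,4)] by (simp add: x y z ty(5,6))
    finally show ?thesis .
  next
    case 4
    have "(\<Sum>(u, m, v)\<in>splits3 xs. ?F u m v) \<doteq> (\<Sum>i\<in>splits3 xs. 0)"
    proof (rule veq_sum)
      fix i assume i: "i \<in> splits3 xs"
      obtain u m v where umv: "i = (u, m, v)" by (cases i)
      have "length u + length m + length v = length xs" using i umv by (auto simp: splits3_def)
      then have "3 \<le> length m \<or> 2 \<le> length u + length v" using 4 by linarith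
      from veq_sgm[OF insertion_zero[OF xs i[unfolded umv] this], of "sdeg (map genx v :: ('k, 'o, 'm) expr list)"]
      show "(case i of (u, m, v) \<Rightarrow> ?F u m v) \<doteq> 0" by (simp add: umv)
    qed
    then show ?thesis by simp
  qed
qed

text \<open>This is the heart of the stability of (R_C)_+ under b_1. The relation for
  \<open>Bop (map genx xs)\<close> in the free category and the relation for \<open>xs\<close> in C
  agree summand by summand, by substitution of congruent arguments, except for the block that is all
  of \<open>xs\<close>. As both sums vanish, the two exceptional summands agree as well.\<close>

lemma dd_gen:
  assumes xs: "composable C xs" and l: "2 \<le> length xs"
  shows "fr (dd (Bop (map genx xs))) \<doteq> fr (dd (genx (barr C xs)))"
proof -
  let ?g = "genx :: ('o, 'm) arr \<Rightarrow> ('k, 'o, 'm) expr"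
  let ?T = "\<lambda>u m v. sgm (sdeg (map ?g v)) (fr (b (map ?g u @ b (map ?g m) # map ?g v)))"
  let ?S = "\<lambda>u m v. sgm (sdeg (map ?g v)) (fr (?g (barr C (u @ barr C m # v))))"
  have p: "path (bsrc xs) (map ?g xs) (btgt xs)" using xs composable_path by blast
  have ne: "xs \<noteq> []" using l by auto
  let ?c = "fr (dd (Bop (map ?g xs))) - fr (dd (?g (barr C xs)))"
  have e1: "(\<Sum>(u, m, v)\<in>splits3 xs. ?T u m v) - (\<Sum>(u, m, v)\<in>splits3 xs. ?S u m v) \<doteq> 0 - 0"
  proof (rule veq_diff[OF _ relation_C[OF xs l]])
    show "(\<Sum>(u, m, v)\<in>splits3 xs. ?T u m v) \<doteq> 0"
      using ainf_relation[OF p] l unfolding sum_splits3_map by simp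
  qed
  have e2: "(\<Sum>(u, m, v)\<in>splits3 xs. ?T u m v) - (\<Sum>(u, m, v)\<in>splits3 xs. ?S u m v)
    \<doteq> (\<Sum>(u, m, v)\<in>splits3 xs. if u = [] \<and> v = [] then ?c else 0)"
    unfolding sum_subtractf[symmetric]
  proof (rule veq_sum)
    fix i assume i: "i \<in> splits3 xs"
    obtain u m v where umv: "i = (u, m, v)" by (cases i)
    have xs': "xs = u @ m @ v" and m: "m \<noteq> []" using i umv by (auto simp: splits3_def)
    have cm: "composable C m" using p m xs' by (auto simp: composable_iff)
    have "?T u m v - ?S u m v \<doteq> (if u = [] \<and> v = [] then ?c else 0)"
    proof (cases "u = [] \<and> v = []")
      case True
      have "?g (barr C [barr C xs]) = dd (?g (barr C xs))"
        by (simp add: genx_def barr_def bsrc_def btgt_def bdeg_def)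
      then show ?thesis using True l xs' by simp
    next
      case False
      have py: "path (bsrc xs) (map ?g (u @ barr C m # v)) (btgt xs)"
        by (rule path_barr[OF p]) (use i umv in simp)
      have pb: "path (bsrc xs) (map ?g u @ b (map ?g m) # map ?g v) (btgt xs)"
        by (rule path_insertion[OF p]) (use xs' m in \<open>simp add: splits3_def\<close>)
      have l2: "2 \<le> length (map ?g u @ ?g (barr C m) # map ?g v)" using False by (auto simp: Suc_le_eq)
      have "slot (map ?g u) (map ?g v) (fr (b (map ?g m))) \<doteq> slot (map ?g u) (map ?g v) (fr (?g (barr C m)))"
        by (rule slot_veq[OF bb_genx[OF cm]])
      then have "fr (Bop (map ?g u @ b (map ?g m) # map ?g v)) \<doteq> fr (Bop (map ?g u @ ?g (barr C m) # map ?g v))"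
        using wf_BopI[OF pb] wf_BopI[OF py] l2 by (simp add: lift_fr del: wf_expr.simps)
      also have "fr (Bop (map ?g u @ ?g (barr C m) # map ?g v)) = fr (b (map ?g (u @ barr C m # v)))"
        using False by auto
      also have "\<dots> \<doteq> fr (?g (barr C (u @ barr C m # v)))"
        by (rule bb_genx) (use py composable_iff in blast)
      finally have "?T u m v \<doteq> ?S u m v" using False by (intro veq_sgm) auto
      then show ?thesis using False by (auto simp: veq_def)
    qed
    then show "(case i of (u, m, v) \<Rightarrow> ?T u m v) - (case i of (u, m, v) \<Rightarrow> ?S u m v)
        \<doteq> (case i of (u, m, v) \<Rightarrow> if u = [] \<and> v = [] then ?c else 0)" by (simp add: umv)
  qed
  have "?c \<doteq> 0"
    using veq_trans[OF veq_sym[OF e2] e1] unfolding sum_splits3_full[OF ne, of "\<lambda>_. ?c"] by simp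
  then show ?thesis by (simp add: veq_def)
qed

section \<open>The differential on classes, and its square\<close>

lemma multilin_map:
  assumes "\<And>s t. F (Plus s t) = Plus (F s) (F t)" "\<And>a t. F (Scale a t) = Scale a (F t)"
    "\<And>t. typed X Y d t \<Longrightarrow> typed X' Y' d' (F t)" "\<And>t t'. \<kappa> t t' \<Longrightarrow> fr (F t) \<doteq> fr (F t')"
  shows "multilin \<kappa> (typed X Y d) (\<lambda>t. fr (F t))"
  unfolding multilin_def
proof (intro conjI allI impI)
  fix s t assume "typed X Y d s" "typed X Y d t"
  from assms(3)[OF this(1)] assms(3)[OF this(2)]
  show "fr (F (Plus s t)) \<doteq> fr (F s) + fr (F t)"
    unfolding assms by (intro veq_Plus) (auto simp: typed_def)
next
  fix a t assume "typed X Y d t"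
  from assms(3)[OF this] show "fr (F (Scale a t)) \<doteq> scl a (fr (F t))"
    by (simp add: assms(2) lift_fr typed_def)
qed (use assms in auto)

text \<open>A block lies before the varying argument, after it, or contains it. In the first two
  cases linearity is that of a plain argument. In the last case the argument sits inside the inner
  operation, and if that operation is b_1, the second half of \<open>\<kappa>\<close> is what is
  known about it.\<close>

lemma multilin_dd_Bop:
  fixes us vs :: "('k, 'o, 'm) expr list"
  assumes w: "wf (Bop (us @ t0 # vs))"
  defines "\<kappa> \<equiv> \<lambda>t t'. eqv True t t' \<and> fr (dd t) \<doteq> fr (dd t')"
  defines "\<tau> \<equiv> typed (esrc t0) (etgt t0) (edeg t0)"
  shows "multilin \<kappa> \<tau> (\<lambda>t. fr (dd (Bop (us @ t # vs))))"
proof -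
  obtain X Y where p: "path X us (esrc t0)" "path (etgt t0) vs Y" and l: "1 \<le> length us + length vs"
    using w unfolding wf_Bop_iff by auto
  have \<tau>P: "\<tau> s \<Longrightarrow> \<tau> t \<Longrightarrow> \<tau> (Plus s t)" and \<tau>S: "a \<in> carrier R \<Longrightarrow> \<tau> t \<Longrightarrow> \<tau> (Scale a t)" for a s t
    unfolding \<tau>_def by (auto intro: typed_Plus typed_Scale)
  have \<kappa>1: "\<kappa> t t' \<Longrightarrow> fr t \<doteq> fr t'" and \<kappa>2: "\<kappa> t t' \<Longrightarrow> fr (dd t) \<doteq> fr (dd t')" for t t'
    by (auto simp: \<kappa>_def intro: eqv_veq)
  have base: "multilin \<kappa> \<tau> fr"
    unfolding \<tau>_def by (rule multilin_fr) (simp add: \<kappa>_def)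
  have slot_lin: "multilin \<kappa> \<tau> (\<lambda>t. fr (Bop (us' @ t # vs')))"
    if "path X' us' (esrc t0)" "path (etgt t0) vs' Y'" "us' \<noteq> [] \<or> vs' \<noteq> []" for X' Y' us' vs'
  proof (rule multilin_Bop[OF base \<tau>P \<tau>S])
    fix t assume "\<tau> t"
    then have "path X' (us' @ t # vs') Y'" using that by (auto simp: \<tau>_def typed_def)
    then show "wf (Bop (us' @ t # vs'))" by (rule wf_BopI) (use that(3) in \<open>auto simp: Suc_le_eq\<close>)
  qed
  let ?B = "\<lambda>u m v. if u = [] \<and> v = [] then 0 else sgm (sdeg v) (fr (Bop (u @ b m # v)))"
  let ?d = "edeg t0"
  \<comment> \<open>The degree of the varying argument occurs in the sign of the first sum; it is
    frozen to \<open>?d\<close>, the common degree of all arguments in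
    \<open>\<tau>\<close>.\<close>
  let ?G = "\<lambda>t. (\<Sum>(u, m, r)\<in>splits3 us. sgm (sdeg r + ?d + sdeg vs) (fr (Bop ((u @ b m # r) @ t # vs))))
    + (\<Sum>(r, m, v)\<in>splits3 vs. sgm (sdeg v) (fr (Bop (us @ t # (r @ b m # v)))))
    + (\<Sum>(u, l)\<in>splits2 us. \<Sum>(r, v)\<in>splits2 vs. if u = [] \<and> v = [] then 0 else sgm (sdeg v) (fr (Bop (u @ b (l @ t # r) # v))))"
  have pt: "path X (us @ t # vs) Y" if "\<tau> t" for t
    using that p by (auto simp: \<tau>_def typed_def)
  have lt: "2 \<le> length (us @ t # vs)" for t :: "('k, 'o, 'm) expr" using l by simp
  have G: "fr (dd (Bop (us @ t # vs))) \<doteq> - ?G t" if t: "\<tau> t" for t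
  proof -
    have "(\<Sum>(u, m, v)\<in>splits3 (us @ t # vs). ?B u m v) = ?G t"
      unfolding sum_splits3_middle[of ?B] using t
      by (intro arg_cong2[where f = "(+)"] sum.cong refl)
        (auto simp: \<tau>_def typed_def add.assoc)
    then show ?thesis using dd_Bop[OF pt[OF t] lt] by simp
  qed
  have G_lin: "multilin \<kappa> \<tau> ?G"
  proof (intro multilin_add multilin_sum)
    fix i assume i: "i \<in> splits3 us"
    obtain u m r where i': "i = (u, m, r)" by (cases i)
    have "path X (u @ b m # r) (esrc t0)" using path_insertion[OF p(1)] i i' by blast
    from slot_lin[OF this p(2)] have "multilin \<kappa> \<tau> (\<lambda>t. fr (Bop ((u @ b m # r) @ t # vs)))" by simp
    then show "multilin \<kappa> \<tau> (\<lambda>t. case i of (u, m, r) \<Rightarrow> sgm (sdeg r + ?d + sdeg vs) (fr (Bop ((u @ b m # r) @ t # vs))))"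
      unfolding i' prod.case by (rule multilin_sgm)
  next
    fix i assume i: "i \<in> splits3 vs"
    obtain r m v where i': "i = (r, m, v)" by (cases i)
    have "path (etgt t0) (r @ b m # v) Y" using path_insertion[OF p(2)] i i' by blast
    from slot_lin[OF p(1) this] have "multilin \<kappa> \<tau> (\<lambda>t. fr (Bop (us @ t # (r @ b m # v))))" by simp
    then show "multilin \<kappa> \<tau> (\<lambda>t. case i of (r, m, v) \<Rightarrow> sgm (sdeg v) (fr (Bop (us @ t # (r @ b m # v)))))"
      unfolding i' prod.case by (rule multilin_sgm)
  next
    fix i assume i: "i \<in> splits2 us"
    obtain u l where i': "i = (u, l)" by (cases i)
    have "multilin \<kappa> \<tau> (\<lambda>t. \<Sum>(r, v)\<in>splits2 vs. if u = [] \<and> v = [] then 0 else sgm (sdeg v) (fr (Bop (u @ b (l @ t # r) # v))))"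
    proof (intro multilin_sum)
      fix j assume j: "j \<in> splits2 vs"
      obtain r v where j': "j = (r, v)" by (cases j)
      have u: "us = u @ l" and v: "vs = r @ v" using i i' j j' by (auto simp: splits2_def)
      obtain P Q where PQ: "path X u P" "path P l (esrc t0)" "path (etgt t0) r Q" "path Q v Y"
        using p u v by auto
      have lr: "path P (l @ t # r) Q" if "\<tau> t" for t using PQ that by (auto simp: \<tau>_def typed_def)
      have inner: "multilin \<kappa> \<tau> (\<lambda>t. fr (b (l @ t # r)))"
      proof (cases "l = [] \<and> r = []")
        case True
        then show ?thesis unfolding \<tau>_def
          by (auto intro!: multilin_map[where F = dd] \<kappa>2 typed_dd)
      next
        case False
        have "multilin \<kappa> \<tau> (\<lambda>t. fr (Bop (l @ t # r)))"
          by (rule slot_lin[OF PQ(2,3)]) (use False in auto)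
        then show ?thesis using False by auto
      qed
      show "multilin \<kappa> \<tau> (\<lambda>t. case j of (r, v) \<Rightarrow> if u = [] \<and> v = [] then 0 else sgm (sdeg v) (fr (Bop (u @ b (l @ t # r) # v))))"
      proof (cases "u = [] \<and> v = []")
        case True
        then show ?thesis by (simp add: j' multilin_zero)
      next
        case False
        have "multilin \<kappa> \<tau> (\<lambda>t. fr (Bop (u @ b (l @ t # r) # v)))"
        proof (rule multilin_Bop[OF inner \<tau>P \<tau>S])
          fix t assume t: "\<tau> t"
          show "wf (Bop (u @ b (l @ t # r) # v))"
            using typed_bb[OF lr[OF t]] PQ False
            by (intro wf_BopI[where X = X and Y = Y]) (auto simp: typed_def Suc_le_eq)
        qed
        from multilin_sgm[OF this] show ?thesis by (simp only: j' prod.case if_not_P[OF False])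
      qed
    qed
    then show "multilin \<kappa> \<tau> (\<lambda>t. case i of (u, l) \<Rightarrow> \<Sum>(r, v)\<in>splits2 vs. if u = [] \<and> v = [] then 0
        else sgm (sdeg v) (fr (Bop (u @ b (l @ t # r) # v))))"
      by (simp only: i' prod.case)
  qed
  show ?thesis
  proof (rule multilin_veq[OF multilin_minus[OF G_lin]])
    show "fr (dd (Bop (us @ t # vs))) \<doteq> - ?G t" if "\<tau> t" for t
      by (rule G[OF that])
  qed (auto intro: \<tau>P \<tau>S)
qed

lemma dd_Hop_veq:
  assumes "wf (Hop t)"
  shows "fr (dd (Hop t)) \<doteq> fr t - fr (Hop (dd t))"
proof -
  have t: "wf t" "in_P t" "esrc t \<in> B \<or> etgt t \<in> B" using assms by auto
  have H: "wf (Hop (dd t))" "esrc (dd t) = esrc t" "etgt (dd t) = etgt t" "edeg (dd t) = edeg t + 1"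
    using typed_dd_P[OF t(1)] t by (auto simp: typed_def)
  have "fr (dd (Hop t)) \<doteq> fr t + fr (Scale (\<ominus>\<^bsub>R\<^esub> \<one>\<^bsub>R\<^esub>) (Hop (dd t)))"
    using t H minus_one_closed by (simp del: wf_expr.simps(6)) (intro veq_Plus, simp)
  also have "\<dots> \<doteq> fr t + (- fr (Hop (dd t)))"
    by (intro veq_add veq_refl veq_Scale_minus H)
  finally show ?thesis by simp
qed

lemma veq_Hop_Plus:
  assumes "wf (Hop s)" "wf (Hop t)" "esrc s = esrc t" "etgt s = etgt t" "edeg s = edeg t"
  shows "fr (Hop (Plus s t)) \<doteq> fr (Hop s) + fr (Hop t)"
proof -
  have "fr (Hop (Plus s t)) \<doteq> fr (Plus (Hop s) (Hop t))"
    using assms by (intro lin_veq lin_identity.intros) auto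
  also have "\<dots> \<doteq> fr (Hop s) + fr (Hop t)" using assms by (intro veq_Plus) auto
  finally show ?thesis .
qed

lemma veq_Hop_Scale: "wf (Hop t) \<Longrightarrow> a \<in> carrier R \<Longrightarrow> fr (Hop (Scale a t)) \<doteq> scl a (fr (Hop t))"
  using lin_veq[of "Hop (Scale a t)" "Scale a (Hop t)"] by (simp add: lift_fr lin_identity.intros)

lemma multilin_dd_Hop:
  assumes w: "wf (Hop t0)"
  shows "multilin (\<lambda>t t'. eqv True t t' \<and> fr (dd t) \<doteq> fr (dd t'))
    (\<lambda>t. typed (esrc t0) (etgt t0) (edeg t0) t \<and> in_P t) (\<lambda>t. fr (dd (Hop t)))" (is "multilin ?\<kappa> ?\<tau> _")
proof -
  have H: "wf (Hop t)" "wf (Hop (dd t))" "typed (esrc t0) (etgt t0) (edeg t0 + 1) (dd t)" if "?\<tau> t" for t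
    using that w typed_dd_P[of t] by (auto simp: typed_def)
  have m1: "multilin ?\<kappa> ?\<tau> (\<lambda>t. fr t)"
    using multilin_fr[of ?\<kappa> "esrc t0" "etgt t0" "edeg t0"] by (auto simp: multilin_def)
  have m2: "multilin ?\<kappa> ?\<tau> (\<lambda>t. fr (Hop (dd t)))"
    unfolding multilin_def
  proof (intro conjI allI impI)
    fix s t assume st: "?\<tau> s" "?\<tau> t"
    show "fr (Hop (dd (Plus s t))) \<doteq> fr (Hop (dd s)) + fr (Hop (dd t))"
      using H[OF st(1)] H[OF st(2)] by (simp add: typed_def veq_Hop_Plus)
  next
    fix a t assume "a \<in> carrier R" "?\<tau> t"
    then show "fr (Hop (dd (Scale a t))) \<doteq> scl a (fr (Hop (dd t)))"
      using H[of t] by (simp add: veq_Hop_Scale)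
  next
    fix t t' assume st: "?\<tau> t" "?\<tau> t'" "?\<kappa> t t'"
    \<comment> \<open>\<open>qeq_Hop\<close> asks for a congruence of expressions, so the congruence
      of integral combinations is turned back into one by \<open>eqv_of_null\<close>.\<close>
    then have "eqv True (dd t) (dd t')" using H[OF st(1)] H[OF st(2)] veq_typedD by blast
    then show "fr (Hop (dd t)) \<doteq> fr (Hop (dd t'))"
      using H[OF st(1)] H[OF st(2)] by (intro eqv_veq qeq_Hop) auto
  qed
  show ?thesis
  proof (rule multilin_veq[OF multilin_diff[OF m1 m2]])
    show "fr (dd (Hop t)) \<doteq> fr t - fr (Hop (dd t))" if "?\<tau> t" for t
      by (rule dd_Hop_veq[OF H(1)[OF that]])
  qed (auto intro: typed_Plus typed_Scale)
qed

lemma dd_eqv: "eqv True s t \<Longrightarrow> eqv True (dd s) (dd t)"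
proof (rule eqv_recursion[where F = dd and k = 1])
  fix X Y d f g assume "wf (Gen X Y d f)" "wf (Gen X Y d g)"
  then show "fr (dd (Gen X Y d (f \<oplus>\<^bsub>shom C X Y d\<^esub> g))) \<doteq> fr (dd (Gen X Y d f)) + fr (dd (Gen X Y d g))"
    by (simp add: b1C_add veq_Gen_add b1C_closed)
next
  fix X Y d a f assume "a \<in> carrier R" "wf (Gen X Y d f)"
  then show "fr (dd (Gen X Y d (a \<odot>\<^bsub>shom C X Y d\<^esub> f))) \<doteq> scl a (fr (dd (Gen X Y d f)))"
    using veq_Gen_smult[of X Y "bop C [Arr X Y d f]" "d + 1" a]
    by (simp add: b1C_smult b1C_closed lift_fr)
qed ((erule typed_dd | (erule (1) dd_gen) | erule multilin_dd_Bop | erule multilin_dd_Hop | assumption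
  | (simp; fail))+)

abbreviation "DD \<equiv> lift wf dd"

lemma admissible_eqv:
  assumes "\<And>s t. eqv True s t \<Longrightarrow> eqv True (F s) (F t)" "\<And>s t. F (Plus s t) = Plus (F s) (F t)"
    "\<And>X Y d t. typed X Y d t \<Longrightarrow> typed X Y (d + k) (F t)"
  shows "admissible wf F"
  unfolding admissible_def
proof (intro conjI allI impI)
  fix s t assume st: "wf (Plus s t)"
  then have "typed (esrc s) (etgt s) (edeg s + k) (F s)" "typed (esrc s) (etgt s) (edeg s + k) (F t)"
    by (intro assms; simp add: typed_def)+
  then show "fr (F (Plus s t)) \<doteq> fr (F s) + fr (F t)"
    unfolding assms(2) by (intro veq_Plus) (auto simp: typed_def)
qed (auto dest: eqv_typed intro: eqv_veq assms)

lemma DD_veq: "x \<doteq> y \<Longrightarrow> DD x \<doteq> DD y"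
  by (rule lift_veq[OF admissible_eqv[where k = 1]]) (auto intro: dd_eqv typed_dd)

abbreviation slotb where
  "slotb u v \<equiv> lift (\<lambda>t. \<exists>X Y. path X (u @ t # v) Y) (\<lambda>t. b (u @ t # v))"

lemma slotb_veq: "x \<doteq> y \<Longrightarrow> slotb u v x \<doteq> slotb u v y"
proof (cases "u = [] \<and> v = []")
  case True
  then have "slotb u v = DD" by (auto simp: lift_def intro!: arg_cong[where f = frag_extend])
  then show "x \<doteq> y \<Longrightarrow> slotb u v x \<doteq> slotb u v y" using DD_veq by simp
next
  case False
  have "slotb u v = slot u v"
    unfolding lift_def using False
    by (intro arg_cong[where f = frag_extend] ext) (auto simp: wf_Bop_iff Suc_le_eq simp del: wf_expr.simps)
  then show "x \<doteq> y \<Longrightarrow> slotb u v x \<doteq> slotb u v y" using slot_veq by simp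
qed

lemma slotb_fr: "path X (u @ t # v) Y \<Longrightarrow> slotb u v (fr t) = fr (b (u @ t # v))"
  by (rule lift_fr) blast

text \<open>For \<open>Bop ts\<close>, contract two blocks in succession and sum over all ways to do
  so. Grouped by the first block, each inner sum is an A-infinity relation and vanishes, except that
  the block which is all of \<open>ts\<close> leaves \<open>dd (dd (Bop ts))\<close>. Grouped by the
  relative position of the blocks, disjoint pairs cancel, and nested pairs vanish by the relation
  inside the larger block.\<close>

lemma dd_dd: "wf t \<Longrightarrow> fr (dd (dd t)) \<doteq> 0"
proof (induction t)
  case (Gen X Y d f)
  then show ?case using veq_Gen_zero[of X Y "d + 2"] b1C_b1C[of X Y f d] by (simp add: add.assoc)
next
  case (Nul X Y d)
  then show ?case by (simp add: veq_Nul)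
next
  case (Plus s t)
  have w: "wf (Plus (dd (dd s)) (dd (dd t)))"
    using Plus.prems typed_dd[OF typed_dd, of _ _ _ s] typed_dd[OF typed_dd, of _ _ _ t] by (auto simp: typed_def)
  have "fr (dd (dd (Plus s t))) \<doteq> fr (dd (dd s)) + fr (dd (dd t))" using veq_Plus[OF w] by simp
  also have "\<dots> \<doteq> 0 + 0" using Plus by (intro veq_add) auto
  finally show ?case by simp
next
  case (Scale a t)
  have "wf (dd (dd t))" using Scale.prems typed_dd[OF typed_dd, of _ _ _ t] by (auto simp: typed_def)
  then have "fr (dd (dd (Scale a t))) = scl a (fr (dd (dd t)))" by (simp add: lift_fr)
  also have "\<dots> \<doteq> scl a 0" using Scale by (intro scl_veq) auto
  finally show ?case by simp
next
  case (Hop t)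
  have t: "wf t" "in_P t" "esrc t \<in> B \<or> etgt t \<in> B" using Hop.prems by auto
  have ty: "typed (esrc t) (etgt t) (edeg t + 1) (dd t)" "in_P (dd t)" using typed_dd_P[OF t(1)] t by auto
  have wt: "wf (dd t)" using ty(1) by (simp add: typed_def)
  have ty2: "typed (esrc t) (etgt t) (edeg t + 2) (dd (dd t))" "in_P (dd (dd t))"
    using typed_dd[OF ty(1)] typed_dd_P[of "dd t"] ty(2) wt by (simp_all add: add.assoc)
  have H: "wf (Hop t)" "wf (Hop (dd t))" "wf (Hop (dd (dd t)))" "wf (dd t)" using t ty ty2 by (auto simp: typed_def)
  have XY: "esrc t \<in> aob C" "etgt t \<in> aob C" using wf_ob[OF t(1)] by auto
  have N: "typed (esrc t) (etgt t) (edeg t + 2) (Nul (esrc t) (etgt t) (edeg t + 2))"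
    "wf (Hop (Nul (esrc t) (etgt t) (edeg t + 2)))" "wf (Hop (Nul (esrc t) (etgt t) (edeg t + 2)))"
    using XY t by (auto simp: typed_def)
  have "fr (dd (dd t)) \<doteq> fr (Nul (esrc t) (etgt t) (edeg t + 2))"
    using veq_trans[OF Hop.IH[OF t(1)] veq_sym[OF veq_Nul[OF XY]]] .
  then have "eqv True (dd (dd t)) (Nul (esrc t) (etgt t) (edeg t + 2))"
    using ty2 N veq_typedD by blast
  then have "fr (Hop (dd (dd t))) \<doteq> fr (Hop (Nul (esrc t) (etgt t) (edeg t + 2)))"
    using H N by (intro eqv_veq qeq_Hop)
  \<comment> \<open>No identity says directly that H sends \<open>Nul\<close> to zero; it follows
    from additivity, as H(0) = H(0) + H(0).\<close>
  also have "\<dots> \<doteq> 0"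
  proof (rule null_of_double)
    let ?N = "Nul (esrc t) (etgt t) (edeg t + 2)"
    have "eqv True ?N (Plus ?N ?N)"
      using XY by (intro qeq_sym[OF lin_eqv] lin_identity.intros) auto
    then have "fr (Hop ?N) \<doteq> fr (Hop (Plus ?N ?N))" using N XY t by (intro eqv_veq qeq_Hop) auto
    also have "\<dots> \<doteq> fr (Hop ?N) + fr (Hop ?N)" using N by (intro veq_Hop_Plus) auto
    finally show "fr (Hop ?N) \<doteq> fr (Hop ?N) + fr (Hop ?N)" .
  qed
  finally have z: "fr (Hop (dd (dd t))) \<doteq> 0" .
  have "fr (dd (dd (Hop t))) = DD (fr (dd (Hop t)))"
    using typed_dd[of _ _ _ "Hop t"] H(1) by (subst lift_fr) (auto simp: typed_def)
  also have "\<dots> \<doteq> DD (fr t - fr (Hop (dd t)))" by (rule DD_veq[OF dd_Hop_veq[OF H(1)]])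
  also have "\<dots> = fr (dd t) - fr (dd (Hop (dd t)))" using t H by (simp add: lift_fr del: ediff.simps wf_expr.simps)
  also have "\<dots> \<doteq> fr (dd t) - (fr (dd t) - fr (Hop (dd (dd t))))"
    by (intro veq_diff veq_refl dd_Hop_veq H)
  also have "\<dots> \<doteq> 0" using z by simp
  finally show ?case .
next
  case (Bop ts)
  obtain X Y where p: "path X ts Y" and l: "2 \<le> length ts" using Bop.prems unfolding wf_Bop_iff by blast
  have ne: "ts \<noteq> []" using l by auto
  let ?F = "\<lambda>u m v u' m' v'. sgm (sdeg v) (sgm (sdeg v') (fr (b (u' @ b m' # v'))))"
  let ?T = "\<Sum>(u, m, v)\<in>splits3 ts. \<Sum>(u', m', v')\<in>splits3 (u @ b m # v). ?F u m v u' m' v'"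
  have "?T \<doteq> (\<Sum>(u, m, v)\<in>splits3 ts. if u = [] \<and> v = [] then fr (dd (dd (Bop m))) else 0)"
  proof (rule veq_sum)
    fix i assume i: "i \<in> splits3 ts"
    obtain u m v where i': "i = (u, m, v)" by (cases i)
    have "(\<Sum>(u', m', v')\<in>splits3 (u @ b m # v). ?F u m v u' m' v') \<doteq>
        (if u = [] \<and> v = [] then fr (dd (dd (Bop m))) else 0)"
    proof (cases "u = [] \<and> v = []")
      case True
      then have "m = ts" using i i' by (simp add: splits3_def)
      then show ?thesis using True l by (simp add: sum_splits3_Cons)
    next
      case False
      have "path X (u @ b m # v) Y" using path_insertion[OF p] i i' by blast
      from veq_sgm[OF ainf_relation[OF this], of "sdeg v"]
      show ?thesis using False by (auto simp: sgm_sum split_def Suc_le_eq)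
    qed
    then show "(case i of (u, m, v) \<Rightarrow> \<Sum>(u', m', v')\<in>splits3 (u @ b m # v). ?F u m v u' m' v')
      \<doteq> (case i of (u, m, v) \<Rightarrow> if u = [] \<and> v = [] then fr (dd (dd (Bop m))) else 0)" by (simp add: i')
  qed
  also have "\<dots> = fr (dd (dd (Bop ts)))" by (rule sum_splits3_full[OF ne])
  finally have 1: "?T \<doteq> fr (dd (dd (Bop ts)))" .
  have T: "?T = (\<Sum>(u, m, r, n, v)\<in>splits5 ts. ?F (u @ m @ r) n v u m (r @ b n # v) + ?F u m (r @ n @ v) (u @ b m # r) n v)
    + (\<Sum>(u, M, v)\<in>splits3 ts. \<Sum>(l, m, r)\<in>splits3 M. ?F (u @ l) m (r @ v) u (l @ b m # r) v)"
    by (rule sum_splits3_splits3[where X = b and F = ?F])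
  \<comment> \<open>Contracting \<open>n\<close> raises the degree to the right of \<open>m\<close>
    by one, so the two orders carry opposite signs.\<close>
  have "(\<Sum>(u, m, r, n, v)\<in>splits5 ts. ?F (u @ m @ r) n v u m (r @ b n # v) + ?F u m (r @ n @ v) (u @ b m # r) n v) = 0"
  proof (rule sum.neutral, rule ballI)
    fix i assume i: "i \<in> splits5 ts"
    obtain u m r n v where i': "i = (u, m, r, n, v)" by (cases i)
    have ts: "ts = u @ m @ r @ n @ v" and n: "n \<noteq> []" using i i' by (auto simp: splits5_def)
    obtain P Q where "path P n Q" using p ts by auto
    then have "edeg (b n) = sdeg n + 1" using typed_bb n by (auto simp: typed_def)
    then show "(case i of (u, m, r, n, v) \<Rightarrow> ?F (u @ m @ r) n v u m (r @ b n # v) + ?F u m (r @ n @ v) (u @ b m # r) n v) = 0"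
      by (simp add: i' sgm_def)
  qed
  moreover have "(\<Sum>(u, M, v)\<in>splits3 ts. \<Sum>(l, m, r)\<in>splits3 M. ?F (u @ l) m (r @ v) u (l @ b m # r) v) \<doteq> (\<Sum>i\<in>splits3 ts. 0)"
  proof (rule veq_sum)
    fix i assume i: "i \<in> splits3 ts"
    obtain u M v where i': "i = (u, M, v)" by (cases i)
    have ts: "ts = u @ M @ v" and M: "M \<noteq> []" using i i' by (auto simp: splits3_def)
    obtain P Q where PQ: "path X u P" "path P M Q" "path Q v Y" using p ts by auto
    \<comment> \<open>\<open>ainf_relation\<close> starts at length two. For a larger block of
      length one the sum is \<open>dd (dd t)\<close>, which the induction hypothesis covers.\<close>
    have in0: "(\<Sum>(l, m, r)\<in>splits3 M. sgm (sdeg r) (fr (b (l @ b m # r)))) \<doteq> 0"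
    proof (cases "2 \<le> length M")
      case True
      then show ?thesis by (rule ainf_relation[OF PQ(2)])
    next
      case False
      then obtain t where t: "M = [t]" using M by (cases M rule: remdups_adj.cases) auto
      then have "t \<in> set ts" "wf t" using ts PQ by auto
      then show ?thesis using Bop.IH by (simp add: t sum_splits3_Cons)
    qed
    have "(\<Sum>(l, m, r)\<in>splits3 M. ?F (u @ l) m (r @ v) u (l @ b m # r) v)
      = slotb u v (\<Sum>(l, m, r)\<in>splits3 M. sgm (sdeg r) (fr (b (l @ b m # r))))"
      unfolding lift_sum
    proof (rule sum.cong[OF refl])
      fix j assume j: "j \<in> splits3 M"
      obtain l m r where j': "j = (l, m, r)" by (cases j)
      have "path P (l @ b m # r) Q" using path_insertion[OF PQ(2)] j j' by blast
      then have "path X (u @ b (l @ b m # r) # v) Y" using PQ typed_bb[of P "l @ b m # r" Q] by (auto simp: typed_def)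
      note sb = slotb_fr[OF this]
      show "(case j of (l, m, r) \<Rightarrow> ?F (u @ l) m (r @ v) u (l @ b m # r) v)
        = slotb u v (case j of (l, m, r) \<Rightarrow> sgm (sdeg r) (fr (b (l @ b m # r))))"
        unfolding j' prod.case lift_simps(5) sb sgm_simps(6) by (rule sgm_parity) simp
    qed
    also have "\<dots> \<doteq> slotb u v 0" by (rule slotb_veq[OF in0])
    finally show "(case i of (u, M, v) \<Rightarrow> \<Sum>(l, m, r)\<in>splits3 M. ?F (u @ l) m (r @ v) u (l @ b m # r) v) \<doteq> 0"
      by (simp add: i')
  qed
  ultimately have "?T \<doteq> 0" unfolding T by simp
  from veq_trans[OF veq_sym[OF 1] this] show ?case .
qed

section \<open>The quotient A-infinity category\<close>

abbreviation "E \<equiv> free_ainf R C B"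
abbreviation "D \<equiv> quotient_ainf (free_ainf R C B) (R_plus R C B)"

lemma typed_ob: "typed X Y d t \<Longrightarrow> X \<in> aob C \<and> Y \<in> aob C"
  using wf_ob by (auto simp: typed_def)

lemma typed_Nul: "X \<in> aob C \<Longrightarrow> Y \<in> aob C \<Longrightarrow> typed X Y d (Nul X Y d)"
  by (simp add: typed_def)

lemma veq_iff: "typed X Y d s \<Longrightarrow> typed X Y d t \<Longrightarrow> fr s \<doteq> fr t \<longleftrightarrow> eqv True s t"
  using veq_typedD eqv_veq by blast

lemma eqv_Nul_iff: "typed X Y d t \<Longrightarrow> eqv True t (Nul X Y d) \<longleftrightarrow> fr t \<doteq> 0"
  using veq_iff[of X Y d t "Nul X Y d"] veq_Nul[of X Y d] typed_ob[of X Y d t] typed_Nul[of X Y d]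
    veq_trans veq_sym by metis

lemma veq_Hop_null:
  assumes "wf (Hop t)" "fr t \<doteq> 0"
  shows "fr (Hop t) \<doteq> 0"
proof -
  let ?N = "Nul (esrc t) (etgt t) (edeg t)"
  have t: "wf t" "esrc t \<in> B \<or> etgt t \<in> B" using assms by auto
  have XY: "esrc t \<in> aob C" "etgt t \<in> aob C" using wf_ob[OF t(1)] by auto
  have N: "wf (Hop ?N)" using XY t by auto
  have "eqv True t ?N" using assms t eqv_Nul_iff[of "esrc t" "etgt t" "edeg t" t] by (simp add: typed_def)
  then have "fr (Hop t) \<doteq> fr (Hop ?N)" using assms N by (intro eqv_veq qeq_Hop)
  also have "\<dots> \<doteq> 0"
  proof (rule null_of_double)
    have "eqv True ?N (Plus ?N ?N)"
      using XY by (intro qeq_sym[OF lin_eqv] lin_identity.intros) auto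
    then have "fr (Hop ?N) \<doteq> fr (Hop (Plus ?N ?N))" using N XY t by (intro eqv_veq qeq_Hop) auto
    also have "\<dots> \<doteq> fr (Hop ?N) + fr (Hop ?N)" using N by (intro veq_Hop_Plus) auto
    finally show "fr (Hop ?N) \<doteq> fr (Hop ?N) + fr (Hop ?N)" .
  qed
  finally show ?thesis .
qed

lemma eqv_Bop_list:
  "list_all2 (eqv q) ts ts' \<Longrightarrow> path X (us @ ts @ vs) Y \<Longrightarrow> 2 \<le> length (us @ ts @ vs)
    \<Longrightarrow> path X (us @ ts' @ vs) Y \<and> eqv q (Bop (us @ ts @ vs)) (Bop (us @ ts' @ vs))"
proof (induction arbitrary: us rule: list_all2_induct)
  case Nil
  then show ?case using wf_BopI[of X "us @ vs" Y] by (auto intro: qeq_refl simp del: wf_expr.simps)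
next
  case (Cons t ts t' ts')
  have p: "path X (us @ t' # ts @ vs) Y" using Cons.prems(1) eqv_typed[OF Cons.hyps(1)] by auto
  have 1: "eqv q (Bop (us @ t # ts @ vs)) (Bop (us @ t' # ts @ vs))"
    using wf_BopI[OF Cons.prems] by (intro qeq_Bop Cons.hyps) simp
  have "path X ((us @ [t']) @ ts' @ vs) Y \<and> eqv q (Bop ((us @ [t']) @ ts @ vs)) (Bop ((us @ [t']) @ ts' @ vs))"
    using p Cons.prems by (intro Cons.IH) auto
  then show ?case using qeq_trans[OF 1] by auto
qed

lemma list_all2_Bop:
  assumes "list_all2 (eqv q) ts ts'" "path X ts Y" "2 \<le> length ts"
  shows "path X ts' Y" "eqv q (Bop ts) (Bop ts')"
  using eqv_Bop_list[OF assms(1), of X "[]" "[]" Y] assms by auto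

lemma bop_E:
  assumes "2 \<le> length ys"
  shows "bop E ys = ecl False (Bop (map (\<lambda>y. rep (aval y)) ys))"
  using assms by (cases ys rule: remdups_adj.cases) (auto simp: free_ainf_def ecls_ecl)

lemma aob_E [simp]: "aob E = aob C"
  by (simp add: free_ainf_def)

definition earr :: "('k, 'o, 'm) expr \<Rightarrow> ('o, ('k, 'o, 'm) expr set) arr" where
  "earr t = Arr (esrc t) (etgt t) (edeg t) (ecl False t)"

lemma bop_E_earr:
  assumes p: "path X ts Y" and l: "2 \<le> length ts"
  shows "bop E (map earr ts) = ecl False (Bop ts)"
proof -
  have ne: "ts \<noteq> []" using l by auto
  have "list_all2 (eqv False) ts (map (\<lambda>t. rep (ecl False t)) ts)"
    using p ne by (auto simp: list_all2_map2 list_all2_same path_iff intro!: eqv_rep)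
  from list_all2_Bop(2)[OF this p l] have "ecl False (Bop ts) = ecl False (Bop (map (\<lambda>t. rep (ecl False t)) ts))"
    using ecl_eq_iff[OF wf_BopI[OF p l]] by simp
  then show ?thesis using l by (simp add: bop_E earr_def o_def)
qed

lemma composable_earr:
  assumes "path X ts Y" "ts \<noteq> []"
  shows "composable E (map earr ts)"
proof -
  have "\<forall>t\<in>set ts. wf t \<and> esrc t \<in> aob C \<and> etgt t \<in> aob C"
    using assms wf_ob by (auto simp: path_iff)
  moreover have "successively (\<lambda>x y. etgt x = esrc y) ts" using assms by (simp add: path_iff)
  ultimately show ?thesis
    using assms(2) by (auto simp: composable_def successively_map earr_def shom_free_ainf emod_simps typed_def)
qed

lemma bends_earr: "path X ts Y \<Longrightarrow> ts \<noteq> [] \<Longrightarrow>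
    bsrc (map earr ts) = X \<and> btgt (map earr ts) = Y \<and> bdeg (map earr ts) = sdeg ts + 1"
  by (auto simp: path_iff bsrc_def btgt_def bdeg_def hd_map last_map earr_def o_def)

lemma map_gen_arr: "map (gen_arr R C B) xs = map earr (map genx xs)"
  by (simp add: gen_arr_def earr_def genx_def ecls_ecl)

text \<open>\<open>H_op\<close> picks some member of the class that satisfies \<open>in_P\<close>.
  Any two such members are congruent, and \<open>qeq_Hop\<close> applies to them.\<close>

lemma H_op_ecl:
  assumes "wf (Hop t)"
  shows "H_op R C B (ecl False t) = ecl False (Hop t)"
proof -
  let ?u = "rep {u \<in> ecl False t. in_P u}"
  have "t \<in> {u \<in> ecl False t. in_P u}" using assms by (auto simp: ecl_def intro: qeq_refl)
  then have "?u \<in> {u \<in> ecl False t. in_P u}" unfolding rep_def by (rule someI)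
  then have u: "eqv False t ?u" "in_P ?u" by (auto simp: ecl_def)
  then have "eqv False (Hop t) (Hop ?u)" using assms eqv_typed[OF u(1)] by (intro qeq_Hop) auto
  then have "ecl False (Hop t) = ecl False (Hop ?u)" using ecl_eq_iff[OF assms] by blast
  then show ?thesis by (simp add: H_op_def ecls_ecl)
qed

lemma eqv_False_veq: "eqv False s t \<Longrightarrow> fr s \<doteq> fr t"
  by (rule eqv_veq[OF qeq_mono])

lemma ecl_False_veq: "ecl False s = ecl False t \<Longrightarrow> wf s \<Longrightarrow> fr s \<doteq> fr t"
  using ecl_eq_iff eqv_False_veq by blast

lemma veq_Plus_neg: "typed X Y d s \<Longrightarrow> typed X Y d t \<Longrightarrow> fr (Plus s (Scale (\<ominus>\<^bsub>R\<^esub> \<one>\<^bsub>R\<^esub>) t)) \<doteq> fr s - fr t"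
proof -
  assume st: "typed X Y d s" "typed X Y d t"
  then have "fr (Plus s (Scale (\<ominus>\<^bsub>R\<^esub> \<one>\<^bsub>R\<^esub>) t)) \<doteq> fr s + fr (Scale (\<ominus>\<^bsub>R\<^esub> \<one>\<^bsub>R\<^esub>) t)"
    using minus_one_closed by (intro veq_Plus) (auto simp: typed_def)
  also have "\<dots> \<doteq> fr s + - fr t" using st by (intro veq_add veq_refl veq_Scale_minus) (auto simp: typed_def)
  finally show ?thesis by simp
qed

text \<open>One half of the comparison of (R_C)_+ with the congruence: being represented by an
  expression that is zero modulo \<open>null\<close> holds for the generators and survives each
  closure rule. \<open>R_plus_eqv\<close> is the other half.\<close>

lemma in_R_plus_imp:
  "in_R_plus R C B X Y d K \<Longrightarrow> \<exists>t. typed X Y d t \<and> K = ecl False t \<and> fr t \<doteq> 0"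
proof (induction rule: in_R_plus.induct)
  case (1 X Y d)
  then show ?case using typed_Nul veq_Nul unfolding shom_free_ainf emod_simps(2) by blast
next
  case (2 X Y d K L)
  then obtain s t where st: "typed X Y d s" "K = ecl False s" "fr s \<doteq> 0" "typed X Y d t" "L = ecl False t" "fr t \<doteq> 0"
    by blast
  have "fr (Plus s t) \<doteq> fr s + fr t" using st by (intro veq_Plus) (auto simp: typed_def)
  also have "\<dots> \<doteq> 0 + 0" by (intro veq_add st)
  finally have "fr (Plus s t) \<doteq> 0" by simp
  moreover have "typed X Y d (Plus s t)" using st by (intro typed_Plus)
  ultimately show ?case using st by (auto simp: shom_free_ainf emod_simps)
next
  case (3 a X Y d K)
  then obtain t where t: "typed X Y d t" "K = ecl False t" "fr t \<doteq> 0" by blast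
  have "fr (Scale a t) = scl a (fr t)" using t by (simp add: lift_fr typed_def)
  also have "\<dots> \<doteq> scl a 0" by (intro scl_veq t 3)
  finally have "fr (Scale a t) \<doteq> 0" by simp
  moreover have "typed X Y d (Scale a t)" using t 3 by (intro typed_Scale)
  ultimately show ?case using t 3 by (auto simp: shom_free_ainf emod_simps)
next
  case (4 xs)
  let ?s = "Bop (map genx xs) :: ('k, 'o, 'm) expr"
  let ?t = "genx (barr C xs) :: ('k, 'o, 'm) expr"
  have ne: "xs \<noteq> []" using 4 by auto
  have p: "path (bsrc xs) (map genx xs) (btgt xs)" using 4 composable_path by blast
  have s: "typed (bsrc xs) (btgt xs) (bdeg xs) ?s"
    using wf_Bop_genx[OF 4] by (simp add: typed_def del: esrc.simps etgt.simps edeg.simps wf_expr.simps)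
  have t: "typed (bsrc xs) (btgt xs) (bdeg xs) ?t" using wf_barr[OF 4(1)] by (simp add: typed_def)
  have XY: "bsrc xs \<in> aob C" "btgt xs \<in> aob C" using typed_ob[OF t] by auto
  interpret M: module R "emod False (bsrc xs) (btgt xs) (bdeg xs)" using XY by (rule module_emod)
  have 1: "bop E (map (gen_arr R C B) xs) = ecl False ?s"
    unfolding map_gen_arr using bop_E_earr[OF p] 4 by simp
  have 2: "aval (gen_arr R C B (Arr (bsrc xs) (btgt xs) (bdeg xs) (bop C xs))) = ecl False ?t"
    by (simp add: gen_arr_def ecls_ecl genx_def)
  let ?n = "Scale (\<ominus>\<^bsub>R\<^esub> \<one>\<^bsub>R\<^esub>) ?t"
  have tn: "typed (bsrc xs) (btgt xs) (bdeg xs) ?n" using t minus_one_closed by (rule typed_Scale[rotated])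
  have "fr (Plus ?s ?n) \<doteq> fr ?s - fr ?t" using s t by (rule veq_Plus_neg)
  also have "\<dots> \<doteq> 0"
    using eqv_veq[OF qeq_gen[OF TrueI 4, where R = R and B = B]] wf_barr[OF 4(1)] by (simp add: veq_def)
  finally have "fr (Plus ?s ?n) \<doteq> 0" .
  then show ?case
    unfolding 1 2 a_minus_def shom_free_ainf module_emod(2)[OF XY t] emod_simps(3)[OF s tn]
    using typed_Plus[OF s tn] by blast
next
  case (5 ys y)
  let ?r = "\<lambda>y. rep (aval y)"
  have ne: "ys \<noteq> []" using 5 by auto
  \<comment> \<open>The operations of the free category work with chosen expressions; these have the
    same type as the classes they represent, so the chosen list is again a path.\<close>
  have ty: "typed (asrc z) (atgt z) (adeg z) (?r z) \<and> ecl False (?r z) = aval z" if "z \<in> set ys" for z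
  proof -
    have "aval z \<in> carrier (emod False (asrc z) (atgt z) (adeg z))"
      using 5(1) that by (auto simp: composable_def shom_free_ainf)
    then obtain t where t: "aval z = ecl False t" "typed (asrc z) (atgt z) (adeg z) t" by (auto simp: emod_simps)
    then have "eqv False t (?r z)" using eqv_rep by (simp add: typed_def)
    then show ?thesis using t eqv_typedD ecl_eq_iff[of t False "?r z"] by (auto simp: typed_def)
  qed
  have m: "map (\<lambda>y. asrc y) ys = map esrc (map ?r ys)" "map atgt ys = map etgt (map ?r ys)"
    "map adeg ys = map edeg (map ?r ys)"
    using ty by (auto simp: typed_def)
  have "successively (\<lambda>s t. etgt s = esrc t) (map ?r ys) = successively (\<lambda>x y. atgt x = asrc y) ys"
    unfolding successively_map by (rule successively_cong) (use ty in \<open>auto simp: typed_def\<close>)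
  moreover have "bsrc ys = hd (map esrc (map ?r ys))" "btgt ys = last (map etgt (map ?r ys))"
    unfolding m[symmetric] using ne by (simp_all add: bsrc_def btgt_def hd_map last_map)
  ultimately have p: "path (bsrc ys) (map ?r ys) (btgt ys)"
    using 5(1) ty ne by (auto simp: path_iff composable_def typed_def)
  have dg: "bdeg ys = sdeg (map ?r ys) + 1" unfolding bdeg_def m ..
  have T: "typed (bsrc ys) (btgt ys) (bdeg ys) (Bop (map ?r ys))"
    unfolding dg using 5(2) by (intro typed_Bop[OF p]) simp
  obtain t where t: "typed (asrc y) (atgt y) (adeg y) t" "aval y = ecl False t" "fr t \<doteq> 0" using 5 by blast
  have "fr (?r y) \<doteq> fr t" by (rule ecl_False_veq) (use ty[OF 5(3)] t in \<open>auto simp: typed_def\<close>)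
  then have r0: "fr (?r y) \<doteq> 0" using t(3) veq_trans by blast
  obtain us vs where ys: "ys = us @ y # vs" using split_list[OF 5(3)] by blast
  have "fr (Bop (map ?r ys)) = slot (map ?r us) (map ?r vs) (fr (?r y))"
    using T by (simp add: ys lift_fr typed_def)
  also have "\<dots> \<doteq> slot (map ?r us) (map ?r vs) 0" by (rule slot_veq[OF r0])
  finally show ?case using T bop_E[OF 5(2)] by auto
next
  case (6 X Y d K)
  obtain t where t: "typed X Y d t" "K = ecl False t" "fr t \<doteq> 0" using 6 by blast
  obtain u where u: "K = ecl False u" "typed X Y d u" "in_P u" using 6(2) by (auto simp: P_part_def typed_def ecls_ecl)
  have "fr u \<doteq> fr t" by (rule ecl_False_veq) (use t u in \<open>auto simp: typed_def\<close>)
  then have u0: "fr u \<doteq> 0" using t(3) veq_trans by blast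
  have w: "wf (Hop u)" using u 6(3) by (auto simp: typed_def)
  have "typed X Y (d - 1) (Hop u)" using u 6(3) by (auto simp: typed_def)
  then show ?case using veq_Hop_null[OF w u0] H_op_ecl[OF w] u(1) by auto
qed

lemma R_plus_subgroup:
  assumes "X \<in> aob C" "Y \<in> aob C"
  shows "abelian_subgroup (R_plus R C B X Y d) (emod False X Y d)"
proof -
  interpret M: module R "emod False X Y d" using assms by (rule module_emod)
  have sub: "R_plus R C B X Y d \<subseteq> carrier (emod False X Y d)"
    using in_R_plus_imp unfolding R_plus_def emod_simps by blast
  have "subgroup (R_plus R C B X Y d) (add_monoid (emod False X Y d))"
  proof (rule group.subgroupI[OF M.a_group])
    show "R_plus R C B X Y d \<subseteq> carrier (add_monoid (emod False X Y d))" using sub by simp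
    show "R_plus R C B X Y d \<noteq> {}" using in_R_plus.intros(1)[OF assms] by (auto simp: R_plus_def)
  next
    fix K assume K: "K \<in> R_plus R C B X Y d"
    then have "(\<ominus>\<^bsub>R\<^esub> \<one>\<^bsub>R\<^esub>) \<odot>\<^bsub>emod False X Y d\<^esub> K \<in> R_plus R C B X Y d"
      using in_R_plus.intros(3)[OF minus_one_closed, of C B X Y d K] by (simp add: R_plus_def shom_free_ainf)
    then show "inv\<^bsub>add_monoid (emod False X Y d)\<^esub> K \<in> R_plus R C B X Y d"
      using K sub M.smult_l_minus[of "\<one>\<^bsub>R\<^esub>" K] by (auto simp: a_inv_def)
  next
    fix K L assume "K \<in> R_plus R C B X Y d" "L \<in> R_plus R C B X Y d"
    then show "K \<otimes>\<^bsub>add_monoid (emod False X Y d)\<^esub> L \<in> R_plus R C B X Y d"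
      using in_R_plus.intros(2)[of R C B X Y d K L] by (simp add: R_plus_def shom_free_ainf)
  qed
  then show ?thesis by (intro abelian_subgroupI2 M.a_comm_group)
qed

text \<open>The rules of \<open>qeq\<close> match closure properties of (R_C)_+:
  \<open>qeq_gen\<close> its generators, \<open>qeq_Bop\<close> and \<open>qeq_Hop\<close> its
  closure under b_n and H, symmetry and transitivity the laws of a subgroup. The rules
  \<open>qeq_lin\<close> and \<open>qeq_refl\<close> give a difference that is zero already in the
  free category.\<close>

lemma R_plus_eqv:
  "eqv True s t \<Longrightarrow> in_R_plus R C B (esrc s) (etgt s) (edeg s) (ecl False (Plus s (Scale (\<ominus>\<^bsub>R\<^esub> \<one>\<^bsub>R\<^esub>) t)))"
proof (induction rule: qeq.induct)
  have zero: "in_R_plus R C B (esrc s) (etgt s) (edeg s) (ecl False (Plus s (Scale (\<ominus>\<^bsub>R\<^esub> \<one>\<^bsub>R\<^esub>) t)))"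
    if "eqv False s t" for s t
  proof -
    let ?X = "esrc s" and ?Y = "etgt s" and ?d = "edeg s"
    have s: "typed ?X ?Y ?d s" and t: "typed ?X ?Y ?d t" using eqv_typed[OF that] by (auto simp: typed_def)
    have XY: "?X \<in> aob C" "?Y \<in> aob C" using typed_ob[OF s] by auto
    interpret M: module R "emod False ?X ?Y ?d" using XY by (rule module_emod)
    have "ecl False (Plus s (Scale (\<ominus>\<^bsub>R\<^esub> \<one>\<^bsub>R\<^esub>) t))
        = ecl False s \<oplus>\<^bsub>emod False ?X ?Y ?d\<^esub> (\<ominus>\<^bsub>emod False ?X ?Y ?d\<^esub> ecl False t)"
      using s t module_emod(2)[OF XY t] emod_simps(3)[OF s typed_Scale[OF minus_one_closed t]] by simp
    also have "ecl False t = ecl False s" using that ecl_eq_iff s by (auto simp: typed_def)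
    also have "ecl False s \<oplus>\<^bsub>emod False ?X ?Y ?d\<^esub> (\<ominus>\<^bsub>emod False ?X ?Y ?d\<^esub> ecl False s) = \<zero>\<^bsub>emod False ?X ?Y ?d\<^esub>"
      using s by (intro M.r_neg) (auto simp: emod_simps)
    finally show ?thesis using in_R_plus.intros(1)[OF XY, where d = ?d and R = R and B = B] by (simp add: shom_free_ainf)
  qed
  have minus: "ecl False (Plus s (Scale (\<ominus>\<^bsub>R\<^esub> \<one>\<^bsub>R\<^esub>) t)) = ecl False s \<ominus>\<^bsub>emod False X Y d\<^esub> ecl False t"
    if "typed X Y d s" "typed X Y d t" for X Y d s t
    using that typed_ob module_emod(2)[of X Y d t] emod_simps(3)[OF that(1) typed_Scale[OF minus_one_closed that(2)]]
    by (simp add: a_minus_def)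
  have mem: "ecl False t \<in> carrier (emod False X Y d)" if "typed X Y d t" for X Y d t
    using that by (auto simp: emod_simps)
  {
    case (qeq_lin s t)
    then show ?case by (intro zero qeq.qeq_lin)
  next
    case (qeq_gen xs)
    let ?s = "Bop (map genx xs) :: ('k, 'o, 'm) expr"
    let ?t = "genx (barr C xs) :: ('k, 'o, 'm) expr"
    have p: "path (bsrc xs) (map genx xs) (btgt xs)" using qeq_gen composable_path by blast
    have s: "typed (bsrc xs) (btgt xs) (bdeg xs) ?s"
      using wf_Bop_genx[OF qeq_gen(2,3)] by (simp add: typed_def del: esrc.simps etgt.simps edeg.simps wf_expr.simps)
    have t: "typed (bsrc xs) (btgt xs) (bdeg xs) ?t" using qeq_gen by (simp add: typed_def)
    have 1: "bop E (map (gen_arr R C B) xs) = ecl False ?s"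
      unfolding map_gen_arr using bop_E_earr[OF p] qeq_gen by simp
    have 2: "aval (gen_arr R C B (Arr (bsrc xs) (btgt xs) (bdeg xs) (bop C xs))) = ecl False ?t"
      by (simp add: gen_arr_def ecls_ecl genx_def)
    have st: "esrc ?s = bsrc xs" "etgt ?s = btgt xs" "edeg ?s = bdeg xs" using s by (auto simp: typed_def)
    show ?case
      unfolding st minus[OF s t] using in_R_plus.intros(4)[OF qeq_gen(2,3), where R = R and B = B]
      unfolding 1 2 shom_free_ainf .
  next
    case (qeq_refl t)
    then show ?case by (intro zero qeq.qeq_refl)
  next
    case (qeq_sym s t)
    note e = eqv_typed[OF qeq_sym(1)]
    let ?X = "esrc s" and ?Y = "etgt s" and ?d = "edeg s"
    have s: "typed ?X ?Y ?d s" and t: "typed ?X ?Y ?d t" using e by (auto simp: typed_def)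
    have XY: "?X \<in> aob C" "?Y \<in> aob C" using typed_ob[OF s] by auto
    interpret M: module R "emod False ?X ?Y ?d" using XY by (rule module_emod)
    interpret S: abelian_subgroup "R_plus R C B ?X ?Y ?d" "emod False ?X ?Y ?d" using XY by (rule R_plus_subgroup)
    have "ecl False s \<ominus>\<^bsub>emod False ?X ?Y ?d\<^esub> ecl False t \<in> R_plus R C B ?X ?Y ?d"
      using qeq_sym(2) minus[OF s t] by (simp add: R_plus_def)
    from S.a_inv_closed[OF this]
    have "ecl False t \<ominus>\<^bsub>emod False ?X ?Y ?d\<^esub> ecl False s \<in> R_plus R C B ?X ?Y ?d"
      using mem[OF s] mem[OF t] by (simp add: a_minus_def M.minus_add M.a_comm)
    then show ?case using minus[OF t s] e by (simp add: R_plus_def)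
  next
    case (qeq_trans r s t)
    note e = eqv_typed[OF qeq_trans(1)] eqv_typed[OF qeq_trans(2)]
    let ?X = "esrc r" and ?Y = "etgt r" and ?d = "edeg r"
    have r: "typed ?X ?Y ?d r" and s: "typed ?X ?Y ?d s" and t: "typed ?X ?Y ?d t" using e by (auto simp: typed_def)
    have XY: "?X \<in> aob C" "?Y \<in> aob C" using typed_ob[OF s] by auto
    interpret M: module R "emod False ?X ?Y ?d" using XY by (rule module_emod)
    interpret S: abelian_subgroup "R_plus R C B ?X ?Y ?d" "emod False ?X ?Y ?d" using XY by (rule R_plus_subgroup)
    have "ecl False r \<ominus>\<^bsub>emod False ?X ?Y ?d\<^esub> ecl False s \<in> R_plus R C B ?X ?Y ?d"
      "ecl False s \<ominus>\<^bsub>emod False ?X ?Y ?d\<^esub> ecl False t \<in> R_plus R C B ?X ?Y ?d"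
      using qeq_trans(3,4) minus[OF r s] minus[OF s t] e by (simp_all add: R_plus_def)
    from S.a_closed[OF this]
    have "ecl False r \<ominus>\<^bsub>emod False ?X ?Y ?d\<^esub> ecl False t \<in> R_plus R C B ?X ?Y ?d"
      using mem[OF r] mem[OF s] mem[OF t] by (simp add: a_minus_def M.a_assoc M.r_neg1)
    then show ?case using minus[OF r t] by (simp add: R_plus_def)
  next
    case (qeq_Plus s s' t t')
    note e = eqv_typed[OF qeq_Plus(1)] eqv_typed[OF qeq_Plus(2)]
    let ?X = "esrc s" and ?Y = "etgt s" and ?d = "edeg s"
    have s: "typed ?X ?Y ?d s" and t: "typed ?X ?Y ?d t" and s': "typed ?X ?Y ?d s'" and t': "typed ?X ?Y ?d t'"
      using e qeq_Plus(3) by (auto simp: typed_def)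
    have XY: "?X \<in> aob C" "?Y \<in> aob C" using typed_ob[OF s] by auto
    interpret M: module R "emod False ?X ?Y ?d" using XY by (rule module_emod)
    interpret S: abelian_subgroup "R_plus R C B ?X ?Y ?d" "emod False ?X ?Y ?d" using XY by (rule R_plus_subgroup)
    have "ecl False s \<ominus>\<^bsub>emod False ?X ?Y ?d\<^esub> ecl False s' \<in> R_plus R C B ?X ?Y ?d"
      "ecl False t \<ominus>\<^bsub>emod False ?X ?Y ?d\<^esub> ecl False t' \<in> R_plus R C B ?X ?Y ?d"
      using qeq_Plus(3,4,5) minus[OF s s'] minus[OF t t'] by (simp_all add: R_plus_def)
    from S.a_closed[OF this]
    have "ecl False (Plus s t) \<ominus>\<^bsub>emod False ?X ?Y ?d\<^esub> ecl False (Plus s' t') \<in> R_plus R C B ?X ?Y ?d"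
      using mem[OF s] mem[OF s'] mem[OF t] mem[OF t']
      unfolding emod_simps(3)[OF s t, symmetric] emod_simps(3)[OF s' t', symmetric]
      by (simp add: a_minus_def M.minus_add M.a_ac)
    then show ?case using minus[OF typed_Plus[OF s t] typed_Plus[OF s' t']] by (simp add: R_plus_def)
  next
    case (qeq_Scale a t t')
    note e = eqv_typed[OF qeq_Scale(2)]
    let ?X = "esrc t" and ?Y = "etgt t" and ?d = "edeg t"
    have t: "typed ?X ?Y ?d t" and t': "typed ?X ?Y ?d t'"
      using e by (auto simp: typed_def)
    have XY: "?X \<in> aob C" "?Y \<in> aob C" using typed_ob[OF t] by auto
    interpret M: module R "emod False ?X ?Y ?d" using XY by (rule module_emod)
    have "in_R_plus R C B ?X ?Y ?d (ecl False t \<ominus>\<^bsub>emod False ?X ?Y ?d\<^esub> ecl False t')"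
      using qeq_Scale(3) minus[OF t t'] by simp
    from in_R_plus.intros(3)[OF qeq_Scale(1) this]
    have "in_R_plus R C B ?X ?Y ?d (ecl False (Scale a t) \<ominus>\<^bsub>emod False ?X ?Y ?d\<^esub> ecl False (Scale a t'))"
      using mem[OF t] mem[OF t'] qeq_Scale(1)
      unfolding emod_simps(4)[OF qeq_Scale(1) t, symmetric] emod_simps(4)[OF qeq_Scale(1) t', symmetric]
      by (simp add: shom_free_ainf a_minus_def M.smult_r_distr M.smult_r_minus)
    then show ?case using minus[OF typed_Scale[OF qeq_Scale(1) t] typed_Scale[OF qeq_Scale(1) t']] by simp
  next
    case (qeq_Bop t t' us vs)
    note e = eqv_typed[OF qeq_Bop(1)]
    let ?c = "\<ominus>\<^bsub>R\<^esub> \<one>\<^bsub>R\<^esub>"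
    let ?n = "Scale ?c t'"
    let ?p = "Plus t ?n"
    obtain X Y where p: "path X (us @ t # vs) Y" and l: "2 \<le> length (us @ t # vs)"
      using qeq_Bop(2) unfolding wf_Bop_iff by blast
    have p': "path X (us @ t' # vs) Y" "path X (us @ ?n # vs) Y" "path X (us @ ?p # vs) Y"
      using p e minus_one_closed by auto
    let ?d = "sdeg us + edeg t + sdeg vs + 1"
    have T: "typed X Y ?d (Bop (us @ t # vs))" "typed X Y ?d (Bop (us @ t' # vs))"
      "typed X Y ?d (Bop (us @ ?n # vs))" "typed X Y ?d (Bop (us @ ?p # vs))"
      using typed_Bop[OF p l] typed_Bop[OF p'(1)] typed_Bop[OF p'(2)] typed_Bop[OF p'(3)] l e
      by (simp_all add: add.assoc)
    have ends: "esrc (Bop (us @ t # vs)) = X" "etgt (Bop (us @ t # vs)) = Y" "edeg (Bop (us @ t # vs)) = ?d"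
      using T(1) by (auto simp: typed_def)
    \<comment> \<open>Closure under b_n speaks of an argument in (R_C)_+, so the difference of two
      values of b_n is rewritten as its value at the difference of the arguments.\<close>
    have mult: "ecl False (Bop (us @ ?p # vs)) = ecl False (Plus (Bop (us @ t # vs)) (Scale ?c (Bop (us @ t' # vs))))"
    proof -
      have e1: "eqv False (Bop (us @ ?p # vs)) (Plus (Bop (us @ t # vs)) (Bop (us @ ?n # vs)))"
        using T(4) typed_Plus[OF T(1,3)] by (intro qeq.qeq_lin lin_identity.intros) (auto simp: typed_def)
      have e2: "eqv False (Bop (us @ ?n # vs)) (Scale ?c (Bop (us @ t' # vs)))"
        using T(3) typed_Scale[OF minus_one_closed T(2)] by (intro qeq.qeq_lin lin_identity.intros) (auto simp: typed_def)
      have w: "wf (Bop (us @ t # vs))" "wf (Plus (Bop (us @ t # vs)) (Bop (us @ ?n # vs)))" "wf (Bop (us @ ?p # vs))"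
        using T(1,4) typed_Plus[OF T(1,3)] by (simp_all only: typed_def)
      show ?thesis
        using qeq.qeq_trans[OF e1 qeq.qeq_Plus[OF qeq.qeq_refl[OF w(1)] e2 w(2)]] ecl_eq_iff[OF w(3)] by blast
    qed
    have l': "2 \<le> length (us @ ?p # vs)" using l by simp
    have ne: "us @ ?p # vs \<noteq> []" by simp
    have "in_R_plus R C B (bsrc (map earr (us @ ?p # vs))) (btgt (map earr (us @ ?p # vs)))
        (bdeg (map earr (us @ ?p # vs))) (bop E (map earr (us @ ?p # vs)))"
    proof (rule in_R_plus.intros(5)[where y = "earr ?p"])
      show "composable E (map earr (us @ ?p # vs))" by (rule composable_earr[OF p'(3) ne])
      show "in_R_plus R C B (asrc (earr ?p)) (atgt (earr ?p)) (adeg (earr ?p)) (aval (earr ?p))"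
        using qeq_Bop(3) by (simp add: earr_def)
    qed (use l in auto)
    moreover have "sdeg (us @ ?p # vs) + 1 = ?d" by simp
    ultimately show ?case
      unfolding bop_E_earr[OF p'(3) l'] mult ends using bends_earr[OF p'(3) ne] by (simp add: add.assoc)
  next
    case (qeq_Hop t t')
    note e = eqv_typed[OF qeq_Hop(1)]
    let ?c = "\<ominus>\<^bsub>R\<^esub> \<one>\<^bsub>R\<^esub>"
    let ?n = "Scale ?c t'"
    let ?p = "Plus t ?n"
    let ?X = "esrc t" and ?Y = "etgt t" and ?d = "edeg t"
    have w: "wf ?p" "wf (Hop ?p)" "wf (Hop ?n)" "in_P ?p" and B: "?X \<in> B \<or> ?Y \<in> B"
      using e qeq_Hop(2,3) minus_one_closed by auto
    have "in_R_plus R C B ?X ?Y (?d - 1) (H_op R C B (ecl False ?p))"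
      by (rule in_R_plus.intros(6)[OF qeq_Hop(4) _ B]) (use w in \<open>auto simp: P_part_def ecls_ecl\<close>)
    moreover have "ecl False (Hop ?p) = ecl False (Plus (Hop t) (Scale ?c (Hop t')))"
    proof -
      have w': "wf (Plus (Hop t) (Hop ?n))" "wf (Plus (Hop t) (Scale ?c (Hop t')))" "wf (Scale ?c (Hop t'))"
        using e w qeq_Hop(2,3) by auto
      have e1: "eqv False (Hop ?p) (Plus (Hop t) (Hop ?n))"
        using w w' by (intro qeq.qeq_lin lin_identity.intros)
      have e2: "eqv False (Hop ?n) (Scale ?c (Hop t'))"
        using w w' by (intro qeq.qeq_lin lin_identity.intros)
      show ?thesis
        using qeq.qeq_trans[OF e1 qeq.qeq_Plus[OF qeq.qeq_refl[OF qeq_Hop(2)] e2 w'(1)]] ecl_eq_iff[OF w(2)] by blast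
    qed
    ultimately show ?case using H_op_ecl[OF w(2)] by simp
  }
qed

section \<open>Cosets represented by expressions, and the operations on them\<close>

definition dcl :: "'o \<Rightarrow> 'o \<Rightarrow> int \<Rightarrow> ('k, 'o, 'm) expr \<Rightarrow> ('k, 'o, 'm) expr set set" where
  "dcl X Y d t = R_plus R C B X Y d +>\<^bsub>emod False X Y d\<^esub> ecl False t"

text \<open>Here the two halves meet: membership in a coset of (R_C)_+ becomes a congruence between
  expressions. From now on the quotient is handled through \<doteq>.\<close>

lemma ecl_in_dcl_iff:
  assumes s: "typed X Y d s" and t: "typed X Y d t"
  shows "ecl False s \<in> dcl X Y d t \<longleftrightarrow> fr s \<doteq> fr t"
proof -
  have XY: "X \<in> aob C" "Y \<in> aob C" using typed_ob[OF s] by auto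
  interpret M: module R "emod False X Y d" using XY by (rule module_emod)
  interpret S: abelian_subgroup "R_plus R C B X Y d" "emod False X Y d" using XY by (rule R_plus_subgroup)
  let ?p = "Plus s (Scale (\<ominus>\<^bsub>R\<^esub> \<one>\<^bsub>R\<^esub>) t)"
  have p: "typed X Y d ?p" using typed_Plus[OF s typed_Scale[OF minus_one_closed t]] .
  have "ecl False s \<in> dcl X Y d t \<longleftrightarrow>
    ecl False s \<oplus>\<^bsub>emod False X Y d\<^esub> (\<ominus>\<^bsub>emod False X Y d\<^esub> ecl False t) \<in> R_plus R C B X Y d"
    unfolding dcl_def by (rule S.a_rcos_module) (use s t in \<open>auto simp: emod_simps\<close>)
  also have "\<dots> \<longleftrightarrow> in_R_plus R C B X Y d (ecl False ?p)"
    unfolding module_emod(2)[OF XY t] emod_simps(3)[OF s typed_Scale[OF minus_one_closed t]] by (simp add: R_plus_def)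
  also have "\<dots> \<longleftrightarrow> fr s \<doteq> fr t"
  proof
    assume "in_R_plus R C B X Y d (ecl False ?p)"
    then obtain u where u: "typed X Y d u" "ecl False ?p = ecl False u" "fr u \<doteq> 0" using in_R_plus_imp by blast
    then have "fr ?p \<doteq> 0" using ecl_False_veq[OF u(2)] p veq_trans by (auto simp: typed_def)
    then have "fr s - fr t \<doteq> 0" using veq_Plus_neg[OF s t] veq_sym veq_trans by blast
    then show "fr s \<doteq> fr t" by (simp add: veq_def)
  next
    assume "fr s \<doteq> fr t"
    then have "eqv True s t" using veq_typedD s t by blast
    from R_plus_eqv[OF this] show "in_R_plus R C B X Y d (ecl False ?p)" using s by (simp add: typed_def)
  qed
  finally show ?thesis .
qed

lemma dcl_mem:
  assumes "K \<in> dcl X Y d t" "typed X Y d t"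
  obtains u where "K = ecl False u" "typed X Y d u" "fr u \<doteq> fr t"
proof -
  have XY: "X \<in> aob C" "Y \<in> aob C" using typed_ob[OF assms(2)] by auto
  interpret M: module R "emod False X Y d" using XY by (rule module_emod)
  have "R_plus R C B X Y d \<subseteq> carrier (emod False X Y d)"
    using in_R_plus_imp unfolding R_plus_def emod_simps by blast
  then have "dcl X Y d t \<subseteq> carrier (emod False X Y d)"
    unfolding dcl_def using assms(2) by (intro M.a_r_coset_subset_G) (auto simp: emod_simps)
  then obtain u where u: "K = ecl False u" "typed X Y d u" using assms(1) by (auto simp: emod_simps)
  then show thesis using that ecl_in_dcl_iff[OF u(2) assms(2)] assms(1) by blast
qed

text \<open>An element of the quotient is a set of classes, so its operations choose twice: a class
  in the coset and an expression in the class. Both choices are invisible modulo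
  \<open>null\<close>.\<close>

lemma rep_dcl:
  assumes "typed X Y d t"
  shows "fr (rep (rep (dcl X Y d t))) \<doteq> fr t" "typed X Y d (rep (rep (dcl X Y d t)))"
    "\<exists>u. rep (dcl X Y d t) = ecl False u \<and> typed X Y d u \<and> fr u \<doteq> fr t"
proof -
  have "ecl False t \<in> dcl X Y d t" using ecl_in_dcl_iff[OF assms assms] by simp
  then have "rep (dcl X Y d t) \<in> dcl X Y d t" unfolding rep_def by (rule someI)
  then obtain u where u: "rep (dcl X Y d t) = ecl False u" "typed X Y d u" "fr u \<doteq> fr t"
    using dcl_mem assms by blast
  then show "\<exists>u. rep (dcl X Y d t) = ecl False u \<and> typed X Y d u \<and> fr u \<doteq> fr t" by blast
  have r: "eqv False u (rep (ecl False u))" using u by (intro eqv_rep) (simp add: typed_def)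
  then show "fr (rep (rep (dcl X Y d t))) \<doteq> fr t" "typed X Y d (rep (rep (dcl X Y d t)))"
    using u eqv_False_veq[OF r] eqv_typedD[OF r] veq_sym veq_trans by (metis, metis)
qed

lemma dcl_eq_iff:
  assumes s: "typed X Y d s" and t: "typed X Y d t"
  shows "dcl X Y d s = dcl X Y d t \<longleftrightarrow> fr s \<doteq> fr t"
proof
  assume "dcl X Y d s = dcl X Y d t"
  then show "fr s \<doteq> fr t" using ecl_in_dcl_iff[OF s s] ecl_in_dcl_iff[OF s t] by simp
next
  assume st: "fr s \<doteq> fr t"
  have "dcl X Y d s \<subseteq> dcl X Y d t" if s: "typed X Y d s" and t: "typed X Y d t" and st: "fr s \<doteq> fr t" for s t
  proof
    fix K assume "K \<in> dcl X Y d s"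
    then obtain u where u: "K = ecl False u" "typed X Y d u" "fr u \<doteq> fr s" using s by (rule dcl_mem)
    show "K \<in> dcl X Y d t" using veq_trans[OF u(3) st] ecl_in_dcl_iff[OF u(2) t] by (simp add: u(1))
  qed
  from this[OF s t st] this[OF t s veq_sym[OF st]] show "dcl X Y d s = dcl X Y d t" by blast
qed

lemma aob_D [simp]: "aob D = aob C"
  by (simp add: quotient_ainf_def free_ainf_def)

lemma shom_D:
  assumes XY: "X \<in> aob C" "Y \<in> aob C"
  shows "carrier (shom D X Y d) = {dcl X Y d t | t. typed X Y d t}"
    "\<zero>\<^bsub>shom D X Y d\<^esub> = dcl X Y d (Nul X Y d)"
    "\<And>s t. typed X Y d s \<Longrightarrow> typed X Y d t
      \<Longrightarrow> dcl X Y d s \<oplus>\<^bsub>shom D X Y d\<^esub> dcl X Y d t = dcl X Y d (Plus s t)"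
    "\<And>a t. a \<in> carrier R \<Longrightarrow> typed X Y d t \<Longrightarrow> a \<odot>\<^bsub>shom D X Y d\<^esub> dcl X Y d t = dcl X Y d (Scale a t)"
proof -
  interpret M: module R "emod False X Y d" using XY by (rule module_emod)
  interpret S: abelian_subgroup "R_plus R C B X Y d" "emod False X Y d" using XY by (rule R_plus_subgroup)
  show "carrier (shom D X Y d) = {dcl X Y d t | t. typed X Y d t}"
    by (auto simp: quotient_ainf_def shom_free_ainf A_RCOSETS_def' dcl_def emod_simps)
  have N: "typed X Y d (Nul X Y d)" using XY by (rule typed_Nul)
  show "\<zero>\<^bsub>shom D X Y d\<^esub> = dcl X Y d (Nul X Y d)"
    using M.a_coset_join2[OF M.zero_closed S.a_subgroup S.zero_closed]
    by (simp add: quotient_ainf_def shom_free_ainf dcl_def emod_simps)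
  show "dcl X Y d s \<oplus>\<^bsub>shom D X Y d\<^esub> dcl X Y d t = dcl X Y d (Plus s t)"
    if st: "typed X Y d s" "typed X Y d t" for s t
    using S.a_rcos_sum[of "ecl False s" "ecl False t"] st
    by (auto simp: quotient_ainf_def shom_free_ainf dcl_def emod_simps)
  show "a \<odot>\<^bsub>shom D X Y d\<^esub> dcl X Y d t = dcl X Y d (Scale a t)" if a: "a \<in> carrier R" "typed X Y d t" for a t
  proof -
    obtain u where u: "rep (dcl X Y d t) = ecl False u" "typed X Y d u" "fr u \<doteq> fr t"
      using rep_dcl(3)[OF a(2)] by blast
    have "a \<odot>\<^bsub>shom D X Y d\<^esub> dcl X Y d t = dcl X Y d (Scale a u)"
      using u a by (simp add: quotient_ainf_def shom_free_ainf emod_simps) (simp add: dcl_def)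
    also have "\<dots> = dcl X Y d (Scale a t)"
      unfolding dcl_eq_iff[OF typed_Scale[OF a(1) u(2)] typed_Scale[OF a]]
      using scl_veq[OF a(1) u(3)] u(2) a(2) by (simp add: lift_fr typed_def)
    finally show ?thesis .
  qed
qed

lemma module_D:
  assumes XY: "X \<in> aob C" "Y \<in> aob C"
  shows "module R (shom D X Y d)"
  by (rule module_of_exprs(1)[where M = "shom D X Y d" and c = "dcl X Y d" and q = True, OF XY shom_D[OF XY]])
    (use dcl_eq_iff eqv_veq in auto)

lemma bop_D: "bop D xs = R_plus R C B (bsrc xs) (btgt xs) (bdeg xs)
    +>\<^bsub>emod False (bsrc xs) (btgt xs) (bdeg xs)\<^esub>
    bop E (map (\<lambda>x. Arr (asrc x) (atgt x) (adeg x) (rep (aval x))) xs)"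
  by (simp add: quotient_ainf_def shom_free_ainf)

lemma bop_E1: "bop E [x] = ecl False (dd (rep (aval x)))"
  by (simp add: free_ainf_def ecls_ecl)

lemma bop_D1:
  assumes t: "typed X Y d t"
  shows "bop D [Arr X Y d (dcl X Y d t)] = dcl X Y (d + 1) (dd t)"
proof -
  have r: "fr (rep (rep (dcl X Y d t))) \<doteq> fr t" "typed X Y d (rep (rep (dcl X Y d t)))"
    using rep_dcl[OF t] by auto
  have "eqv True (rep (rep (dcl X Y d t))) t" using r t veq_typedD by blast
  then have "fr (dd (rep (rep (dcl X Y d t)))) \<doteq> fr (dd t)" by (intro eqv_veq dd_eqv)
  then show ?thesis
    using dcl_eq_iff[OF typed_dd[OF r(2)] typed_dd[OF t]]
    by (simp add: bop_D bop_E1 bsrc_def btgt_def bdeg_def) (simp add: dcl_def)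
qed

lemma typed_Bop2: "typed X Y d s \<Longrightarrow> typed Y Z e t \<Longrightarrow> typed X Z (d + e + 1) (Bop [s, t])"
  by (auto simp: typed_def)

lemma veq_Bop2:
  assumes "fr s \<doteq> fr s'" "fr t \<doteq> fr t'" "typed X Y d s" "typed X Y d s'" "typed Y Z e t" "typed Y Z e t'"
  shows "fr (Bop [s, t]) \<doteq> fr (Bop [s', t'])"
proof -
  have "list_all2 (eqv True) [s, t] [s', t']" using assms veq_typedD by (auto)
  from list_all2_Bop(2)[OF this, of X Z] show ?thesis using assms by (intro eqv_veq) (auto simp: typed_def)
qed

lemma bop_D2:
  assumes s: "typed X Y d s" and t: "typed Y Z e t"
  shows "bop D [Arr X Y d (dcl X Y d s), Arr Y Z e (dcl Y Z e t)] = dcl X Z (d + e + 1) (Bop [s, t])"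
proof -
  let ?s = "rep (rep (dcl X Y d s))" and ?t = "rep (rep (dcl Y Z e t))"
  have r: "fr ?s \<doteq> fr s" "typed X Y d ?s" "fr ?t \<doteq> fr t" "typed Y Z e ?t"
    using rep_dcl[OF s] rep_dcl[OF t] by auto
  have "fr (Bop [?s, ?t]) \<doteq> fr (Bop [s, t])" by (rule veq_Bop2) (use r s t in auto)
  then show ?thesis
    using dcl_eq_iff[OF typed_Bop2[OF r(2,4)] typed_Bop2[OF s t]]
    by (simp add: bop_D bop_E bsrc_def btgt_def bdeg_def) (simp add: dcl_def)
qed

lemma relation2:
  assumes s: "typed X Y d s" and t: "typed Y Z e t"
  shows "fr (dd (Bop [s, t])) + (sgm e (fr (Bop [dd s, t])) + fr (Bop [s, dd t])) \<doteq> 0"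
proof -
  have "path X [s, t] Z" using s t by (auto simp: typed_def)
  from ainf_relation[OF this] t show ?thesis
    by (simp add: sum_splits3_Cons sum_splits2_Cons algebra_simps typed_def)
qed

lemma relation3:
  assumes r: "typed W X c r" and s: "typed X Y d s" and t: "typed Y Z e t"
  shows "fr (dd (Bop [r, s, t])) + (sgm (d + e) (fr (Bop [dd r, s, t])) + sgm e (fr (Bop [r, dd s, t])) + fr (Bop [r, s, dd t])
    + sgm e (fr (Bop [Bop [r, s], t])) + fr (Bop [r, Bop [s, t]])) \<doteq> 0"
proof -
  have "path W [r, s, t] Z" using r s t by (auto simp: typed_def)
  from ainf_relation[OF this] s t show ?thesis
    by (simp add: sum_splits3_Cons sum_splits2_Cons algebra_simps typed_def)
qed

lemma veq_cong: "y \<doteq> z \<Longrightarrow> x \<doteq> y \<longleftrightarrow> x \<doteq> z"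
  using veq_trans veq_sym by blast

lemma Bop_null:
  assumes "path X (us @ t # vs) Y" "us \<noteq> [] \<or> vs \<noteq> []" "fr t \<doteq> 0"
  shows "fr (Bop (us @ t # vs)) \<doteq> 0"
proof -
  have "wf (Bop (us @ t # vs))" using assms(2) by (intro wf_BopI[OF assms(1)]) (auto simp: Suc_le_eq)
  then have "fr (Bop (us @ t # vs)) = slot us vs (fr t)" by (rule lift_fr[symmetric])
  also have "\<dots> \<doteq> slot us vs 0" by (rule slot_veq[OF assms(3)])
  finally show ?thesis by simp
qed

lemma Bop2_null:
  assumes "typed X Y d s" "typed Y Z e t"
  shows "fr s \<doteq> 0 \<Longrightarrow> fr (Bop [s, t]) \<doteq> 0" "fr t \<doteq> 0 \<Longrightarrow> fr (Bop [s, t]) \<doteq> 0"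
  using Bop_null[of X "[]" s "[t]" Z] Bop_null[of X "[s]" t "[]" Z] assms by (auto simp: typed_def)

lemma Bop3_null:
  assumes "typed W X c r" "typed X Y d s" "typed Y Z e t"
  shows "fr r \<doteq> 0 \<Longrightarrow> fr (Bop [r, s, t]) \<doteq> 0" "fr s \<doteq> 0 \<Longrightarrow> fr (Bop [r, s, t]) \<doteq> 0"
    "fr t \<doteq> 0 \<Longrightarrow> fr (Bop [r, s, t]) \<doteq> 0"
  using Bop_null[of W "[]" r "[s, t]" Z] Bop_null[of W "[r]" s "[t]" Z] Bop_null[of W "[r, s]" t "[]" Z] assms
  by (auto simp: typed_def)

lemma cocycles_D:
  assumes XY: "X \<in> aob C" "Y \<in> aob C"
  shows "cocycles D X Y = {dcl X Y (-1) t | t. typed X Y (-1) t \<and> fr (dd t) \<doteq> 0}"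
proof -
  have "bop D [Arr X Y (-1) (dcl X Y (-1) t)] = \<zero>\<^bsub>shom D X Y 0\<^esub> \<longleftrightarrow> fr (dd t) \<doteq> 0"
    if t: "typed X Y (-1) t" for t
  proof -
    have t': "typed X Y 0 (dd t)" using typed_dd[OF t] by simp
    show ?thesis
      using dcl_eq_iff[OF t' typed_Nul[OF XY]] bop_D1[OF t] veq_cong[OF veq_Nul[OF XY, of 0], of "fr (dd t)"]
      by (simp add: shom_D(2)[OF XY])
  qed
  then show ?thesis unfolding cocycles_def shom_D(1)[OF XY] by auto
qed

lemma coboundaries_D:
  assumes XY: "X \<in> aob C" "Y \<in> aob C"
  shows "coboundaries D X Y = {dcl X Y (-1) (dd u) | u. typed X Y (-2) u}"
proof -
  have "bop D [Arr X Y (-2) (dcl X Y (-2) t)] = dcl X Y (-1) (dd t)" if t: "typed X Y (-2) t" for t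
    using bop_D1[OF t] by simp
  then have "(\<lambda>x. bop D [Arr X Y (-2) x]) ` {dcl X Y (-2) t | t. typed X Y (-2) t}
      = {dcl X Y (-1) (dd u) | u. typed X Y (-2) u}"
    by force
  then show ?thesis unfolding coboundaries_def shom_D(1)[OF XY] .
qed

lemma coboundaries_DI:
  assumes "typed X Y (-1) t" "typed X Y (-2) u" "fr t \<doteq> fr (dd u)"
  shows "dcl X Y (-1) t \<in> coboundaries D X Y"
proof -
  have XY: "X \<in> aob C" "Y \<in> aob C" using typed_ob[OF assms(1)] by auto
  have "typed X Y (-1) (dd u)" using typed_dd[OF assms(2)] by simp
  then show ?thesis using assms dcl_eq_iff unfolding coboundaries_D[OF XY] by blast
qed

lemma neg_veq: "typed X Y d t \<Longrightarrow> fr (Scale (\<ominus>\<^bsub>R\<^esub> \<one>\<^bsub>R\<^esub>) t) \<doteq> - fr t"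
  by (rule veq_Scale_minus) (simp add: typed_def)

lemma typed_neg: "typed X Y d t \<Longrightarrow> typed X Y d (Scale (\<ominus>\<^bsub>R\<^esub> \<one>\<^bsub>R\<^esub>) t)"
  by (rule typed_Scale[OF minus_one_closed])

lemma dd_neg_veq: "typed X Y d t \<Longrightarrow> fr (dd (Scale (\<ominus>\<^bsub>R\<^esub> \<one>\<^bsub>R\<^esub>) t)) \<doteq> - fr (dd t)"
  using neg_veq[OF typed_dd] by simp

lemma veq_eq_minus: "x + y \<doteq> 0 \<Longrightarrow> x \<doteq> - y"
  by (simp add: veq_def)

text \<open>On cocycles the summands with b_1 on an argument drop out of the relations of arity two
  and three. What is left says that products of cocycles are cocycles and that the two bracketings
  of a product differ by the boundary of the ternary operation. Units are a premise because their
  construction requires the contraction, which comes later.\<close>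

lemma h0_ainf_D:
  assumes unit: "\<And>X. X \<in> aob C \<Longrightarrow> \<exists>i. unit_elt R D X i"
  shows "h0_ainf R D"
proof (rule h0_ainf.intro)
  fix X Y d assume "X \<in> aob D" "Y \<in> aob D"
  then have XY: "X \<in> aob C" "Y \<in> aob C" by auto
  show "module R (shom D X Y d)" by (rule module_D[OF XY])
  fix x assume "x \<in> carrier (shom D X Y d)"
  then obtain t where t: "x = dcl X Y d t" "typed X Y d t" by (auto simp: shom_D[OF XY])
  show "bop D [Arr X Y d x] \<in> carrier (shom D X Y (d + 1))"
    using bop_D1[OF t(2)] typed_dd[OF t(2)] by (auto simp: t(1) shom_D[OF XY])
  have "typed X Y (d + 2) (dd (dd t))" using typed_dd[OF typed_dd[OF t(2)]] by (simp add: add.assoc)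
  moreover have "fr (dd (dd t)) \<doteq> fr (Nul X Y (d + 2))"
    using veq_trans[OF dd_dd veq_sym[OF veq_Nul[OF XY]]] t(2) by (auto simp: typed_def)
  ultimately show "bop D [Arr X Y (d + 1) (bop D [Arr X Y d x])] = \<zero>\<^bsub>shom D X Y (d + 2)\<^esub>"
    using bop_D1[OF t(2)] bop_D1[OF typed_dd[OF t(2)]] dcl_eq_iff typed_Nul[OF XY]
    by (simp add: t(1) shom_D(2)[OF XY] add.assoc)
  fix y assume "y \<in> carrier (shom D X Y d)"
  then obtain s where s: "y = dcl X Y d s" "typed X Y d s" by (auto simp: shom_D[OF XY])
  show "bop D [Arr X Y d (x \<oplus>\<^bsub>shom D X Y d\<^esub> y)]
      = bop D [Arr X Y d x] \<oplus>\<^bsub>shom D X Y (d + 1)\<^esub> bop D [Arr X Y d y]"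
    using bop_D1[OF t(2)] bop_D1[OF s(2)] bop_D1[OF typed_Plus[OF t(2) s(2)]] typed_dd[OF t(2)] typed_dd[OF s(2)]
    by (simp add: t(1) s(1) shom_D(3)[OF XY] t(2) s(2))
next
  fix X Y Z d e x y assume "X \<in> aob D" "Y \<in> aob D" "Z \<in> aob D"
  then have XY: "X \<in> aob C" "Y \<in> aob C" and YZ: "Y \<in> aob C" "Z \<in> aob C" and XZ: "X \<in> aob C" "Z \<in> aob C" by auto
  assume "x \<in> carrier (shom D X Y d)" "y \<in> carrier (shom D Y Z e)"
  then obtain s t where s: "x = dcl X Y d s" "typed X Y d s" and t: "y = dcl Y Z e t" "typed Y Z e t"
    by (auto simp: shom_D[OF XY] shom_D[OF YZ])
  note st = typed_Bop2[OF s(2) t(2)]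
  show "bop D [Arr X Y d x, Arr Y Z e y] \<in> carrier (shom D X Z (d + e + 1))"
    using bop_D2[OF s(2) t(2)] st by (auto simp: s(1) t(1) shom_D[OF XZ])
  { fix x' assume "x' \<in> carrier (shom D X Y d)"
    then obtain s' where s': "x' = dcl X Y d s'" "typed X Y d s'" by (auto simp: shom_D[OF XY])
    note st' = typed_Bop2[OF s'(2) t(2)]
    have "fr (Bop ([] @ Plus s s' # [t])) \<doteq> fr (Bop ([] @ s # [t])) + fr (Bop ([] @ s' # [t]))"
      using admissible_slot[of "[]" "[t]"] typed_Plus[OF s(2) s'(2)] st unfolding admissible_def
      by (auto simp: typed_def)
    also have "\<dots> \<doteq> fr (Plus (Bop [s, t]) (Bop [s', t]))"
      using st st' by (simp add: veq_sym[OF veq_Plus] typed_def)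
    finally show "bop D [Arr X Y d (x \<oplus>\<^bsub>shom D X Y d\<^esub> x'), Arr Y Z e y]
        = bop D [Arr X Y d x, Arr Y Z e y] \<oplus>\<^bsub>shom D X Z (d + e + 1)\<^esub> bop D [Arr X Y d x', Arr Y Z e y]"
      using bop_D2[OF s(2) t(2)] bop_D2[OF s'(2) t(2)] bop_D2[OF typed_Plus[OF s(2) s'(2)] t(2)]
        dcl_eq_iff[OF typed_Bop2[OF typed_Plus[OF s(2) s'(2)] t(2)] typed_Plus[OF st st']]
      by (simp add: s s' t shom_D(3)[OF XY] shom_D(3)[OF XZ st st'])
  }
  { fix y' assume "y' \<in> carrier (shom D Y Z e)"
    then obtain t' where t': "y' = dcl Y Z e t'" "typed Y Z e t'" by (auto simp: shom_D[OF YZ])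
    note st' = typed_Bop2[OF s(2) t'(2)]
    have "fr (Bop ([s] @ Plus t t' # [])) \<doteq> fr (Bop ([s] @ t # [])) + fr (Bop ([s] @ t' # []))"
      using admissible_slot[of "[s]" "[]"] typed_Plus[OF t(2) t'(2)] st unfolding admissible_def
      by (auto simp: typed_def)
    also have "\<dots> \<doteq> fr (Plus (Bop [s, t]) (Bop [s, t']))"
      using st st' by (simp add: veq_sym[OF veq_Plus] typed_def)
    finally show "bop D [Arr X Y d x, Arr Y Z e (y \<oplus>\<^bsub>shom D Y Z e\<^esub> y')]
        = bop D [Arr X Y d x, Arr Y Z e y] \<oplus>\<^bsub>shom D X Z (d + e + 1)\<^esub> bop D [Arr X Y d x, Arr Y Z e y']"
      using bop_D2[OF s(2) t(2)] bop_D2[OF s(2) t'(2)] bop_D2[OF s(2) typed_Plus[OF t(2) t'(2)]]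
        dcl_eq_iff[OF typed_Bop2[OF s(2) typed_Plus[OF t(2) t'(2)]] typed_Plus[OF st st']]
      by (simp add: s t t' shom_D(3)[OF YZ] shom_D(3)[OF XZ st st'])
  }
next
  fix X Y Z x y assume "X \<in> aob D" "Y \<in> aob D" "Z \<in> aob D"
  then have XY: "X \<in> aob C" "Y \<in> aob C" and YZ: "Y \<in> aob C" "Z \<in> aob C" and XZ: "X \<in> aob C" "Z \<in> aob C" by auto
  { assume "x \<in> cocycles D X Y" "y \<in> cocycles D Y Z"
    then obtain s t where s: "x = dcl X Y (-1) s" "typed X Y (-1) s" "fr (dd s) \<doteq> 0"
      and t: "y = dcl Y Z (-1) t" "typed Y Z (-1) t" "fr (dd t) \<doteq> 0"
      by (auto simp: cocycles_D[OF XY] cocycles_D[OF YZ])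
    have n: "fr (Bop [dd s, t]) \<doteq> 0" "fr (Bop [s, dd t]) \<doteq> 0"
      using Bop2_null(1)[OF typed_dd[OF s(2)] t(2)] Bop2_null(2)[OF s(2) typed_dd[OF t(2)]] s t by auto
    have "fr (dd (Bop [s, t])) \<doteq> - (sgm (-1) (fr (Bop [dd s, t])) + fr (Bop [s, dd t]))"
      by (rule veq_eq_minus[OF relation2[OF s(2) t(2)]])
    also have "\<dots> \<doteq> - (sgm (-1) 0 + 0)" by (intro veq_minus veq_add veq_sgm n)
    finally have "fr (dd (Bop [s, t])) \<doteq> 0" by simp
    then show "bop D [Arr X Y (-1) x, Arr Y Z (-1) y] \<in> cocycles D X Z"
      using bop_D2[OF s(2) t(2)] typed_Bop2[OF s(2) t(2)] by (auto simp: s(1) t(1) cocycles_D[OF XZ])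
  }
  { assume "x \<in> coboundaries D X Y" "y \<in> cocycles D Y Z"
    then obtain s t where s: "x = dcl X Y (-1) (dd s)" "typed X Y (-2) s"
      and t: "y = dcl Y Z (-1) t" "typed Y Z (-1) t" "fr (dd t) \<doteq> 0"
      by (auto simp: coboundaries_D[OF XY] cocycles_D[OF YZ])
    have ds: "typed X Y (-1) (dd s)" using typed_dd[OF s(2)] by simp
    have n: "fr (Bop [s, dd t]) \<doteq> 0" using Bop2_null(2)[OF s(2) typed_dd[OF t(2)]] t by auto
    have "fr (dd (Bop [s, t])) + (- fr (Bop [dd s, t]) + fr (Bop [s, dd t])) - fr (Bop [s, dd t]) \<doteq> 0 - 0"
      using veq_diff[OF relation2[OF s(2) t(2)] n] by simp
    then have "fr (Bop [dd s, t]) \<doteq> fr (dd (Bop [s, t]))" using veq_sym by (simp add: veq_def)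
    then show "bop D [Arr X Y (-1) x, Arr Y Z (-1) y] \<in> coboundaries D X Z"
      using bop_D2[OF ds t(2)] typed_Bop2[OF ds t(2)] typed_Bop2[OF s(2) t(2)]
      by (simp add: s(1) t(1) coboundaries_DI)
  }
  { assume "x \<in> cocycles D X Y" "y \<in> coboundaries D Y Z"
    then obtain s t where s: "x = dcl X Y (-1) s" "typed X Y (-1) s" "fr (dd s) \<doteq> 0"
      and t: "y = dcl Y Z (-1) (dd t)" "typed Y Z (-2) t"
      by (auto simp: cocycles_D[OF XY] coboundaries_D[OF YZ])
    have dt: "typed Y Z (-1) (dd t)" using typed_dd[OF t(2)] by simp
    \<comment> \<open>With the boundary in the second argument, the relation of arity two gives
      minus the boundary of the product.\<close>
    let ?u = "Scale (\<ominus>\<^bsub>R\<^esub> \<one>\<^bsub>R\<^esub>) (Bop [s, t])"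
    have st: "typed X Z (-2) (Bop [s, t])" using typed_Bop2[OF s(2) t(2)] by simp
    have n: "sgm (-2) (fr (Bop [dd s, t])) \<doteq> 0" using Bop2_null(1)[OF typed_dd[OF s(2)] t(2)] s veq_sgm[of _ 0] by fastforce
    have "fr (dd (Bop [s, t])) + (sgm (-2) (fr (Bop [dd s, t])) + fr (Bop [s, dd t])) - sgm (-2) (fr (Bop [dd s, t])) \<doteq> 0 - 0"
      using veq_diff[OF relation2[OF s(2) t(2)] n] by simp
    then have "fr (Bop [s, dd t]) \<doteq> - fr (dd (Bop [s, t]))" by (simp add: veq_def add.commute)
    also have "\<dots> \<doteq> fr (dd ?u)" by (rule veq_sym[OF dd_neg_veq[OF st]])
    finally show "bop D [Arr X Y (-1) x, Arr Y Z (-1) y] \<in> coboundaries D X Z"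
      using bop_D2[OF s(2) dt] typed_Bop2[OF s(2) dt] typed_neg[OF st]
      by (simp add: s(1) t(1) coboundaries_DI)
  }
next
  fix W X Y Z x y z assume "W \<in> aob D" "X \<in> aob D" "Y \<in> aob D" "Z \<in> aob D"
  then have WX: "W \<in> aob C" "X \<in> aob C" and XY: "X \<in> aob C" "Y \<in> aob C" and YZ: "Y \<in> aob C" "Z \<in> aob C"
    and WZ: "W \<in> aob C" "Z \<in> aob C" by auto
  assume "x \<in> cocycles D W X" "y \<in> cocycles D X Y" "z \<in> cocycles D Y Z"
  then obtain r s t where r: "x = dcl W X (-1) r" "typed W X (-1) r" "fr (dd r) \<doteq> 0"
    and s: "y = dcl X Y (-1) s" "typed X Y (-1) s" "fr (dd s) \<doteq> 0"
    and t: "z = dcl Y Z (-1) t" "typed Y Z (-1) t" "fr (dd t) \<doteq> 0"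
    by (auto simp: cocycles_D[OF WX] cocycles_D[OF XY] cocycles_D[OF YZ])
  have rs: "typed W Y (-1) (Bop [r, s])" using typed_Bop2[OF r(2) s(2)] by simp
  have st: "typed X Z (-1) (Bop [s, t])" using typed_Bop2[OF s(2) t(2)] by simp
  have 1: "typed W Z (-1) (Bop [Bop [r, s], t])" using typed_Bop2[OF rs t(2)] by simp
  have 2: "typed W Z (-1) (Bop [r, Bop [s, t]])" using typed_Bop2[OF r(2) st] by simp
  have u: "typed W Z (-2) (Bop [r, s, t])" using r s t by (auto simp: typed_def)
  have du: "typed W Z (-1) (dd (Bop [r, s, t]))" using typed_dd[OF u] by simp
  have n: "fr (Bop [dd r, s, t]) \<doteq> 0" "fr (Bop [r, dd s, t]) \<doteq> 0" "fr (Bop [r, s, dd t]) \<doteq> 0"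
    using Bop3_null(1)[OF typed_dd[OF r(2)] s(2) t(2)] Bop3_null(2)[OF r(2) typed_dd[OF s(2)] t(2)]
      Bop3_null(3)[OF r(2) s(2) typed_dd[OF t(2)]] r s t by auto
  have n': "sgm (-2) (fr (Bop [dd r, s, t])) + sgm (-1) (fr (Bop [r, dd s, t])) + fr (Bop [r, s, dd t])
      \<doteq> sgm (-2) 0 + sgm (-1) 0 + 0"
    by (intro veq_add veq_sgm n)
  have "fr (Bop [Bop [r, s], t]) \<doteq> fr (dd (Bop [r, s, t])) + fr (Bop [r, Bop [s, t]])"
    using veq_diff[OF n' relation3[OF r(2) s(2) t(2)]] by (simp add: veq_def algebra_simps)
  also have "\<dots> \<doteq> fr (Plus (dd (Bop [r, s, t])) (Bop [r, Bop [s, t]]))"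
    using 2 du by (intro veq_sym[OF veq_Plus]) (simp add: typed_def)
  finally have e: "dcl W Z (-1) (Bop [Bop [r, s], t])
      = dcl W Z (-1) (dd (Bop [r, s, t])) \<oplus>\<^bsub>shom D W Z (-1)\<^esub> dcl W Z (-1) (Bop [r, Bop [s, t]])"
    using dcl_eq_iff[OF 1 typed_Plus[OF du 2]] by (simp add: shom_D(3)[OF WZ du 2])
  show "\<exists>b\<in>coboundaries D W Z. bop D [Arr W Y (-1) (bop D [Arr W X (-1) x, Arr X Y (-1) y]), Arr Y Z (-1) z]
      = b \<oplus>\<^bsub>shom D W Z (-1)\<^esub> bop D [Arr W X (-1) x, Arr X Z (-1) (bop D [Arr X Y (-1) y, Arr Y Z (-1) z])]"
  proof
    show "dcl W Z (-1) (dd (Bop [r, s, t])) \<in> coboundaries D W Z" by (rule coboundaries_DI[OF du u]) simp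
  qed (use e bop_D2[OF r(2) s(2)] bop_D2[OF s(2) t(2)] bop_D2[OF rs t(2)] bop_D2[OF r(2) st] in \<open>simp add: r(1) s(1) t(1)\<close>)
qed (use unit in auto)

section \<open>The contraction of the complexes of morphisms from or to an object of the subcategory\<close>

text \<open>H extended by zero from P to P \<oplus> PH, and by zero to the morphisms between objects
  outside B. The recursion replaces a decomposition of elements, which their classes do not display.
  On \<open>Hop t\<close> the degree is two below that of \<open>t\<close>, one step for H and one
  for \<open>hx\<close>.\<close>

fun hx :: "('k, 'o, 'm) expr \<Rightarrow> ('k, 'o, 'm) expr" where
  "hx (Gen X Y d f) = (if X \<in> B \<or> Y \<in> B then Hop (Gen X Y d f) else Nul X Y (d - 1))"
| "hx (Nul X Y d) = Nul X Y (d - 1)"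
| "hx (Plus s t) = Plus (hx s) (hx t)"
| "hx (Scale a t) = Scale a (hx t)"
| "hx (Bop ts) = (if esrc (Bop ts) \<in> B \<or> etgt (Bop ts) \<in> B then Hop (Bop ts)
    else Nul (esrc (Bop ts)) (etgt (Bop ts)) (edeg (Bop ts) - 1))"
| "hx (Hop t) = Nul (esrc t) (etgt t) (edeg t - 2)"

declare hx.simps(5) [simp del]

lemma typed_hx: "typed X Y d t \<Longrightarrow> typed X Y (d - 1) (hx t)"
proof (induction t arbitrary: X Y d)
  case (Bop ts)
  then show ?case using wf_ob[of "Bop ts"] by (auto simp: hx.simps(5) typed_def simp del: esrc.simps(5) etgt.simps(5))
next
  case (Hop t)
  then show ?case using wf_ob[of t] by (auto simp: typed_def)
qed (auto simp: typed_def)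

lemma Nul_veq: "typed X Y d t \<Longrightarrow> fr (Nul X Y e) \<doteq> 0"
  using typed_ob veq_Nul by blast

lemma multilin_Hop:
  assumes F: "multilin \<kappa> \<tau> (\<lambda>t. fr (F t))"
    and \<tau>: "\<And>s t. \<tau> s \<Longrightarrow> \<tau> t \<Longrightarrow> \<tau> (Plus s t)" "\<And>a t. a \<in> carrier R \<Longrightarrow> \<tau> t \<Longrightarrow> \<tau> (Scale a t)"
    and ty: "\<And>t. \<tau> t \<Longrightarrow> typed X Y d (F t)" "\<And>t. \<tau> t \<Longrightarrow> wf (Hop (F t))"
  shows "multilin \<kappa> \<tau> (\<lambda>t. fr (Hop (F t)))"
  unfolding multilin_def
proof (intro conjI allI impI)
  fix s t assume st: "\<tau> s" "\<tau> t"
  note w = ty[OF st(1)] ty[OF st(2)] ty[OF \<tau>(1)[OF st]]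
  have "fr (F (Plus s t)) \<doteq> fr (F s) + fr (F t)" by (rule multilinD(1)[OF F st])
  also have "\<dots> \<doteq> fr (Plus (F s) (F t))" using w by (intro veq_sym[OF veq_Plus]) (auto simp: typed_def)
  finally have "eqv True (F (Plus s t)) (Plus (F s) (F t))"
    using veq_typedD w typed_Plus by blast
  then have "fr (Hop (F (Plus s t))) \<doteq> fr (Hop (Plus (F s) (F t)))"
    using w by (intro eqv_veq qeq_Hop) (auto simp: typed_def)
  also have "\<dots> \<doteq> fr (Hop (F s)) + fr (Hop (F t))" using w by (intro veq_Hop_Plus) (auto simp: typed_def)
  finally show "fr (Hop (F (Plus s t))) \<doteq> fr (Hop (F s)) + fr (Hop (F t))" .
next
  fix a t assume at: "a \<in> carrier R" "\<tau> t"
  note w = ty[OF at(2)] ty[OF \<tau>(2)[OF at]]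
  have "fr (F (Scale a t)) \<doteq> scl a (fr (F t))" by (rule multilinD(2)[OF F at])
  also have "\<dots> = fr (Scale a (F t))" using w by (simp add: lift_fr typed_def)
  finally have "eqv True (F (Scale a t)) (Scale a (F t))"
    using veq_typedD w typed_Scale at by blast
  then have "fr (Hop (F (Scale a t))) \<doteq> fr (Hop (Scale a (F t)))"
    using w at by (intro eqv_veq qeq_Hop) (auto simp: typed_def)
  also have "\<dots> \<doteq> scl a (fr (Hop (F t)))" using w at by (intro veq_Hop_Scale)
  finally show "fr (Hop (F (Scale a t))) \<doteq> scl a (fr (Hop (F t)))" .
next
  fix t t' assume st: "\<tau> t" "\<tau> t'" "\<kappa> t t'"
  have "eqv True (F t) (F t')" using veq_typedD multilinD(3)[OF F st] ty st by blast
  then show "fr (Hop (F t)) \<doteq> fr (Hop (F t'))" using ty st by (intro eqv_veq qeq_Hop)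
qed

lemma multilin_slot:
  assumes w: "wf (Bop (us @ t0 # vs))" and \<kappa>: "\<And>t t'. \<kappa> t t' \<Longrightarrow> eqv True t t'"
  shows "multilin \<kappa> (typed (esrc t0) (etgt t0) (edeg t0)) (\<lambda>t. fr (Bop (us @ t # vs)))"
proof (rule multilin_Bop[OF multilin_fr[OF \<kappa>] typed_Plus typed_Scale])
  fix t assume "typed (esrc t0) (etgt t0) (edeg t0) t"
  then show "wf (Bop (us @ t # vs))" using wf_Bop_subst(1)[OF w] by (auto simp: typed_def simp del: wf_expr.simps)
qed

lemma typed_Bop_subst:
  assumes "wf (Bop (us @ t0 # vs))" "typed (esrc t0) (etgt t0) d t"
  shows "typed (esrc (Bop (us @ t0 # vs))) (etgt (Bop (us @ t0 # vs))) (sdeg us + d + sdeg vs + 1) (Bop (us @ t # vs))"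
  using wf_Bop_subst[OF assms(1), of t] assms(2) by (auto simp: typed_def simp del: esrc.simps etgt.simps wf_expr.simps)

lemma hx_eqv: "eqv True s t \<Longrightarrow> eqv True (hx s) (hx t)"
proof (rule eqv_recursion[where F = hx and k = "-1"])
  fix X Y d t assume "typed X Y d t"
  then show "typed X Y (d + -1) (hx t)" using typed_hx by simp
next
  fix X Y d f g assume "wf (Gen X Y d f)" "wf (Gen X Y d g)" "wf (Gen X Y d (f \<oplus>\<^bsub>shom C X Y d\<^esub> g))"
  then have w: "wf (Gen X Y d f)" "wf (Gen X Y d g)" "wf (Gen X Y d (f \<oplus>\<^bsub>shom C X Y d\<^esub> g))" by simp_all
  have N: "fr (Nul X Y (d - 1)) \<doteq> fr (Nul X Y (d - 1)) + fr (Nul X Y (d - 1))"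
    using veq_Nul[of X Y "d - 1"] veq_minus[of _ 0] w by (fastforce simp: veq_def)
  have "fr (Hop (Gen X Y d (f \<oplus>\<^bsub>shom C X Y d\<^esub> g))) \<doteq> fr (Hop (Gen X Y d f)) + fr (Hop (Gen X Y d g))"
    if "X \<in> B \<or> Y \<in> B"
  proof -
    have "fr (Hop (Gen X Y d (f \<oplus>\<^bsub>shom C X Y d\<^esub> g))) \<doteq> fr (Hop (Plus (Gen X Y d f) (Gen X Y d g)))"
      using w that by (intro eqv_veq qeq_Hop lin_eqv lin_identity.intros) auto
    also have "\<dots> \<doteq> fr (Hop (Gen X Y d f)) + fr (Hop (Gen X Y d g))"
      using w that by (intro veq_Hop_Plus) auto
    finally show ?thesis .
  qed
  then show "fr (hx (Gen X Y d (f \<oplus>\<^bsub>shom C X Y d\<^esub> g))) \<doteq> fr (hx (Gen X Y d f)) + fr (hx (Gen X Y d g))"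
    using N by simp
next
  fix X Y d a f assume w: "a \<in> carrier R" "wf (Gen X Y d f)" "wf (Gen X Y d (a \<odot>\<^bsub>shom C X Y d\<^esub> f))"
  have N: "fr (Nul X Y (d - 1)) \<doteq> scl a (fr (Nul X Y (d - 1)))"
  proof -
    have z: "fr (Nul X Y (d - 1)) \<doteq> 0" using w by (intro veq_Nul) auto
    from scl_veq[OF w(1) z] have "scl a (fr (Nul X Y (d - 1))) \<doteq> 0" by simp
    from veq_trans[OF z veq_sym[OF this]] show ?thesis .
  qed
  have "fr (Hop (Gen X Y d (a \<odot>\<^bsub>shom C X Y d\<^esub> f))) \<doteq> scl a (fr (Hop (Gen X Y d f)))"
    if "X \<in> B \<or> Y \<in> B"
  proof -
    have "fr (Hop (Gen X Y d (a \<odot>\<^bsub>shom C X Y d\<^esub> f))) \<doteq> fr (Hop (Scale a (Gen X Y d f)))"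
      using w that by (intro eqv_veq qeq_Hop lin_eqv lin_identity.intros) auto
    also have "\<dots> \<doteq> scl a (fr (Hop (Gen X Y d f)))"
      using w that by (intro veq_Hop_Scale) auto
    finally show ?thesis .
  qed
  then show "fr (hx (Gen X Y d (a \<odot>\<^bsub>shom C X Y d\<^esub> f))) \<doteq> scl a (fr (hx (Gen X Y d f)))"
    using N by simp
next
  fix xs assume xs: "composable C xs" "2 \<le> length xs" "wf (genx (barr C xs))"
  note e = wf_Bop_genx[OF xs(1,2)]
  have "fr (Hop (Bop (map genx xs))) \<doteq> fr (Hop (genx (barr C xs)))" if "bsrc xs \<in> B \<or> btgt xs \<in> B"
    using xs e that by (intro eqv_veq qeq_Hop qeq_gen) (auto simp: genx_def simp del: esrc.simps(5) etgt.simps(5) edeg.simps(5) wf_expr.simps(5))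
  then show "fr (hx (Bop (map genx xs))) \<doteq> fr (hx (genx (barr C xs)))"
    using e by (simp add: hx.simps(5) genx_def del: esrc.simps(5) etgt.simps(5) edeg.simps(5) wf_expr.simps(5))
next
  fix us t vs assume w: "wf (Bop (us @ t # vs))"
  let ?\<kappa> = "\<lambda>t t'. eqv True t t' \<and> fr (hx t) \<doteq> fr (hx t')"
  let ?X = "esrc (Bop (us @ t # vs))" and ?Y = "etgt (Bop (us @ t # vs))"
  let ?d = "sdeg us + edeg t + sdeg vs + 1"
  have ty: "typed ?X ?Y ?d (Bop (us @ u # vs))" if "typed (esrc t) (etgt t) (edeg t) u" for u
    by (rule typed_Bop_subst[OF w that])
  show "multilin ?\<kappa> (typed (esrc t) (etgt t) (edeg t)) (\<lambda>t. fr (hx (Bop (us @ t # vs))))"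
  proof (cases "?X \<in> B \<or> ?Y \<in> B")
    case True
    show ?thesis
    proof (rule multilin_veq[OF multilin_Hop[OF multilin_slot[OF w, of ?\<kappa>] typed_Plus typed_Scale ty]])
      fix u assume "typed (esrc t) (etgt t) (edeg t) u"
      from ty[OF this] True show "wf (Hop (Bop (us @ u # vs)))" "fr (hx (Bop (us @ u # vs))) \<doteq> fr (Hop (Bop (us @ u # vs)))"
        by (auto simp: hx.simps(5) typed_def simp del: esrc.simps(5) etgt.simps(5) edeg.simps(5) wf_expr.simps(5))
    qed (auto intro: typed_Plus typed_Scale)
  next
    case False
    show ?thesis
    proof (rule multilin_veq[OF multilin_zero])
      fix u assume "typed (esrc t) (etgt t) (edeg t) u"
      from ty[OF this] False Nul_veq[OF ty[OF this]] show "fr (hx (Bop (us @ u # vs))) \<doteq> 0"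
        by (auto simp: hx.simps(5) typed_def simp del: esrc.simps(5) etgt.simps(5) edeg.simps(5) wf_expr.simps(5))
    qed (auto intro: typed_Plus typed_Scale)
  qed
next
  fix t assume w: "wf (Hop t)"
  show "multilin (\<lambda>t t'. eqv True t t' \<and> fr (hx t) \<doteq> fr (hx t'))
      (\<lambda>u. typed (esrc t) (etgt t) (edeg t) u \<and> in_P u) (\<lambda>t. fr (hx (Hop t)))"
    by (rule multilin_veq[OF multilin_zero]) (auto intro: typed_Plus typed_Scale Nul_veq simp: typed_def intro!: veq_Nul dest: wf_ob)
qed auto

abbreviation "HX \<equiv> lift wf hx"

lemma HX_veq: "x \<doteq> y \<Longrightarrow> HX x \<doteq> HX y"
proof (rule lift_veq[OF admissible_eqv[where k = "-1"]])
  show "typed X Y (d + -1) (hx t)" if "typed X Y d t" for X Y d t using typed_hx[OF that] by simp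
qed (auto intro: hx_eqv)

lemma wf_hx: "wf t \<Longrightarrow> wf (hx t)"
  using typed_hx[of "esrc t" "etgt t" "edeg t" t] by (simp add: typed_def)

lemma hx_Hop: "wf (Hop t) \<Longrightarrow> fr (hx t) \<doteq> fr (Hop t)"
proof (induction t)
  case (Nul X Y d)
  then have N: "fr (Nul X Y (d - 1)) \<doteq> 0" by (intro veq_Nul) auto
  have "fr (Hop (Nul X Y d)) \<doteq> 0" using Nul by (intro veq_Hop_null veq_Nul) auto
  then show ?case using veq_trans[OF N veq_sym] by simp
next
  case (Plus s t)
  have w: "wf (Hop s)" "wf (Hop t)" "wf s" "wf t" using Plus.prems by auto
  have "fr (hx (Plus s t)) \<doteq> fr (hx s) + fr (hx t)"
    using Plus.prems typed_hx[of "esrc s" "etgt s" "edeg s" s] typed_hx[of "esrc s" "etgt s" "edeg s" t]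
    by (auto simp: typed_def intro!: veq_Plus)
  also have "\<dots> \<doteq> fr (Hop s) + fr (Hop t)" by (intro veq_add Plus w)
  also have "\<dots> \<doteq> fr (Hop (Plus s t))" using Plus.prems by (intro veq_sym[OF veq_Hop_Plus]) auto
  finally show ?case .
next
  case (Scale a t)
  have w: "wf (Hop t)" "wf t" "a \<in> carrier R" using Scale.prems by auto
  have "fr (hx (Scale a t)) = scl a (fr (hx t))" using wf_hx[OF w(2)] by (simp add: lift_fr)
  also have "\<dots> \<doteq> scl a (fr (Hop t))" by (intro scl_veq Scale w)
  also have "\<dots> \<doteq> fr (Hop (Scale a t))" by (intro veq_sym[OF veq_Hop_Scale] w)
  finally show ?case .
qed (auto simp: hx.simps(5))

text \<open>On P this is the defining identity Hb_1 = 1 - b_1H. On \<open>Hop t\<close> the first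
  summand is zero, and in \<open>dd (Hop t)\<close>, which is \<open>t\<close> minus
  \<open>Hop (dd t)\<close>, \<open>hx\<close> turns the first term into \<open>Hop t\<close> and
  kills the second. Sums and multiples need their own induction step because their terms may come
  from both parts.\<close>

lemma hx_contraction:
  "typed X Y d t \<Longrightarrow> X \<in> B \<or> Y \<in> B \<Longrightarrow> fr (dd (hx t)) + fr (hx (dd t)) \<doteq> fr t"
proof -
  have P: "fr (dd (hx t)) + fr (hx (dd t)) \<doteq> fr t" if t: "typed X Y d t" "in_P t" and B: "X \<in> B \<or> Y \<in> B" for t d
  proof -
    have w: "wf (Hop t)" "wf (Hop (dd t))" "wf t"
      using t B typed_dd_P[of t] by (auto simp: typed_def)
    have "fr (dd (hx t)) = DD (fr (hx t))" using wf_hx[OF w(3)] by (simp add: lift_fr)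
    also have "\<dots> \<doteq> DD (fr (Hop t))" by (rule DD_veq[OF hx_Hop[OF w(1)]])
    also have "\<dots> = fr (dd (Hop t))" using w by (simp add: lift_fr)
    also have "\<dots> \<doteq> fr t - fr (Hop (dd t))" by (rule dd_Hop_veq[OF w(1)])
    finally have "fr (dd (hx t)) + fr (hx (dd t)) \<doteq> (fr t - fr (Hop (dd t))) + fr (Hop (dd t))"
      by (intro veq_add hx_Hop w)
    then show ?thesis by simp
  qed
  show "typed X Y d t \<Longrightarrow> X \<in> B \<or> Y \<in> B \<Longrightarrow> fr (dd (hx t)) + fr (hx (dd t)) \<doteq> fr t"
  proof (induction t arbitrary: d)
    case (Plus s t)
    have st: "typed X Y d s" "typed X Y d t" using Plus.prems by (auto simp: typed_def)
    note w = typed_dd[OF typed_hx[OF st(1)]] typed_dd[OF typed_hx[OF st(2)]]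
      typed_hx[OF typed_dd[OF st(1)]] typed_hx[OF typed_dd[OF st(2)]]
    have "fr (dd (hx (Plus s t))) + fr (hx (dd (Plus s t))) \<doteq>
        (fr (dd (hx s)) + fr (dd (hx t))) + (fr (hx (dd s)) + fr (hx (dd t)))"
      using w by (simp, intro veq_add veq_Plus) (auto simp: typed_def)
    also have "\<dots> = (fr (dd (hx s)) + fr (hx (dd s))) + (fr (dd (hx t)) + fr (hx (dd t)))" by simp
    also have "\<dots> \<doteq> fr s + fr t" by (intro veq_add Plus.IH(1)[OF st(1) Plus.prems(2)] Plus.IH(2)[OF st(2) Plus.prems(2)])
    also have "\<dots> \<doteq> fr (Plus s t)" using Plus.prems by (intro veq_sym[OF veq_Plus]) (auto simp: typed_def)
    finally show ?case .
  next
    case (Scale a t)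
    have t: "typed X Y d t" "a \<in> carrier R" using Scale.prems by (auto simp: typed_def)
    note w = typed_dd[OF typed_hx[OF t(1)]] typed_hx[OF typed_dd[OF t(1)]]
    have "fr (dd (hx (Scale a t))) + fr (hx (dd (Scale a t))) = scl a (fr (dd (hx t)) + fr (hx (dd t)))"
      using w by (simp add: lift_fr typed_def)
    also have "\<dots> \<doteq> scl a (fr t)" by (intro scl_veq t Scale.IH[OF t(1) Scale.prems(2)])
    also have "\<dots> = fr (Scale a t)" using t by (simp add: lift_fr typed_def)
    finally show ?case .
  next
    case (Hop t)
    have t: "typed X Y (d + 1) t" "in_P t" "wf (Hop t)" using Hop.prems by (auto simp: typed_def)
    have w: "wf (Hop (dd t))" "wf (dd t)" "wf t" using t typed_dd_P[of t] by (auto simp: typed_def)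
    have N: "fr (dd (hx (Hop t))) \<doteq> 0" using Nul_veq[OF t(1)] t(1) by (simp add: typed_def)
    have "typed X Y (d + 1) (dd (Hop t))" by (rule typed_dd[OF Hop.prems(1)])
    then have "fr (hx (dd (Hop t))) = HX (fr (dd (Hop t)))" by (subst lift_fr) (simp_all add: typed_def)
    also have "\<dots> \<doteq> HX (fr t - fr (Hop (dd t)))" by (rule HX_veq[OF dd_Hop_veq[OF t(3)]])
    also have "\<dots> = fr (hx t) - fr (hx (Hop (dd t)))" using w by (simp add: lift_fr)
    also have "\<dots> \<doteq> fr (Hop t) - 0"
      using veq_Nul wf_ob[OF w(2)] by (intro veq_diff hx_Hop t) simp
    finally have "fr (dd (hx (Hop t))) + fr (hx (dd (Hop t))) \<doteq> 0 + (fr (Hop t) - 0)" by (intro veq_add N)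
    then show ?case by simp
  next
    case (Gen X' Y' d' f)
    show ?case by (rule P[OF Gen.prems(1) _ Gen.prems(2)]) simp
  next
    case (Nul X' Y' d')
    show ?case by (rule P[OF Nul.prems(1) _ Nul.prems(2)]) simp
  next
    case (Bop ts)
    show ?case by (rule P[OF Bop.prems(1) _ Bop.prems(2)]) simp
  qed
qed

end

lemma sgm_succ [simp]: "sgm (d - 1) x = - sgm d x" "sgm (d + 1) x = - sgm d x" "sgm (1 + d) x = - sgm d x"
    "sgm (d + (e - 1)) x = - sgm (d + e) x" "sgm (d + (e + 1)) x = - sgm (d + e) x"
  by (auto simp: sgm_def)

lemma sum_splits2_right_Nil:
  fixes c :: "'v::ab_group_add"
  shows "(\<Sum>(u, v)\<in>splits2 us. if v = [] then c else 0) = c"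
proof (induction us rule: rev_induct)
  case (snoc x us)
  show ?case by (subst sum_splits2_snoc) (simp add: split_def)
qed simp

lemma sum_splits2_left_Nil:
  fixes c :: "'v::ab_group_add"
  shows "(\<Sum>(u, v)\<in>splits2 us. if u = [] then c else 0) = c"
proof (induction us)
  case (Cons x us)
  show ?case by (subst sum_splits2_Cons) (simp add: split_def)
qed simp

context dg_exprs
begin

section \<open>Unitality of the quotient\<close>

abbreviation I :: "'o \<Rightarrow> ('k, 'o, 'm) expr" where
  "I X \<equiv> Gen X X (-1) (ident X)"

lemma typed_I: "X \<in> aob C \<Longrightarrow> typed X X (-1) (I X)"
  by (simp add: typed_def ident_closed)

lemma dd_I: "X \<in> aob C \<Longrightarrow> fr (dd (I X)) \<doteq> 0"
  using veq_Gen_zero[of X X 0] by (simp add: b1C_ident)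

lemma multilin_subset: "multilin \<kappa> \<tau> G \<Longrightarrow> (\<And>t. \<tau>' t \<Longrightarrow> \<tau> t) \<Longrightarrow> multilin \<kappa> \<tau>' G"
  by (auto simp: multilin_def)

lemma multilin_comp:
  assumes F: "multilin \<kappa> \<tau> (\<lambda>t. fr (F t))" and \<phi>: "admissible wf \<phi>"
    and sc: "\<And>a t. a \<in> carrier R \<Longrightarrow> wf t \<Longrightarrow> fr (\<phi> (Scale a t)) \<doteq> scl a (fr (\<phi> t))"
    and w: "\<And>t. \<tau> t \<Longrightarrow> wf (F t)"
    and \<tau>: "\<And>s t. \<tau> s \<Longrightarrow> \<tau> t \<Longrightarrow> \<tau> (Plus s t)" "\<And>a t. a \<in> carrier R \<Longrightarrow> \<tau> t \<Longrightarrow> \<tau> (Scale a t)"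
  shows "multilin \<kappa> \<tau> (\<lambda>t. fr (\<phi> (F t)))"
  unfolding multilin_def
proof (intro conjI allI impI)
  fix s t assume st: "\<tau> s" "\<tau> t"
  from lift_veq[OF \<phi> multilinD(1)[OF F st]]
  show "fr (\<phi> (F (Plus s t))) \<doteq> fr (\<phi> (F s)) + fr (\<phi> (F t))"
    using st \<tau>(1)[OF st] w by (simp add: lift_fr)
next
  fix a t assume at: "a \<in> carrier R" "\<tau> t"
  have "fr (\<phi> (F (Scale a t))) \<doteq> fr (\<phi> (Scale a (F t)))"
    using lift_veq[OF \<phi> multilinD(2)[OF F at]] at \<tau>(2)[OF at] w by (simp add: lift_fr)
  also have "\<dots> \<doteq> scl a (fr (\<phi> (F t)))" using at w by (intro sc)
  finally show "fr (\<phi> (F (Scale a t))) \<doteq> scl a (fr (\<phi> (F t)))" .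
next
  fix t t' assume st: "\<tau> t" "\<tau> t'" "\<kappa> t t'"
  from lift_veq[OF \<phi> multilinD(3)[OF F st]]
  show "fr (\<phi> (F t)) \<doteq> fr (\<phi> (F t'))" using st w by (simp add: lift_fr)
qed

text \<open>On morphisms of C the operation b_n of the quotient is that of C, and it vanishes for n
  \<ge> 3. The unit homotopies and the computation with the cone both rest on this.\<close>

lemma genx_higher_null:
  assumes "composable C ys" "3 \<le> length ys"
  shows "fr (Bop (map genx ys)) \<doteq> 0"
proof -
  have XY: "bsrc ys \<in> aob C" "btgt ys \<in> aob C" using wf_ob[OF wf_barr[OF assms(1)]] by simp_all
  have "fr (Bop (map genx ys)) \<doteq> fr (genx (barr C ys))"
    using bb_genx[OF assms(1)] assms(2) by simp
  also have "\<dots> \<doteq> 0" using higher[OF assms] veq_Gen_zero[OF XY] by (simp add: genx_def)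
  finally show ?thesis .
qed

end

text \<open>
  A homotopy between the identity and multiplication \<open>\<phi>\<close> by a unit is determined by its values on
  \<open>sC\<close> and on \<open>Im b\<^sub>n\<close>: on \<open>Im H\<close> it is forced by \<open>b\<^sub>1\<close>, up to the contraction \<^const>\<open>dg_exprs.hx\<close>.
\<close>

locale unit_homotopy = dg_exprs R C B ident
  for R :: "'k ring" and C :: "('k, 'o, 'm) ainf" and B :: "'o set" and ident :: "'o \<Rightarrow> 'm" +
  fixes \<phi> h :: "('k, 'o, 'm) expr \<Rightarrow> ('k, 'o, 'm) expr"
  assumes phi_typed: "typed X Y d t \<Longrightarrow> typed X Y d (\<phi> t)"
    and phi_P: "in_P (\<phi> t)"
    and phi_admissible: "admissible wf \<phi>"
    and phi_Scale: "a \<in> carrier R \<Longrightarrow> wf t \<Longrightarrow> fr (\<phi> (Scale a t)) \<doteq> scl a (fr (\<phi> t))"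
    and phi_dd: "wf t \<Longrightarrow> fr (dd (\<phi> t)) \<doteq> fr (\<phi> (dd t))"
    and h_typed: "typed X Y d t \<Longrightarrow> typed X Y (d - 1) (h t)"
    and h_Gen [simp]: "h (Gen X Y d f) = Nul X Y (d - 1)"
    and h_Nul [simp]: "h (Nul X Y d) = Nul X Y (d - 1)"
    and h_Plus [simp]: "h (Plus s t) = Plus (h s) (h t)"
    and h_Scale [simp]: "h (Scale a t) = Scale a (h t)"
    and h_Hop: "h (Hop t) = Plus (Hop (\<phi> (Hop t))) (Scale (\<ominus>\<^bsub>R\<^esub> \<one>\<^bsub>R\<^esub>) (hx (h t)))"
    and h_gen: "composable C xs \<Longrightarrow> 2 \<le> length xs \<Longrightarrow> fr (h (Bop (map genx xs))) \<doteq> 0"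
    and h_multilin: "wf (Bop (us @ t0 # vs)) \<Longrightarrow>
      multilin (\<lambda>t t'. eqv True t t' \<and> fr (h t) \<doteq> fr (h t')) (typed (esrc t0) (etgt t0) (edeg t0))
        (\<lambda>t. fr (h (Bop (us @ t # vs))))"
begin

definition claim :: "('k, 'o, 'm) expr \<Rightarrow> bool" where
  "claim t \<longleftrightarrow> fr (\<phi> t) \<doteq> fr t + (fr (dd (h t)) + fr (h (dd t)))"

lemma h_Hop_veq:
  assumes w: "wf (Hop t)"
  shows "fr (h (Hop t)) \<doteq> fr (Hop (\<phi> (Hop t))) - fr (hx (h t))"
proof -
  let ?X = "esrc t" and ?Y = "etgt t" and ?d = "edeg t"
  have t: "typed ?X ?Y ?d t" "typed ?X ?Y (?d - 1) (Hop t)" and B: "?X \<in> B \<or> ?Y \<in> B"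
    using w by (auto simp: typed_def)
  have 1: "typed ?X ?Y (?d - 1 - 1) (Hop (\<phi> (Hop t)))"
    using phi_typed[OF t(2)] phi_P B by (auto simp: typed_def)
  have 2: "typed ?X ?Y (?d - 1 - 1) (hx (h t))" by (rule typed_hx[OF h_typed[OF t(1)]])
  show ?thesis unfolding h_Hop by (rule veq_Plus_neg[OF 1 2])
qed

lemma h_eqv: "eqv True s t \<Longrightarrow> eqv True (h s) (h t)"
proof (rule eqv_recursion[where F = h and k = "-1"])
  fix X Y d t assume "typed X Y d t"
  then show "typed X Y (d + -1) (h t)" using h_typed by simp
next
  fix X Y d f g assume "wf (Gen X Y d f)" "wf (Gen X Y d g)"
  then have "fr (Nul X Y (d - 1)) \<doteq> 0" by (intro veq_Nul) auto
  from veq_trans[OF this veq_sym[OF veq_add[OF this this, simplified]]]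
  show "fr (h (Gen X Y d (f \<oplus>\<^bsub>shom C X Y d\<^esub> g))) \<doteq> fr (h (Gen X Y d f)) + fr (h (Gen X Y d g))"
    by simp
next
  fix X Y d a f assume a: "a \<in> carrier R" "wf (Gen X Y d f)"
  then have "fr (Nul X Y (d - 1)) \<doteq> 0" by (intro veq_Nul) auto
  from veq_trans[OF this veq_sym[OF scl_veq[OF a(1) this, unfolded lift_simps]]]
  show "fr (h (Gen X Y d (a \<odot>\<^bsub>shom C X Y d\<^esub> f))) \<doteq> scl a (fr (h (Gen X Y d f)))"
    by simp
next
  fix xs assume xs: "composable C xs" "2 \<le> length xs" "wf (genx (barr C xs))"
  have "fr (Nul (bsrc xs) (btgt xs) (bdeg xs - 1)) \<doteq> 0" using wf_ob[OF xs(3)] by (intro veq_Nul) auto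
  from veq_trans[OF h_gen[OF xs(1,2)] veq_sym[OF this]]
  show "fr (h (Bop (map genx xs))) \<doteq> fr (h (genx (barr C xs)))" by (simp add: genx_def)
next
  fix t assume w: "wf (Hop t)"
  let ?X = "esrc t" and ?Y = "etgt t" and ?d = "edeg t"
  let ?\<kappa> = "\<lambda>t t'. eqv True t t' \<and> fr (h t) \<doteq> fr (h t')"
  let ?\<tau> = "\<lambda>u. typed ?X ?Y ?d u \<and> in_P u"
  have B: "?X \<in> B \<or> ?Y \<in> B" using w by auto
  have \<tau>: "?\<tau> s \<Longrightarrow> ?\<tau> t \<Longrightarrow> ?\<tau> (Plus s t)" "a \<in> carrier R \<Longrightarrow> ?\<tau> t \<Longrightarrow> ?\<tau> (Scale a t)" for s t a
    by (auto intro: typed_Plus typed_Scale)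
  have H: "typed ?X ?Y (?d - 1) (Hop u)" "wf (Hop u)" if "?\<tau> u" for u using that B by (auto simp: typed_def)
  have id: "multilin ?\<kappa> ?\<tau> fr" by (rule multilin_subset[OF multilin_fr]) auto
  have m0: "multilin ?\<kappa> ?\<tau> (\<lambda>t. fr (Hop t))"
    by (rule multilin_Hop[OF id]) (use \<tau> H in auto)
  have m1: "multilin ?\<kappa> ?\<tau> (\<lambda>t. fr (\<phi> (Hop t)))"
    by (rule multilin_comp[OF m0 phi_admissible phi_Scale H(2) \<tau>])
  have m2: "multilin ?\<kappa> ?\<tau> (\<lambda>t. fr (Hop (\<phi> (Hop t))))"
  proof (rule multilin_Hop[OF m1 \<tau>])
    fix u assume u: "?\<tau> u"
    show "typed ?X ?Y (?d - 1) (\<phi> (Hop u))" by (rule phi_typed[OF H(1)[OF u]])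
    then show "wf (Hop (\<phi> (Hop u)))" using phi_P B by (auto simp: typed_def)
  qed
  have m3: "multilin ?\<kappa> ?\<tau> (\<lambda>t. fr (hx (h t)))"
  proof (rule multilin_subset[OF multilin_map[where F = "\<lambda>t. hx (h t)"]])
    fix s u assume "?\<kappa> s u"
    then have su: "eqv True s u" "fr (h s) \<doteq> fr (h u)" by auto
    have "wf (h s)" "wf (h u)" using eqv_typed[OF su(1)] h_typed by (auto simp: typed_def)
    then show "fr (hx (h s)) \<doteq> fr (hx (h u))" using HX_veq[OF su(2)] by (simp add: lift_fr)
  qed (auto intro: typed_hx h_typed)
  show "multilin ?\<kappa> ?\<tau> (\<lambda>t. fr (h (Hop t)))"
    by (rule multilin_veq[OF multilin_diff[OF m2 m3]]) (use h_Hop_veq H(2) \<tau> in auto)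
qed (use h_multilin in auto)

abbreviation "HH \<equiv> lift wf h"

lemma HH_veq: "x \<doteq> y \<Longrightarrow> HH x \<doteq> HH y"
proof (rule lift_veq[OF admissible_eqv[where k = "-1"]])
  show "typed X Y (d + -1) (h t)" if "typed X Y d t" for X Y d t using h_typed[OF that] by simp
qed (auto intro: h_eqv)

abbreviation "PHI \<equiv> lift wf \<phi>"

lemma PHI_veq: "x \<doteq> y \<Longrightarrow> PHI x \<doteq> PHI y"
  by (rule lift_veq[OF phi_admissible])

lemma wf_typed: "wf t \<Longrightarrow> typed (esrc t) (etgt t) (edeg t) t"
  by (simp add: typed_def)

lemma typed_wf: "typed X Y d t \<Longrightarrow> wf t"
  by (simp add: typed_def)

lemma claim_Nul:
  assumes "wf (Nul X Y d)"
  shows "claim (Nul X Y d)"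
proof -
  have z: "fr (Nul X Y e) \<doteq> 0" for e using assms by (intro veq_Nul) auto
  have e1: "fr (\<phi> (Nul X Y d)) \<doteq> 0" using PHI_veq[OF z[of d]] assms by (simp add: lift_fr)
  have e2: "fr (Nul X Y d) + (fr (dd (h (Nul X Y d))) + fr (h (dd (Nul X Y d)))) \<doteq> 0"
    using veq_add[OF z[of d] veq_add[OF z[of d] z[of d]]] by simp
  show ?thesis unfolding claim_def by (rule veq_trans[OF e1 veq_sym[OF e2]])
qed

lemma claim_Plus:
  assumes st: "wf (Plus s t)" and c: "claim s" "claim t"
  shows "claim (Plus s t)"
proof -
  let ?X = "esrc s" and ?Y = "etgt s" and ?d = "edeg s"
  have ty: "typed ?X ?Y ?d s" "typed ?X ?Y ?d t" using st by (auto simp: typed_def)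
  note w = typed_dd[OF h_typed[OF ty(1)]] typed_dd[OF h_typed[OF ty(2)]]
    h_typed[OF typed_dd[OF ty(1)]] h_typed[OF typed_dd[OF ty(2)]]
  have "fr (\<phi> (Plus s t)) \<doteq> fr (\<phi> s) + fr (\<phi> t)"
    using phi_admissible st by (auto simp: admissible_def)
  also have "\<dots> \<doteq> (fr s + (fr (dd (h s)) + fr (h (dd s)))) + (fr t + (fr (dd (h t)) + fr (h (dd t))))"
    using c unfolding claim_def by (rule veq_add)
  also have "\<dots> = (fr s + fr t) + ((fr (dd (h s)) + fr (dd (h t))) + (fr (h (dd s)) + fr (h (dd t))))"
    by simp
  also have "\<dots> \<doteq> fr (Plus s t) + (fr (Plus (dd (h s)) (dd (h t))) + fr (Plus (h (dd s)) (h (dd t))))"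
    using w st by (intro veq_add veq_sym[OF veq_Plus]) (auto simp: typed_def)
  finally show ?thesis by (simp add: claim_def)
qed

lemma claim_Scale:
  assumes st: "wf (Scale a t)" and c: "claim t"
  shows "claim (Scale a t)"
proof -
  have t: "wf t" "a \<in> carrier R" using st by auto
  note w = typed_wf[OF typed_dd[OF h_typed[OF wf_typed[OF t(1)]]]] typed_wf[OF h_typed[OF typed_dd[OF wf_typed[OF t(1)]]]]
  have "fr (\<phi> (Scale a t)) \<doteq> scl a (fr (\<phi> t))" by (intro phi_Scale t)
  also have "\<dots> \<doteq> scl a (fr t + (fr (dd (h t)) + fr (h (dd t))))"
    using c unfolding claim_def by (intro scl_veq t)
  also have "\<dots> = fr (Scale a t) + (fr (dd (h (Scale a t))) + fr (h (dd (Scale a t))))"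
    using t w by (simp add: lift_fr)
  finally show ?thesis by (simp add: claim_def)
qed

text \<open>The contraction formula is applied to \<open>\<phi> (Hop y)\<close> and to
  \<open>h y\<close>. The two occurrences of \<open>h y\<close> itself cancel; the claim for
  \<open>y\<close>, mapped by \<open>hx\<close>, and the commutation of \<open>\<phi>\<close> with
  the differential cancel everything else except \<open>\<phi> (Hop y)\<close> and
  \<open>Hop y\<close>.\<close>

lemma claim_Hop:
  assumes w: "wf (Hop y)" and c: "claim y"
  shows "claim (Hop y)"
proof -
  let ?X = "esrc y" and ?Y = "etgt y" and ?d = "edeg y"
  have B: "?X \<in> B \<or> ?Y \<in> B" and P: "in_P y" "in_P (dd y)" using w typed_dd_P[of y] by auto
  have y: "typed ?X ?Y ?d y" using w by (simp add: typed_def)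
  note dy = typed_dd[OF y]
  have Hy: "typed ?X ?Y (?d - 1) (Hop y)" "typed ?X ?Y (?d + 1 - 1) (Hop (dd y))"
    and wH: "wf (Hop (dd y))" using w dy P by (auto simp: typed_def)
  let ?P = "\<phi> (Hop y)" and ?P' = "\<phi> (Hop (dd y))"
  have p: "typed ?X ?Y (?d - 1) ?P" "typed ?X ?Y (?d + 1 - 1) ?P'" by (intro phi_typed Hy)+
  have wP: "wf (Hop ?P)" "wf (Hop ?P')" using p phi_P B by (auto simp: typed_def)
  have wdP: "wf (Hop (dd ?P))" using typed_dd_P[of ?P] p(1) phi_P[of "Hop y"] B by (auto simp: typed_def)
  note hy = h_typed[OF y]
  note xhy = typed_hx[OF hy]
  have hH: "typed ?X ?Y (?d - 1 - 1) (h (Hop y))" "typed ?X ?Y (?d + 1 - 1 - 1) (h (Hop (dd y)))"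
    by (intro h_typed Hy)+
  have 1: "fr (dd (h (Hop y))) \<doteq> (fr ?P - fr (hx (dd ?P))) - (fr (h y) - fr (hx (dd (h y))))"
  proof -
    have "fr (dd (h (Hop y))) = DD (fr (h (Hop y)))" using typed_wf[OF hH(1)] by (simp add: lift_fr)
    also have "\<dots> \<doteq> DD (fr (Hop ?P) - fr (hx (h y)))" by (rule DD_veq[OF h_Hop_veq[OF w]])
    also have "\<dots> = fr (dd (Hop ?P)) - fr (dd (hx (h y)))"
      using wP(1) typed_wf[OF xhy] by (simp add: lift_fr del: ediff.simps wf_expr.simps)
    also have "\<dots> \<doteq> (fr ?P - fr (Hop (dd ?P))) - (fr (h y) - fr (hx (dd (h y))))"
      using hx_contraction[OF hy B] by (intro veq_diff[OF dd_Hop_veq[OF wP(1)]]) (simp add: veq_def algebra_simps)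
    also have "\<dots> \<doteq> (fr ?P - fr (hx (dd ?P))) - (fr (h y) - fr (hx (dd (h y))))"
      by (intro veq_diff veq_refl veq_sym[OF hx_Hop[OF wdP]])
    finally show ?thesis .
  qed
  have 2: "fr (h (dd (Hop y))) \<doteq> fr (h y) - (fr (Hop ?P') - fr (hx (h (dd y))))"
  proof -
    have e: "h (dd (Hop y)) = Plus (h y) (Scale (\<ominus>\<^bsub>R\<^esub> \<one>\<^bsub>R\<^esub>) (h (Hop (dd y))))" by simp
    have "fr (h (dd (Hop y))) \<doteq> fr (h y) - fr (h (Hop (dd y)))"
      unfolding e by (rule veq_Plus_neg[of ?X ?Y "?d - 1"]) (use hy hH(2) in auto)
    also have "\<dots> \<doteq> fr (h y) - (fr (Hop ?P') - fr (hx (h (dd y))))"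
      by (intro veq_diff veq_refl h_Hop_veq wH)
    finally show ?thesis .
  qed
  have 3: "fr (hx (dd (h y))) + fr (hx (h (dd y))) \<doteq> fr (hx (\<phi> y)) - fr (Hop y)"
  proof -
    have "fr (dd (h y)) + fr (h (dd y)) \<doteq> fr (\<phi> y) - fr y"
      using veq_sym[OF c[unfolded claim_def]] by (simp add: veq_def algebra_simps)
    from HX_veq[OF this] have "fr (hx (dd (h y))) + fr (hx (h (dd y))) \<doteq> fr (hx (\<phi> y)) - fr (hx y)"
      using typed_wf[OF typed_dd[OF hy]] typed_wf[OF h_typed[OF dy]] typed_wf[OF phi_typed[OF y]] typed_wf[OF y]
      by (simp add: lift_fr)
    also have "\<dots> \<doteq> fr (hx (\<phi> y)) - fr (Hop y)" by (intro veq_diff veq_refl hx_Hop w)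
    finally show ?thesis .
  qed
  have 4: "fr (hx (dd ?P)) \<doteq> fr (hx (\<phi> y)) - fr (Hop ?P')"
  proof -
    have "fr (dd ?P) \<doteq> fr (\<phi> (dd (Hop y)))" using w by (intro phi_dd)
    also have "fr (\<phi> (dd (Hop y))) = PHI (fr (dd (Hop y)))"
      using typed_wf[OF typed_dd[OF Hy(1)]] by (subst lift_fr) simp_all
    also have "\<dots> \<doteq> PHI (fr y - fr (Hop (dd y)))" by (rule PHI_veq[OF dd_Hop_veq[OF w]])
    also have "\<dots> = fr (\<phi> y) - fr ?P'" using typed_wf[OF y] wH by (simp add: lift_fr del: wf_expr.simps)
    finally have "HX (fr (dd ?P)) \<doteq> HX (fr (\<phi> y) - fr ?P')" by (rule HX_veq)
    then have "fr (hx (dd ?P)) \<doteq> fr (hx (\<phi> y)) - fr (hx ?P')"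
      using typed_wf[OF typed_dd[OF p(1)]] typed_wf[OF phi_typed[OF y]] typed_wf[OF p(2)] by (simp add: lift_fr)
    also have "\<dots> \<doteq> fr (hx (\<phi> y)) - fr (Hop ?P')" by (intro veq_diff veq_refl hx_Hop wP)
    finally show ?thesis .
  qed
  \<comment> \<open>An exact identity in the free abelian group: the defect of the claim is a signed
    sum of the defects of the four congruences.\<close>
  have "fr (Hop y) + (fr (dd (h (Hop y))) + fr (h (dd (Hop y)))) - fr ?P
    = (fr (dd (h (Hop y))) - ((fr ?P - fr (hx (dd ?P))) - (fr (h y) - fr (hx (dd (h y))))))
    + (fr (h (dd (Hop y))) - (fr (h y) - (fr (Hop ?P') - fr (hx (h (dd y))))))
    + ((fr (hx (dd (h y))) + fr (hx (h (dd y)))) - (fr (hx (\<phi> y)) - fr (Hop y)))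
    - (fr (hx (dd ?P)) - (fr (hx (\<phi> y)) - fr (Hop ?P')))" by (simp add: algebra_simps)
  also have "null True \<dots>"
    using null_diff[OF null_add[OF null_add[OF 1[unfolded veq_def] 2[unfolded veq_def]] 3[unfolded veq_def]] 4[unfolded veq_def]] .
  finally show ?thesis unfolding claim_def veq_def[symmetric] by (rule veq_sym)
qed

lemma homotopic_to_idI:
  assumes XY: "X \<in> aob C" "Y \<in> aob C" and c: "\<And>t. wf t \<Longrightarrow> claim t"
    and psi: "\<And>d t. typed X Y d t \<Longrightarrow> \<psi> d (dcl X Y d t) = dcl X Y d (\<phi> t)"
  shows "homotopic_to_id R D X Y \<psi>"
proof -
  \<comment> \<open>The homotopy on the quotient acts on a chosen expression; \<open>h_eqv\<close>
    makes the outcome independent of the choice.\<close>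
  define k where "k d K = dcl X Y (d - 1) (h (rep (rep K)))" for d K
  have k: "k d (dcl X Y d t) = dcl X Y (d - 1) (h t)" if t: "typed X Y d t" for d t
  proof -
    have r: "fr (rep (rep (dcl X Y d t))) \<doteq> fr t" "typed X Y d (rep (rep (dcl X Y d t)))"
      using rep_dcl[OF t] by auto
    have "fr (h (rep (rep (dcl X Y d t)))) \<doteq> fr (h t)"
      using veq_typedD[OF r t] by (intro eqv_veq h_eqv)
    then show ?thesis using dcl_eq_iff[OF h_typed[OF r(2)] h_typed[OF t]] by (simp add: k_def)
  qed
  have E: "\<exists>t. x = dcl X Y d t \<and> typed X Y d t" if "x \<in> carrier (shom D X Y d)" for x d
    using that by (auto simp: shom_D[OF XY])
  show ?thesis
    unfolding homotopic_to_id_def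
  proof (intro exI[of _ k] conjI allI ballI)
    show "k d \<in> carrier (shom D X Y d) \<rightarrow> carrier (shom D X Y (d - 1))" for d
      using h_typed by (auto simp: shom_D[OF XY] k)
  next
    fix d x y assume "x \<in> carrier (shom D X Y d)" "y \<in> carrier (shom D X Y d)"
    then obtain s t where "x = dcl X Y d s" "typed X Y d s" "y = dcl X Y d t" "typed X Y d t" using E by metis
    then show "k d (x \<oplus>\<^bsub>shom D X Y d\<^esub> y) = k d x \<oplus>\<^bsub>shom D X Y (d - 1)\<^esub> k d y"
      by (simp add: shom_D(3)[OF XY] k typed_Plus h_typed)
  next
    fix d a x assume "a \<in> carrier R" "x \<in> carrier (shom D X Y d)"
    then obtain t where "a \<in> carrier R" "x = dcl X Y d t" "typed X Y d t" using E by metis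
    then show "k d (a \<odot>\<^bsub>shom D X Y d\<^esub> x) = a \<odot>\<^bsub>shom D X Y (d - 1)\<^esub> k d x"
      by (simp add: shom_D(4)[OF XY] k typed_Scale h_typed)
  next
    fix d x assume "x \<in> carrier (shom D X Y d)"
    then obtain t where t: "x = dcl X Y d t" "typed X Y d t" using E by metis
    have 1: "typed X Y d (dd (h t))" using typed_dd[OF h_typed[OF t(2)]] by simp
    have 2: "typed X Y d (h (dd t))" using h_typed[OF typed_dd[OF t(2)]] by simp
    have "fr (\<phi> t) \<doteq> fr t + (fr (dd (h t)) + fr (h (dd t)))"
      using c[OF typed_wf[OF t(2)]] by (simp add: claim_def)
    also have "\<dots> \<doteq> fr t + fr (Plus (dd (h t)) (h (dd t)))"
      by (intro veq_add veq_refl veq_sym[OF veq_Plus] typed_wf[OF typed_Plus[OF 1 2]])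
    also have "\<dots> \<doteq> fr (Plus t (Plus (dd (h t)) (h (dd t))))"
      by (intro veq_sym[OF veq_Plus] typed_wf[OF typed_Plus[OF t(2) typed_Plus[OF 1 2]]])
    finally have "dcl X Y d (\<phi> t) = dcl X Y d (Plus t (Plus (dd (h t)) (h (dd t))))"
      using dcl_eq_iff[OF phi_typed[OF t(2)] typed_Plus[OF t(2) typed_Plus[OF 1 2]]] by simp
    then show "\<psi> d x = x \<oplus>\<^bsub>shom D X Y d\<^esub>
           (bop D [Arr X Y (d - 1) (k d x)] \<oplus>\<^bsub>shom D X Y d\<^esub> k (d + 1) (bop D [Arr X Y d x]))"
      using bop_D1[OF h_typed[OF t(2)]] bop_D1[OF t(2)] k[OF t(2)] k[OF typed_dd[OF t(2)]] 1 2
      by (simp add: t(1) psi[OF t(2)] shom_D(3)[OF XY] t(2) typed_Plus)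
  qed
qed

end

section \<open>Multiplication by the identities of C, and its homotopies\<close>

context dg_exprs
begin

abbreviation negs :: "('k, 'o, 'm) expr \<Rightarrow> ('k, 'o, 'm) expr" where
  "negs \<equiv> Scale (\<ominus>\<^bsub>R\<^esub> \<one>\<^bsub>R\<^esub>)"

definition phiR :: "('k, 'o, 'm) expr \<Rightarrow> ('k, 'o, 'm) expr" where
  "phiR t = Bop [t, I (etgt t)]"

definition phiL :: "('k, 'o, 'm) expr \<Rightarrow> ('k, 'o, 'm) expr" where
  "phiL t = Scale (sgn_in R (edeg t + 1)) (Bop [I (esrc t), t])"

text \<open>The value on \<open>Bop\<close> comes from the A-infinity relation for \<open>ts\<close>
  followed by the identity: b_{n+1}(t_1, ..., t_n, 1) is the first guess, and the summand of the
  relation that contracts t_n with the identity is corrected by the homotopy at t_n. On generators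
  the unit is strict and zero will do; on \<open>Hop\<close> the formula is the one prescribed by
  \<open>unit_homotopy\<close>.\<close>

fun hr :: "('k, 'o, 'm) expr \<Rightarrow> ('k, 'o, 'm) expr" where
  "hr (Gen X Y d f) = Nul X Y (d - 1)"
| "hr (Nul X Y d) = Nul X Y (d - 1)"
| "hr (Plus s t) = Plus (hr s) (hr t)"
| "hr (Scale a t) = Scale a (hr t)"
| "hr (Bop ts) = Plus (Bop (ts @ [I (etgt (Bop ts))])) (negs (Bop (butlast ts @ [last (map hr ts)])))"
| "hr (Hop t) = Plus (Hop (phiR (Hop t))) (negs (hx (hr t)))"

text \<open>The mirror image of \<open>hr\<close>. The first sign is that of -(i \<otimes> 1
  \<otimes> ... \<otimes> 1)b_{n+1}, the identity of degree -1 passing all of \<open>ts\<close>. The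
  second is the sign of the homotopy, also of degree -1, passing all arguments but the
  first.\<close>

fun hl :: "('k, 'o, 'm) expr \<Rightarrow> ('k, 'o, 'm) expr" where
  "hl (Gen X Y d f) = Nul X Y (d - 1)"
| "hl (Nul X Y d) = Nul X Y (d - 1)"
| "hl (Plus s t) = Plus (hl s) (hl t)"
| "hl (Scale a t) = Scale a (hl t)"
| "hl (Bop ts) = Plus (Scale (sgn_in R (sum_list (map edeg ts) + 1)) (Bop (I (esrc (Bop ts)) # ts)))
    (negs (Scale (sgn_in R (sum_list (map edeg (tl ts)))) (Bop (hd (map hl ts) # tl ts))))"
| "hl (Hop t) = Plus (Hop (phiL (Hop t))) (negs (hx (hl t)))"

declare hr.simps(5) [simp del] hl.simps(5) [simp del]

lemma typed_phiR: "typed X Y d t \<Longrightarrow> typed X Y d (phiR t)"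
  using typed_Bop2[of X Y d t Y "-1" "I Y"] typed_I[of Y] typed_ob[of X Y d t]
  by (simp add: phiR_def typed_def)

lemma typed_phiL: "typed X Y d t \<Longrightarrow> typed X Y d (phiL t)"
  using typed_Bop2[of X X "-1" "I X" Y d t] typed_I[of X] typed_ob[of X Y d t] sgn_closed
  by (simp add: phiL_def typed_def)

lemma typed_hr: "typed X Y d t \<Longrightarrow> typed X Y (d - 1) (hr t)"
proof (induction t arbitrary: X Y d)
  case (Bop ts)
  then obtain X' Y' where p: "path X' ts Y'" and l: "2 \<le> length ts" unfolding typed_def wf_Bop_iff by blast
  have ne: "ts \<noteq> []" using l by auto
  have XY: "X' = X" "Y' = Y" "d = sdeg ts + 1" using Bop_ends[OF p ne] Bop.prems by (auto simp: typed_def)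
  obtain us z where ts: "ts = us @ [z]" using ne by (cases ts rule: rev_cases) auto
  have z: "typed (esrc z) Y (edeg z) z" "path X us (esrc z)" using p XY ts by (auto simp: typed_def)
  have h: "typed (esrc z) Y (edeg z - 1) (hr z)" by (rule Bop.IH[OF _ z(1)]) (simp add: ts)
  have I: "typed Y Y (-1) (I Y)" using typed_I typed_ob[OF z(1)] by blast
  have "path X (ts @ [I Y]) Y" using p I XY by (auto simp: typed_def)
  from typed_Bop[OF this] have 1: "typed X Y (d - 1) (Bop (ts @ [I Y]))" using ne XY by (simp add: Suc_le_eq)
  have "path X (us @ [hr z]) Y" "edeg (hr z) = edeg z - 1" using z h by (auto simp: typed_def)
  from typed_Bop[OF this(1)] this(2) have 2: "typed X Y (d - 1) (Bop (us @ [hr z]))"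
    using l XY ts by (simp add: algebra_simps)
  have Y: "etgt (Bop ts) = Y" using Bop.prems by (simp add: typed_def)
  show ?case unfolding hr.simps(5) Y using typed_Plus[OF 1 typed_neg[OF 2]] by (simp add: ts)
next
  case (Hop t)
  have t: "typed X Y (d + 1) t" "X \<in> B \<or> Y \<in> B" using Hop.prems by (auto simp: typed_def)
  have 1: "typed X Y (d - 1) (Hop (phiR (Hop t)))"
    using typed_phiR[OF Hop.prems] t by (auto simp: typed_def phiR_def)
  have 2: "typed X Y (d - 1) (hx (hr t))" using typed_hx[OF Hop.IH[OF t(1)]] by simp
  show ?case using typed_Plus[OF 1 typed_neg[OF 2]] by simp
qed (auto simp: typed_def)

lemma typed_hl: "typed X Y d t \<Longrightarrow> typed X Y (d - 1) (hl t)"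
proof (induction t arbitrary: X Y d)
  case (Bop ts)
  then obtain X' Y' where p: "path X' ts Y'" and l: "2 \<le> length ts" unfolding typed_def wf_Bop_iff by blast
  have ne: "ts \<noteq> []" using l by auto
  have XY: "X' = X" "Y' = Y" "d = sdeg ts + 1" using Bop_ends[OF p ne] Bop.prems by (auto simp: typed_def)
  obtain us z where ts: "ts = z # us" using ne by (cases ts) auto
  have z: "typed X (etgt z) (edeg z) z" "path (etgt z) us Y" using p XY ts by (auto simp: typed_def)
  have h: "typed X (etgt z) (edeg z - 1) (hl z)" by (rule Bop.IH[OF _ z(1)]) (simp add: ts)
  have I: "typed X X (-1) (I X)" using typed_I typed_ob[OF z(1)] by blast
  have "path X (I X # ts) Y" using p I XY by (auto simp: typed_def)
  from typed_Bop[OF this] have 1: "typed X Y (d - 1) (Bop (I X # ts))" using ne XY by (simp add: Suc_le_eq)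
  have "path X (hl z # us) Y" "edeg (hl z) = edeg z - 1" using z h by (auto simp: typed_def)
  from typed_Bop[OF this(1)] this(2) have 2: "typed X Y (d - 1) (Bop (hl z # us))"
    using l XY ts by (simp add: algebra_simps)
  have X: "esrc (Bop ts) = X" using Bop.prems by (simp add: typed_def)
  show ?case unfolding hl.simps(5) X
    using typed_Plus[OF typed_Scale[OF sgn_closed 1] typed_neg[OF typed_Scale[OF sgn_closed 2]]] by (simp add: ts)
next
  case (Hop t)
  have t: "typed X Y (d + 1) t" "X \<in> B \<or> Y \<in> B" using Hop.prems by (auto simp: typed_def)
  have 1: "typed X Y (d - 1) (Hop (phiL (Hop t)))"
    using typed_phiL[OF Hop.prems] t by (auto simp: typed_def phiL_def)
  have 2: "typed X Y (d - 1) (hx (hl t))" using typed_hx[OF Hop.IH[OF t(1)]] by simp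
  show ?case using typed_Plus[OF 1 typed_neg[OF 2]] by simp
qed (auto simp: typed_def)

lemma hr_Bop:
  assumes p: "path X (us @ [z]) Y" and us: "us \<noteq> []"
  shows "fr (hr (Bop (us @ [z]))) \<doteq> fr (Bop (us @ [z, I Y])) - fr (Bop (us @ [hr z]))"
proof -
  have z: "typed (esrc z) Y (edeg z) z" "path X us (esrc z)" using p by (auto simp: typed_def)
  have h: "typed (esrc z) Y (edeg z - 1) (hr z)" by (rule typed_hr[OF z(1)])
  have I: "typed Y Y (-1) (I Y)" using typed_I typed_ob[OF z(1)] by blast
  let ?d = "sdeg us + edeg z"
  have "path X (us @ [z, I Y]) Y" using z I by (auto simp: typed_def)
  from typed_Bop[OF this] have 1: "typed X Y ?d (Bop (us @ [z, I Y]))" by simp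
  have "path X (us @ [hr z]) Y" "edeg (hr z) = edeg z - 1" using z h by (auto simp: typed_def)
  from typed_Bop[OF this(1)] this(2) have 2: "typed X Y ?d (Bop (us @ [hr z]))"
    using us by (simp add: algebra_simps Suc_le_eq)
  have Y: "etgt (Bop (us @ [z])) = Y" using Bop_ends[OF p] by simp
  show ?thesis
    unfolding hr.simps(5) Y using veq_Plus_neg[OF 1 2] by simp
qed

lemma hl_Bop:
  assumes p: "path X (z # us) Y" and us: "us \<noteq> []"
  shows "fr (hl (Bop (z # us))) \<doteq> sgm (edeg z + sdeg us + 1) (fr (Bop (I X # z # us))) - sgm (sdeg us) (fr (Bop (hl z # us)))"
proof -
  have z: "typed X (etgt z) (edeg z) z" "path (etgt z) us Y" using p by (auto simp: typed_def)
  have h: "typed X (etgt z) (edeg z - 1) (hl z)" by (rule typed_hl[OF z(1)])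
  have I: "typed X X (-1) (I X)" using typed_I typed_ob[OF z(1)] by blast
  let ?d = "edeg z + sdeg us"
  have "path X (I X # z # us) Y" using z I by (auto simp: typed_def)
  from typed_Bop[OF this] have 1: "typed X Y ?d (Bop (I X # z # us))" by simp
  have "path X (hl z # us) Y" "edeg (hl z) = edeg z - 1" using z h by (auto simp: typed_def)
  from typed_Bop[OF this(1)] this(2) have 2: "typed X Y ?d (Bop (hl z # us))"
    using us by (simp add: algebra_simps Suc_le_eq)
  have X: "esrc (Bop (z # us)) = X" using Bop_ends[OF p] by simp
  have "fr (hl (Bop (z # us))) \<doteq> fr (Scale (sgn_in R (edeg z + sdeg us + 1)) (Bop (I X # z # us)))
      - fr (Scale (sgn_in R (sdeg us)) (Bop (hl z # us)))"
    unfolding hl.simps(5) X using veq_Plus_neg[OF typed_Scale[OF sgn_closed 1] typed_Scale[OF sgn_closed 2]]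
    by simp
  also have "\<dots> \<doteq> sgm (edeg z + sdeg us + 1) (fr (Bop (I X # z # us))) - sgm (sdeg us) (fr (Bop (hl z # us)))"
    using 1 2 by (intro veq_diff veq_Scale_sgn) (auto simp: typed_def)
  finally show ?thesis .
qed

lemma admissible_phiR: "admissible wf phiR"
proof -
  have a: "fr (phiR s) \<doteq> fr (phiR t)" if st: "eqv True s t" for s t
  proof -
    have w: "wf (phiR s)" "etgt s = etgt t"
      using eqv_typed[OF st] typed_phiR[of "esrc s" "etgt s" "edeg s" s] by (auto simp: typed_def)
    show ?thesis using qeq_Bop[OF st, of "[]" "[I (etgt s)]"] w by (auto simp: phiR_def intro!: eqv_veq)
  qed
  have "fr (phiR (Plus s t)) \<doteq> fr (phiR s) + fr (phiR t)" if st: "wf (Plus s t)" for s t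
    using admissible_slot[of "[]" "[I (etgt s)]"] st typed_phiR[of "esrc s" "etgt s" "edeg s" s]
    unfolding admissible_def by (auto simp: phiR_def typed_def)
  then show ?thesis using a unfolding admissible_def by (auto dest: eqv_typed)
qed

lemma phiL_veq: "wf t \<Longrightarrow> fr (phiL t) \<doteq> sgm (edeg t + 1) (fr (Bop [I (esrc t), t]))"
  using typed_phiL[of "esrc t" "etgt t" "edeg t" t] unfolding phiL_def
  by (intro veq_Scale_sgn) (auto simp: typed_def)

lemma admissible_phiL: "admissible wf phiL"
proof -
  have a: "fr (phiL s) \<doteq> fr (phiL t)" if st: "eqv True s t" for s t
  proof -
    have w: "wf (phiL s)" "wf (phiL t)" "esrc s = esrc t" "edeg s = edeg t" "wf s" "wf t"
      using eqv_typed[OF st] typed_phiL[of "esrc s" "etgt s" "edeg s" s] typed_phiL[of "esrc s" "etgt s" "edeg s" t]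
      by (auto simp: typed_def)
    have "fr (Bop [I (esrc s), s]) \<doteq> fr (Bop [I (esrc s), t])"
      using qeq_Bop[OF st, of "[I (esrc s)]" "[]"] w by (auto simp: phiL_def intro!: eqv_veq)
    from veq_trans[OF veq_trans[OF phiL_veq[OF w(5)] veq_sgm[OF this]] veq_sym[OF phiL_veq[OF w(6), folded w(3,4)]]]
    show ?thesis .
  qed
  have "fr (phiL (Plus s t)) \<doteq> fr (phiL s) + fr (phiL t)" if st: "wf (Plus s t)" for s t
  proof -
    let ?d = "edeg s + 1" and ?X = "esrc s"
    have w: "wf s" "wf t" "esrc t = ?X" "edeg t + 1 = ?d" using st by auto
    have "fr (Bop [I ?X, Plus s t]) \<doteq> fr (Bop [I ?X, s]) + fr (Bop [I ?X, t])"
      using admissible_slot[of "[I ?X]" "[]"] st typed_phiL[of "esrc s" "etgt s" "edeg s" s]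
      unfolding admissible_def by (auto simp: phiL_def typed_def)
    from veq_sgm[OF this, of ?d]
    have 1: "sgm ?d (fr (Bop [I ?X, Plus s t])) \<doteq> sgm ?d (fr (Bop [I ?X, s])) + sgm ?d (fr (Bop [I ?X, t]))"
      by (simp only: sgm_simps)
    have "fr (phiL (Plus s t)) \<doteq> sgm ?d (fr (Bop [I ?X, Plus s t]))"
      using phiL_veq[OF st] by (simp only: edeg.simps esrc.simps)
    also note 1
    also have "sgm ?d (fr (Bop [I ?X, s])) + sgm ?d (fr (Bop [I ?X, t])) \<doteq> fr (phiL s) + fr (phiL t)"
      using veq_add[OF phiL_veq[OF w(1)] phiL_veq[OF w(2)]] unfolding w(3,4) by (rule veq_sym)
    finally show ?thesis .
  qed
  then show ?thesis using a unfolding admissible_def by (auto dest: eqv_typed)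
qed

lemma phiR_Scale: "a \<in> carrier R \<Longrightarrow> wf t \<Longrightarrow> fr (phiR (Scale a t)) \<doteq> scl a (fr (phiR t))"
proof -
  assume at: "a \<in> carrier R" "wf t"
  have w: "wf (Bop ([] @ t # [I (etgt t)]))"
    using typed_phiR[of "esrc t" "etgt t" "edeg t" t] at by (simp add: phiR_def typed_def)
  show ?thesis
    using multilinD(2)[OF multilin_slot[OF w, of "\<lambda>s t. False"] at(1), of t] at(2)
    by (simp add: phiR_def typed_def)
qed

lemma phiL_Scale: "a \<in> carrier R \<Longrightarrow> wf t \<Longrightarrow> fr (phiL (Scale a t)) \<doteq> scl a (fr (phiL t))"
proof -
  assume at: "a \<in> carrier R" "wf t"
  have w: "wf (Bop ([I (esrc t)] @ t # []))"
    using typed_phiL[of "esrc t" "etgt t" "edeg t" t] at by (simp add: phiL_def typed_def)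
  have 1: "fr (Bop [I (esrc t), Scale a t]) \<doteq> scl a (fr (Bop [I (esrc t), t]))"
    using multilinD(2)[OF multilin_slot[OF w, of "\<lambda>s t. False"] at(1), of t] at(2)
    by (simp add: typed_def)
  have "fr (phiL (Scale a t)) \<doteq> sgm (edeg t + 1) (fr (Bop [I (esrc t), Scale a t]))"
    using phiL_veq[of "Scale a t"] at by (simp only: edeg.simps esrc.simps wf_expr.simps)
  also have "\<dots> \<doteq> sgm (edeg t + 1) (scl a (fr (Bop [I (esrc t), t])))" by (rule veq_sgm[OF 1])
  also have "\<dots> = scl a (sgm (edeg t + 1) (fr (Bop [I (esrc t), t])))" by (simp only: lift_simps)
  also have "\<dots> \<doteq> scl a (fr (phiL t))" using at by (intro scl_veq veq_sym[OF phiL_veq])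
  finally show ?thesis .
qed

lemma phiR_dd: "wf t \<Longrightarrow> fr (dd (phiR t)) \<doteq> fr (phiR (dd t))"
proof -
  assume w: "wf t"
  let ?Y = "etgt t"
  have t: "typed (esrc t) ?Y (edeg t) t" using w by (simp add: typed_def)
  have Y: "?Y \<in> aob C" using wf_ob[OF w] by simp
  have e: "etgt (dd t) = ?Y" using typed_dd[OF t] by (simp add: typed_def)
  have n: "fr (Bop [t, dd (I ?Y)]) \<doteq> 0" by (rule Bop2_null(2)[OF t typed_dd[OF typed_I[OF Y]] dd_I[OF Y]])
  show ?thesis using veq_diff[OF relation2[OF t typed_I[OF Y]] n] e by (simp add: phiR_def veq_def del: ediff.simps)
qed

lemma phiL_dd: "wf t \<Longrightarrow> fr (dd (phiL t)) \<doteq> fr (phiL (dd t))"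
proof -
  assume w: "wf t"
  let ?X = "esrc t" and ?d = "edeg t"
  have t: "typed ?X (etgt t) (edeg t) t" using w by (simp add: typed_def)
  have X: "?X \<in> aob C" using wf_ob[OF w] by simp
  have e: "esrc (dd t) = ?X" "edeg (dd t) = ?d + 1" "wf (dd t)" using typed_dd[OF t] by (auto simp: typed_def)
  have n: "fr (Bop [dd (I ?X), t]) \<doteq> 0" by (rule Bop2_null(1)[OF typed_dd[OF typed_I[OF X]] t dd_I[OF X]])
  have 1: "fr (dd (Bop [I ?X, t])) \<doteq> - fr (Bop [I ?X, dd t])"
    using veq_diff[OF relation2[OF typed_I[OF X] t] veq_sgm[OF n, of ?d]] by (simp add: veq_def del: ediff.simps)
  have tb: "typed ?X (etgt t) ?d (Bop [I ?X, t])" using typed_Bop2[OF typed_I[OF X] t] by simp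
  have "fr (dd (phiL t)) = fr (Scale (sgn_in R (?d + 1)) (dd (Bop [I ?X, t])))" by (simp add: phiL_def)
  also have "\<dots> \<doteq> sgm (?d + 1) (fr (dd (Bop [I ?X, t])))"
    using typed_dd[OF tb] by (intro veq_Scale_sgn) (simp add: typed_def)
  also have "\<dots> \<doteq> sgm (?d + 1) (- fr (Bop [I ?X, dd t]))" by (rule veq_sgm[OF 1])
  also have "\<dots> = sgm (edeg (dd t) + 1) (fr (Bop [I (esrc (dd t)), dd t]))" by (simp add: e sgm_def)
  also have "\<dots> \<doteq> fr (phiL (dd t))" by (rule veq_sym[OF phiL_veq[OF e(3)]])
  finally show ?thesis .
qed

lemma hr_multilin:
  assumes w: "wf (Bop (us @ t0 # vs))"
  shows "multilin (\<lambda>t t'. eqv True t t' \<and> fr (hr t) \<doteq> fr (hr t')) (typed (esrc t0) (etgt t0) (edeg t0))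
    (\<lambda>t. fr (hr (Bop (us @ t # vs))))" (is "multilin ?\<kappa> ?\<tau> _")
proof -
  obtain X Y where p: "path X (us @ t0 # vs) Y" and l: "1 \<le> length us + length vs"
    using w unfolding wf_Bop_iff by auto
  have Y: "Y \<in> aob C" using wf_ob[OF w] Bop_ends[OF p] by simp
  have I: "wf (I Y)" using typed_I[OF Y] by (simp add: typed_def)
  have tp: "path X (us @ t # vs) Y" if "?\<tau> t" for t using p that by (auto simp: typed_def)
  \<comment> \<open>\<open>hr\<close> enters the last argument alone. The varying argument is either
    that one, where the congruence of \<open>hr t\<close> and \<open>hr t'\<close> is used, or a
    plain argument in both terms of \<open>hr_Bop\<close>.\<close>
  show ?thesis
  proof (cases vs rule: rev_cases)
    case Nil
    then have us: "us \<noteq> []" using l by auto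
    have "path X (us @ [t0, I Y]) Y" using p Nil I by auto
    from wf_BopI[OF this] have w1: "wf (Bop (us @ t0 # [I Y]))" by simp
    have m2: "multilin ?\<kappa> ?\<tau> (\<lambda>t. fr (Bop (us @ hr t # [])))"
    proof (rule multilin_Bop[OF multilin_map[where F = hr] typed_Plus typed_Scale])
      fix t assume "?\<tau> t"
      then have "path X (us @ [hr t]) Y" using p Nil typed_hr[of _ _ _ t] by (auto simp: typed_def)
      then show "wf (Bop (us @ [hr t]))" by (rule wf_BopI) (use us in \<open>auto simp: Suc_le_eq\<close>)
    qed (auto intro: typed_hr)
    show ?thesis
    proof (rule multilin_veq[OF multilin_diff[OF multilin_slot[OF w1] m2]])
      fix t assume "?\<tau> t"
      from hr_Bop[OF _ us, of X t Y] tp[OF this] Nil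
      show "fr (hr (Bop (us @ t # vs))) \<doteq> fr (Bop (us @ t # [I Y])) - fr (Bop (us @ hr t # []))" by simp
    qed (auto intro: typed_Plus typed_Scale)
  next
    case (snoc vs' z)
    have "path X (us @ t0 # vs' @ [z, I Y]) Y" using p snoc I by auto
    from wf_BopI[OF this] have w1: "wf (Bop (us @ t0 # (vs' @ [z, I Y])))" by simp
    have "path X (us @ t0 # vs' @ [hr z]) Y" using p snoc typed_hr[of "esrc z" "etgt z" "edeg z" z] by (auto simp: typed_def)
    from wf_BopI[OF this] have w2: "wf (Bop (us @ t0 # (vs' @ [hr z])))" by simp
    show ?thesis
    proof (rule multilin_veq[OF multilin_diff[OF multilin_slot[OF w1] multilin_slot[OF w2]]])
      fix t assume "?\<tau> t"
      from hr_Bop[of X "us @ t # vs'" z Y] tp[OF this] snoc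
      show "fr (hr (Bop (us @ t # vs))) \<doteq> fr (Bop (us @ t # (vs' @ [z, I Y]))) - fr (Bop (us @ t # (vs' @ [hr z])))"
        by simp
    qed (auto intro: typed_Plus typed_Scale)
  qed
qed

lemma hl_multilin:
  assumes w: "wf (Bop (us @ t0 # vs))"
  shows "multilin (\<lambda>t t'. eqv True t t' \<and> fr (hl t) \<doteq> fr (hl t')) (typed (esrc t0) (etgt t0) (edeg t0))
    (\<lambda>t. fr (hl (Bop (us @ t # vs))))" (is "multilin ?\<kappa> ?\<tau> _")
proof -
  obtain X Y where p: "path X (us @ t0 # vs) Y" and l: "1 \<le> length us + length vs"
    using w unfolding wf_Bop_iff by auto
  have X: "X \<in> aob C" using wf_ob[OF w] Bop_ends[OF p] by simp
  have I: "wf (I X)" using typed_I[OF X] by (simp add: typed_def)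
  have tp: "path X (us @ t # vs) Y" if "?\<tau> t" for t using p that by (auto simp: typed_def)
  have "path X (I X # us @ t0 # vs) Y" using p I by auto
  from wf_BopI[OF this] have w1: "wf (Bop ((I X # us) @ t0 # vs))" by simp
  show ?thesis
  proof (cases us)
    case Nil
    then have vs: "vs \<noteq> []" using l by auto
    have m2: "multilin ?\<kappa> ?\<tau> (\<lambda>t. fr (Bop ([] @ hl t # vs)))"
    proof (rule multilin_Bop[OF multilin_map[where F = hl] typed_Plus typed_Scale])
      fix t assume "?\<tau> t"
      then have "path X ([] @ hl t # vs) Y" using p Nil typed_hl[of _ _ _ t] by (auto simp: typed_def)
      then show "wf (Bop ([] @ hl t # vs))" by (rule wf_BopI) (use vs in \<open>auto simp: Suc_le_eq\<close>)
    qed (auto intro: typed_hl)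
    show ?thesis
    proof (rule multilin_veq[OF multilin_diff[OF multilin_sgm[OF multilin_slot[OF w1], of _ "edeg t0 + sdeg vs + 1"]
            multilin_sgm[OF m2, of "sdeg vs"]]])
      fix t assume t: "?\<tau> t"
      from hl_Bop[OF _ vs, of X t Y] tp[OF this] Nil t
      show "fr (hl (Bop (us @ t # vs))) \<doteq> sgm (edeg t0 + sdeg vs + 1) (fr (Bop ((I X # us) @ t # vs)))
          - sgm (sdeg vs) (fr (Bop ([] @ hl t # vs)))" by (simp add: typed_def del: sgm_succ)
    qed (auto intro: typed_Plus typed_Scale)
  next
    case (Cons z us')
    let ?e = "edeg z + (sdeg us' + (edeg t0 + sdeg vs)) + 1"
    have "path X (hl z # us' @ t0 # vs) Y" using p Cons typed_hl[of "esrc z" "etgt z" "edeg z" z] by (auto simp: typed_def)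
    from wf_BopI[OF this] have w2: "wf (Bop ((hl z # us') @ t0 # vs))" by simp
    show ?thesis
    proof (rule multilin_veq[OF multilin_diff[OF multilin_sgm[OF multilin_slot[OF w1], of _ ?e]
            multilin_sgm[OF multilin_slot[OF w2], of _ "sdeg us' + (edeg t0 + sdeg vs)"]]])
      fix t assume t: "?\<tau> t"
      from hl_Bop[of X z "us' @ t # vs" Y] tp[OF this] Cons t
      show "fr (hl (Bop (us @ t # vs))) \<doteq> sgm ?e (fr (Bop ((I X # us) @ t # vs)))
          - sgm (sdeg us' + (edeg t0 + sdeg vs)) (fr (Bop ((hl z # us') @ t # vs)))"
        by (simp add: typed_def del: sgm_succ)
    qed (auto intro: typed_Plus typed_Scale)
  qed
qed

lemma composable_snoc_ident:
  assumes "composable C xs"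
  shows "composable C (xs @ [Arr (btgt xs) (btgt xs) (-1) (ident (btgt xs))])"
    "composable C (Arr (bsrc xs) (bsrc xs) (-1) (ident (bsrc xs)) # xs)"
proof -
  have p: "path (bsrc xs) (map genx xs) (btgt xs)" and ne: "xs \<noteq> []" using assms composable_path by auto
  have XY: "bsrc xs \<in> aob C" "btgt xs \<in> aob C" using wf_ob[OF wf_barr[OF assms]] by simp_all
  have "path (bsrc xs) (map genx (xs @ [Arr (btgt xs) (btgt xs) (-1) (ident (btgt xs))])) (btgt xs)"
    using p XY by (auto simp: genx_def ident_closed)
  moreover have "path (bsrc xs) (map genx (Arr (bsrc xs) (bsrc xs) (-1) (ident (bsrc xs)) # xs)) (btgt xs)"
    using p XY by (auto simp: genx_def ident_closed)
  ultimately show "composable C (xs @ [Arr (btgt xs) (btgt xs) (-1) (ident (btgt xs))])"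
    "composable C (Arr (bsrc xs) (bsrc xs) (-1) (ident (bsrc xs)) # xs)"
    unfolding composable_iff by blast+
qed

text \<open>\<open>hr\<close> is zero on generators, so to respect the identification of b_n on C it
  has to vanish here. Both terms of \<open>hr_Bop\<close> do: the first is an operation on at least
  three morphisms of C, the second has \<open>hr\<close> of a generator as an argument.\<close>

lemma hr_gen:
  assumes xs: "composable C xs" "2 \<le> length xs"
  shows "fr (hr (Bop (map genx xs))) \<doteq> 0"
proof -
  have p: "path (bsrc xs) (map genx xs) (btgt xs)" using xs composable_path by blast
  obtain ys x where ys: "xs = ys @ [x]" "ys \<noteq> []" using xs(2) by (cases xs rule: rev_cases) (auto simp: Suc_le_eq)
  let ?i = "Arr (btgt xs) (btgt xs) (-1) (ident (btgt xs))"
  have n1: "fr (Bop (map genx ys @ [genx x, I (btgt xs)])) \<doteq> 0"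
    using genx_higher_null[OF composable_snoc_ident(1)[OF xs(1)]] xs(2) ys by (simp add: genx_def)
  have hx: "hr (genx x) = Nul (asrc x) (atgt x) (adeg x - 1)" by (simp add: genx_def)
  have x: "asrc x \<in> aob C" "atgt x \<in> aob C" using xs ys by (auto simp: composable_def)
  have n2: "fr (Bop (map genx ys @ [hr (genx x)])) \<doteq> 0"
    by (rule Bop_null[of "bsrc xs" _ _ _ "btgt xs"]) (use p ys x in \<open>auto simp: hx veq_Nul\<close>)
  have "fr (hr (Bop (map genx ys @ [genx x]))) \<doteq> fr (Bop (map genx ys @ [genx x, I (btgt xs)])) - fr (Bop (map genx ys @ [hr (genx x)]))"
    by (rule hr_Bop[of "bsrc xs"]) (use p ys in auto)
  also have "\<dots> \<doteq> 0 - 0" by (intro veq_diff n1 n2)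
  finally show ?thesis by (simp add: ys)
qed

lemma hl_gen:
  assumes xs: "composable C xs" "2 \<le> length xs"
  shows "fr (hl (Bop (map genx xs))) \<doteq> 0"
proof -
  have p: "path (bsrc xs) (map genx xs) (btgt xs)" using xs composable_path by blast
  obtain ys x where ys: "xs = x # ys" "ys \<noteq> []" using xs(2) by (cases xs) (auto simp: Suc_le_eq)
  have n1: "fr (Bop (I (bsrc xs) # genx x # map genx ys)) \<doteq> 0"
    using genx_higher_null[OF composable_snoc_ident(2)[OF xs(1)]] xs(2) ys by (simp add: genx_def)
  have hx: "hl (genx x) = Nul (asrc x) (atgt x) (adeg x - 1)" by (simp add: genx_def)
  have x: "asrc x \<in> aob C" "atgt x \<in> aob C" using xs ys by (auto simp: composable_def)
  have n2: "fr (Bop ([] @ hl (genx x) # map genx ys)) \<doteq> 0"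
    by (rule Bop_null[of "bsrc xs" _ _ _ "btgt xs"]) (use p ys x in \<open>auto simp: hx veq_Nul\<close>)
  have "fr (hl (Bop (genx x # map genx ys))) \<doteq>
      sgm (edeg (genx x :: ('k, 'o, 'm) expr) + sdeg (map genx ys :: ('k, 'o, 'm) expr list) + 1) (fr (Bop (I (bsrc xs) # genx x # map genx ys)))
      - sgm (sdeg (map genx ys :: ('k, 'o, 'm) expr list)) (fr (Bop (hl (genx x) # map genx ys)))"
    by (rule hl_Bop[of "bsrc xs" _ _ "btgt xs"]) (use p ys in auto)
  also have "\<dots> \<doteq> sgm (edeg (genx x :: ('k, 'o, 'm) expr) + sdeg (map genx ys :: ('k, 'o, 'm) expr list) + 1) 0 - sgm (sdeg (map genx ys :: ('k, 'o, 'm) expr list)) 0"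
    using n2 by (intro veq_diff veq_sgm n1) simp
  finally show ?thesis by (simp add: ys)
qed

lemma in_P_phi: "in_P (phiR t)" "in_P (phiL t)"
  by (simp_all add: phiR_def phiL_def)

lemma unit_homotopy_right: "unit_homotopy R C B ident phiR hr"
proof
  show "hr (Hop t) = Plus (Hop (phiR (Hop t))) (Scale (\<ominus>\<^bsub>R\<^esub> \<one>\<^bsub>R\<^esub>) (hx (hr t)))" for t by simp
qed (auto intro: typed_phiR admissible_phiR phiR_Scale phiR_dd typed_hr hr_gen hr_multilin in_P_phi)

lemma unit_homotopy_left: "unit_homotopy R C B ident phiL hl"
proof
  show "hl (Hop t) = Plus (Hop (phiL (Hop t))) (Scale (\<ominus>\<^bsub>R\<^esub> \<one>\<^bsub>R\<^esub>) (hx (hl t)))" for t by simp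
qed (auto intro: typed_phiL admissible_phiL phiL_Scale phiL_dd typed_hl hl_gen hl_multilin in_P_phi)

text \<open>For \<open>Bop ts\<close> a certain sum of terms \<open>k\<close> over all contractions
  of one block of \<open>ts\<close> is evaluated twice. Comparison with \<open>hr\<close> applied to
  the relation for \<open>ts\<close> leaves the block that is all of \<open>ts\<close>, which gives
  \<open>phiR (Bop ts)\<close> minus the two homotopy terms of the claim. Expanding \<open>k\<close>
  instead, the relations for \<open>ts\<close> followed by the identity and for \<open>us\<close>
  followed by \<open>hr z\<close> cancel everything but \<open>fr (Bop ts)\<close>, which is
  contributed by the claim for the last argument \<open>z\<close>.\<close>

lemma claim_right:
  assumes "wf t"
  shows "fr (phiR t) \<doteq> fr t + (fr (dd (hr t)) + fr (hr (dd t)))"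
proof -
  interpret r: unit_homotopy R C B ident phiR hr by (rule unit_homotopy_right)
  from assms have "r.claim t"
  proof (induction t)
    case (Gen X Y d f)
    then have w: "X \<in> aob C" "Y \<in> aob C" "f \<in> carrier (shom C X Y d)" by auto
    let ?xs = "[Arr X Y d f, Arr Y Y (-1) (ident Y)]"
    have c: "composable C ?xs" using w ident_closed by (auto simp: composable_def)
    have b: "barr C ?xs = Arr X Y d f" using ident_right[OF w] by (simp add: barr_def bsrc_def btgt_def bdeg_def)
    have "fr (phiR (Gen X Y d f)) \<doteq> fr (Gen X Y d f)"
      using bb_genx[OF c] by (simp add: b) (simp add: phiR_def genx_def)
    moreover have "fr (dd (hr (Gen X Y d f))) + fr (hr (dd (Gen X Y d f))) \<doteq> 0 + 0"
      using w by (intro veq_add) (simp_all add: veq_Nul)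
    ultimately show ?case unfolding r.claim_def using veq_add[OF _ veq_sym] by fastforce
  next
    case (Bop ts)
    obtain X Y where p0: "path X ts Y" and l: "2 \<le> length ts" using Bop.prems unfolding wf_Bop_iff by blast
    have "ts \<noteq> []" using l by auto
    then obtain us z where ts: "ts = us @ [z]" by (cases ts rule: rev_cases) auto
    have us: "us \<noteq> []" using l ts by auto
    have p: "path X (us @ [z]) Y" using p0 ts by simp
    let ?i = "I Y"
    have z: "typed (esrc z) Y (edeg z) z" "path X us (esrc z)" "wf z" using p by (auto simp: typed_def)
    have Y: "Y \<in> aob C" using typed_ob[OF z(1)] by simp
    have hz: "typed (esrc z) Y (edeg z - 1) (hr z)" by (rule typed_hr[OF z(1)])
    have dz: "edeg (hr z) = edeg z - 1" using hz by (simp add: typed_def)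
    have cz: "fr (Bop [z, ?i]) \<doteq> fr z + (fr (dd (hr z)) + fr (hr (dd z)))"
    proof -
      have "r.claim z" using Bop.IH[of z] z ts by simp
      moreover have "etgt z = Y" using z by (simp add: typed_def)
      ultimately show ?thesis unfolding r.claim_def phiR_def by simp
    qed
    have pi: "path X (ts @ [?i]) Y" and ph: "path X (us @ [hr z]) Y"
      using p ts typed_I[OF Y] hz z by (auto simp: typed_def)
    \<comment> \<open>The right-hand side of \<open>hr_Bop\<close>, extended to lists of one entry,
      where it is multiplication by the identity minus the differential of
      \<open>hr\<close>.\<close>
    define k where "k w = fr (b (w @ [?i])) - fr (b (butlast w @ [hr (last w)]))" for w
    have hk: "fr (hr (Bop w)) \<doteq> k w" if "path X' w Y" "2 \<le> length w" for w X'
    proof -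
      have "w \<noteq> []" using that(2) by auto
      then obtain us z where "w = us @ [z]" by (cases w rule: rev_cases) auto
      then show ?thesis using hr_Bop[of X' us z Y] that by (auto simp: k_def Suc_le_eq)
    qed
    let ?S = "\<Sum>(u, m, v)\<in>splits3 ts. sgm (sdeg v) (k (u @ b m # v))"
    have pS: "path X (u @ b m # v) Y" if "(u, m, v) \<in> splits3 ts" for u m v
      using path_insertion[OF p0 that] .
    \<comment> \<open>A proper contraction leaves at least two entries, where \<open>k\<close>
      agrees with \<open>hr\<close> of the operation, and the values of \<open>hr\<close> sum to
      zero by the relation for \<open>ts\<close>.\<close>
    have S1: "?S \<doteq> k [Bop ts] - fr (hr (dd (Bop ts)))"
    proof -
      have "(\<Sum>(u, m, v)\<in>splits3 ts. sgm (sdeg v) (r.HH (fr (b (u @ b m # v))))) \<doteq> 0"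
        using r.HH_veq[OF ainf_relation[OF p0 l]] by (simp add: lift_sum split_def)
      moreover have "(\<Sum>(u, m, v)\<in>splits3 ts. sgm (sdeg v) (k (u @ b m # v)))
          - (\<Sum>(u, m, v)\<in>splits3 ts. sgm (sdeg v) (r.HH (fr (b (u @ b m # v)))))
          \<doteq> (\<Sum>(u, m, v)\<in>splits3 ts. if u = [] \<and> v = [] then k [Bop m] - fr (hr (dd (Bop m))) else 0)"
        unfolding sum_subtractf[symmetric]
      proof (rule veq_sum)
        fix x assume x: "x \<in> splits3 ts"
        obtain u m v where x': "x = (u, m, v)" by (cases x)
        have q: "path X (u @ b m # v) Y" using pS x x' by simp
        have w: "wf (b (u @ b m # v))" using typed_bb[OF q] by (simp add: typed_def)
        have "sgm (sdeg v) (k (u @ b m # v)) - sgm (sdeg v) (r.HH (fr (b (u @ b m # v))))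
            \<doteq> (if u = [] \<and> v = [] then k [Bop m] - fr (hr (dd (Bop m))) else 0)"
        proof (cases "u = [] \<and> v = []")
          case True
          then have "m = ts" using x x' by (simp add: splits3_def)
          then show ?thesis using True w l by (simp add: lift_fr)
        next
          case False
          then have "fr (hr (b (u @ b m # v))) \<doteq> k (u @ b m # v)"
            using hk[OF q] by (auto simp: Suc_le_eq)
          from veq_sgm[OF veq_sym[OF this], of "sdeg v"] False w show ?thesis
            by (auto simp: lift_fr veq_def)
        qed
        then show "(case x of (u, m, v) \<Rightarrow> sgm (sdeg v) (k (u @ b m # v)))
            - (case x of (u, m, v) \<Rightarrow> sgm (sdeg v) (r.HH (fr (b (u @ b m # v)))))
            \<doteq> (case x of (u, m, v) \<Rightarrow> if u = [] \<and> v = [] then k [Bop m] - fr (hr (dd (Bop m))) else 0)"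
          by (simp add: x')
      qed
      ultimately show ?thesis
        unfolding sum_splits3_full[OF \<open>ts \<noteq> []\<close>, of "\<lambda>m. k [Bop m] - fr (hr (dd (Bop m)))"]
        using veq_add by fastforce
    qed
    let ?A = "\<lambda>u l. fr (b (u @ [Bop (l @ [z, ?i])]))"
    let ?B = "\<lambda>u l. fr (b (u @ [b (l @ [hr z])]))"
    let ?SA = "\<Sum>(u, l)\<in>splits2 us. ?A u l" and ?SB = "\<Sum>(u, l)\<in>splits2 us. ?B u l"
    let ?T1 = "\<Sum>(u, m, v)\<in>splits3 ts. sgm (sdeg v) (fr (b (u @ b m # v @ [?i])))"
    let ?T2 = "\<Sum>(u, m, v)\<in>splits3 ts. sgm (sdeg v) (fr (b (butlast (u @ b m # v) @ [hr (last (u @ b m # v))])))"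
    let ?T3 = "\<Sum>(u, m, v)\<in>splits3 us. sgm (sdeg v + edeg z) (fr (b (u @ b m # v @ [hr z])))"
    have S: "?S = ?T1 - ?T2"
      unfolding sum_subtractf[symmetric] by (rule sum.cong) (auto simp: k_def)
    \<comment> \<open>In the relation for \<open>ts\<close> followed by the identity, blocks that
      avoid the identity give \<open>- ?T1\<close>, the sign coming from its degree -1. The identity
      alone contributes b_1 of a cocycle, and the remaining blocks end with the identity and give
      \<open>?SA\<close>.\<close>
    have T1: "?T1 \<doteq> ?SA"
    proof -
      have n: "fr (b (ts @ [dd ?i])) \<doteq> 0"
      proof -
        have "path X (ts @ [dd ?i]) Y" using p0 typed_dd[OF typed_I[OF Y]] by (auto simp: typed_def)
        from Bop_null[OF this _ dd_I[OF Y]] l show ?thesis by (auto simp: ts)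
      qed
      have e1: "(\<Sum>(u, m, v)\<in>splits3 (ts @ [?i]). sgm (sdeg v) (fr (b (u @ b m # v)))) \<doteq> 0"
        by (rule ainf_relation[OF pi]) (use l in simp)
      have e2: "(\<Sum>(u, m, v)\<in>splits3 (ts @ [?i]). sgm (sdeg v) (fr (b (u @ b m # v))))
        = - ?T1 + (fr (b (ts @ [dd ?i])) + ?SA)"
      proof -
        have "(\<Sum>(u, m, v)\<in>splits3 ts. sgm (sdeg (v @ [?i])) (fr (b (u @ b m # v @ [?i])))) = - ?T1"
          unfolding sum_negf[symmetric] by (rule sum.cong) auto
        moreover have "(\<Sum>(u, l)\<in>splits2 us. sgm (sdeg ([] :: ('k, 'o, 'm) expr list)) (fr (b (u @ b ((l @ [z]) @ [?i]) # [])))) = ?SA"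
          by (rule sum.cong) auto
        ultimately show ?thesis
          unfolding sum_splits3_snoc ts sum_splits2_snoc by (simp add: ts)
      qed
      have "- ?T1 + (fr (b (ts @ [dd ?i])) + ?SA) - fr (b (ts @ [dd ?i])) \<doteq> 0 - 0"
        by (rule veq_diff[OF e1[unfolded e2] n])
      then have "?SA \<doteq> ?T1" by (simp add: veq_def)
      then show ?thesis by (rule veq_sym)
    qed
    have T3: "?T3 \<doteq> ?SB"
    proof -
      have "(\<Sum>(u, m, v)\<in>splits3 (us @ [hr z]). sgm (sdeg v) (fr (b (u @ b m # v)))) \<doteq> 0"
        by (rule ainf_relation[OF ph]) (use us in \<open>simp add: Suc_le_eq\<close>)
      moreover have "(\<Sum>(u, m, v)\<in>splits3 (us @ [hr z]). sgm (sdeg v) (fr (b (u @ b m # v)))) = - ?T3 + ?SB"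
      proof -
        have "(\<Sum>(u, m, v)\<in>splits3 us. sgm (sdeg (v @ [hr z])) (fr (b (u @ b m # v @ [hr z])))) = - ?T3"
          unfolding sum_negf[symmetric] by (rule sum.cong) (auto simp: dz)
        then show ?thesis unfolding sum_splits3_snoc by simp
      qed
      ultimately show ?thesis using veq_sym by (simp add: veq_def)
    qed
    let ?G = "\<lambda>u l. fr (b (u @ [hr (b (l @ [z]))]))"
    have T2: "?T2 = ?T3 + (\<Sum>(u, l)\<in>splits2 us. ?G u l)"
      unfolding ts sum_splits3_snoc by (simp add: butlast_append)
    \<comment> \<open>If the block is \<open>z\<close> alone, the claim for \<open>z\<close> applies
      and yields the extra summand \<open>Bop ts\<close>. A longer block is itself an operation, and
      \<open>hr_Bop\<close> applies.\<close>
    have G: "(\<Sum>(u, l)\<in>splits2 us. ?G u l) \<doteq> ?SA - ?SB - fr (Bop ts)"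
    proof -
      have "(\<Sum>(u, l)\<in>splits2 us. ?G u l) \<doteq> (\<Sum>(u, l)\<in>splits2 us. ?A u l - ?B u l - (if l = [] then fr (Bop ts) else 0))"
      proof (rule veq_sum)
        fix x assume x: "x \<in> splits2 us"
        obtain u l where x': "x = (u, l)" by (cases x)
        have ul: "us = u @ l" using x x' by (simp add: splits2_def)
        obtain Q where Q: "path X u Q" "path Q l (esrc z)" using z(2) ul by auto
        have lz: "path Q (l @ [z]) Y" and lzi: "path Q (l @ [z, ?i]) Y" and lh: "path Q (l @ [hr z]) Y"
          using Q z hz typed_I[OF Y] by (auto simp: typed_def)
        have t1: "typed Q Y (sdeg l + edeg z + 1) (b (l @ [z]))" and t2: "typed Q Y (sdeg l + edeg z) (Bop (l @ [z, ?i]))"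
          and t3: "typed Q Y (sdeg l + edeg z) (b (l @ [hr z]))"
          using typed_bb[OF lz] typed_Bop[OF lzi] typed_bb[OF lh] by (simp_all add: dz algebra_simps)
        have pA: "path X (u @ [Bop (l @ [z, ?i])]) Y" "path X (u @ [b (l @ [hr z])]) Y" "path X (u @ [hr (b (l @ [z]))]) Y"
          using Q t2 t3 typed_hr[OF t1] by (auto simp: typed_def simp del: wf_expr.simps esrc.simps etgt.simps)
        have "?G u l \<doteq> ?A u l - ?B u l - (if l = [] then fr (Bop ts) else 0)"
        proof (cases "l = []")
          case True
          then have u: "u = us" "Q = esrc z" using ul Q by auto
          have "fr (hr (dd z)) \<doteq> fr (Bop [z, ?i]) - fr (dd (hr z)) - fr z"
            using veq_sym[OF cz] by (simp add: veq_def algebra_simps)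
          from slotb_veq[OF this, of us "[]"] show ?thesis
            using slotb_fr[OF pA(1)] slotb_fr[OF pA(2)] slotb_fr[OF pA(3)] slotb_fr[OF p] True u us
            by (simp add: ts)
        next
          case False
          then have "fr (hr (b (l @ [z]))) \<doteq> fr (Bop (l @ [z, ?i])) - fr (b (l @ [hr z]))"
            using hr_Bop[OF lz False] by simp
          from slotb_veq[OF this, of u "[]"] show ?thesis
            using slotb_fr[OF pA(1)] slotb_fr[OF pA(2)] slotb_fr[OF pA(3)] False by simp
        qed
        then show "(case x of (u, l) \<Rightarrow> ?G u l) \<doteq> (case x of (u, l) \<Rightarrow> ?A u l - ?B u l - (if l = [] then fr (Bop ts) else 0))"
          by (simp add: x')
      qed
      also have "(\<Sum>(u, l)\<in>splits2 us. ?A u l - ?B u l - (if l = [] then fr (Bop ts) else 0)) = ?SA - ?SB - fr (Bop ts)"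
        using sum_splits2_right_Nil[of "fr (Bop ts)" us] by (simp add: sum_subtractf split_def)
      finally show ?thesis .
    qed
    have "?T1 - (?T3 + (\<Sum>(u, l)\<in>splits2 us. ?G u l)) \<doteq> ?SA - (?SB + (?SA - ?SB - fr (Bop ts)))"
      by (intro veq_diff veq_add T1 T3 G)
    then have "?S \<doteq> fr (Bop ts)" unfolding S T2 by simp
    from veq_trans[OF veq_sym[OF S1] this]
    have "k [Bop ts] - fr (hr (dd (Bop ts))) \<doteq> fr (Bop ts)" .
    moreover have "k [Bop ts] = fr (phiR (Bop ts)) - fr (dd (hr (Bop ts)))"
      using Bop_ends[OF p0 \<open>ts \<noteq> []\<close>] by (simp add: k_def phiR_def del: etgt.simps(5))
    ultimately show ?case unfolding r.claim_def by (simp add: veq_def algebra_simps)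
  next
    case (Nul X Y d)
    then show ?case by (rule r.claim_Nul)
  next
    case (Plus s t)
    then show ?case by (intro r.claim_Plus) auto
  next
    case (Scale a t)
    then show ?case by (intro r.claim_Scale) auto
  next
    case (Hop t)
    then show ?case by (intro r.claim_Hop) auto
  qed
  then show ?thesis by (simp add: r.claim_def)
qed

text \<open>The count is that of \<open>claim_right\<close> with the identity in front, but the
  signs stay: the identity and the homotopy act at the first place and pass every later argument.
  The relations are therefore multiplied by the sign of \<open>sdeg ts\<close> or
  \<open>sdeg us\<close> before they are compared.\<close>

lemma claim_left:
  assumes "wf t"
  shows "fr (phiL t) \<doteq> fr t + (fr (dd (hl t)) + fr (hl (dd t)))"
proof -
  interpret r: unit_homotopy R C B ident phiL hl by (rule unit_homotopy_left)
  from assms have "r.claim t"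
  proof (induction t)
    case (Gen X Y d f)
    then have w: "X \<in> aob C" "Y \<in> aob C" "f \<in> carrier (shom C X Y d)" by auto
    let ?xs = "[Arr X X (-1) (ident X), Arr X Y d f]"
    have c: "composable C ?xs" using w ident_closed by (auto simp: composable_def)
    let ?g = "bop C ?xs"
    have b: "barr C ?xs = Arr X Y d ?g" by (simp add: barr_def bsrc_def btgt_def bdeg_def)
    have g: "?g \<in> carrier (shom C X Y d)" using b2C_closed[OF w(1,1,2) ident_closed[OF w(1)] w(3)] by simp
    have "fr (phiL (Gen X Y d f)) \<doteq> sgm (d + 1) (fr (Bop [I X, Gen X Y d f]))"
      using phiL_veq[OF Gen] by (simp only: edeg.simps esrc.simps)
    also have "\<dots> \<doteq> sgm (d + 1) (fr (Gen X Y d ?g))"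
      using bb_genx[OF c] by (intro veq_sgm) (simp add: b, simp add: genx_def)
    also have "\<dots> \<doteq> fr (Gen X Y d (sgn_in R (d + 1) \<odot>\<^bsub>shom C X Y d\<^esub> ?g))"
      by (rule veq_sym[OF veq_Gen_sgn[OF w(1,2) g]])
    also have "\<dots> = fr (Gen X Y d f)" using ident_left[OF w] by simp
    finally have 1: "fr (phiL (Gen X Y d f)) \<doteq> fr (Gen X Y d f)" .
    have "fr (dd (hl (Gen X Y d f))) + fr (hl (dd (Gen X Y d f))) \<doteq> 0 + 0"
      using w by (intro veq_add) (simp_all add: veq_Nul)
    with 1 show ?case unfolding r.claim_def using veq_add[OF _ veq_sym] by fastforce
  next
    case (Bop ts)
    obtain X Y where p0: "path X ts Y" and l: "2 \<le> length ts" using Bop.prems unfolding wf_Bop_iff by blast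
    have "ts \<noteq> []" using l by auto
    then obtain z us where ts: "ts = z # us" by (cases ts) auto
    have us: "us \<noteq> []" using l ts by auto
    have p: "path X (z # us) Y" using p0 ts by simp
    let ?i = "I X"
    let ?e = "sdeg ts + 1"
    have z: "typed X (etgt z) (edeg z) z" "path (etgt z) us Y" "wf z" using p by (auto simp: typed_def)
    have X: "X \<in> aob C" using typed_ob[OF z(1)] by simp
    have hz: "typed X (etgt z) (edeg z - 1) (hl z)" by (rule typed_hl[OF z(1)])
    have dz: "edeg (hl z) = edeg z - 1" using hz by (simp add: typed_def)
    have cz: "sgm (edeg z + 1) (fr (Bop [?i, z])) \<doteq> fr z + (fr (dd (hl z)) + fr (hl (dd z)))"
    proof -
      have "r.claim z" using Bop.IH[of z] z ts by simp
      moreover have "esrc z = X" using z by (simp add: typed_def)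
      ultimately show ?thesis using veq_trans[OF veq_sym[OF phiL_veq[OF z(3)]]] unfolding r.claim_def by metis
    qed
    have pi: "path X (?i # ts) Y" and ph: "path X (hl z # us) Y"
      using p ts typed_I[OF X] hz z by (auto simp: typed_def)
    define k where "k w = sgm (sdeg w + 1) (fr (b (?i # w))) - sgm (sdeg (tl w)) (fr (b (hl (hd w) # tl w)))" for w
    have hk: "fr (hl (Bop w)) \<doteq> k w" if w2: "path X w Y'" "2 \<le> length w" for w Y'
    proof -
      obtain z us where w: "w = z # us" "us \<noteq> []" using w2(2) by (cases w) (auto simp: Suc_le_eq)
      then show ?thesis using hl_Bop[of X z us Y'] w2 by (simp add: k_def del: sgm_succ)
    qed
    let ?S = "\<Sum>(u, m, v)\<in>splits3 ts. sgm (sdeg v) (k (u @ b m # v))"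
    have pS: "path X (u @ b m # v) Y" if "(u, m, v) \<in> splits3 ts" for u m v
      using path_insertion[OF p0 that] .
    have S1: "?S \<doteq> k [Bop ts] - fr (hl (dd (Bop ts)))"
    proof -
      have "(\<Sum>(u, m, v)\<in>splits3 ts. sgm (sdeg v) (r.HH (fr (b (u @ b m # v))))) \<doteq> 0"
        using r.HH_veq[OF ainf_relation[OF p0 l]] by (simp add: lift_sum split_def)
      moreover have "(\<Sum>(u, m, v)\<in>splits3 ts. sgm (sdeg v) (k (u @ b m # v)))
          - (\<Sum>(u, m, v)\<in>splits3 ts. sgm (sdeg v) (r.HH (fr (b (u @ b m # v)))))
          \<doteq> (\<Sum>(u, m, v)\<in>splits3 ts. if u = [] \<and> v = [] then k [Bop m] - fr (hl (dd (Bop m))) else 0)"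
        unfolding sum_subtractf[symmetric]
      proof (rule veq_sum)
        fix x assume x: "x \<in> splits3 ts"
        obtain u m v where x': "x = (u, m, v)" by (cases x)
        have q: "path X (u @ b m # v) Y" using pS x x' by simp
        have w: "wf (b (u @ b m # v))" using typed_bb[OF q] by (simp add: typed_def)
        have "sgm (sdeg v) (k (u @ b m # v)) - sgm (sdeg v) (r.HH (fr (b (u @ b m # v))))
            \<doteq> (if u = [] \<and> v = [] then k [Bop m] - fr (hl (dd (Bop m))) else 0)"
        proof (cases "u = [] \<and> v = []")
          case True
          then have "m = ts" using x x' by (simp add: splits3_def)
          then show ?thesis using True w l by (simp add: lift_fr)
        next
          case False
          then have "fr (hl (b (u @ b m # v))) \<doteq> k (u @ b m # v)"
            using hk[OF q] by (auto simp: Suc_le_eq)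
          from veq_sgm[OF veq_sym[OF this], of "sdeg v"] False w show ?thesis
            by (auto simp: lift_fr veq_def)
        qed
        then show "(case x of (u, m, v) \<Rightarrow> sgm (sdeg v) (k (u @ b m # v)))
            - (case x of (u, m, v) \<Rightarrow> sgm (sdeg v) (r.HH (fr (b (u @ b m # v)))))
            \<doteq> (case x of (u, m, v) \<Rightarrow> if u = [] \<and> v = [] then k [Bop m] - fr (hl (dd (Bop m))) else 0)"
          by (simp add: x')
      qed
      ultimately show ?thesis
        unfolding sum_splits3_full[OF \<open>ts \<noteq> []\<close>, of "\<lambda>m. k [Bop m] - fr (hl (dd (Bop m)))"]
        using veq_add by fastforce
    qed
    let ?A = "\<lambda>l v. sgm (edeg z + sdeg l + 1) (fr (b (Bop (?i # z # l) # v)))"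
    let ?B = "\<lambda>l v. sgm (sdeg l) (fr (b (b (hl z # l) # v)))"
    let ?SA = "\<Sum>(l, v)\<in>splits2 us. ?A l v" and ?SB = "\<Sum>(l, v)\<in>splits2 us. ?B l v"
    let ?T1 = "\<Sum>(u, m, v)\<in>splits3 ts. sgm (sdeg v) (sgm (sdeg (u @ b m # v) + 1) (fr (b (?i # u @ b m # v))))"
    let ?T2 = "\<Sum>(u, m, v)\<in>splits3 ts. sgm (sdeg v)
        (sgm (sdeg (tl (u @ b m # v))) (fr (b (hl (hd (u @ b m # v)) # tl (u @ b m # v)))))"
    let ?T3 = "\<Sum>(u, m, v)\<in>splits3 us. sgm (sdeg us + sdeg v) (fr (b (hl z # u @ b m # v)))"
    have dbm: "edeg (b m) = sdeg m + 1" if "path P ts' Q" "(u, m, v) \<in> splits3 ts'" for u m v ts' P Q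
    proof -
      have "m \<noteq> []" and ts': "ts' = u @ m @ v" using that by (auto simp: splits3_def)
      moreover have "\<exists>P Q. path P m Q" using that(1) unfolding ts' by auto
      ultimately show ?thesis using typed_bb by (auto simp: typed_def)
    qed
    have S: "?S = ?T1 - ?T2"
      unfolding sum_subtractf[symmetric] by (rule sum.cong) (auto simp: k_def simp del: sgm_succ)
    have T1: "?T1 \<doteq> ?SA"
    proof -
      have n: "fr (b (dd ?i # ts)) \<doteq> 0"
      proof -
        have "path X ([] @ dd ?i # ts) Y" using p0 typed_dd[OF typed_I[OF X]] by (auto simp: typed_def)
        from Bop_null[OF this _ dd_I[OF X]] l show ?thesis by (auto simp: ts)
      qed
      let ?U = "\<Sum>(u, m, v)\<in>splits3 ts. sgm (sdeg v) (fr (b (?i # u @ b m # v)))"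
      let ?V = "\<Sum>(l, v)\<in>splits2 us. sgm (sdeg v) (fr (b (Bop (?i # z # l) # v)))"
      have e1: "(\<Sum>(u, m, v)\<in>splits3 (?i # ts). sgm (sdeg v) (fr (b (u @ b m # v)))) \<doteq> 0"
        by (rule ainf_relation[OF pi]) (use l in simp)
      have e2: "(\<Sum>(u, m, v)\<in>splits3 (?i # ts). sgm (sdeg v) (fr (b (u @ b m # v))))
        = ?U + (sgm (sdeg ts) (fr (b (dd ?i # ts))) + ?V)"
        unfolding sum_splits3_Cons ts sum_splits2_Cons by (simp add: ts)
      have "?U + (sgm (sdeg ts) (fr (b (dd ?i # ts))) + ?V) - sgm (sdeg ts) (fr (b (dd ?i # ts))) \<doteq> 0 - sgm (sdeg ts) 0"
        by (rule veq_diff[OF e1[unfolded e2] veq_sgm[OF n]])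
      then have "?U \<doteq> - ?V" by (simp add: veq_def)
      from veq_sgm[OF this, of "sdeg ts"] have 1: "sgm (sdeg ts) ?U \<doteq> - sgm (sdeg ts) ?V" by simp
      have "?T1 = sgm (sdeg ts) ?U"
        unfolding sgm_sum
      proof (rule sum.cong[OF refl])
        fix x assume x: "x \<in> splits3 ts"
        obtain u m v where x': "x = (u, m, v)" by (cases x)
        have "sdeg ts = sdeg u + sdeg m + sdeg v" using x x' by (auto simp: splits3_def)
        then show "(case x of (u, m, v) \<Rightarrow> sgm (sdeg v) (sgm (sdeg (u @ b m # v) + 1) (fr (b (?i # u @ b m # v)))))
            = sgm (sdeg ts) (case x of (u, m, v) \<Rightarrow> sgm (sdeg v) (fr (b (?i # u @ b m # v))))"
          using dbm[OF p0, of u m v] x by (auto simp: x' sgm_def)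
      qed
      moreover have "- sgm (sdeg ts) ?V = ?SA"
        unfolding sgm_sum sum_negf[symmetric] by (rule sum.cong) (auto simp: splits2_def ts sgm_def)
      ultimately show ?thesis using 1 by simp
    qed
    \<comment> \<open>The relation for \<open>hl z # us\<close>, multiplied by the sign of
      \<open>sdeg us\<close>.\<close>
    have T3: "?T3 + ?SB + fr (b (dd (hl z) # us)) - fr (b (dd (hl z) # us)) \<doteq> 0"
    proof -
      let ?U = "\<Sum>(u, m, v)\<in>splits3 us. sgm (sdeg v) (fr (b (hl z # u @ b m # v)))"
      let ?V = "\<Sum>(l, v)\<in>splits2 us. sgm (sdeg v) (fr (b (b (hl z # l) # v)))"
      have "(\<Sum>(u, m, v)\<in>splits3 (hl z # us). sgm (sdeg v) (fr (b (u @ b m # v)))) \<doteq> 0"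
        by (rule ainf_relation[OF ph]) (use us in \<open>simp add: Suc_le_eq\<close>)
      then have "?U + ?V \<doteq> 0" unfolding sum_splits3_Cons by simp
      from veq_sgm[OF this, of "sdeg us"] have 1: "sgm (sdeg us) ?U + sgm (sdeg us) ?V \<doteq> 0" by simp
      have "?T3 = sgm (sdeg us) ?U" unfolding sgm_sum by (rule sum.cong) auto
      moreover have "?SB = sgm (sdeg us) ?V"
        unfolding sgm_sum by (rule sum.cong) (auto simp: splits2_def sgm_def)
      ultimately show ?thesis using 1 by simp
    qed
    let ?G = "\<lambda>l v. fr (b (hl (b (z # l)) # v))"
    have T2: "?T2 = (\<Sum>(l, v)\<in>splits2 us. ?G l v) - ?T3"
    proof -
      have "(\<Sum>(u, m, v)\<in>splits3 us. sgm (sdeg v) (sgm (sdeg (u @ b m # v)) (fr (b (hl z # u @ b m # v))))) = - ?T3"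
        unfolding sum_negf[symmetric]
      proof (rule sum.cong[OF refl])
        fix x assume x: "x \<in> splits3 us"
        obtain u m v where x': "x = (u, m, v)" by (cases x)
        have "sdeg us = sdeg u + sdeg m + sdeg v" using x x' by (auto simp: splits3_def)
        then show "(case x of (u, m, v) \<Rightarrow> sgm (sdeg v) (sgm (sdeg (u @ b m # v)) (fr (b (hl z # u @ b m # v)))))
            = - (case x of (u, m, v) \<Rightarrow> sgm (sdeg us + sdeg v) (fr (b (hl z # u @ b m # v))))"
          using dbm[OF z(2), of u m v] x by (auto simp: x' sgm_def)
      qed
      moreover have "(\<Sum>(l, v)\<in>splits2 us. sgm (sdeg v) (sgm (sdeg v) (fr (b (hl (b (z # l)) # v))))) = (\<Sum>(l, v)\<in>splits2 us. ?G l v)"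
        by (rule sum.cong) (auto simp: sgm_def)
      ultimately show ?thesis unfolding ts sum_splits3_Cons by simp
    qed
    have G: "(\<Sum>(l, v)\<in>splits2 us. ?G l v) \<doteq> ?SA - ?SB - fr (Bop ts)"
    proof -
      have "(\<Sum>(l, v)\<in>splits2 us. ?G l v) \<doteq> (\<Sum>(l, v)\<in>splits2 us. ?A l v - ?B l v - (if l = [] then fr (Bop ts) else 0))"
      proof (rule veq_sum)
        fix x assume x: "x \<in> splits2 us"
        obtain l v where x': "x = (l, v)" by (cases x)
        have ul: "us = l @ v" using x x' by (simp add: splits2_def)
        obtain Q where Q: "path (etgt z) l Q" "path Q v Y" using z(2) ul by auto
        have lz: "path X (z # l) Q" and lzi: "path X (?i # z # l) Q" and lh: "path X (hl z # l) Q"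
          using Q z hz typed_I[OF X] by (auto simp: typed_def)
        have t1: "typed X Q (edeg z + sdeg l + 1) (b (z # l))" and t2: "typed X Q (edeg z + sdeg l) (Bop (?i # z # l))"
          and t3: "typed X Q (edeg z + sdeg l) (b (hl z # l))"
          using typed_bb[OF lz] typed_Bop[OF lzi] typed_bb[OF lh] by (simp_all add: dz algebra_simps)
        have pA: "path X ([] @ Bop (?i # z # l) # v) Y" "path X ([] @ b (hl z # l) # v) Y" "path X ([] @ hl (b (z # l)) # v) Y"
          using Q t2 t3 typed_hl[OF t1] by (auto simp: typed_def simp del: wf_expr.simps esrc.simps etgt.simps)
        have "?G l v \<doteq> ?A l v - ?B l v - (if l = [] then fr (Bop ts) else 0)"
        proof (cases "l = []")
          case True
          then have u: "v = us" "Q = etgt z" using ul Q by auto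
          have "fr (hl (dd z)) \<doteq> sgm (edeg z + 1) (fr (Bop [?i, z])) - fr (dd (hl z)) - fr z"
            using veq_sym[OF cz] by (simp add: veq_def algebra_simps)
          from slotb_veq[OF this, of "[]" us] show ?thesis
            using slotb_fr[OF pA(1)] slotb_fr[OF pA(2)] slotb_fr[OF pA(3)] slotb_fr[of X "[]" z us Y] p True u us
            by (simp add: ts del: path.simps)
        next
          case False
          then have "fr (hl (b (z # l))) \<doteq> sgm (edeg z + sdeg l + 1) (fr (Bop (?i # z # l))) - sgm (sdeg l) (fr (b (hl z # l)))"
            using hl_Bop[OF lz False] by (simp del: sgm_succ)
          from slotb_veq[OF this, of "[]" v] show ?thesis
            using slotb_fr[OF pA(1)] slotb_fr[OF pA(2)] slotb_fr[OF pA(3)] False by simp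
        qed
        then show "(case x of (l, v) \<Rightarrow> ?G l v) \<doteq> (case x of (l, v) \<Rightarrow> ?A l v - ?B l v - (if l = [] then fr (Bop ts) else 0))"
          by (simp add: x' del: sgm_succ)
      qed
      also have "(\<Sum>(l, v)\<in>splits2 us. ?A l v - ?B l v - (if l = [] then fr (Bop ts) else 0)) = ?SA - ?SB - fr (Bop ts)"
        using sum_splits2_left_Nil[of "fr (Bop ts)" us] by (simp add: sum_subtractf split_def del: sgm_succ)
      finally show ?thesis .
    qed
    have "?T1 - ((\<Sum>(l, v)\<in>splits2 us. ?G l v) - ?T3) - (?T3 + ?SB) \<doteq> ?SA - (?SA - ?SB - fr (Bop ts) - ?T3) - (?T3 + ?SB)"
      by (intro veq_diff veq_refl T1 G)
    then have "?S - (?T3 + ?SB) \<doteq> fr (Bop ts)" unfolding S T2 by simp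
    moreover have "?T3 + ?SB \<doteq> 0" using T3 by simp
    ultimately have "?S - (?T3 + ?SB) + (?T3 + ?SB) \<doteq> fr (Bop ts) + 0" by (rule veq_add)
    then have "?S \<doteq> fr (Bop ts)" by simp
    from veq_trans[OF veq_sym[OF S1] this]
    have k1: "k [Bop ts] - fr (hl (dd (Bop ts))) \<doteq> fr (Bop ts)" .
    have k2: "k [Bop ts] = sgm (edeg (Bop ts) + 1) (fr (Bop [I (esrc (Bop ts)), Bop ts])) - fr (dd (hl (Bop ts)))"
      using Bop_ends[OF p0 \<open>ts \<noteq> []\<close>] by (simp add: k_def del: esrc.simps(5) sgm_succ)
    have k3: "fr (phiL (Bop ts)) \<doteq> k [Bop ts] + fr (dd (hl (Bop ts)))"
      using phiL_veq[OF Bop.prems] unfolding k2 by simp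
    show ?case
      unfolding r.claim_def using null_add[OF k1[unfolded veq_def] k3[unfolded veq_def]]
      by (simp add: veq_def algebra_simps)
  next
    case (Nul X Y d)
    then show ?case by (rule r.claim_Nul)
  next
    case (Plus s t)
    then show ?case by (intro r.claim_Plus) auto
  next
    case (Scale a t)
    then show ?case by (intro r.claim_Scale) auto
  next
    case (Hop t)
    then show ?case by (intro r.claim_Hop) auto
  qed
  then show ?thesis by (simp add: r.claim_def)
qed

lemma unit_elt_D:
  assumes X: "X \<in> aob C"
  shows "unit_elt R D X (dcl X X (-1) (I X))"
proof -
  interpret r: unit_homotopy R C B ident phiR hr by (rule unit_homotopy_right)
  interpret l: unit_homotopy R C B ident phiL hl by (rule unit_homotopy_left)
  note I = typed_I[OF X]
  have dI: "typed X X 0 (dd (I X))" using typed_dd[OF I] by simp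
  show ?thesis
    unfolding unit_elt_def
  proof (intro conjI ballI)
    show "dcl X X (-1) (I X) \<in> carrier (shom D X X (-1))" using I by (auto simp: shom_D[OF X X])
    show "bop D [Arr X X (-1) (dcl X X (-1) (I X))] = \<zero>\<^bsub>shom D X X 0\<^esub>"
      using bop_D1[OF I] dcl_eq_iff[OF dI typed_Nul[OF X X]] veq_trans[OF dd_I[OF X] veq_sym[OF veq_Nul[OF X X]]]
      by (simp add: shom_D(2)[OF X X] del: ediff.simps)
  next
    fix W assume "W \<in> aob D"
    then have W: "W \<in> aob C" by simp
    show "homotopic_to_id R D W X (\<lambda>d x. bop D [Arr W X d x, Arr X X (-1) (dcl X X (-1) (I X))])"
    proof (rule r.homotopic_to_idI[OF W X])
      show "r.claim t" if "wf t" for t using claim_right[OF that] by (simp add: r.claim_def)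
      show "bop D [Arr W X d (dcl W X d t), Arr X X (-1) (dcl X X (-1) (I X))] = dcl W X d (phiR t)"
        if "typed W X d t" for d t
        using bop_D2[OF that I] that by (simp add: phiR_def typed_def)
    qed
  next
    fix Y assume "Y \<in> aob D"
    then have Y: "Y \<in> aob C" by simp
    show "homotopic_to_id R D X Y (\<lambda>d x. sgn_in R (d + 1) \<odot>\<^bsub>shom D X Y d\<^esub> bop D [Arr X X (-1) (dcl X X (-1) (I X)), Arr X Y d x])"
    proof (rule l.homotopic_to_idI[OF X Y])
      show "l.claim t" if "wf t" for t using claim_left[OF that] by (simp add: l.claim_def)
      show "sgn_in R (d + 1) \<odot>\<^bsub>shom D X Y d\<^esub> bop D [Arr X X (-1) (dcl X X (-1) (I X)), Arr X Y d (dcl X Y d t)] = dcl X Y d (phiL t)"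
        if t: "typed X Y d t" for d t
        using bop_D2[OF I t] shom_D(4)[OF X Y sgn_closed, of d "Bop [I X, t]" "d + 1"] typed_Bop2[OF I t] t X
        by (simp add: phiL_def typed_def ident_closed)
    qed
  qed
qed

lemma h0_D: "h0_ainf R D"
  using h0_ainf_D unit_elt_D by blast

section \<open>The embedding into the quotient\<close>

text \<open>The identities of C are strict units, so the zero homotopy serves on both sides.\<close>

lemma unit_elt_C:
  assumes X: "X \<in> aob C"
  shows "unit_elt R C X (ident X)"
proof -
  have h0: "homotopic_to_id R C V Y \<psi>"
    if VY: "V \<in> aob C" "Y \<in> aob C" and \<psi>: "\<And>d x. x \<in> carrier (shom C V Y d) \<Longrightarrow> \<psi> d x = x" for V Y \<psi>
  proof -
    have M: "module R (shom C V Y d)" for d using VY by (rule module_C)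
    have z: "\<zero>\<^bsub>shom C V Y d\<^esub> \<in> carrier (shom C V Y d)" for d
      using M[of d] by (simp add: module_def abelian_group_def abelian_monoid.zero_closed)
    have zz: "x \<oplus>\<^bsub>shom C V Y d\<^esub> \<zero>\<^bsub>shom C V Y d\<^esub> = x" if "x \<in> carrier (shom C V Y d)" for d x
      using M[of d] that by (simp add: module_def abelian_group_def abelian_monoid.r_zero)
    show ?thesis
      unfolding homotopic_to_id_def
    proof (intro exI[of _ "\<lambda>d x. \<zero>\<^bsub>shom C V Y (d - 1)\<^esub>"] conjI allI ballI)
      show "(\<lambda>x. \<zero>\<^bsub>shom C V Y (d - 1)\<^esub>) \<in> carrier (shom C V Y d) \<rightarrow> carrier (shom C V Y (d - 1))" for d
        using z by blast
    next
      fix d x y assume "x \<in> carrier (shom C V Y d)"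
      show "\<zero>\<^bsub>shom C V Y (d - 1)\<^esub> = \<zero>\<^bsub>shom C V Y (d - 1)\<^esub> \<oplus>\<^bsub>shom C V Y (d - 1)\<^esub> \<zero>\<^bsub>shom C V Y (d - 1)\<^esub>"
        using zz[OF z, of "d - 1"] by simp
    next
      fix d a x assume "a \<in> carrier R"
      then show "\<zero>\<^bsub>shom C V Y (d - 1)\<^esub> = a \<odot>\<^bsub>shom C V Y (d - 1)\<^esub> \<zero>\<^bsub>shom C V Y (d - 1)\<^esub>"
        using module.smult_r_null[OF M] by simp
    next
      fix d x assume x: "x \<in> carrier (shom C V Y d)"
      have "bop C [Arr V Y (d - 1) \<zero>\<^bsub>shom C V Y (d - 1)\<^esub>] = \<zero>\<^bsub>shom C V Y d\<^esub>"
        using b1C_zero[OF VY, of "d - 1"] by simp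
      then show "\<psi> d x = x \<oplus>\<^bsub>shom C V Y d\<^esub> (bop C [Arr V Y (d - 1) \<zero>\<^bsub>shom C V Y (d - 1)\<^esub>]
          \<oplus>\<^bsub>shom C V Y d\<^esub> \<zero>\<^bsub>shom C V Y (d + 1 - 1)\<^esub>)"
        using zz[OF z, of d] zz[OF x] \<psi>[OF x] by simp
    qed
  qed
  show ?thesis
    unfolding unit_elt_def
    using X ident_closed b1C_ident ident_right ident_left by (auto intro!: h0)
qed

lemma h0_C: "h0_ainf R C"
proof (rule h0_ainf.intro)
  fix X Y Z x y assume XYZ: "X \<in> aob C" "Y \<in> aob C" "Z \<in> aob C"
  have M: "module R (shom C X Z d)" for d using XYZ(1,3) by (rule module_C)
  interpret M1: module R "shom C X Z (-1)" by (rule M)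
  interpret M0: module R "shom C X Z 0" by (rule M)
  { assume x: "x \<in> cocycles C X Y" and y: "y \<in> cocycles C Y Z"
    then have x': "x \<in> carrier (shom C X Y (-1))" "bop C [Arr X Y (-1) x] = \<zero>\<^bsub>shom C X Y 0\<^esub>"
      and y': "y \<in> carrier (shom C Y Z (-1))" "bop C [Arr Y Z (-1) y] = \<zero>\<^bsub>shom C Y Z 0\<^esub>"
      by (auto simp: cocycles_def)
    have c: "bop C [Arr X Y (-1) x, Arr Y Z (-1) y] \<in> carrier (shom C X Z (-1))"
      using b2C_closed[OF XYZ x'(1) y'(1)] by simp
    have "bop C [Arr X Z (-1) (bop C [Arr X Y (-1) x, Arr Y Z (-1) y])] = \<zero>\<^bsub>shom C X Z 0\<^esub>"
      using leibniz[OF XYZ x'(1) y'(1)] b2C_zero_left[OF XYZ y'(1), of 0] b2C_zero_right[OF XYZ x'(1), of 0]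
        b1C_closed[OF XYZ(1,3) c] sgn_closed by (simp add: x' y')
    then show "bop C [Arr X Y (-1) x, Arr Y Z (-1) y] \<in> cocycles C X Z" using c by (simp add: cocycles_def) }
  { assume x: "x \<in> coboundaries C X Y" and y: "y \<in> cocycles C Y Z"
    then obtain u where u: "u \<in> carrier (shom C X Y (-2))" "x = bop C [Arr X Y (-2) u]"
      and y': "y \<in> carrier (shom C Y Z (-1))" "bop C [Arr Y Z (-1) y] = \<zero>\<^bsub>shom C Y Z 0\<^esub>"
      by (auto simp: cocycles_def coboundaries_def)
    have x': "x \<in> carrier (shom C X Y (-1))" using b1C_closed[OF XYZ(1,2) u(1)] u by simp
    have c: "bop C [Arr X Y (-2) u, Arr Y Z (-1) y] \<in> carrier (shom C X Z (-2))"
      "bop C [Arr X Y (-1) x, Arr Y Z (-1) y] \<in> carrier (shom C X Z (-1))"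
      using b2C_closed[OF XYZ u(1) y'(1)] b2C_closed[OF XYZ x' y'(1)] by simp_all
    let ?b = "bop C [Arr X Z (-2) (bop C [Arr X Y (-2) u, Arr Y Z (-1) y])]"
    have b: "?b \<in> carrier (shom C X Z (-1))" using b1C_closed[OF XYZ(1,3) c(1)] by simp
    have "?b \<oplus>\<^bsub>shom C X Z (-1)\<^esub> (\<ominus>\<^bsub>shom C X Z (-1)\<^esub> bop C [Arr X Y (-1) x, Arr Y Z (-1) y]) = \<zero>\<^bsub>shom C X Z (-1)\<^esub>"
      using leibniz[OF XYZ u(1) y'(1)] b2C_zero_right[OF XYZ u(1), of 0] c
        M1.smult_l_minus[of "\<one>\<^bsub>R\<^esub>"] by (simp add: y' u(2)[symmetric] sgn_in_def)
    then have "bop C [Arr X Y (-1) x, Arr Y Z (-1) y] = ?b"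
      using c b by (metis M1.minus_equality M1.minus_minus M1.a_comm M1.a_inv_closed)
    then show "bop C [Arr X Y (-1) x, Arr Y Z (-1) y] \<in> coboundaries C X Z" using c by (auto simp: coboundaries_def) }
  { assume x: "x \<in> cocycles C X Y" and y: "y \<in> coboundaries C Y Z"
    then obtain u where u: "u \<in> carrier (shom C Y Z (-2))" "y = bop C [Arr Y Z (-2) u]"
      and x': "x \<in> carrier (shom C X Y (-1))" "bop C [Arr X Y (-1) x] = \<zero>\<^bsub>shom C X Y 0\<^esub>"
      by (auto simp: cocycles_def coboundaries_def)
    have y': "y \<in> carrier (shom C Y Z (-1))" using b1C_closed[OF XYZ(2,3) u(1)] u by simp
    interpret M2: module R "shom C X Z (-2)" by (rule M)
    let ?v = "bop C [Arr X Y (-1) x, Arr Y Z (-2) u]"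
    have c: "?v \<in> carrier (shom C X Z (-2))"
      "bop C [Arr X Y (-1) x, Arr Y Z (-1) y] \<in> carrier (shom C X Z (-1))"
      using b2C_closed[OF XYZ x'(1) u(1)] b2C_closed[OF XYZ x'(1) y'] by simp_all
    let ?b = "bop C [Arr X Z (-2) ?v]"
    have b: "?b \<in> carrier (shom C X Z (-1))" using b1C_closed[OF XYZ(1,3) c(1)] by simp
    have "?b \<oplus>\<^bsub>shom C X Z (-1)\<^esub> bop C [Arr X Y (-1) x, Arr Y Z (-1) y] = \<zero>\<^bsub>shom C X Z (-1)\<^esub>"
      using leibniz[OF XYZ x'(1) u(1)] b2C_zero_left[OF XYZ u(1), of 0] c
      by (simp add: x' u(2)[symmetric] sgn_in_def)
    \<comment> \<open>A boundary in the second argument makes the product minus a boundary;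
      linearity of b_1 then moves the sign inside.\<close>
    then have "bop C [Arr X Y (-1) x, Arr Y Z (-1) y] = \<ominus>\<^bsub>shom C X Z (-1)\<^esub> ?b"
      using c b by (metis M1.minus_equality M1.a_comm)
    also have "\<dots> = (\<ominus>\<^bsub>R\<^esub> \<one>\<^bsub>R\<^esub>) \<odot>\<^bsub>shom C X Z (-1)\<^esub> ?b"
      using b M1.smult_l_minus[of "\<one>\<^bsub>R\<^esub>"] by simp
    also have "\<dots> = bop C [Arr X Z (-2) ((\<ominus>\<^bsub>R\<^esub> \<one>\<^bsub>R\<^esub>) \<odot>\<^bsub>shom C X Z (-2)\<^esub> ?v)]"
      using b1C_smult[OF XYZ(1,3) c(1) minus_one_closed] by simp
    finally show "bop C [Arr X Y (-1) x, Arr Y Z (-1) y] \<in> coboundaries C X Z"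
      using M2.smult_closed[OF minus_one_closed c(1)] by (auto simp: coboundaries_def) }
next
  fix W X Y Z x y z assume ob: "W \<in> aob C" "X \<in> aob C" "Y \<in> aob C" "Z \<in> aob C"
  interpret M: module R "shom C W Z (-1)" using ob(1,4) by (rule module_C)
  interpret M2: module R "shom C W Z (-2)" using ob(1,4) by (rule module_C)
  assume "x \<in> cocycles C W X" "y \<in> cocycles C X Y" "z \<in> cocycles C Y Z"
  then have x: "x \<in> carrier (shom C W X (-1))" and y: "y \<in> carrier (shom C X Y (-1))" and z: "z \<in> carrier (shom C Y Z (-1))"
    by (auto simp: cocycles_def)
  let ?A = "bop C [Arr W Y (-1) (bop C [Arr W X (-1) x, Arr X Y (-1) y]), Arr Y Z (-1) z]"
  let ?B = "bop C [Arr W X (-1) x, Arr X Z (-1) (bop C [Arr X Y (-1) y, Arr Y Z (-1) z])]"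
  have xy: "bop C [Arr W X (-1) x, Arr X Y (-1) y] \<in> carrier (shom C W Y (-1))"
    and yz: "bop C [Arr X Y (-1) y, Arr Y Z (-1) z] \<in> carrier (shom C X Z (-1))"
    using b2C_closed[OF ob(1-3) x y] b2C_closed[OF ob(2-4) y z] by simp_all
  have AB: "?A \<in> carrier (shom C W Z (-1))" "?B \<in> carrier (shom C W Z (-1))"
    using b2C_closed[OF ob(1,3,4) xy z] b2C_closed[OF ob(1,2,4) x yz] by simp_all
  have "\<ominus>\<^bsub>shom C W Z (-1)\<^esub> ?A \<oplus>\<^bsub>shom C W Z (-1)\<^esub> ?B = \<zero>\<^bsub>shom C W Z (-1)\<^esub>"
    using assoc[OF ob x y z] AB M.smult_l_minus[of "\<one>\<^bsub>R\<^esub>"] by (simp add: sgn_in_def)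
  then have "?A = ?B" using AB by (metis M.minus_equality M.minus_minus M.a_inv_closed)
  moreover have "\<zero>\<^bsub>shom C W Z (-1)\<^esub> \<in> coboundaries C W Z"
    using b1C_zero[OF ob(1,4), of "-2"] M2.zero_closed unfolding coboundaries_def by force
  ultimately show "\<exists>b\<in>coboundaries C W Z. ?A = b \<oplus>\<^bsub>shom C W Z (-1)\<^esub> ?B" using AB by force
qed (assumption | rule module_C b1C_closed b1C_add b1C_b1C b2C_closed b2C_add_left b2C_add_right exI unit_elt_C)+

text \<open>The functor \<open>emb_Q\<close> written through \<open>dcl\<close>, so that its values
  are visibly represented by expressions.\<close>

definition emb :: "('o, 'm, 'o, ('k, 'o, 'm) expr set set) strict_ainf_functor" where
  "emb = \<lparr> sob = (\<lambda>X. X), scomp = (\<lambda>X Y d f. dcl X Y d (Gen X Y d f)) \<rparr>"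

lemma typed_Gen: "X \<in> aob C \<Longrightarrow> Y \<in> aob C \<Longrightarrow> f \<in> carrier (shom C X Y d) \<Longrightarrow> typed X Y d (Gen X Y d f)"
  by (simp add: typed_def)

lemma veq_Bop_Gen:
  assumes "X \<in> aob C" "Y \<in> aob C" "Z \<in> aob C" "x \<in> carrier (shom C X Y d)" "y \<in> carrier (shom C Y Z e)"
  shows "fr (Bop [Gen X Y d x, Gen Y Z e y]) \<doteq> fr (Gen X Z (d + e + 1) (bop C [Arr X Y d x, Arr Y Z e y]))"
proof -
  have "composable C [Arr X Y d x, Arr Y Z e y]" using assms by (auto simp: composable_def)
  from bb_genx[OF this] show ?thesis by (simp add: genx_def barr_def bsrc_def btgt_def bdeg_def)
qed

lemma is_functor_emb: "is_functor (H0 R C) (H0 R D) (H0_functor D emb)"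
  and fmor_emb: "\<And>X Y x. X \<in> aob C \<Longrightarrow> Y \<in> aob C \<Longrightarrow> x \<in> cocycles C X Y
      \<Longrightarrow> fmor (H0_functor D emb) X Y (H0_class C X Y x) = H0_class D X Y (dcl X Y (-1) (Gen X Y (-1) x))"
proof -
  have closed: "scomp emb X Y d x \<in> carrier (shom D X Y d)"
    if "X \<in> aob C" "Y \<in> aob C" "x \<in> carrier (shom C X Y d)" for X Y d x
    using typed_Gen[OF that] by (auto simp: emb_def shom_D[OF that(1,2)])
  have zero: "scomp emb X Y d \<zero>\<^bsub>shom C X Y d\<^esub> = \<zero>\<^bsub>shom D X Y d\<^esub>" if XY: "X \<in> aob C" "Y \<in> aob C" for X Y d
  proof -
    interpret M: module R "shom C X Y d" using XY by (rule module_C)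
    have "fr (Gen X Y d \<zero>\<^bsub>shom C X Y d\<^esub>) \<doteq> fr (Nul X Y d)"
      by (rule veq_trans[OF veq_Gen_zero[OF XY] veq_sym[OF veq_Nul[OF XY]]])
    then show ?thesis
      using dcl_eq_iff[OF typed_Gen[OF XY M.zero_closed] typed_Nul[OF XY]] by (simp add: emb_def shom_D(2)[OF XY])
  qed
  have add: "scomp emb X Y d (x \<oplus>\<^bsub>shom C X Y d\<^esub> y) = scomp emb X Y d x \<oplus>\<^bsub>shom D X Y d\<^esub> scomp emb X Y d y"
    if XY: "X \<in> aob C" "Y \<in> aob C" and x: "x \<in> carrier (shom C X Y d)" and y: "y \<in> carrier (shom C X Y d)" for X Y d x y
  proof -
    interpret M: module R "shom C X Y d" using XY by (rule module_C)
    note t = typed_Gen[OF XY x] typed_Gen[OF XY y]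
    have "fr (Gen X Y d (x \<oplus>\<^bsub>shom C X Y d\<^esub> y)) \<doteq> fr (Plus (Gen X Y d x) (Gen X Y d y))"
      by (rule veq_trans[OF veq_Gen_add[OF XY x y] veq_sym[OF veq_Plus]]) (use XY x y in auto)
    then show ?thesis
      using dcl_eq_iff[OF typed_Gen[OF XY M.a_closed[OF x y]] typed_Plus[OF t]]
      by (simp add: emb_def shom_D(3)[OF XY t])
  qed
  have b1: "scomp emb X Y (d + 1) (bop C [Arr X Y d x]) = bop D [Arr X Y d (scomp emb X Y d x)]"
    if "X \<in> aob C" "Y \<in> aob C" "x \<in> carrier (shom C X Y d)" for X Y d x
    using bop_D1[OF typed_Gen[OF that]] by (simp add: emb_def)
  have b2: "scomp emb X Z (d + e + 1) (bop C [Arr X Y d x, Arr Y Z e y])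
        = bop D [Arr X Y d (scomp emb X Y d x), Arr Y Z e (scomp emb Y Z e y)]"
    if XYZ: "X \<in> aob C" "Y \<in> aob C" "Z \<in> aob C" and x: "x \<in> carrier (shom C X Y d)" and y: "y \<in> carrier (shom C Y Z e)"
    for X Y Z d e x y
    using bop_D2[OF typed_Gen[OF XYZ(1,2) x] typed_Gen[OF XYZ(2,3) y]] veq_Bop_Gen[OF XYZ x y]
      dcl_eq_iff[OF typed_Bop2[OF typed_Gen[OF XYZ(1,2) x] typed_Gen[OF XYZ(2,3) y]]
        typed_Gen[OF XYZ(1,3) b2C_closed[OF XYZ x y]]]
    by (simp add: emb_def)
  have unit: "\<exists>i. unit_elt R C X i \<and> unit_elt R D X (scomp emb X X (-1) i)" if "X \<in> aob C" for X
    using unit_elt_C[OF that] unit_elt_D[OF that] by (auto simp: emb_def)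
  have sob: "sob emb X = X" for X by (simp add: emb_def)
  show "is_functor (H0 R C) (H0 R D) (H0_functor D emb)"
    by (rule is_functor_H0(1)[where F = emb, OF h0_C h0_D aob_D sob]; (rule closed zero add b1 b2 unit; assumption))
  show "fmor (H0_functor D emb) X Y (H0_class C X Y x) = H0_class D X Y (dcl X Y (-1) (Gen X Y (-1) x))"
    if x: "X \<in> aob C" "Y \<in> aob C" "x \<in> cocycles C X Y" for X Y x
  proof -
    have "fmor (H0_functor D emb) X Y (H0_class C X Y x) = H0_class D X Y (scomp emb X Y (-1) x)"
      by (rule is_functor_H0(2)[where F = emb, OF h0_C h0_D aob_D sob _ _ _ _ _ _ x])
        (rule closed zero add b1 b2 unit; assumption)+
    then show ?thesis by (simp add: emb_def)
  qed
qed

section \<open>Morphisms with a contractible cone become invertible\<close>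

text \<open>Being a boundary is made a property of integral combinations rather than of single
  expressions. Sums and negatives of boundaries can then be used without assembling one expression
  by hand.\<close>

definition bd :: "'o \<Rightarrow> 'o \<Rightarrow> (('k, 'o, 'm) expr \<Rightarrow>\<^sub>0 int) \<Rightarrow> bool" where
  "bd X Y x \<longleftrightarrow> (\<exists>w. typed X Y (-2) w \<and> x \<doteq> fr (dd w))"

lemma bd_dd: "typed X Y (-2) w \<Longrightarrow> bd X Y (fr (dd w))"
  unfolding bd_def using veq_refl by blast

lemma bd_veq: "bd X Y x \<Longrightarrow> y \<doteq> x \<Longrightarrow> bd X Y y"
  unfolding bd_def using veq_trans by blast

lemma bd_add: "bd X Y x \<Longrightarrow> bd X Y y \<Longrightarrow> bd X Y (x + y)"
proof -
  assume "bd X Y x" "bd X Y y"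
  then obtain v w where vw: "typed X Y (-2) v" "x \<doteq> fr (dd v)" "typed X Y (-2) w" "y \<doteq> fr (dd w)" by (auto simp: bd_def)
  have "x + y \<doteq> fr (dd v) + fr (dd w)" by (intro veq_add vw)
  also have "\<dots> \<doteq> fr (dd (Plus v w))"
    using veq_sym[OF veq_Plus, of "dd v" "dd w"] typed_dd[OF vw(1)] typed_dd[OF vw(3)] by (simp add: typed_def)
  finally show "bd X Y (x + y)" using typed_Plus[OF vw(1,3)] by (auto simp: bd_def)
qed

lemma bd_minus: "bd X Y x \<Longrightarrow> bd X Y (- x)"
proof -
  assume "bd X Y x"
  then obtain v where v: "typed X Y (-2) v" "x \<doteq> fr (dd v)" by (auto simp: bd_def)
  have "- x \<doteq> - fr (dd v)" by (intro veq_minus v)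
  also have "\<dots> \<doteq> fr (dd (negs v))" by (rule veq_sym[OF dd_neg_veq[OF v(1)]])
  finally show "bd X Y (- x)" using typed_neg[OF v(1)] unfolding bd_def by blast
qed

lemma H0_class_dcl:
  assumes s: "typed X Y (-1) s" and t: "typed X Y (-1) t" and b: "bd X Y (fr s - fr t)"
  shows "H0_class D X Y (dcl X Y (-1) s) = H0_class D X Y (dcl X Y (-1) t)"
proof -
  interpret D: h0_ainf R D by (rule h0_D)
  have XY: "X \<in> aob C" "Y \<in> aob C" using typed_ob[OF s] by auto
  obtain w where w: "typed X Y (-2) w" "fr s - fr t \<doteq> fr (dd w)" using b by (auto simp: bd_def)
  have dw: "typed X Y (-1) (dd w)" using typed_dd[OF w(1)] by simp
  have "fr s \<doteq> fr (dd w) + fr t" using w(2) by (simp add: veq_def algebra_simps)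
  also have "\<dots> \<doteq> fr (Plus (dd w) t)" using typed_Plus[OF dw t] by (intro veq_sym[OF veq_Plus]) (simp add: typed_def)
  finally have "dcl X Y (-1) s = dcl X Y (-1) (dd w) \<oplus>\<^bsub>shom D X Y (-1)\<^esub> dcl X Y (-1) t"
    using dcl_eq_iff[OF s typed_Plus[OF dw t]] by (simp add: shom_D(3)[OF XY dw t])
  then have "dcl X Y (-1) s \<in> H0_class D X Y (dcl X Y (-1) t)"
    using coboundaries_DI[OF dw w(1)] by (auto simp: D.H0_class_iff)
  then show ?thesis using XY t by (intro D.H0_class_eqI) (auto simp: shom_D[OF XY])
qed

lemma bd_Bop_left:
  assumes s: "typed X Y (-2) s" and t: "typed Y Z (-1) t" "fr (dd t) \<doteq> 0"
  shows "fr (Bop [dd s, t]) \<doteq> fr (dd (Bop [s, t]))"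
proof -
  have n: "fr (Bop [s, dd t]) \<doteq> 0" using Bop2_null(2)[OF s typed_dd[OF t(1)]] t by auto
  show ?thesis using veq_sym[OF veq_diff[OF relation2[OF s t(1)] n]] by (simp add: veq_def)
qed

text \<open>H is available at the objects of B, whereas a distinguished triangle makes the mapping
  cone merely isomorphic in the homotopy category to such an object. The identity of
  \<open>Z\<close> is cohomologous to c c', that is, to c 1 c' with the identity of \<open>V\<close>
  in the middle, and a product of cocycles in which one factor is a boundary is a boundary.\<close>

lemma bd_ident_transfer:
  assumes ob: "Z \<in> aob C" "V \<in> aob C" and c: "c \<in> cocycles C Z V" and c': "c' \<in> cocycles C V Z"
    and cc: "H0_class C Z Z (bop C [Arr Z V (-1) c, Arr V Z (-1) c']) = H0_class C Z Z (ident Z)"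
    and V: "bd V V (fr (I V))"
  shows "bd Z Z (fr (I Z))"
proof -
  interpret C: h0_ainf R C by (rule h0_C)
  have cC: "c \<in> carrier (shom C Z V (-1))" "c' \<in> carrier (shom C V Z (-1))" using c c' by (auto simp: cocycles_def)
  let ?c = "Gen Z V (-1) c" and ?c' = "Gen V Z (-1) c'"
  let ?cc = "bop C [Arr Z V (-1) c, Arr V Z (-1) c']"
  have tc: "typed Z V (-1) ?c" "typed V Z (-1) ?c'" using ob cC by (auto intro: typed_Gen)
  have dc: "fr (dd ?c) \<doteq> 0" "fr (dd ?c') \<doteq> 0" using c c' veq_Gen_zero ob by (auto simp: cocycles_def)
  obtain w where w: "typed V V (-2) w" "fr (I V) \<doteq> fr (dd w)" using V by (auto simp: bd_def)
  let ?s = "Bop [?c, w]"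
  have s: "typed Z V (-2) ?s" using typed_Bop2[OF tc(1) w(1)] by simp
  have ccc: "?cc \<in> carrier (shom C Z Z (-1))" using b2C_closed[OF ob ob(1) cC] by simp
  have "fr ?c \<doteq> fr (Bop [?c, I V])"
    using veq_sym[OF veq_Bop_Gen[OF ob ob(2) cC(1) ident_closed[OF ob(2)]]] ident_right[OF ob cC(1)] by simp
  also have "\<dots> \<doteq> fr (Bop [?c, dd w])"
    using typed_dd[OF w(1)] by (intro veq_Bop2[OF veq_refl w(2) tc(1) tc(1) typed_I[OF ob(2)]]) simp
  also have "\<dots> \<doteq> - fr (dd ?s)"
  proof -
    have "fr (Bop [dd ?c, w]) \<doteq> 0" by (rule Bop2_null(1)[OF typed_dd[OF tc(1)] w(1) dc(1)])
    from veq_diff[OF relation2[OF tc(1) w(1)] veq_sgm[OF this, of "-2"]]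
    show ?thesis by (simp add: veq_def algebra_simps)
  qed
  also have "\<dots> \<doteq> fr (dd (negs ?s))" by (rule veq_sym[OF dd_neg_veq[OF s]])
  finally have 1: "fr ?c \<doteq> fr (dd (negs ?s))" .
  let ?n = "negs ?s"
  have n: "typed Z V (-2) ?n" by (rule typed_neg[OF s])
  have dn: "typed Z V (-1) (dd ?n)" using typed_dd[OF n] by simp
  have "fr (Gen Z Z (-1) ?cc) \<doteq> fr (Bop [?c, ?c'])" using veq_sym[OF veq_Bop_Gen[OF ob ob(1) cC]] by simp
  also have "\<dots> \<doteq> fr (Bop [dd ?n, ?c'])" by (rule veq_Bop2[OF 1 veq_refl tc(1) dn tc(2) tc(2)])
  also have "\<dots> \<doteq> fr (dd (Bop [?n, ?c']))" by (rule bd_Bop_left[OF n tc(2) dc(2)])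
  finally have 2: "bd Z Z (fr (Gen Z Z (-1) ?cc))"
    using bd_veq[OF bd_dd[of Z Z "Bop [?n, ?c']"]] typed_Bop2[OF n tc(2)] by simp
  have "?cc \<in> H0_class C Z Z (ident Z)"
    unfolding cc[symmetric] by (rule C.H0_class_mem[OF ob(1,1) ccc])
  then obtain u where u: "u \<in> carrier (shom C Z Z (-2))"
      "?cc = bop C [Arr Z Z (-2) u] \<oplus>\<^bsub>shom C Z Z (-1)\<^esub> ident Z"
    by (auto simp: C.H0_class_iff coboundaries_def)
  have "fr (Gen Z Z (-1) ?cc) \<doteq> fr (Gen Z Z (-1) (bop C [Arr Z Z (-2) u])) + fr (I Z)"
    unfolding u(2) using b1C_closed[OF ob(1,1) u(1)] by (intro veq_Gen_add ob ident_closed) simp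
  then have "fr (I Z) \<doteq> fr (Gen Z Z (-1) ?cc) + - fr (dd (Gen Z Z (-2) u))"
    using veq_sym by (simp add: veq_def algebra_simps)
  then show ?thesis
    by (rule bd_veq[rotated]) (intro bd_add bd_minus 2 bd_dd typed_Gen ob u)
qed

text \<open>The contraction formula at the cocycle \<open>I V\<close>: the term containing b_1 of it
  drops out.\<close>

lemma bd_ident:
  assumes V: "V \<in> aob C" "V \<in> B"
  shows "bd V V (fr (I V))"
proof -
  note t = typed_I[OF V(1)]
  have "fr (hx (dd (I V))) = HX (fr (dd (I V)))"
    using typed_dd[OF t] by (subst lift_fr) (simp_all add: typed_def)
  also have "\<dots> \<doteq> HX 0" by (rule HX_veq[OF dd_I[OF V(1)]])
  finally have "fr (hx (dd (I V))) \<doteq> 0" by simp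
  from veq_diff[OF hx_contraction[OF t] this] V(2) have "fr (I V) \<doteq> fr (dd (hx (I V)))"
    using veq_sym by fastforce
  then show ?thesis using typed_hx[OF t] unfolding bd_def by (intro exI[of _ "hx (I V)"]) simp
qed

text \<open>All degrees are shifted by one: \<open>p\<close>, a map to \<open>X[1]\<close>, is a
  morphism to \<open>X\<close> of degree 1 and so has shifted degree 0, and the splitting
  \<open>j\<close>, of degree -1, has shifted degree -2. The equations are those of a cone: i p = 0,
  \<open>j\<close> bounds f i, \<open>q\<close> bounds p f up to sign, and j p and i q are
  identities up to sign.\<close>

lemma cone_iso:
  assumes ob: "X \<in> aob C" "Y \<in> aob C" "Z \<in> aob C"
    and f: "f \<in> cocycles C X Y" and i: "i \<in> cocycles C Y Z"
    and p: "p \<in> carrier (shom C Z X 0)" "bop C [Arr Z X 0 p] = \<zero>\<^bsub>shom C Z X 1\<^esub>"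
    and j: "j \<in> carrier (shom C X Z (-2))" and q: "q \<in> carrier (shom C Z Y (-1))"
    and ip: "bop C [Arr Y Z (-1) i, Arr Z X 0 p] = \<zero>\<^bsub>shom C Y X 0\<^esub>"
    and fi: "bop C [Arr X Y (-1) f, Arr Y Z (-1) i] = bop C [Arr X Z (-2) j]"
    and pf: "bop C [Arr Z X 0 p, Arr X Y (-1) f] = \<ominus>\<^bsub>shom C Z Y 0\<^esub> bop C [Arr Z Y (-1) q]"
    and jp: "bop C [Arr X Z (-2) j, Arr Z X 0 p] = \<ominus>\<^bsub>shom C X X (-1)\<^esub> ident X"
    and iq: "bop C [Arr Y Z (-1) i, Arr Z Y (-1) q] = ident Y"
    and Z: "bd Z Z (fr (I Z))"
  shows "is_iso (H0 R D) X Y (H0_class D X Y (dcl X Y (-1) (Gen X Y (-1) f)))"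
proof -
  interpret D: h0_ainf R D by (rule h0_D)
  have fC: "f \<in> carrier (shom C X Y (-1))" and iC: "i \<in> carrier (shom C Y Z (-1))" using f i by (auto simp: cocycles_def)
  let ?f = "Gen X Y (-1) f" and ?i = "Gen Y Z (-1) i" and ?p = "Gen Z X 0 p" and ?j = "Gen X Z (-2) j" and ?q = "Gen Z Y (-1) q"
  have tf: "typed X Y (-1) ?f" and ti: "typed Y Z (-1) ?i" and tp: "typed Z X 0 ?p"
    and tj: "typed X Z (-2) ?j" and tq: "typed Z Y (-1) ?q"
    using ob fC iC p j q by (auto intro: typed_Gen)
  have df: "fr (dd ?f) \<doteq> 0" and di: "fr (dd ?i) \<doteq> 0" and dp: "fr (dd ?p) \<doteq> 0"
    using f i p veq_Gen_zero ob by (auto simp: cocycles_def)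
  obtain h where h: "typed Z Z (-2) h" "fr (I Z) \<doteq> fr (dd h)" using Z by (auto simp: bd_def)
  have tdh: "typed Z Z (-1) (dd h)" using typed_dd[OF h(1)] by simp
  note tI = typed_I[OF ob(3)]
  \<comment> \<open>\<open>h\<close> contracts \<open>Z\<close>, so its composite with the cocycle
    \<open>i\<close> has boundary -i. Together with i p = 0 this makes \<open>?g\<close> a
    cocycle.\<close>
  let ?u = "Bop [?i, h]"
  have tu: "typed Y Z (-2) ?u" using typed_Bop2[OF ti h(1)] by simp
  have tdu: "typed Y Z (-1) (dd ?u)" using typed_dd[OF tu] by simp
  let ?g = "Bop [?u, ?p]"
  have tg: "typed Y X (-1) ?g" using typed_Bop2[OF tu tp] by simp
  have vip: "fr (Bop [?i, ?p]) \<doteq> 0"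
    using veq_trans[OF veq_Bop_Gen[OF ob(2,3,1) iC p(1)]] veq_Gen_zero[OF ob(2,1)] by (simp add: ip)
  have vfi: "fr (Bop [?f, ?i]) \<doteq> fr (dd ?j)"
    using veq_Bop_Gen[OF ob(1,2,3) fC iC] by (simp add: fi)
  have vneg: "fr (Gen V W d (\<ominus>\<^bsub>shom C V W d\<^esub> x)) \<doteq> - fr (Gen V W d x)"
    if VW: "V \<in> aob C" "W \<in> aob C" and x: "x \<in> carrier (shom C V W d)" for V W d x
  proof -
    interpret M: module R "shom C V W d" using VW by (rule module_C)
    have "fr (Gen V W d (\<ominus>\<^bsub>shom C V W d\<^esub> x)) + fr (Gen V W d x) \<doteq> fr (Gen V W d \<zero>\<^bsub>shom C V W d\<^esub>)"
      using veq_sym[OF veq_Gen_add[OF VW M.a_inv_closed[OF x] x]] x by (simp add: M.l_neg)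
    from veq_trans[OF this veq_Gen_zero[OF VW]] show ?thesis by (simp add: veq_def)
  qed
  have tdq: "bop C [Arr Z Y (-1) q] \<in> carrier (shom C Z Y 0)" using b1C_closed[OF ob(3,2) q] by simp
  have vpf: "fr (Bop [?p, ?f]) \<doteq> - fr (dd ?q)"
    using veq_trans[OF veq_Bop_Gen[OF ob(3,1,2) p(1) fC]] vneg[OF ob(3,2) tdq] by (simp add: pf)
  have vjp: "fr (Bop [?j, ?p]) \<doteq> - fr (I X)"
    using veq_trans[OF veq_Bop_Gen[OF ob(1,3,1) j p(1)]] vneg[OF ob(1,1) ident_closed[OF ob(1)]] by (simp add: jp)
  have viq: "fr (Bop [?i, ?q]) \<doteq> fr (I Y)"
    using veq_Bop_Gen[OF ob(2,3,2) iC q] by (simp add: iq)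
  have unit: "fr (Bop [Gen V Z d x, dd h]) \<doteq> fr (Gen V Z d x)"
    if V: "V \<in> aob C" and x: "x \<in> carrier (shom C V Z d)" for V d x
  proof -
    note t = typed_Gen[OF V ob(3) x]
    have "fr (Bop [Gen V Z d x, dd h]) \<doteq> fr (Bop [Gen V Z d x, I Z])"
      by (rule veq_Bop2[OF veq_refl veq_sym[OF h(2)] t t tdh tI])
    also have "\<dots> \<doteq> fr (Gen V Z d x)"
      using veq_Bop_Gen[OF V ob(3,3) x ident_closed[OF ob(3)]] ident_right[OF V ob(3) x] by simp
    finally show ?thesis .
  qed
  have du: "fr (dd ?u) \<doteq> - fr ?i"
  proof -
    have "fr (Bop [dd ?i, h]) \<doteq> 0" by (rule Bop2_null(1)[OF typed_dd[OF ti] h(1) di])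
    from veq_diff[OF veq_diff[OF relation2[OF ti h(1)] veq_sgm[OF this, of "-2"]] unit[OF ob(2) iC]]
    show ?thesis by (simp add: veq_def algebra_simps)
  qed
  have tni: "typed Y Z (-1) (negs ?i)" by (rule typed_neg[OF ti])
  have du': "fr (dd ?u) \<doteq> fr (negs ?i)" by (rule veq_trans[OF du veq_sym[OF neg_veq[OF ti]]])
  have Bdu: "fr (Bop [dd ?u, t]) \<doteq> - fr (Bop [?i, t])" if t: "typed Z W d t" for W d t
  proof -
    have "fr (Bop [dd ?u, t]) \<doteq> fr (Bop [negs ?i, t])" by (rule veq_Bop2[OF du' veq_refl tdu tni t t])
    also have "\<dots> \<doteq> fr (negs (Bop [?i, t]))"
      using tni typed_Bop2[OF tni t] typed_neg[OF typed_Bop2[OF ti t]] lin_veq[OF lin_identity.intros(12)[of R C "[]" _ ?i "[t]"]]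
      by (simp add: typed_def)
    also have "\<dots> \<doteq> - fr (Bop [?i, t])" by (rule neg_veq[OF typed_Bop2[OF ti t]])
    finally show ?thesis .
  qed
  have dg: "fr (dd ?g) \<doteq> 0"
  proof -
    have 1: "fr (Bop [?u, dd ?p]) \<doteq> 0" by (rule Bop2_null(2)[OF tu typed_dd[OF tp] dp])
    have 2: "fr (Bop [dd ?u, ?p]) \<doteq> 0" using veq_trans[OF Bdu[OF tp] veq_minus[OF vip]] by simp
    show ?thesis using veq_diff[OF relation2[OF tu tp] veq_add[OF 2 1]] by (simp add: veq_def algebra_simps)
  qed
  have high: "fr (Bop [Gen V W d x, Gen W V' d' x', Gen V' W' d'' x'']) \<doteq> 0"
    if "V \<in> aob C" "W \<in> aob C" "V' \<in> aob C" "W' \<in> aob C" "x \<in> carrier (shom C V W d)" "x' \<in> carrier (shom C W V' d')"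
      "x'' \<in> carrier (shom C V' W' d'')" for V W V' W' d d' d'' x x' x''
    using genx_higher_null[of "[Arr V W d x, Arr W V' d' x', Arr V' W' d'' x'']"] that
    by (auto simp: composable_def genx_def)
  \<comment> \<open>In these summands of the ternary relations \<open>?u\<close> appears through its
    boundary, which is minus a generator; they reduce to ternary operations on morphisms of C, which
    vanish by \<open>high\<close>.\<close>
  have mid: "fr (Bop [s, dd ?u, t]) \<doteq> 0"
    if s: "typed V Y d s" and t: "typed Z W e t" and z: "fr (Bop [s, ?i, t]) \<doteq> 0" for V W d e s t
  proof -
    have w: "path V ([s] @ dd ?u # [t]) W" "path V ([s] @ negs ?i # [t]) W" "path V ([s] @ ?i # [t]) W"
      using s t tdu tni ti by (auto simp: typed_def)
    have "slot [s] [t] (fr (dd ?u)) \<doteq> slot [s] [t] (- fr ?i)" by (rule slot_veq[OF du])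
    then have "fr (Bop [s, dd ?u, t]) \<doteq> - fr (Bop [s, ?i, t])"
      using wf_BopI[OF w(1)] wf_BopI[OF w(3)] by (simp add: lift_fr del: wf_expr.simps ediff.simps)
    from veq_trans[OF this veq_minus[OF z]] show ?thesis by simp
  qed
  have first: "fr (Bop [dd ?u, s, t]) \<doteq> 0"
    if s: "typed Z V d s" and t: "typed V W e t" and z: "fr (Bop [?i, s, t]) \<doteq> 0" for V W d e s t
  proof -
    have w: "path Y ([] @ dd ?u # [s, t]) W" "path Y ([] @ ?i # [s, t]) W"
      using s t tdu tni ti by (auto simp: typed_def)
    have "slot [] [s, t] (fr (dd ?u)) \<doteq> slot [] [s, t] (- fr ?i)" by (rule slot_veq[OF du])
    then have "fr (Bop [dd ?u, s, t]) \<doteq> - fr (Bop [?i, s, t])"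
      using wf_BopI[OF w(1)] wf_BopI[OF w(2)] by (simp add: lift_fr del: wf_expr.simps ediff.simps)
    from veq_trans[OF this veq_minus[OF z]] show ?thesis by simp
  qed
  \<comment> \<open>f i is the boundary of \<open>j\<close>, so f u equals \<open>j\<close> modulo
    boundaries, and (f u)p equals j p = -1 modulo boundaries. Reassociating to f(u p) through the
    ternary relation changes the sign once more.\<close>
  have fg: "bd X X (fr (Bop [?f, ?g]) - fr (I X))"
  proof -
    let ?w = "Bop [?f, ?i, h]" and ?jh = "Bop [?j, h]" and ?v = "Bop [?f, ?u, ?p]"
    have tw: "typed X Z (-3) ?w" and tjh: "typed X Z (-3) ?jh" and tv: "typed X X (-2) ?v" and tfu: "typed X Z (-2) (Bop [?f, ?u])"
      and tfi: "typed X Z (-1) (Bop [?f, ?i])"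
      using tf ti h(1) tj tu tp by (auto simp: typed_def)
    have 1: "fr (Bop [?f, ?i, dd h]) \<doteq> 0"
    proof -
      have w: "path X ([?f, ?i] @ dd h # []) Z" "path X ([?f, ?i] @ I Z # []) Z"
        using tf ti tdh tI by (auto simp: typed_def)
      have "slot [?f, ?i] [] (fr (dd h)) \<doteq> slot [?f, ?i] [] (fr (I Z))" by (rule slot_veq[OF veq_sym[OF h(2)]])
      then have "fr (Bop [?f, ?i, dd h]) \<doteq> fr (Bop [?f, ?i, I Z])"
        using wf_BopI[OF w(1)] wf_BopI[OF w(2)] by (simp add: lift_fr del: wf_expr.simps ediff.simps)
      also have "\<dots> \<doteq> 0" by (rule high) (use ob fC iC ident_closed in auto)
      finally show ?thesis .
    qed
    have 2: "fr (Bop [dd ?f, ?i, h]) \<doteq> 0" "fr (Bop [?f, dd ?i, h]) \<doteq> 0"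
      by (rule Bop3_null(1)[OF typed_dd[OF tf] ti h(1) df], rule Bop3_null(2)[OF tf typed_dd[OF ti] h(1) di])
    have 3: "fr (Bop [Bop [?f, ?i], h]) \<doteq> - fr (dd ?jh) - fr ?j"
    proof -
      have "fr (Bop [Bop [?f, ?i], h]) \<doteq> fr (Bop [dd ?j, h])"
        using typed_dd[OF tj] by (intro veq_Bop2[OF vfi veq_refl tfi _ h(1) h(1)]) simp
      also have "\<dots> \<doteq> - fr (dd ?jh) - fr ?j"
        using veq_diff[OF relation2[OF tj h(1)] unit[OF ob(1) j]] by (simp add: veq_def sgm_def algebra_simps)
      finally show ?thesis .
    qed
    have 4: "fr (Bop [?f, ?u]) \<doteq> fr (dd ?jh) + fr ?j - fr (dd ?w)"
    proof -
      have "fr (Bop [?f, ?u]) + fr (Bop [Bop [?f, ?i], h]) + fr (dd ?w) \<doteq> 0"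
        using veq_diff[OF relation3[OF tf ti h(1)] veq_add[OF veq_add[OF veq_sgm[OF 2(1), of "-3"] veq_sgm[OF 2(2), of "-2"]] 1]]
        by (simp add: sgm_def veq_def algebra_simps)
      from veq_diff[OF this 3] show ?thesis by (simp add: veq_def algebra_simps)
    qed
    have tdjh: "typed X Z (-2) (dd ?jh)" "typed X Z (-2) (dd ?w)" using typed_dd[OF tjh] typed_dd[OF tw] by simp_all
    have pd: "fr (Bop [dd s, ?p]) \<doteq> - fr (dd (Bop [s, ?p]))" if s: "typed X Z (-3) s" for s
    proof -
      have "fr (Bop [s, dd ?p]) \<doteq> 0" by (rule Bop2_null(2)[OF s typed_dd[OF tp] dp])
      from veq_diff[OF relation2[OF s tp] this] show ?thesis by (simp add: veq_def algebra_simps)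
    qed
    have 5: "fr (Bop [Bop [?f, ?u], ?p]) \<doteq> - fr (dd (Bop [?jh, ?p])) + - fr (I X) - - fr (dd (Bop [?w, ?p]))"
    proof -
      have w: "wf (Bop [Bop [?f, ?u], ?p])" "wf (Bop [dd ?jh, ?p])" "wf (Bop [?j, ?p])" "wf (Bop [dd ?w, ?p])"
        using typed_Bop2[OF tfu tp] typed_Bop2[OF tdjh(1) tp] typed_Bop2[OF tj tp] typed_Bop2[OF tdjh(2) tp]
        by (auto simp: typed_def)
      have "slot [] [?p] (fr (Bop [?f, ?u])) \<doteq> slot [] [?p] (fr (dd ?jh) + fr ?j - fr (dd ?w))" by (rule slot_veq[OF 4])
      then have "fr (Bop [Bop [?f, ?u], ?p]) \<doteq> fr (Bop [dd ?jh, ?p]) + fr (Bop [?j, ?p]) - fr (Bop [dd ?w, ?p])"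
        using w by (simp add: lift_fr del: wf_expr.simps ediff.simps)
      also have "\<dots> \<doteq> - fr (dd (Bop [?jh, ?p])) + - fr (I X) - - fr (dd (Bop [?w, ?p]))"
        by (intro veq_diff veq_add pd tjh tw vjp)
      finally show ?thesis .
    qed
    have 6: "fr (Bop [dd ?f, ?u, ?p]) \<doteq> 0" "fr (Bop [?f, dd ?u, ?p]) \<doteq> 0" "fr (Bop [?f, ?u, dd ?p]) \<doteq> 0"
      by (rule Bop3_null(1)[OF typed_dd[OF tf] tu tp df], rule mid[OF tf tp], rule high, (use ob fC iC p in auto)[7],
          rule Bop3_null(3)[OF tf tu typed_dd[OF tp] dp])
    have "fr (Bop [?f, ?g]) + fr (Bop [Bop [?f, ?u], ?p]) + fr (dd ?v) \<doteq> 0"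
      using veq_diff[OF relation3[OF tf tu tp] veq_add[OF veq_add[OF veq_sgm[OF 6(1), of "-2"] veq_sgm[OF 6(2), of 0]] 6(3)]]
      by (simp add: sgm_def veq_def algebra_simps)
    from veq_diff[OF this 5]
    have 7: "fr (Bop [?f, ?g]) - fr (I X) \<doteq> fr (dd (Bop [?jh, ?p])) + - fr (dd (Bop [?w, ?p])) + - fr (dd ?v)"
      by (simp add: veq_def algebra_simps)
    have "typed X X (-2) (Bop [?jh, ?p])" "typed X X (-2) (Bop [?w, ?p])"
      using typed_Bop2[OF tjh tp] typed_Bop2[OF tw tp] by simp_all
    then show ?thesis by (intro bd_veq[OF _ 7] bd_add bd_minus bd_dd tv)
  qed
  \<comment> \<open>Reassociating turns g f into u(p f), and p f is minus the boundary of
    \<open>q\<close>. The Leibniz relation moves this boundary onto \<open>?u\<close>, where it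
    becomes -i, and i q is the identity.\<close>
  have gf: "bd Y Y (fr (Bop [?g, ?f]) - fr (I Y))"
  proof -
    let ?v = "Bop [?u, ?p, ?f]"
    have tv: "typed Y Y (-2) ?v" and tpf: "typed Z Y 0 (Bop [?p, ?f])" and tuq: "typed Y Y (-2) (Bop [?u, ?q])"
      using tf tu tp tq by (auto simp: typed_def)
    have tdq': "typed Z Y 0 (dd ?q)" using typed_dd[OF tq] by simp
    have 1: "fr (Bop [dd ?u, ?p, ?f]) \<doteq> 0" "fr (Bop [?u, dd ?p, ?f]) \<doteq> 0" "fr (Bop [?u, ?p, dd ?f]) \<doteq> 0"
      by (rule first[OF tp tf], rule high, (use ob fC iC p in auto)[7], rule Bop3_null(2)[OF tu typed_dd[OF tp] tf dp],
          rule Bop3_null(3)[OF tu tp typed_dd[OF tf] df])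
    have 2: "fr (Bop [?g, ?f]) \<doteq> fr (dd ?v) + fr (Bop [?u, Bop [?p, ?f]])"
      using veq_diff[OF veq_add[OF veq_add[OF veq_sgm[OF 1(1), of "-1"] veq_sgm[OF 1(2), of "-1"]] 1(3)] relation3[OF tu tp tf]]
      by (simp add: sgm_def veq_def algebra_simps)
    have 3: "fr (Bop [?u, Bop [?p, ?f]]) \<doteq> - fr (Bop [?u, dd ?q])"
    proof -
      have w: "wf (Bop [?u, Bop [?p, ?f]])" "wf (Bop [?u, dd ?q])"
        using typed_Bop2[OF tu tpf] typed_Bop2[OF tu tdq'] by (auto simp: typed_def)
      have "slot [?u] [] (fr (Bop [?p, ?f])) \<doteq> slot [?u] [] (- fr (dd ?q))" by (rule slot_veq[OF vpf])
      then show ?thesis using w by (simp add: lift_fr del: wf_expr.simps ediff.simps)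
    qed
    have 4: "fr (Bop [dd ?u, ?q]) \<doteq> - fr (I Y)" by (rule veq_trans[OF Bdu[OF tq] veq_minus[OF viq]])
    have 5: "fr (Bop [?u, dd ?q]) \<doteq> - fr (dd (Bop [?u, ?q])) - fr (I Y)"
      using veq_add[OF relation2[OF tu tq] 4] by (simp add: veq_def sgm_def algebra_simps del: ediff.simps)
    have 6: "fr (Bop [?g, ?f]) - fr (I Y) \<doteq> fr (dd ?v) + fr (dd (Bop [?u, ?q]))"
      using veq_add[OF 2 veq_diff[OF 3 5]] by (simp add: veq_def algebra_simps del: ediff.simps)
    show ?thesis by (intro bd_veq[OF _ 6] bd_add bd_dd tv tuq)
  qed
  have cf: "dcl X Y (-1) ?f \<in> cocycles D X Y" using tf df unfolding cocycles_D[OF ob(1,2)] by blast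
  have cg: "dcl Y X (-1) ?g \<in> cocycles D Y X" using tg dg unfolding cocycles_D[OF ob(2,1)] by blast
  have obD: "X \<in> aob D" "Y \<in> aob D" using ob by simp_all
  have tfg: "typed X X (-1) (Bop [?f, ?g])" "typed Y Y (-1) (Bop [?g, ?f])"
    using typed_Bop2[OF tf tg] typed_Bop2[OF tg tf] by simp_all
  have "cmp (H0 R D) X Y X (H0_class D X Y (dcl X Y (-1) ?f)) (H0_class D Y X (dcl Y X (-1) ?g)) = idn (H0 R D) X"
    using D.H0_cmp[OF obD obD(1) cf cg] bop_D2[OF tf tg] H0_class_dcl[OF tfg(1) typed_I[OF ob(1)] fg]
      D.H0_idn[OF obD(1) unit_elt_D[OF ob(1)]] by simp
  moreover have "cmp (H0 R D) Y X Y (H0_class D Y X (dcl Y X (-1) ?g)) (H0_class D X Y (dcl X Y (-1) ?f)) = idn (H0 R D) Y"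
    using D.H0_cmp[OF obD(2,1,2) cg cf] bop_D2[OF tg tf] H0_class_dcl[OF tfg(2) typed_I[OF ob(2)] gf]
      D.H0_idn[OF obD(2) unit_elt_D[OF ob(2)]] by simp
  ultimately show ?thesis
    unfolding is_iso_def using D.H0_homI[OF cf] D.H0_homI[OF cg] by blast
qed

end

section \<open>Complexes over a linear category\<close>

lemma module_componentwise:
  assumes R: "cring R" and M: "\<And>n. module R (M n)"
  shows "module R \<lparr> carrier = {f. \<forall>n. f n \<in> carrier (M n)}, mult = undefined, one = undefined,
    ring.zero = (\<lambda>n. \<zero>\<^bsub>M n\<^esub>), add = (\<lambda>f g n. f n \<oplus>\<^bsub>M n\<^esub> g n), smult = (\<lambda>a f n. a \<odot>\<^bsub>M n\<^esub> f n) \<rparr>"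
    (is "module R ?P")
proof -
  have G: "abelian_group (M n)" for n using M[of n] by (simp add: module_def)
  note [simp] = abelian_group.axioms(1)[OF G, THEN abelian_monoid.a_closed] abelian_group.axioms(1)[OF G, THEN abelian_monoid.zero_closed]
    module.smult_closed[OF M] abelian_group.l_neg[OF G] abelian_group.a_inv_closed[OF G]
  show ?thesis
  proof (intro moduleI R abelian_groupI)
    fix x assume x: "x \<in> carrier ?P"
    show "\<exists>y\<in>carrier ?P. y \<oplus>\<^bsub>?P\<^esub> x = \<zero>\<^bsub>?P\<^esub>"
    proof
      show "(\<lambda>n. \<ominus>\<^bsub>M n\<^esub> x n) \<oplus>\<^bsub>?P\<^esub> x = \<zero>\<^bsub>?P\<^esub>" using x by (simp add: fun_eq_iff)
      show "(\<lambda>n. \<ominus>\<^bsub>M n\<^esub> x n) \<in> carrier ?P" using x by simp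
    qed
  qed (auto simp: fun_eq_iff module.smult_l_distr[OF M] module.smult_r_distr[OF M] module.smult_assoc1[OF M]
      module.smult_one[OF M] abelian_monoid.a_assoc[OF abelian_group.axioms(1)[OF G]]
      abelian_monoid.l_zero[OF abelian_group.axioms(1)[OF G]]
      intro!: abelian_monoid.a_comm[OF abelian_group.axioms(1)[OF G]])
qed

text \<open>The pattern in which the six terms of the Leibniz relation for complexes appear, up to
  the signs of \<open>p\<close>, \<open>q\<close> and \<open>t\<close>, which depend on the parities
  of the degrees.\<close>

lemma (in abelian_group) cancel_six:
  assumes "p \<in> carrier G" "q \<in> carrier G" "t \<in> carrier G"
  shows "(p \<oplus> q) \<oplus> ((t \<oplus> \<ominus> q) \<oplus> (\<ominus> p \<oplus> \<ominus> t)) = \<zero>"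
proof -
  have "(t \<oplus> \<ominus> q) \<oplus> (\<ominus> p \<oplus> \<ominus> t) = (\<ominus> q \<oplus> t) \<oplus> (\<ominus> t \<oplus> \<ominus> p)"
    using assms by (metis a_comm a_inv_closed)
  also have "\<dots> = \<ominus> q \<oplus> (t \<oplus> (\<ominus> t \<oplus> \<ominus> p))" using assms by (simp add: a_assoc)
  also have "\<dots> = \<ominus> (p \<oplus> q)" using assms by (metis r_neg2 minus_add a_comm a_inv_closed)
  finally show ?thesis using assms by (simp add: r_neg)
qed

locale linear_cat =
  fixes R :: "'k ring" and A :: "('k, 'o, 'm) lin_cat"
  assumes linear: "linear_category R A"
begin

lemma cring_R: "cring R"
  using linear by (simp add: linear_category_def)

lemma module_hom: "x \<in> lob A \<Longrightarrow> y \<in> lob A \<Longrightarrow> module R (lhom A x y)"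
  using linear by (simp add: linear_category_def)

lemma hom_group: "x \<in> lob A \<Longrightarrow> y \<in> lob A \<Longrightarrow> abelian_group (lhom A x y)"
  using module_hom by (simp add: module_def)

lemma cmp_closed: "x \<in> lob A \<Longrightarrow> y \<in> lob A \<Longrightarrow> z \<in> lob A \<Longrightarrow> f \<in> carrier (lhom A x y) \<Longrightarrow> g \<in> carrier (lhom A y z)
    \<Longrightarrow> lcmp A x y z f g \<in> carrier (lhom A x z)"
  using linear by (simp add: linear_category_def category_def underlying_cat_def)

lemma cmp_assoc: "w \<in> lob A \<Longrightarrow> x \<in> lob A \<Longrightarrow> y \<in> lob A \<Longrightarrow> z \<in> lob A \<Longrightarrow> f \<in> carrier (lhom A w x)
    \<Longrightarrow> g \<in> carrier (lhom A x y) \<Longrightarrow> h \<in> carrier (lhom A y z)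
    \<Longrightarrow> lcmp A w y z (lcmp A w x y f g) h = lcmp A w x z f (lcmp A x y z g h)"
  using linear by (simp add: linear_category_def category_def underlying_cat_def)

lemma id_closed: "x \<in> lob A \<Longrightarrow> lidn A x \<in> carrier (lhom A x x)"
  using linear by (simp add: linear_category_def category_def underlying_cat_def)

lemma cmp_id_left: "x \<in> lob A \<Longrightarrow> y \<in> lob A \<Longrightarrow> f \<in> carrier (lhom A x y) \<Longrightarrow> lcmp A x x y (lidn A x) f = f"
  and cmp_id_right: "x \<in> lob A \<Longrightarrow> y \<in> lob A \<Longrightarrow> f \<in> carrier (lhom A x y) \<Longrightarrow> lcmp A x y y f (lidn A y) = f"
  using linear by (simp_all add: linear_category_def category_def underlying_cat_def)

lemma cmp_bilinear:
  assumes "x \<in> lob A" "y \<in> lob A" "z \<in> lob A"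
    "f \<in> carrier (lhom A x y)" "f' \<in> carrier (lhom A x y)" "g \<in> carrier (lhom A y z)" "g' \<in> carrier (lhom A y z)"
    "a \<in> carrier R"
  shows "lcmp A x y z (f \<oplus>\<^bsub>lhom A x y\<^esub> f') g = lcmp A x y z f g \<oplus>\<^bsub>lhom A x z\<^esub> lcmp A x y z f' g"
    and "lcmp A x y z f (g \<oplus>\<^bsub>lhom A y z\<^esub> g') = lcmp A x y z f g \<oplus>\<^bsub>lhom A x z\<^esub> lcmp A x y z f g'"
    and "lcmp A x y z (a \<odot>\<^bsub>lhom A x y\<^esub> f) g = a \<odot>\<^bsub>lhom A x z\<^esub> lcmp A x y z f g"
    and "lcmp A x y z f (a \<odot>\<^bsub>lhom A y z\<^esub> g) = a \<odot>\<^bsub>lhom A x z\<^esub> lcmp A x y z f g"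
  using linear assms unfolding linear_category_def by blast+

lemma zero_R: "\<zero>\<^bsub>R\<^esub> \<in> carrier R"
  using cring_R by (simp add: cring_def ring.ring_simprules)

lemma cmp_add_left: "x \<in> lob A \<Longrightarrow> y \<in> lob A \<Longrightarrow> z \<in> lob A \<Longrightarrow> f \<in> carrier (lhom A x y)
    \<Longrightarrow> f' \<in> carrier (lhom A x y) \<Longrightarrow> g \<in> carrier (lhom A y z)
    \<Longrightarrow> lcmp A x y z (f \<oplus>\<^bsub>lhom A x y\<^esub> f') g = lcmp A x y z f g \<oplus>\<^bsub>lhom A x z\<^esub> lcmp A x y z f' g"
  by (rule cmp_bilinear(1)[OF _ _ _ _ _ _ _ zero_R])

lemma cmp_add_right: "x \<in> lob A \<Longrightarrow> y \<in> lob A \<Longrightarrow> z \<in> lob A \<Longrightarrow> f \<in> carrier (lhom A x y)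
    \<Longrightarrow> g \<in> carrier (lhom A y z) \<Longrightarrow> g' \<in> carrier (lhom A y z)
    \<Longrightarrow> lcmp A x y z f (g \<oplus>\<^bsub>lhom A y z\<^esub> g') = lcmp A x y z f g \<oplus>\<^bsub>lhom A x z\<^esub> lcmp A x y z f g'"
  by (rule cmp_bilinear(2)[OF _ _ _ _ _ _ _ zero_R])

lemma cmp_smult_left: "x \<in> lob A \<Longrightarrow> y \<in> lob A \<Longrightarrow> z \<in> lob A \<Longrightarrow> f \<in> carrier (lhom A x y)
    \<Longrightarrow> g \<in> carrier (lhom A y z) \<Longrightarrow> a \<in> carrier R
    \<Longrightarrow> lcmp A x y z (a \<odot>\<^bsub>lhom A x y\<^esub> f) g = a \<odot>\<^bsub>lhom A x z\<^esub> lcmp A x y z f g"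
  by (rule cmp_bilinear(3))

lemma cmp_smult_right: "x \<in> lob A \<Longrightarrow> y \<in> lob A \<Longrightarrow> z \<in> lob A \<Longrightarrow> f \<in> carrier (lhom A x y)
    \<Longrightarrow> g \<in> carrier (lhom A y z) \<Longrightarrow> a \<in> carrier R
    \<Longrightarrow> lcmp A x y z f (a \<odot>\<^bsub>lhom A y z\<^esub> g) = a \<odot>\<^bsub>lhom A x z\<^esub> lcmp A x y z f g"
  by (rule cmp_bilinear(4))

lemma cmp_zero_left:
  assumes "x \<in> lob A" "y \<in> lob A" "z \<in> lob A" "g \<in> carrier (lhom A y z)"
  shows "lcmp A x y z \<zero>\<^bsub>lhom A x y\<^esub> g = \<zero>\<^bsub>lhom A x z\<^esub>"
proof -
  interpret M: module R "lhom A x y" using assms by (intro module_hom)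
  interpret N: module R "lhom A x z" using assms by (intro module_hom)
  show ?thesis
    using cmp_smult_left[OF assms(1-3) M.zero_closed assms(4) zero_R] cmp_closed[OF assms(1-3) M.zero_closed assms(4)] by simp
qed

lemma cmp_zero_right:
  assumes "x \<in> lob A" "y \<in> lob A" "z \<in> lob A" "f \<in> carrier (lhom A x y)"
  shows "lcmp A x y z f \<zero>\<^bsub>lhom A y z\<^esub> = \<zero>\<^bsub>lhom A x z\<^esub>"
proof -
  interpret M: module R "lhom A y z" using assms by (intro module_hom)
  interpret N: module R "lhom A x z" using assms by (intro module_hom)
  show ?thesis
    using cmp_smult_right[OF assms(1-4) M.zero_closed zero_R] cmp_closed[OF assms(1-4) M.zero_closed] by simp
qed

lemma cmp_minus_left:
  assumes "x \<in> lob A" "y \<in> lob A" "z \<in> lob A" "f \<in> carrier (lhom A x y)" "g \<in> carrier (lhom A y z)"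
  shows "lcmp A x y z (\<ominus>\<^bsub>lhom A x y\<^esub> f) g = \<ominus>\<^bsub>lhom A x z\<^esub> lcmp A x y z f g"
proof -
  interpret M: module R "lhom A x y" using assms by (intro module_hom)
  interpret N: module R "lhom A x z" using assms by (intro module_hom)
  have "lcmp A x y z (\<ominus>\<^bsub>lhom A x y\<^esub> f) g \<oplus>\<^bsub>lhom A x z\<^esub> lcmp A x y z f g = \<zero>\<^bsub>lhom A x z\<^esub>"
    using cmp_add_left[OF assms(1-3) M.a_inv_closed[OF assms(4)] assms(4,5)] assms by (simp add: M.l_neg cmp_zero_left)
  then show ?thesis using assms by (metis N.minus_equality cmp_closed M.a_inv_closed)
qed

lemma cmp_minus_right:
  assumes "x \<in> lob A" "y \<in> lob A" "z \<in> lob A" "f \<in> carrier (lhom A x y)" "g \<in> carrier (lhom A y z)"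
  shows "lcmp A x y z f (\<ominus>\<^bsub>lhom A y z\<^esub> g) = \<ominus>\<^bsub>lhom A x z\<^esub> lcmp A x y z f g"
proof -
  interpret M: module R "lhom A y z" using assms by (intro module_hom)
  interpret N: module R "lhom A x z" using assms by (intro module_hom)
  have "lcmp A x y z f (\<ominus>\<^bsub>lhom A y z\<^esub> g) \<oplus>\<^bsub>lhom A x z\<^esub> lcmp A x y z f g = \<zero>\<^bsub>lhom A x z\<^esub>"
    using cmp_add_right[OF assms(1-4) M.a_inv_closed[OF assms(5)] assms(5)] assms by (simp add: M.l_neg cmp_zero_right)
  then show ?thesis using assms by (metis N.minus_equality cmp_closed M.a_inv_closed)
qed

lemma sgn_smult:
  assumes "x \<in> lob A" "y \<in> lob A" "f \<in> carrier (lhom A x y)"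
  shows "sgn_in R d \<odot>\<^bsub>lhom A x y\<^esub> f = (if even d then f else \<ominus>\<^bsub>lhom A x y\<^esub> f)"
proof -
  interpret M: module R "lhom A x y" using assms by (intro module_hom)
  show ?thesis using assms(3) M.smult_l_minus[of "\<one>\<^bsub>R\<^esub>" f] by (simp add: sgn_in_def)
qed

lemma hom_minus_zero: "x \<in> lob A \<Longrightarrow> y \<in> lob A \<Longrightarrow> \<ominus>\<^bsub>lhom A x y\<^esub> \<zero>\<^bsub>lhom A x y\<^esub> = \<zero>\<^bsub>lhom A x y\<^esub>"
  using abelian_group.minus_equality[OF hom_group] hom_group
  by (metis abelian_group.axioms(1) abelian_monoid.l_zero abelian_monoid.zero_closed)

lemma sgn_R: "sgn_in R d \<in> carrier R"
proof -
  interpret cring R by (rule cring_R)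
  show ?thesis by (simp add: sgn_in_def)
qed

text \<open>Relative to the biproducts in neighbouring degrees the differential of a cone is a
  two-by-two matrix with one zero entry. Composition with an injection or a projection picks out a
  row or a column. The objects are abstract so that the indices of the complexes do not
  interfere.\<close>

lemma cone_differential:
  assumes ob: "x \<in> lob A" "x' \<in> lob A" "y \<in> lob A" "y' \<in> lob A"
    and Z: "is_biproduct A x y z j i p q" and Z': "is_biproduct A x' y' z' j' i' p' q'"
    and a: "a \<in> carrier (lhom A x x')" and b: "b \<in> carrier (lhom A y y')" and f: "f \<in> carrier (lhom A x y')"
    and d: "d = lcmp A z x z' p (lcmp A x x' z' (\<ominus>\<^bsub>lhom A x x'\<^esub> a) j') \<oplus>\<^bsub>lhom A z z'\<^esub>
      (lcmp A z x z' p (lcmp A x y' z' f i') \<oplus>\<^bsub>lhom A z z'\<^esub> lcmp A z y z' q (lcmp A y y' z' b i'))"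
  shows "lcmp A y z z' i d = lcmp A y y' z' b i'"
    and "lcmp A x z z' j d = \<ominus>\<^bsub>lhom A x z'\<^esub> lcmp A x x' z' a j' \<oplus>\<^bsub>lhom A x z'\<^esub> lcmp A x y' z' f i'"
    and "lcmp A z z' x' d p' = \<ominus>\<^bsub>lhom A z x'\<^esub> lcmp A z x x' p a"
    and "lcmp A z z' y' d q' = lcmp A z x y' p f \<oplus>\<^bsub>lhom A z y'\<^esub> lcmp A z y y' q b"
proof -
  note Z = Z[unfolded is_biproduct_def] and Z' = Z'[unfolded is_biproduct_def]
  note [simp] = ob a b f cmp_closed cmp_minus_left cmp_minus_right cmp_add_left cmp_add_right cmp_zero_left cmp_zero_right
    abelian_group.a_inv_closed[OF hom_group] abelian_group.axioms(1)[OF hom_group, THEN abelian_monoid.a_closed]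
    abelian_group.axioms(1)[OF hom_group, THEN abelian_monoid.zero_closed]
    abelian_group.axioms(1)[OF hom_group, THEN abelian_monoid.l_zero]
    abelian_group.axioms(1)[OF hom_group, THEN abelian_monoid.r_zero] hom_minus_zero
    cmp_id_left cmp_id_right
  have ty [simp]: "z \<in> lob A" "z' \<in> lob A" "i \<in> carrier (lhom A y z)" "j \<in> carrier (lhom A x z)"
    "p \<in> carrier (lhom A z x)" "q \<in> carrier (lhom A z y)" "i' \<in> carrier (lhom A y' z')" "j' \<in> carrier (lhom A x' z')"
    "p' \<in> carrier (lhom A z' x')" "q' \<in> carrier (lhom A z' y')"
    using Z Z' by blast+
  \<comment> \<open>Reassociation that brings an injection next to a projection of the same
    biproduct.\<close>
  have pre: "lcmp A w z u t (lcmp A z v u r s) = lcmp A w v u (lcmp A w z v t r) s"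
    if "w \<in> lob A" "u \<in> lob A" "v \<in> lob A" "t \<in> carrier (lhom A w z)" "r \<in> carrier (lhom A z v)" "s \<in> carrier (lhom A v u)" for w u v t r s
    using that by (simp add: cmp_assoc)
  have [simp]: "lcmp A y z z' i (lcmp A z x z' p s) = \<zero>\<^bsub>lhom A y z'\<^esub>" "lcmp A x z z' j (lcmp A z x z' p s) = s"
    if "s \<in> carrier (lhom A x z')" for s using that Z by (simp_all add: pre)
  have [simp]: "lcmp A y z z' i (lcmp A z y z' q s) = s" "lcmp A x z z' j (lcmp A z y z' q s) = \<zero>\<^bsub>lhom A x z'\<^esub>"
    if "s \<in> carrier (lhom A y z')" for s using that Z by (simp_all add: pre)
  show "lcmp A y z z' i d = lcmp A y y' z' b i'"
    "lcmp A x z z' j d = \<ominus>\<^bsub>lhom A x z'\<^esub> lcmp A x x' z' a j' \<oplus>\<^bsub>lhom A x z'\<^esub> lcmp A x y' z' f i'"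
    unfolding d by simp_all
  have [simp]: "lcmp A z z' u (lcmp A z v z' r (lcmp A v w z' s t)) t' = lcmp A z v u r (lcmp A v w u s (lcmp A w z' u t t'))"
    if "w \<in> lob A" "u \<in> lob A" "v \<in> lob A" "r \<in> carrier (lhom A z v)" "s \<in> carrier (lhom A v w)" "t \<in> carrier (lhom A w z')"
      "t' \<in> carrier (lhom A z' u)" for w u v r s t t'
    using that by (simp add: cmp_assoc)
  have [simp]: "lcmp A x' z' x' j' p' = lidn A x'" "lcmp A y' z' y' i' q' = lidn A y'"
    "lcmp A x' z' y' j' q' = \<zero>\<^bsub>lhom A x' y'\<^esub>" "lcmp A y' z' x' i' p' = \<zero>\<^bsub>lhom A y' x'\<^esub>"
    using Z' by blast+
  show "lcmp A z z' x' d p' = \<ominus>\<^bsub>lhom A z x'\<^esub> lcmp A z x x' p a"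
    "lcmp A z z' y' d q' = lcmp A z x y' p f \<oplus>\<^bsub>lhom A z y'\<^esub> lcmp A z y y' q b"
    unfolding d by simp_all
qed

section \<open>The differential graded category of complexes in shifted degrees\<close>

abbreviation Cx :: "('k, ('o, 'm) complex, int \<Rightarrow> 'm) ainf" where "Cx \<equiv> complexes R A"

lemma aob_Cx [simp]: "X \<in> aob Cx \<longleftrightarrow> is_complex A X"
  by (simp add: complexes_def ainf_of_dg_def complexes_dg_def)

lemma complex_ob: "is_complex A X \<Longrightarrow> cob X n \<in> lob A"
  and complex_diff: "is_complex A X \<Longrightarrow> m = n + 1 \<Longrightarrow> cdiff X n \<in> carrier (lhom A (cob X n) (cob X m))"
  and complex_diff_diff: "is_complex A X \<Longrightarrow> m = n + 1 \<Longrightarrow> k = n + 2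
    \<Longrightarrow> lcmp A (cob X n) (cob X m) (cob X k) (cdiff X n) (cdiff X m) = \<zero>\<^bsub>lhom A (cob X n) (cob X k)\<^esub>"
  by (simp_all add: is_complex_def)

lemma shom_Cx: "shom Cx X Y d = (let M = \<lambda>n. lhom A (cob X n) (cob Y (n + (d + 1))) in
    \<lparr> carrier = {f. \<forall>n. f n \<in> carrier (M n)}, mult = undefined, one = undefined,
    ring.zero = (\<lambda>n. \<zero>\<^bsub>M n\<^esub>), add = (\<lambda>f g n. f n \<oplus>\<^bsub>M n\<^esub> g n), smult = (\<lambda>a f n. a \<odot>\<^bsub>M n\<^esub> f n) \<rparr>)"
  by (simp add: complexes_def ainf_of_dg_def complexes_dg_def)

lemma module_Cx: "is_complex A X \<Longrightarrow> is_complex A Y \<Longrightarrow> module R (shom Cx X Y d)"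
  unfolding shom_Cx Let_def by (intro module_componentwise cring_R module_hom complex_ob)

lemma carrier_Cx: "f \<in> carrier (shom Cx X Y d) \<longleftrightarrow> (\<forall>n. f n \<in> carrier (lhom A (cob X n) (cob Y (n + (d + 1)))))"
  by (simp add: shom_Cx)

text \<open>Here and in the following rules the index of the target is a variable bound by an
  equation: n + (d + 1) and n + d + 1 are different terms, and the objects and modules in a goal
  have to agree syntactically.\<close>

lemma carrier_CxD: "f \<in> carrier (shom Cx X Y d) \<Longrightarrow> m = n + d + 1 \<Longrightarrow> f n \<in> carrier (lhom A (cob X n) (cob Y m))"
  by (simp add: carrier_Cx add.assoc)

lemma carrier_CxI: "(\<And>n m. m = n + d + 1 \<Longrightarrow> f n \<in> carrier (lhom A (cob X n) (cob Y m))) \<Longrightarrow> f \<in> carrier (shom Cx X Y d)"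
  by (simp add: carrier_Cx add.assoc)

lemma zero_Cx: "m = n + d + 1 \<Longrightarrow> \<zero>\<^bsub>shom Cx X Y d\<^esub> n = \<zero>\<^bsub>lhom A (cob X n) (cob Y m)\<^esub>"
  and add_Cx: "m = n + d + 1 \<Longrightarrow> (f \<oplus>\<^bsub>shom Cx X Y d\<^esub> g) n = f n \<oplus>\<^bsub>lhom A (cob X n) (cob Y m)\<^esub> g n"
  and smult_Cx: "m = n + d + 1 \<Longrightarrow> (a \<odot>\<^bsub>shom Cx X Y d\<^esub> f) n = a \<odot>\<^bsub>lhom A (cob X n) (cob Y m)\<^esub> f n"
  by (simp_all add: shom_Cx Let_def add.assoc)

lemma minus_Cx:
  assumes XY: "is_complex A X" "is_complex A Y" and f: "f \<in> carrier (shom Cx X Y d)" and m: "m = n + d + 1"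
  shows "(\<ominus>\<^bsub>shom Cx X Y d\<^esub> f) n = \<ominus>\<^bsub>lhom A (cob X n) (cob Y m)\<^esub> f n"
proof -
  interpret M: module R "shom Cx X Y d" using XY by (rule module_Cx)
  interpret N: module R "lhom A (cob X n) (cob Y m)" using XY by (intro module_hom complex_ob)
  have "\<ominus>\<^bsub>shom Cx X Y d\<^esub> f = (\<ominus>\<^bsub>R\<^esub> \<one>\<^bsub>R\<^esub>) \<odot>\<^bsub>shom Cx X Y d\<^esub> f"
    using M.smult_l_minus[OF M.one_closed f] f by simp
  then show ?thesis
    using N.smult_l_minus[OF M.one_closed carrier_CxD[OF f m]] carrier_CxD[OF f m] by (simp add: smult_Cx[OF m])
qed

lemma b1_Cx: "n' = n + 1 \<Longrightarrow> m = n + d + 1 \<Longrightarrow> k = n + d + 2 \<Longrightarrow>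
    bop Cx [Arr X Y d f] n = lcmp A (cob X n) (cob Y m) (cob Y k) (f n) (cdiff Y m)
      \<ominus>\<^bsub>lhom A (cob X n) (cob Y k)\<^esub> (sgn_in R (d + 1) \<odot>\<^bsub>lhom A (cob X n) (cob Y k)\<^esub>
        lcmp A (cob X n) (cob X n') (cob Y k) (cdiff X n) (f n'))"
  by (simp add: complexes_def ainf_of_dg_def complexes_dg_def add.assoc)

lemma b2_Cx: "m = n + d + 1 \<Longrightarrow> k = n + d + e + 2 \<Longrightarrow>
    bop Cx [Arr X Y d f, Arr Y Z e g] n
      = sgn_in R (e + 1) \<odot>\<^bsub>lhom A (cob X n) (cob Z k)\<^esub> lcmp A (cob X n) (cob Y m) (cob Z k) (f n) (g m)"
  by (simp add: complexes_def ainf_of_dg_def complexes_dg_def ac_simps)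

lemma higher_Cx: "3 \<le> length xs \<Longrightarrow> bop Cx xs = \<zero>\<^bsub>shom Cx (bsrc xs) (btgt xs) (bdeg xs)\<^esub>"
  by (cases xs; cases "tl xs"; cases "tl (tl xs)")
    (auto simp: complexes_def ainf_of_dg_def complexes_dg_def split: arr.splits list.splits)

lemma b1_Cx_closed:
  assumes XY: "is_complex A X" "is_complex A Y" and f: "f \<in> carrier (shom Cx X Y d)"
  shows "bop Cx [Arr X Y d f] \<in> carrier (shom Cx X Y (d + 1))"
proof (rule carrier_CxI)
  fix n m assume m: "m = n + (d + 1) + 1"
  note ob = XY[THEN complex_ob]
  interpret M: module R "lhom A (cob X n) (cob Y m)" using ob by (intro module_hom)
  have 1: "f n \<in> carrier (lhom A (cob X n) (cob Y (n + d + 1)))" by (rule carrier_CxD[OF f refl])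
  have 2: "f (n + 1) \<in> carrier (lhom A (cob X (n + 1)) (cob Y m))" by (rule carrier_CxD[OF f]) (simp add: m)
  have 3: "cdiff Y (n + d + 1) \<in> carrier (lhom A (cob Y (n + d + 1)) (cob Y m))"
    by (rule complex_diff[OF XY(2)]) (simp add: m)
  have 4: "m = n + d + 2" using m by simp
  show "bop Cx [Arr X Y d f] n \<in> carrier (lhom A (cob X n) (cob Y m))"
    unfolding b1_Cx[OF refl refl 4] using ob 1 2 3 complex_diff[OF XY(1) refl] sgn_R by (simp add: cmp_closed)
qed

lemma b1_Cx_add:
  assumes XY: "is_complex A X" "is_complex A Y" and f: "f \<in> carrier (shom Cx X Y d)" and g: "g \<in> carrier (shom Cx X Y d)"
  shows "bop Cx [Arr X Y d (f \<oplus>\<^bsub>shom Cx X Y d\<^esub> g)] = bop Cx [Arr X Y d f] \<oplus>\<^bsub>shom Cx X Y (d + 1)\<^esub> bop Cx [Arr X Y d g]"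
proof
  fix n :: int
  define m where "m = n + d + 1"
  define k where "k = n + d + 2"
  define n' where "n' = n + 1"
  have ix: "m = n + d + 1" "k = n + d + 2" "k = n + (d + 1) + 1" "n' = n + 1" "k = n' + d + 1" "k = m + 1"
    by (simp_all add: m_def k_def n'_def)
  note ob [simp] = XY[THEN complex_ob]
  interpret M: module R "lhom A (cob X n) (cob Y k)" by (intro module_hom ob)
  note [simp] = f[THEN carrier_CxD, OF ix(1)] f[THEN carrier_CxD, OF ix(5)] g[THEN carrier_CxD, OF ix(1)] g[THEN carrier_CxD, OF ix(5)]
    complex_diff[OF XY(1) ix(4)] complex_diff[OF XY(2) ix(6)]
  show "bop Cx [Arr X Y d (f \<oplus>\<^bsub>shom Cx X Y d\<^esub> g)] n = (bop Cx [Arr X Y d f] \<oplus>\<^bsub>shom Cx X Y (d + 1)\<^esub> bop Cx [Arr X Y d g]) n"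
    unfolding add_Cx[OF ix(3)] b1_Cx[OF ix(4,1,2)] add_Cx[OF ix(1)] add_Cx[OF ix(5)]
    by (simp add: cmp_closed cmp_add_left cmp_add_right sgn_R M.smult_r_distr M.minus_eq M.minus_add M.a_ac)
qed

lemma b1_Cx_smult:
  assumes XY: "is_complex A X" "is_complex A Y" and f: "f \<in> carrier (shom Cx X Y d)" and a: "a \<in> carrier R"
  shows "bop Cx [Arr X Y d (a \<odot>\<^bsub>shom Cx X Y d\<^esub> f)] = a \<odot>\<^bsub>shom Cx X Y (d + 1)\<^esub> bop Cx [Arr X Y d f]"
proof
  fix n :: int
  define m where "m = n + d + 1"
  define k where "k = n + d + 2"
  define n' where "n' = n + 1"
  have ix: "m = n + d + 1" "k = n + d + 2" "k = n + (d + 1) + 1" "n' = n + 1" "k = n' + d + 1" "k = m + 1"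
    by (simp_all add: m_def k_def n'_def)
  note ob [simp] = XY[THEN complex_ob]
  interpret M: module R "lhom A (cob X n) (cob Y k)" by (intro module_hom ob)
  note [simp] = f[THEN carrier_CxD, OF ix(1)] f[THEN carrier_CxD, OF ix(5)]
    complex_diff[OF XY(1) ix(4)] complex_diff[OF XY(2) ix(6)]
  show "bop Cx [Arr X Y d (a \<odot>\<^bsub>shom Cx X Y d\<^esub> f)] n = (a \<odot>\<^bsub>shom Cx X Y (d + 1)\<^esub> bop Cx [Arr X Y d f]) n"
    unfolding smult_Cx[OF ix(3)] b1_Cx[OF ix(4,1,2)] smult_Cx[OF ix(1)] smult_Cx[OF ix(5)]
    using a by (simp add: cmp_closed cmp_smult_left cmp_smult_right sgn_smult sgn_R M.smult_r_distr M.minus_eq M.smult_r_minus)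
qed

lemma b1_Cx_b1:
  assumes XY: "is_complex A X" "is_complex A Y" and f: "f \<in> carrier (shom Cx X Y d)"
  shows "bop Cx [Arr X Y (d + 1) (bop Cx [Arr X Y d f])] = \<zero>\<^bsub>shom Cx X Y (d + 2)\<^esub>"
proof
  fix n :: int
  define n1 where "n1 = n + 1"
  define n2 where "n2 = n + 2"
  define m where "m = n + d + 1"
  define m1 where "m1 = n + d + 2"
  define m2 where "m2 = n + d + 3"
  note defs = n1_def n2_def m_def m1_def m2_def
  have ix: "n1 = n + 1" "n2 = n + 2" "n2 = n1 + 1" "m = n + d + 1" "m1 = n + d + 2" "m1 = n + (d + 1) + 1" "m2 = n + (d + 1) + 2"
    "m1 = n1 + d + 1" "m2 = n1 + d + 2" "m2 = n2 + d + 1" "m1 = m + 1" "m2 = m + 2" "m2 = m1 + 1" "m2 = n + (d + 2) + 1"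
    by (simp_all add: defs)
  note ob [simp] = XY[THEN complex_ob]
  interpret M: module R "lhom A (cob X n) (cob Y m2)" by (intro module_hom ob)
  interpret M1: module R "lhom A (cob X n1) (cob Y m2)" by (intro module_hom ob)
  interpret M2: module R "lhom A (cob X n) (cob Y m1)" by (intro module_hom ob)
  note ty [simp] = f[THEN carrier_CxD, OF ix(4)] f[THEN carrier_CxD, OF ix(8)] f[THEN carrier_CxD, OF ix(10)]
    complex_diff[OF XY(1) ix(1)] complex_diff[OF XY(1) ix(3)] complex_diff[OF XY(2) ix(11)] complex_diff[OF XY(2) ix(13)]
  have 1: "lcmp A (cob X n) (cob Y m1) (cob Y m2) (lcmp A (cob X n) (cob Y m) (cob Y m1) (f n) (cdiff Y m)) (cdiff Y m1)
      = \<zero>\<^bsub>lhom A (cob X n) (cob Y m2)\<^esub>"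
    using complex_diff_diff[OF XY(2) ix(11,12)] by (simp add: cmp_assoc cmp_zero_right)
  have 2: "lcmp A (cob X n) (cob X n1) (cob Y m2) (cdiff X n) (lcmp A (cob X n1) (cob X n2) (cob Y m2) (cdiff X n1) (f n2))
      = \<zero>\<^bsub>lhom A (cob X n) (cob Y m2)\<^esub>"
    using complex_diff_diff[OF XY(1) ix(1,2)] by (simp add: cmp_assoc[symmetric] cmp_zero_left)
  show "bop Cx [Arr X Y (d + 1) (bop Cx [Arr X Y d f])] n = \<zero>\<^bsub>shom Cx X Y (d + 2)\<^esub> n"
    unfolding zero_Cx[OF ix(14)] b1_Cx[OF ix(1,6,7)] b1_Cx[OF ix(1,4,5)] b1_Cx[OF ix(3,8,9)]
    by (cases "even d") (simp_all add: cmp_closed M.minus_eq M1.minus_eq M2.minus_eq sgn_smult cmp_add_left cmp_add_right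
        cmp_minus_left cmp_minus_right 1 2 cmp_assoc M.minus_add M.r_neg M.l_neg)
qed

lemma b2_Cx_closed:
  assumes XYZ: "is_complex A X" "is_complex A Y" "is_complex A Z"
    and f: "f \<in> carrier (shom Cx X Y d)" and g: "g \<in> carrier (shom Cx Y Z e)"
  shows "bop Cx [Arr X Y d f, Arr Y Z e g] \<in> carrier (shom Cx X Z (d + e + 1))"
proof (rule carrier_CxI)
  fix n k assume k: "k = n + (d + e + 1) + 1"
  note ob = XYZ[THEN complex_ob]
  interpret M: module R "lhom A (cob X n) (cob Z k)" using ob by (intro module_hom)
  have 4: "k = n + d + e + 2" "k = (n + d + 1) + e + 1" using k by simp_all
  show "bop Cx [Arr X Y d f, Arr Y Z e g] n \<in> carrier (lhom A (cob X n) (cob Z k))"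
    unfolding b2_Cx[OF refl 4(1)] using ob carrier_CxD[OF f refl] carrier_CxD[OF g 4(2)] sgn_R by (simp add: cmp_closed)
qed

lemma b2_Cx_add:
  assumes XYZ: "is_complex A X" "is_complex A Y" "is_complex A Z"
    and f: "f \<in> carrier (shom Cx X Y d)" and g: "g \<in> carrier (shom Cx Y Z e)"
  shows "f' \<in> carrier (shom Cx X Y d) \<Longrightarrow> bop Cx [Arr X Y d (f \<oplus>\<^bsub>shom Cx X Y d\<^esub> f'), Arr Y Z e g]
      = bop Cx [Arr X Y d f, Arr Y Z e g] \<oplus>\<^bsub>shom Cx X Z (d + e + 1)\<^esub> bop Cx [Arr X Y d f', Arr Y Z e g]"
    and "g' \<in> carrier (shom Cx Y Z e) \<Longrightarrow> bop Cx [Arr X Y d f, Arr Y Z e (g \<oplus>\<^bsub>shom Cx Y Z e\<^esub> g')]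
      = bop Cx [Arr X Y d f, Arr Y Z e g] \<oplus>\<^bsub>shom Cx X Z (d + e + 1)\<^esub> bop Cx [Arr X Y d f, Arr Y Z e g']"
proof -
  have *: "module R (lhom A (cob X n) (cob Z k))" for n k using XYZ by (intro module_hom complex_ob)
  note ob [simp] = XYZ[THEN complex_ob]
  show "bop Cx [Arr X Y d (f \<oplus>\<^bsub>shom Cx X Y d\<^esub> f'), Arr Y Z e g]
      = bop Cx [Arr X Y d f, Arr Y Z e g] \<oplus>\<^bsub>shom Cx X Z (d + e + 1)\<^esub> bop Cx [Arr X Y d f', Arr Y Z e g]"
    if f': "f' \<in> carrier (shom Cx X Y d)"
  proof
    fix n
    define m where "m = n + d + 1"
    define k where "k = n + d + e + 2"
    have ix: "m = n + d + 1" "k = n + d + e + 2" "k = m + e + 1" "k = n + (d + e + 1) + 1" by (simp_all add: m_def k_def)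
    show "bop Cx [Arr X Y d (f \<oplus>\<^bsub>shom Cx X Y d\<^esub> f'), Arr Y Z e g] n
        = (bop Cx [Arr X Y d f, Arr Y Z e g] \<oplus>\<^bsub>shom Cx X Z (d + e + 1)\<^esub> bop Cx [Arr X Y d f', Arr Y Z e g]) n"
      unfolding add_Cx[OF ix(4)] b2_Cx[OF ix(1,2)] add_Cx[OF ix(1)]
      using carrier_CxD[OF f ix(1)] carrier_CxD[OF f' ix(1)] carrier_CxD[OF g ix(3)]
      by (simp add: cmp_add_left cmp_closed sgn_R module.smult_r_distr[OF *])
  qed
  show "bop Cx [Arr X Y d f, Arr Y Z e (g \<oplus>\<^bsub>shom Cx Y Z e\<^esub> g')]
      = bop Cx [Arr X Y d f, Arr Y Z e g] \<oplus>\<^bsub>shom Cx X Z (d + e + 1)\<^esub> bop Cx [Arr X Y d f, Arr Y Z e g']"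
    if g': "g' \<in> carrier (shom Cx Y Z e)"
  proof
    fix n
    define m where "m = n + d + 1"
    define k where "k = n + d + e + 2"
    have ix: "m = n + d + 1" "k = n + d + e + 2" "k = m + e + 1" "k = n + (d + e + 1) + 1" by (simp_all add: m_def k_def)
    show "bop Cx [Arr X Y d f, Arr Y Z e (g \<oplus>\<^bsub>shom Cx Y Z e\<^esub> g')] n
        = (bop Cx [Arr X Y d f, Arr Y Z e g] \<oplus>\<^bsub>shom Cx X Z (d + e + 1)\<^esub> bop Cx [Arr X Y d f, Arr Y Z e g']) n"
      unfolding add_Cx[OF ix(4)] b2_Cx[OF ix(1,2)] add_Cx[OF ix(3)]
      using carrier_CxD[OF f ix(1)] carrier_CxD[OF g ix(3)] carrier_CxD[OF g' ix(3)]
      by (simp add: cmp_add_right cmp_closed sgn_R module.smult_r_distr[OF *])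
  qed
qed

lemma leibniz_Cx:
  assumes XYZ: "is_complex A X" "is_complex A Y" "is_complex A Z"
    and f: "f \<in> carrier (shom Cx X Y d)" and g: "g \<in> carrier (shom Cx Y Z e)"
  shows "bop Cx [Arr X Z (d + e + 1) (bop Cx [Arr X Y d f, Arr Y Z e g])]
      \<oplus>\<^bsub>shom Cx X Z (d + e + 2)\<^esub>
        (sgn_in R e \<odot>\<^bsub>shom Cx X Z (d + e + 2)\<^esub> bop Cx [Arr X Y (d + 1) (bop Cx [Arr X Y d f]), Arr Y Z e g]
         \<oplus>\<^bsub>shom Cx X Z (d + e + 2)\<^esub> bop Cx [Arr X Y d f, Arr Y Z (e + 1) (bop Cx [Arr Y Z e g])])
      = \<zero>\<^bsub>shom Cx X Z (d + e + 2)\<^esub>"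
proof
  fix n :: int
  define n' where "n' = n + 1"
  define m1 where "m1 = n + d + 1"
  define m2 where "m2 = n + d + 2"
  define k' where "k' = n + d + e + 2"
  define k where "k = n + d + e + 3"
  note defs = n'_def m1_def m2_def k'_def k_def
  have n: "n' = n + 1" and m1: "m1 = n + d + 1" and m2: "m2 = n + d + 2" "m2 = n + (d + 1) + 1" "m2 = n' + d + 1" "m2 = m1 + 1"
    and k': "k' = n + d + e + 2" "k' = n + (d + e + 1) + 1" "k' = m1 + e + 1"
    and k: "k = n + (d + e + 1) + 2" "k = n' + d + e + 2" "k = n + (d + 1) + e + 2" "k = n + d + (e + 1) + 2" "k = m1 + e + 2"
      "k = n + (d + e + 2) + 1" "k = m2 + e + 1" "k = k' + 1"
    by (simp_all add: defs)
  note ob [simp] = XYZ[THEN complex_ob]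
  interpret M: module R "lhom A (cob X n) (cob Z k)" by (intro module_hom ob)
  interpret M1: module R "lhom A (cob X n) (cob Y m2)" by (intro module_hom ob)
  interpret M2: module R "lhom A (cob Y m1) (cob Z k)" by (intro module_hom ob)
  note ty [simp] = carrier_CxD[OF f m1] carrier_CxD[OF f m2(3)] carrier_CxD[OF g k'(3)] carrier_CxD[OF g k(7)]
    complex_diff[OF XYZ(1) n] complex_diff[OF XYZ(2) m2(4)] complex_diff[OF XYZ(3) k(8)]
  \<comment> \<open>The six terms are the composites f g d, d f g and f d g, each occurring twice.
    The eight instances of \<open>cancel_six\<close> below cover the signs that the parities of
    \<open>d\<close> and \<open>e\<close> can give them.\<close>
  define P where "P = lcmp A (cob X n) (cob Y m1) (cob Z k) (f n) (lcmp A (cob Y m1) (cob Z k') (cob Z k) (g m1) (cdiff Z k'))"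
  define Q where "Q = lcmp A (cob X n) (cob X n') (cob Z k) (cdiff X n) (lcmp A (cob X n') (cob Y m2) (cob Z k) (f n') (g m2))"
  define T where "T = lcmp A (cob X n) (cob Y m1) (cob Z k) (f n) (lcmp A (cob Y m1) (cob Y m2) (cob Z k) (cdiff Y m1) (g m2))"
  have [simp]: "P \<in> carrier (lhom A (cob X n) (cob Z k))" "Q \<in> carrier (lhom A (cob X n) (cob Z k))"
    "T \<in> carrier (lhom A (cob X n) (cob Z k))"
    by (simp_all add: P_def Q_def T_def cmp_closed)
  show "(bop Cx [Arr X Z (d + e + 1) (bop Cx [Arr X Y d f, Arr Y Z e g])]
      \<oplus>\<^bsub>shom Cx X Z (d + e + 2)\<^esub>
        (sgn_in R e \<odot>\<^bsub>shom Cx X Z (d + e + 2)\<^esub> bop Cx [Arr X Y (d + 1) (bop Cx [Arr X Y d f]), Arr Y Z e g]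
         \<oplus>\<^bsub>shom Cx X Z (d + e + 2)\<^esub> bop Cx [Arr X Y d f, Arr Y Z (e + 1) (bop Cx [Arr Y Z e g])])) n
      = \<zero>\<^bsub>shom Cx X Z (d + e + 2)\<^esub> n"
    unfolding add_Cx[OF k(6)] smult_Cx[OF k(6)] zero_Cx[OF k(6)] b1_Cx[OF n k'(2) k(1)] b2_Cx[OF m1 k'(1)] b2_Cx[OF m2(3) k(2)]
      b2_Cx[OF m2(2) k(3)] b1_Cx[OF n m1 m2(1)] b2_Cx[OF m1 k(4)] b1_Cx[OF m2(4) k'(3) k(5)]
    using M.cancel_six[of P Q T] M.cancel_six[of P "\<ominus>\<^bsub>lhom A (cob X n) (cob Z k)\<^esub> Q" T]
      M.cancel_six[of "\<ominus>\<^bsub>lhom A (cob X n) (cob Z k)\<^esub> P" Q T] M.cancel_six[of "\<ominus>\<^bsub>lhom A (cob X n) (cob Z k)\<^esub> P" "\<ominus>\<^bsub>lhom A (cob X n) (cob Z k)\<^esub> Q" T]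
      M.cancel_six[of P Q "\<ominus>\<^bsub>lhom A (cob X n) (cob Z k)\<^esub> T"] M.cancel_six[of P "\<ominus>\<^bsub>lhom A (cob X n) (cob Z k)\<^esub> Q" "\<ominus>\<^bsub>lhom A (cob X n) (cob Z k)\<^esub> T"]
      M.cancel_six[of "\<ominus>\<^bsub>lhom A (cob X n) (cob Z k)\<^esub> P" Q "\<ominus>\<^bsub>lhom A (cob X n) (cob Z k)\<^esub> T"]
      M.cancel_six[of "\<ominus>\<^bsub>lhom A (cob X n) (cob Z k)\<^esub> P" "\<ominus>\<^bsub>lhom A (cob X n) (cob Z k)\<^esub> Q" "\<ominus>\<^bsub>lhom A (cob X n) (cob Z k)\<^esub> T"]
    by (cases "even d"; cases "even e")
      (simp_all add: cmp_closed M.minus_eq M1.minus_eq M2.minus_eq sgn_smult cmp_add_left cmp_add_right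
        cmp_minus_left cmp_minus_right cmp_assoc M.minus_add P_def[symmetric] Q_def[symmetric] T_def[symmetric])
qed

lemma assoc_Cx:
  assumes ob: "is_complex A W" "is_complex A X" "is_complex A Y" "is_complex A Z"
    and x: "x \<in> carrier (shom Cx W X d)" and y: "y \<in> carrier (shom Cx X Y e)" and z: "z \<in> carrier (shom Cx Y Z g)"
  shows "sgn_in R g \<odot>\<^bsub>shom Cx W Z (d + e + g + 2)\<^esub>
            bop Cx [Arr W Y (d + e + 1) (bop Cx [Arr W X d x, Arr X Y e y]), Arr Y Z g z]
          \<oplus>\<^bsub>shom Cx W Z (d + e + g + 2)\<^esub>
            bop Cx [Arr W X d x, Arr X Z (e + g + 1) (bop Cx [Arr X Y e y, Arr Y Z g z])]
        = \<zero>\<^bsub>shom Cx W Z (d + e + g + 2)\<^esub>"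
proof
  fix n :: int
  define m where "m = n + d + 1"
  define k where "k = n + d + e + 2"
  define l where "l = n + d + e + g + 3"
  note defs = m_def k_def l_def
  have ix: "m = n + d + 1" "k = n + d + e + 2" "k = n + (d + e + 1) + 1" "k = m + e + 1"
    "l = n + (d + e + g + 2) + 1" "l = n + (d + e + 1) + g + 2" "l = n + d + (e + g + 1) + 2" "l = m + e + g + 2" "l = k + g + 1"
    by (simp_all add: defs)
  note ob [simp] = ob[THEN complex_ob]
  interpret M: module R "lhom A (cob W n) (cob Z l)" by (intro module_hom ob)
  note ty [simp] = carrier_CxD[OF x ix(1)] carrier_CxD[OF y ix(4)] carrier_CxD[OF z ix(9)]
  show "(sgn_in R g \<odot>\<^bsub>shom Cx W Z (d + e + g + 2)\<^esub>
            bop Cx [Arr W Y (d + e + 1) (bop Cx [Arr W X d x, Arr X Y e y]), Arr Y Z g z]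
          \<oplus>\<^bsub>shom Cx W Z (d + e + g + 2)\<^esub>
            bop Cx [Arr W X d x, Arr X Z (e + g + 1) (bop Cx [Arr X Y e y, Arr Y Z g z])]) n
        = \<zero>\<^bsub>shom Cx W Z (d + e + g + 2)\<^esub> n"
    unfolding add_Cx[OF ix(5)] smult_Cx[OF ix(5)] zero_Cx[OF ix(5)] b2_Cx[OF ix(3,6)] b2_Cx[OF ix(1,2)] b2_Cx[OF ix(1,7)] b2_Cx[OF ix(4,8)]
    by (cases "even g"; cases "even e")
      (simp_all add: cmp_closed sgn_smult cmp_minus_left cmp_minus_right cmp_assoc M.r_neg M.l_neg)
qed

definition cid :: "('o, 'm) complex \<Rightarrow> int \<Rightarrow> 'm" where "cid X n = lidn A (cob X n)"

lemma dg_exprs_Cx: "dg_exprs R Cx cid"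
proof (intro dg_exprs.intro exprs.intro dg_exprs_axioms.intro cring_R; (unfold aob_Cx)?)
  fix X :: "('o, 'm) complex" assume X: "is_complex A X"
  note ob [simp] = complex_ob[OF X]
  show cid: "cid X \<in> carrier (shom Cx X X (- 1))"
    by (rule carrier_CxI) (simp add: cid_def id_closed)
  show "bop Cx [Arr X X (- 1) (cid X)] = \<zero>\<^bsub>shom Cx X X 0\<^esub>"
  proof
    fix n
    interpret M: module R "lhom A (cob X n) (cob X (n + 1))" by (intro module_hom ob)
    have ix: "n = n + (- 1) + 1" "n + 1 = n + (- 1) + 2" "n + 1 = n + 0 + 1" by simp_all
    show "bop Cx [Arr X X (- 1) (cid X)] n = \<zero>\<^bsub>shom Cx X X 0\<^esub> n"
      unfolding b1_Cx[OF refl ix(1,2)] zero_Cx[OF ix(3)] using complex_diff[OF X refl]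
      by (simp add: cid_def sgn_smult cmp_id_left cmp_id_right M.minus_eq M.r_neg)
  qed
next
  fix X Y :: "('o, 'm) complex" and d f
  assume XY: "is_complex A X" "is_complex A Y" and f: "f \<in> carrier (shom Cx X Y d)"
  note ob [simp] = XY[THEN complex_ob]
  show "bop Cx [Arr X Y d f, Arr Y Y (- 1) (cid Y)] = f"
  proof
    fix n
    have ix: "n + d + 1 = n + d + - 1 + 2" by simp
    show "bop Cx [Arr X Y d f, Arr Y Y (- 1) (cid Y)] n = f n"
      unfolding b2_Cx[OF refl ix] using carrier_CxD[OF f refl] by (simp add: cid_def sgn_smult cmp_id_right)
  qed
  show "sgn_in R (d + 1) \<odot>\<^bsub>shom Cx X Y d\<^esub> bop Cx [Arr X X (- 1) (cid X), Arr X Y d f] = f"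
  proof
    fix n
    interpret M: module R "lhom A (cob X n) (cob Y (n + d + 1))" by (intro module_hom ob)
    have ix: "n = n + - 1 + 1" "n + d + 1 = n + - 1 + d + 2" by simp_all
    show "(sgn_in R (d + 1) \<odot>\<^bsub>shom Cx X Y d\<^esub> bop Cx [Arr X X (- 1) (cid X), Arr X Y d f]) n = f n"
      unfolding smult_Cx[OF refl] b2_Cx[OF ix] using carrier_CxD[OF f refl] by (simp add: cid_def sgn_smult cmp_id_left)
  qed
qed (assumption | rule module_Cx b1_Cx_closed b1_Cx_add b1_Cx_smult b1_Cx_b1 b2_Cx_closed b2_Cx_add leibniz_Cx assoc_Cx higher_Cx)+

text \<open>\<open>p\<close> is a cocycle of degree 1 from \<open>Z\<close> to \<open>X\<close>
  because \<open>cone_differential\<close> gives d p = -p d, and b_1 of a morphism of odd degree is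
  the sum of the two composites. The morphism \<open>j\<close> returned here is that of
  \<open>mapping_cone\<close> with its index lowered by one: a map from X in degree n+1 to Z in
  degree n is read as starting at degree n.\<close>

lemma mapping_cone_identities:
  assumes XY: "is_complex A X" "is_complex A Y" and f: "f \<in> cocycles Cx X Y" and cone: "mapping_cone A X Y f Z i p"
  obtains j q where "is_complex A Z" "i \<in> cocycles Cx Y Z"
    "p \<in> carrier (shom Cx Z X 0)" "bop Cx [Arr Z X 0 p] = \<zero>\<^bsub>shom Cx Z X 1\<^esub>"
    "j \<in> carrier (shom Cx X Z (-2))" "q \<in> carrier (shom Cx Z Y (-1))"
    "bop Cx [Arr Y Z (-1) i, Arr Z X 0 p] = \<zero>\<^bsub>shom Cx Y X 0\<^esub>"
    "bop Cx [Arr X Y (-1) f, Arr Y Z (-1) i] = bop Cx [Arr X Z (-2) j]"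
    "bop Cx [Arr Z X 0 p, Arr X Y (-1) f] = \<ominus>\<^bsub>shom Cx Z Y 0\<^esub> bop Cx [Arr Z Y (-1) q]"
    "bop Cx [Arr X Z (-2) j, Arr Z X 0 p] = \<ominus>\<^bsub>shom Cx X X (-1)\<^esub> cid X"
    "bop Cx [Arr Y Z (-1) i, Arr Z Y (-1) q] = cid Y"
proof -
  obtain j q where Z: "is_complex A Z"
    and bp: "\<And>n. is_biproduct A (cob X (n + 1)) (cob Y n) (cob Z n) (j n) (i n) (p n) (q n)"
    and dZ: "\<And>n. cdiff Z n = lcmp A (cob Z n) (cob X (n + 1)) (cob Z (n + 1)) (p n)
          (lcmp A (cob X (n + 1)) (cob X (n + 2)) (cob Z (n + 1))
            (\<ominus>\<^bsub>lhom A (cob X (n + 1)) (cob X (n + 2))\<^esub> cdiff X (n + 1)) (j (n + 1)))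
        \<oplus>\<^bsub>lhom A (cob Z n) (cob Z (n + 1))\<^esub>
        (lcmp A (cob Z n) (cob X (n + 1)) (cob Z (n + 1)) (p n)
          (lcmp A (cob X (n + 1)) (cob Y (n + 1)) (cob Z (n + 1)) (f (n + 1)) (i (n + 1)))
        \<oplus>\<^bsub>lhom A (cob Z n) (cob Z (n + 1))\<^esub>
         lcmp A (cob Z n) (cob Y n) (cob Z (n + 1)) (q n)
          (lcmp A (cob Y n) (cob Y (n + 1)) (cob Z (n + 1)) (cdiff Y n) (i (n + 1))))"
    using cone unfolding mapping_cone_def by blast
  note ob [simp] = XY[THEN complex_ob] Z[THEN complex_ob]
  have fC: "f \<in> carrier (shom Cx X Y (-1))" using f by (simp add: cocycles_def)
  have f0 [simp]: "f n \<in> carrier (lhom A (cob X n) (cob Y n))" for n by (rule carrier_CxD[OF fC]) simp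
  note dX [simp] = complex_diff[OF XY(1) refl]
  note dY [simp] = complex_diff[OF XY(2) refl]
  have dX' [simp]: "cdiff X (n + 1) \<in> carrier (lhom A (cob X (n + 1)) (cob X (n + 2)))" for n
    by (rule complex_diff[OF XY(1)]) simp
  have bp1: "is_biproduct A (cob X (n + 2)) (cob Y (n + 1)) (cob Z (n + 1)) (j (n + 1)) (i (n + 1)) (p (n + 1)) (q (n + 1))" for n
    using bp[of "n + 1"] by (simp add: add.assoc)
  have bpm: "is_biproduct A (cob X n) (cob Y (n - 1)) (cob Z (n - 1)) (j (n - 1)) (i (n - 1)) (p (n - 1)) (q (n - 1))" for n
    using bp[of "n - 1"] by simp
  note cd = cone_differential[OF ob(1) ob(1) ob(2) ob(2) bp bp1 dX' dY f0 dZ]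
  \<comment> \<open>\<open>cd(2)\<close> at n - 1, to match the lowered index of
    \<open>j\<close>.\<close>
  have cm: "lcmp A (cob X n) (cob Z (n - 1)) (cob Z n) (j (n - 1)) (cdiff Z (n - 1))
      = \<ominus>\<^bsub>lhom A (cob X n) (cob Z n)\<^esub> lcmp A (cob X n) (cob X (n + 1)) (cob Z n) (cdiff X n) (j n)
        \<oplus>\<^bsub>lhom A (cob X n) (cob Z n)\<^esub> lcmp A (cob X n) (cob Y n) (cob Z n) (f n) (i n)" for n
    using cd(2)[of "n - 1"] by (simp add: ac_simps)
  have ty [simp]: "i n \<in> carrier (lhom A (cob Y n) (cob Z n))" "j n \<in> carrier (lhom A (cob X (n + 1)) (cob Z n))"
      "p n \<in> carrier (lhom A (cob Z n) (cob X (n + 1)))" "q n \<in> carrier (lhom A (cob Z n) (cob Y n))"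
    and eq: "lcmp A (cob X (n + 1)) (cob Z n) (cob X (n + 1)) (j n) (p n) = lidn A (cob X (n + 1))"
      "lcmp A (cob Y n) (cob Z n) (cob Y n) (i n) (q n) = lidn A (cob Y n)"
      "lcmp A (cob Y n) (cob Z n) (cob X (n + 1)) (i n) (p n) = \<zero>\<^bsub>lhom A (cob Y n) (cob X (n + 1))\<^esub>" for n
    using bp[of n] by (simp_all add: is_biproduct_def)
  have ty' [simp]: "p (n + 1) \<in> carrier (lhom A (cob Z (n + 1)) (cob X (n + 2)))"
    "j (n - 1) \<in> carrier (lhom A (cob X n) (cob Z (n - 1)))" for n
    using bp1[of n] bpm[of n] by (simp_all add: is_biproduct_def)
  note grp = abelian_group.minus_minus[OF hom_group] abelian_group.l_neg[OF hom_group] abelian_group.r_neg[OF hom_group]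
    abelian_group.a_inv_closed[OF hom_group] cmp_closed a_minus_def sgn_smult
  have iC: "i \<in> carrier (shom Cx Y Z (-1))" and pC: "p \<in> carrier (shom Cx Z X 0)" and qC: "q \<in> carrier (shom Cx Z Y (-1))"
    and jC: "(\<lambda>n. j (n - 1)) \<in> carrier (shom Cx X Z (-2))"
    by (rule carrier_CxI; simp)+
  have di: "bop Cx [Arr Y Z (-1) i] = \<zero>\<^bsub>shom Cx Y Z 0\<^esub>"
  proof
    fix n :: int
    have ix: "n = n + - 1 + 1" "n + 1 = n + - 1 + 2" "n + 1 = n + 0 + 1" by simp_all
    show "bop Cx [Arr Y Z (-1) i] n = \<zero>\<^bsub>shom Cx Y Z 0\<^esub> n"
      unfolding b1_Cx[OF refl ix(1,2)] zero_Cx[OF ix(3)] cd(1) by (simp add: grp)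
  qed
  have dp: "bop Cx [Arr Z X 0 p] = \<zero>\<^bsub>shom Cx Z X 1\<^esub>"
  proof
    fix n :: int
    have ix: "n + 1 = n + 0 + 1" "n + 2 = n + 0 + 2" "n + 2 = n + 1 + 1" by simp_all
    show "bop Cx [Arr Z X 0 p] n = \<zero>\<^bsub>shom Cx Z X 1\<^esub> n"
      unfolding b1_Cx[OF refl ix(1,2)] zero_Cx[OF ix(3)] cd(3) by (simp add: grp)
  qed
  have ip: "bop Cx [Arr Y Z (-1) i, Arr Z X 0 p] = \<zero>\<^bsub>shom Cx Y X 0\<^esub>"
  proof
    fix n :: int
    have ix: "n = n + - 1 + 1" "n + 1 = n + - 1 + 0 + 2" "n + 1 = n + 0 + 1" by simp_all
    show "bop Cx [Arr Y Z (-1) i, Arr Z X 0 p] n = \<zero>\<^bsub>shom Cx Y X 0\<^esub> n"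
      unfolding b2_Cx[OF ix(1,2)] zero_Cx[OF ix(3)] eq
      by (simp add: grp hom_minus_zero abelian_group.axioms(1)[OF hom_group, THEN abelian_monoid.zero_closed])
  qed
  have fi: "bop Cx [Arr X Y (-1) f, Arr Y Z (-1) i] = bop Cx [Arr X Z (-2) (\<lambda>n. j (n - 1))]"
  proof
    fix n :: int
    interpret M: abelian_group "lhom A (cob X n) (cob Z n)" by (intro hom_group ob)
    have ix: "n = n + - 1 + 1" "n = n + - 1 + - 1 + 2" "n - 1 = n + - 2 + 1" "n = n + - 2 + 2" by simp_all
    have a: "lcmp A (cob X n) (cob X (n + 1)) (cob Z n) (cdiff X n) (j n) \<in> carrier (lhom A (cob X n) (cob Z n))"
      "lcmp A (cob X n) (cob Y n) (cob Z n) (f n) (i n) \<in> carrier (lhom A (cob X n) (cob Z n))"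
      by (simp_all add: cmp_closed)
    show "bop Cx [Arr X Y (-1) f, Arr Y Z (-1) i] n = bop Cx [Arr X Z (-2) (\<lambda>n. j (n - 1))] n"
      unfolding b2_Cx[OF ix(1,2)] b1_Cx[OF refl ix(3,4)] cm
      using a by (simp add: sgn_smult M.minus_eq M.minus_minus) (metis M.a_comm M.a_inv_closed M.r_neg1 M.minus_minus M.a_assoc M.r_neg2)
  qed
  have tdq: "bop Cx [Arr Z Y (-1) q] \<in> carrier (shom Cx Z Y 0)" using b1_Cx_closed[OF Z XY(2) qC] by simp
  have pf: "bop Cx [Arr Z X 0 p, Arr X Y (-1) f] = \<ominus>\<^bsub>shom Cx Z Y 0\<^esub> bop Cx [Arr Z Y (-1) q]"
  proof
    fix n :: int
    interpret M: abelian_group "lhom A (cob Z n) (cob Y (n + 1))" by (intro hom_group ob)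
    have ix: "n + 1 = n + 0 + 1" "n + 1 = n + 0 + - 1 + 2" "n = n + - 1 + 1" "n + 1 = n + - 1 + 2" by simp_all
    have a: "lcmp A (cob Z n) (cob X (n + 1)) (cob Y (n + 1)) (p n) (f (n + 1)) \<in> carrier (lhom A (cob Z n) (cob Y (n + 1)))"
      "lcmp A (cob Z n) (cob Y n) (cob Y (n + 1)) (q n) (cdiff Y n) \<in> carrier (lhom A (cob Z n) (cob Y (n + 1)))"
      by (simp_all add: cmp_closed)
    show "bop Cx [Arr Z X 0 p, Arr X Y (-1) f] n = (\<ominus>\<^bsub>shom Cx Z Y 0\<^esub> bop Cx [Arr Z Y (-1) q]) n"
      unfolding minus_Cx[OF Z XY(2) tdq ix(1)] b2_Cx[OF ix(1,2)] b1_Cx[OF refl ix(3,4)] cd(4)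
      using a by (simp add: sgn_smult M.minus_eq M.minus_minus M.minus_add) (metis M.a_comm M.a_inv_closed M.r_neg1 M.minus_minus M.a_assoc M.r_neg2)
  qed
  have jp: "bop Cx [Arr X Z (-2) (\<lambda>n. j (n - 1)), Arr Z X 0 p] = \<ominus>\<^bsub>shom Cx X X (-1)\<^esub> cid X"
  proof
    fix n :: int
    have ix: "n - 1 = n + - 2 + 1" "n = n + - 2 + 0 + 2" "n = n + - 1 + 1" by simp_all
    have cid: "cid X \<in> carrier (shom Cx X X (- 1))" by (rule carrier_CxI) (simp add: cid_def id_closed)
    show "bop Cx [Arr X Z (-2) (\<lambda>n. j (n - 1)), Arr Z X 0 p] n = (\<ominus>\<^bsub>shom Cx X X (-1)\<^esub> cid X) n"
      unfolding minus_Cx[OF XY(1,1) cid ix(3)] b2_Cx[OF ix(1,2)] using eq(1)[of "n - 1"] by (simp add: sgn_smult id_closed cid_def)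
  qed
  have iq: "bop Cx [Arr Y Z (-1) i, Arr Z Y (-1) q] = cid Y"
  proof
    fix n :: int
    have ix: "n = n + - 1 + 1" "n = n + - 1 + - 1 + 2" by simp_all
    show "bop Cx [Arr Y Z (-1) i, Arr Z Y (-1) q] n = cid Y n"
      unfolding b2_Cx[OF ix] eq by (simp add: sgn_smult id_closed cid_def)
  qed
  have "i \<in> cocycles Cx Y Z" using iC di by (simp add: cocycles_def)
  then show thesis by (rule that[OF Z _ pC dp jC qC ip fi pf jp iq])
qed

section \<open>Inverting the maps with acyclic cone\<close>

abbreviation Ac :: "('k, ('o, 'm) complex, int \<Rightarrow> 'm) ainf" where "Ac \<equiv> acyclic_complexes R A"

text \<open>A distinguished triangle provides isomorphisms \<open>a\<close>, \<open>b\<close> of the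
  homotopy category with a s = f b, where \<open>f\<close> has an honest mapping cone, so
  \<open>s\<close> becomes invertible together with \<open>f\<close>. The third isomorphism
  \<open>c\<close> carries the contractibility of the acyclic object over to the cone.\<close>

lemma acyclic_cone_inverted:
  assumes s: "s \<in> cone_in (H0 R Cx) (distinguished_triangles R A) (H0 R Ac) X' Y'"
  shows "is_iso (H0 R (quot_Q R Cx Ac)) X' Y' (fmor (H0_functor (quot_Q R Cx Ac) (emb_Q R Cx Ac)) X' Y' s)"
proof -
  interpret E: dg_exprs R Cx "aob Ac" cid by (rule dg_exprs_Cx)
  interpret C: h0_ainf R Cx by (rule E.h0_C)
  let ?T = "H0 R Cx" and ?U = "H0 R E.D" and ?F = "H0_functor E.D E.emb"
  obtain Z' v w where tri: "(X', Y', Z', s, v, w) \<in> distinguished_triangles R A" and Z'B: "Z' \<in> aob Ac"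
    using s by (auto simp: cone_in_def H0_def)
  obtain X Y f Z i p a b c where ob': "X' \<in> aob Cx" "Y' \<in> aob Cx" "Z' \<in> aob Cx" and s': "s \<in> hom_of ?T X' Y'"
    and ob: "X \<in> aob Cx" "Y \<in> aob Cx" and f: "f \<in> cocycles Cx X Y" and cone: "mapping_cone A X Y f Z i p"
    and a: "is_iso ?T X X' a" and b: "is_iso ?T Y Y' b" and c: "is_iso ?T Z Z' c"
    and sq: "cmp ?T X Y Y' (H0_class Cx X Y f) b = cmp ?T X X' Y' a s"
    using tri unfolding distinguished_triangles_def Let_def C.H0_ob by blast
  have XY: "is_complex A X" "is_complex A Y" using ob by simp_all
  obtain j q where Z: "is_complex A Z" and cone_ids: "i \<in> cocycles Cx Y Z"
    "p \<in> carrier (shom Cx Z X 0)" "bop Cx [Arr Z X 0 p] = \<zero>\<^bsub>shom Cx Z X 1\<^esub>"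
    "j \<in> carrier (shom Cx X Z (-2))" "q \<in> carrier (shom Cx Z Y (-1))"
    "bop Cx [Arr Y Z (-1) i, Arr Z X 0 p] = \<zero>\<^bsub>shom Cx Y X 0\<^esub>"
    "bop Cx [Arr X Y (-1) f, Arr Y Z (-1) i] = bop Cx [Arr X Z (-2) j]"
    "bop Cx [Arr Z X 0 p, Arr X Y (-1) f] = \<ominus>\<^bsub>shom Cx Z Y 0\<^esub> bop Cx [Arr Z Y (-1) q]"
    "bop Cx [Arr X Z (-2) j, Arr Z X 0 p] = \<ominus>\<^bsub>shom Cx X X (-1)\<^esub> cid X"
    "bop Cx [Arr Y Z (-1) i, Arr Z Y (-1) q] = cid Y"
    by (rule mapping_cone_identities[OF XY f cone])
  have Z: "Z \<in> aob Cx" using Z by simp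
  obtain c' where c': "c \<in> hom_of ?T Z Z'" "c' \<in> hom_of ?T Z' Z" "cmp ?T Z Z' Z c c' = idn ?T Z"
    using c by (auto simp: is_iso_def)
  obtain \<gamma> \<gamma>' where \<gamma>: "\<gamma> \<in> cocycles Cx Z Z'" "c = H0_class Cx Z Z' \<gamma>" "\<gamma>' \<in> cocycles Cx Z' Z" "c' = H0_class Cx Z' Z \<gamma>'"
    using c'(1,2) by (elim C.H0_homE)
  have "E.bd Z Z (E.fr (E.I Z))"
  proof (rule E.bd_ident_transfer[OF Z ob'(3) \<gamma>(1,3) _ E.bd_ident[OF ob'(3) Z'B]])
    show "H0_class Cx Z Z (bop Cx [Arr Z Z' (- 1) \<gamma>, Arr Z' Z (- 1) \<gamma>']) = H0_class Cx Z Z (cid Z)"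
      using c'(3) by (simp add: \<gamma> C.H0_cmp[OF Z ob'(3) Z \<gamma>(1,3)] C.H0_idn[OF Z E.unit_elt_C[OF Z]])
  qed
  from E.cone_iso[OF ob Z f cone_ids this]
  have Ff: "is_iso ?U X Y (fmor ?F X Y (H0_class Cx X Y f))" by (simp add: E.fmor_emb[OF ob f])
  have F: "is_functor ?T ?U ?F" by (rule E.is_functor_emb)
  have U: "category ?U" using F by (simp add: is_functor_def)
  have Fob [simp]: "fob ?F V = V" for V by (simp add: H0_functor_def E.emb_def)
  have obU: "X \<in> ob ?U" "Y \<in> ob ?U" "X' \<in> ob ?U" "Y' \<in> ob ?U"
    using ob ob' by (simp_all add: H0_def)
  have Fa: "is_iso ?U X X' (fmor ?F X X' a)" and Fb: "is_iso ?U Y Y' (fmor ?F Y Y' b)"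
    using is_iso_functor[OF F _ _ a] is_iso_functor[OF F _ _ b] ob ob' by simp_all
  have ab: "a \<in> hom_of ?T X X'" "b \<in> hom_of ?T Y Y'" using a b by (simp_all add: is_iso_def)
  have Fcmp: "fmor ?F V W' (cmp ?T V W W' x y) = cmp ?U V W W' (fmor ?F V W x) (fmor ?F W W' y)"
    if "V \<in> aob Cx" "W \<in> aob Cx" "W' \<in> aob Cx" "x \<in> hom_of ?T V W" "y \<in> hom_of ?T W W'" for V W W' x y
    using F that unfolding is_functor_def Fob C.H0_ob by blast
  have sqU: "cmp ?U X Y Y' (fmor ?F X Y (H0_class Cx X Y f)) (fmor ?F Y Y' b) = cmp ?U X X' Y' (fmor ?F X X' a) (fmor ?F X' Y' s)"
    using arg_cong[OF sq, of "fmor ?F X Y'"] Fcmp[OF ob ob'(2) C.H0_homI[OF f] ab(2)] Fcmp[OF ob(1) ob'(1,2) ab(1) s'] by simp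
  obtain a' where a': "is_iso ?U X' X a'" "cmp ?U X X' X (fmor ?F X X' a) a' = idn ?U X"
      "cmp ?U X' X X' a' (fmor ?F X X' a) = idn ?U X'"
    by (rule is_iso_inverse[OF Fa])
  have Fs: "fmor ?F X' Y' s \<in> hom_of ?U X' Y'"
    using F ob' s' unfolding is_functor_def Fob C.H0_ob by blast
  \<comment> \<open>The images of a s and f b agree; this is solved for the image of
    \<open>s\<close>.\<close>
  have "fmor ?F X' Y' s = cmp ?U X' X Y' a' (cmp ?U X X' Y' (fmor ?F X X' a) (fmor ?F X' Y' s))"
    using category_assoc[OF U obU(3,1,3,4), of a' "fmor ?F X X' a" "fmor ?F X' Y' s"] a' Fa Fs category_idl[OF U obU(3,4) Fs]
    by (simp add: is_iso_def)
  also have "\<dots> = cmp ?U X' X Y' a' (cmp ?U X Y Y' (fmor ?F X Y (H0_class Cx X Y f)) (fmor ?F Y Y' b))" by (simp add: sqU)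
  finally have "is_iso ?U X' Y' (fmor ?F X' Y' s)"
    using is_iso_cmp[OF U obU(3,1,4) a'(1) is_iso_cmp[OF U obU(1,2,4) Ff Fb]] by simp
  moreover have "quot_Q R Cx Ac = E.D" by (simp add: quot_Q_def)
  moreover have "emb_Q R Cx Ac = E.emb" by (simp add: emb_Q_def E.emb_def E.dcl_def E.ecls_ecl E.shom_free_ainf)
  ultimately show ?thesis by simp
qed

lemma is_functor_emb_Q: "is_functor (H0 R Cx) (H0 R (quot_Q R Cx Ac)) (H0_functor (quot_Q R Cx Ac) (emb_Q R Cx Ac))"
proof -
  interpret E: dg_exprs R Cx "aob Ac" cid by (rule dg_exprs_Cx)
  have "emb_Q R Cx Ac = E.emb" by (simp add: emb_Q_def E.emb_def E.dcl_def E.ecls_ecl E.shom_free_ainf)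
  then show ?thesis using E.is_functor_emb by (simp add: quot_Q_def)
qed

end

section \<open>The factorization through the derived category\<close>

theorem corollary8p2:
  fixes R :: "'k ring" and A :: "('k, 'o, 'm) lin_cat"
  assumes "cring R" and "abelian_category R A"
  defines "C \<equiv> complexes R A"
  defines "B \<equiv> acyclic_complexes R A"
  defines "D \<equiv> quot_Q R C B"
  defines "e \<equiv> emb_Q R C B"
  defines "Q \<equiv> Q_Verdier (H0 R C) (distinguished_triangles R A) (H0 R B)"
  shows "is_functor (H0 R C) (H0 R D) (H0_functor D e) \<and>
    is_functor (H0 R C) (derived_category R A) Q \<and>
    (\<exists>g. is_functor (derived_category R A) (H0 R D) g \<and>
      (\<forall>X\<in>ob (derived_category R A). fob g X = X) \<and>
      functor_eq (H0 R C) (H0_functor D e) (functor_comp Q g))"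
proof -
  interpret linear_cat R A using assms(2) by unfold_locales (simp add: abelian_category_def)
  let ?S = "cone_in (H0 R C) (distinguished_triangles R A) (H0 R B)"
  have F: "is_functor (H0 R C) (H0 R D) (H0_functor D e)"
    unfolding D_def e_def B_def C_def by (rule is_functor_emb_Q)
  have fob: "fob (H0_functor D e) X = X" for X by (simp add: H0_functor_def e_def emb_Q_def)
  \<comment> \<open>The Verdier quotient is by definition the localization at \<open>?S\<close>, so
    the extension of the inverting functor is the required functor from the derived
    category.\<close>
  interpret inverting_functor "H0 R C" ?S "H0 R D" "H0_functor D e"
  proof
    fix X Y s assume s: "s \<in> ?S X Y"
    then show "s \<in> hom_of (H0 R C) X Y" by (simp add: cone_in_def)
    show "is_iso (H0 R D) (fob (H0_functor D e) X) (fob (H0_functor D e) Y) (fmor (H0_functor D e) X Y s)"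
      using acyclic_cone_inverted s unfolding fob unfolding D_def e_def B_def C_def by blast
  qed (rule F)
  have L: "derived_category R A = localization (H0 R C) ?S" and Q: "Q = localization_functor (H0 R C) ?S"
    by (simp_all add: derived_category_def verdier_quotient_def Q_def Q_Verdier_def C_def B_def)
  have "fob extension X = X" for X by (simp add: extension_def fob)
  moreover have "is_functor (H0 R C) (localization (H0 R C) ?S) (localization_functor (H0 R C) ?S)"
    using F by (intro is_functor_localization) (simp add: is_functor_def)
  ultimately show ?thesis
    unfolding L Q using F is_functor_extension extension_factors by blast
qed

end
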